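(* Fix $0<\rho<1$ and integers $n\geq1$, $m\geq2$ with $2m\leq n+3$. Fix $a_{1},\ldots,a_{m}>0$ with $\sum_{i}a_{i}=1$. Let $\Omega_{1},\ldots,\Omega_{m}$ and $\Omega_{1}',\ldots,\Omega_{m}'$ be two partitions of $\mathbb{R}^{n+1}$ into measurable sets with $\gamma_{n+1}(\Omega_{i})=\gamma_{n+1}(\Omega_{i}')=a_{i}$ for all $i$ which minimize $$\sum_{i=1}^{m}\int_{\mathbb{R}^{n+1}}1_{\Omega_{i}}(x)T_{\rho}1_{\Omega_{i}'}(x)\gamma_{n+1}(x)\,dx$$ among all such pairs of partitions. Then, after applying a rotation of $\mathbb{R}^{n+1}$ to all the sets $\Omega_{1},\ldots,\Omega_{m},\Omega_{1}',\ldots,\Omega_{m}'$ and changing them on sets of Lebesgue measure zero, there exist measurable sets $\Theta_{1},\ldots,\Theta_{m},\Theta_{1}',\ldots,\Theta_{m}'\subset\mathbb{R}^{2m-2}$ such that $$\Omega_{i}=\Theta_{i}\times\mathbb{R}^{n-2m+3},\qquad \Omega_{i}'=\Theta_{i}'\times\mathbb{R}^{n-2m+3},\qquad\forall\,1\leq i\leq m.$$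
   Context: $\gamma_{n+1}(x)=(2\pi)^{-(n+1)/2}e^{-\|x\|^{2}/2}$, $\gamma_{n+1}(\Omega)=\int_{\Omega}\gamma_{n+1}$. For measurable $f\colon\mathbb{R}^{n+1}\to[0,1]$, $T_{\rho}f(x)=\int_{\mathbb{R}^{n+1}}f(x\rho+y\sqrt{1-\rho^{2}})\gamma_{n+1}(y)\,dy$. A partition of $\mathbb{R}^{n+1}$ means pairwise disjoint measurable sets whose union is $\mathbb{R}^{n+1}$. *)

theory Defs
  imports "HOL-Probability.Probability" "HOL-Combinatorics.Permutations"
begin

definition RN :: "nat \<Rightarrow> (nat \<Rightarrow> real) set" where
  "RN N = PiE {..<N} (\<lambda>_. UNIV)"

definition lebN :: "nat \<Rightarrow> (nat \<Rightarrow> real) measure" where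
  "lebN N = PiM {..<N} (\<lambda>_. lborel)"

definition gauss_density :: "nat \<Rightarrow> (nat \<Rightarrow> real) \<Rightarrow> real" where
  "gauss_density N x = (2 * pi) powr (- real N / 2) * exp (- (\<Sum>i<N. (x i)\<^sup>2) / 2)"

definition gaussN :: "nat \<Rightarrow> (nat \<Rightarrow> real) measure" where
  "gaussN N = density (lebN N) (\<lambda>x. ennreal (gauss_density N x))"

definition T_op :: "nat \<Rightarrow> real \<Rightarrow> ((nat \<Rightarrow> real) \<Rightarrow> real) \<Rightarrow> (nat \<Rightarrow> real) \<Rightarrow> real" where
  "T_op N \<rho> f x = (\<integral>y. f (\<lambda>i\<in>{..<N}. x i * \<rho> + y i * sqrt (1 - \<rho>\<^sup>2)) \<partial>gaussN N)"

definition is_partition :: "nat \<Rightarrow> nat \<Rightarrow> (nat \<Rightarrow> (nat \<Rightarrow> real) set) \<Rightarrow> bool" where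
  "is_partition N m \<Omega> \<longleftrightarrow>
     (\<forall>i<m. \<Omega> i \<in> sets (lebN N)) \<and>
     (\<forall>i<m. \<forall>j<m. i \<noteq> j \<longrightarrow> \<Omega> i \<inter> \<Omega> j = {}) \<and>
     (\<Union>i<m. \<Omega> i) = RN N"

definition noise_obj :: "nat \<Rightarrow> real \<Rightarrow> nat \<Rightarrow> (nat \<Rightarrow> (nat \<Rightarrow> real) set)
    \<Rightarrow> (nat \<Rightarrow> (nat \<Rightarrow> real) set) \<Rightarrow> real" where
  "noise_obj N \<rho> m \<Omega> \<Omega>' =
     (\<Sum>i<m. \<integral>x. indicator (\<Omega> i) x * T_op N \<rho> (indicator (\<Omega>' i)) x \<partial>gaussN N)"

definition admissible :: "nat \<Rightarrow> nat \<Rightarrow> (nat \<Rightarrow> real) \<Rightarrow> (nat \<Rightarrow> (nat \<Rightarrow> real) set)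
    \<Rightarrow> (nat \<Rightarrow> (nat \<Rightarrow> real) set) \<Rightarrow> bool" where
  "admissible N m a \<Omega> \<Omega>' \<longleftrightarrow>
     is_partition N m \<Omega> \<and> is_partition N m \<Omega>' \<and>
     (\<forall>i<m. measure (gaussN N) (\<Omega> i) = a i \<and> measure (gaussN N) (\<Omega>' i) = a i)"

definition detN :: "nat \<Rightarrow> (nat \<Rightarrow> nat \<Rightarrow> real) \<Rightarrow> real" where
  "detN N A = (\<Sum>p | p permutes {..<N}. of_int (sign p) * (\<Prod>i<N. A i (p i)))"

definition is_rotation :: "nat \<Rightarrow> (nat \<Rightarrow> nat \<Rightarrow> real) \<Rightarrow> bool" where
  "is_rotation N A \<longleftrightarrow>
     (\<forall>i<N. \<forall>j<N. (\<Sum>k<N. A k i * A k j) = (if i = j then 1 else 0)) \<and> detN N A = 1"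

definition mat_apply :: "nat \<Rightarrow> (nat \<Rightarrow> nat \<Rightarrow> real) \<Rightarrow> (nat \<Rightarrow> real) \<Rightarrow> (nat \<Rightarrow> real)" where
  "mat_apply N A x = (\<lambda>i\<in>{..<N}. \<Sum>j<N. A i j * x j)"

definition cylinder :: "nat \<Rightarrow> nat \<Rightarrow> (nat \<Rightarrow> real) set \<Rightarrow> (nat \<Rightarrow> real) set" where
  "cylinder N k \<Theta> = {x \<in> RN N. restrict x {..<k} \<in> \<Theta>}"

definition symdiff :: "'a set \<Rightarrow> 'a set \<Rightarrow> 'a set" where
  "symdiff X Y = (X - Y) \<union> (Y - X)"

end

(* Rotate so that the first moments of all sets lie in the first 2m-2 coordinates. Along any other coordinate j, translating
both partitions costs o(s^2) (Lagrange multipliers and the kernel's smoothing), so "layer" moves near places where a set of each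
partition changes along lines parallel to e_j are also free to second order. Minimality then forces the noise kernel, restricted
to the product of the two interfaces (graphs over positive measure sets), to have the form A(y) + B(x) a.e. The Mehler kernel is
too convex for that: on coordinate slices the relation has countably many solutions. Hence no set depends on x_j. *)
theory Submission
 imports Defs "HOL-Complex_Analysis.Complex_Analysis" "Jordan_Normal_Form.Determinant"
begin

text \<open>The interfaces have no a priori regularity, so there is no second variation formula to
  start from. Everything is read off the Lagrangian \<open>L\<close>, which is affine in each
  partition, and two estimates meet. From below: a competitor with volume errors of order s^2 is
  repaired by mixing in a fraction of order s^2 of a partition with the opposite defect. This is why
  competitors take values in the simplex, and why the optimal cost must be differentiable in the
  volumes, i.e. why multipliers must be unique. From above: \<open>T\<close> turns a shift by s into
  a shift by s / rho, so each translated partition is optimal for the other one translated at a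
  suitable speed, and the Lagrangian of the translated pair drops by an explicit nonnegative gap.
  Hence the gap is o(s^2), and it controls the cost of a layer on one partition alone. With layers
  on both, only the bilinear cross term of order s^2 is left; its sign can be reversed, so it is 0.
  The moments of the cells of one partition sum to 0, so each partition has at most m - 1
  independent moment vectors: this is the origin of 2m - 2. Two base coordinates besides j serve to
  exclude flat interfaces.\<close>

abbreviation (input) bm :: "'a measure => ('a => 'b :: topological_space) set" where "bm M == borel_measurable M"

lemmas BI_integrable_add = Bochner_Integration.integrable_add
lemmas BI_integrable_bound = Bochner_Integration.integrable_bound
lemmas BI_integrable_cong = Bochner_Integration.integrable_cong
lemmas BI_integrable_diff = Bochner_Integration.integrable_diff
lemmas BI_integral_add = Bochner_Integration.integral_add
lemmas BI_integral_cong = Bochner_Integration.integral_cong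
lemmas BI_integral_diff = Bochner_Integration.integral_diff
lemmas BI_integral_nonneg = Bochner_Integration.integral_nonneg
lemmas BI_integral_sum = Bochner_Integration.integral_sum

section \<open>Bounded measurable functions and relaxed partitions\<close>

definition bdd :: "'a measure => ('a => real) => bool" where
 "bdd M ph \<longleftrightarrow> ph : bm M & (EX C. ALL x:space M. \<bar>ph x\<bar> <= C)"

lemma bddI: "ph : bm M ==> (!!x. x : space M ==> \<bar>ph x\<bar> <= C) ==> bdd M ph"
 unfolding bdd_def by blast

lemma bdd_meas[measurable_dest]: "bdd M ph ==> ph : bm M"
 unfolding bdd_def by blast

lemma bdd_obtain:
 assumes "bdd M ph"
 obtains C where "0 < C" "!!x. x : space M ==> \<bar>ph x\<bar> <= C"
proof -
 obtain C where C: "ALL x:space M. \<bar>ph x\<bar> <= C" using assms unfolding bdd_def by blast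
 show ?thesis by (rule that[of "\<bar>C\<bar> + 1"]) (use C in force)+
qed

lemma bdd_const[simp, intro]: "bdd M (%_. c)"
 by (rule bddI[where C="\<bar>c\<bar>"]) auto

lemma bdd_add[intro]: "bdd M ph ==> bdd M ps ==> bdd M (%x. ph x + ps x)"
proof -
 assume a: "bdd M ph" and b: "bdd M ps"
 obtain C where C: "!!x. x : space M ==> \<bar>ph x\<bar> <= C" using bdd_obtain[OF a] by blast
 obtain D where D: "!!x. x : space M ==> \<bar>ps x\<bar> <= D" using bdd_obtain[OF b] by blast
 show ?thesis
 proof (rule bddI[where C="C + D"])
  fix x assume "x : space M"
  then show "\<bar>ph x + ps x\<bar> <= C + D" using C[of x] D[of x] by linarith
 qed (use a b in \<open>auto simp: bdd_def\<close>)
qed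

lemma bdd_mult[intro]: "bdd M ph ==> bdd M ps ==> bdd M (%x. ph x * ps x)"
proof -
 assume a: "bdd M ph" and b: "bdd M ps"
 obtain C where C: "0 < C" "!!x. x : space M ==> \<bar>ph x\<bar> <= C" using bdd_obtain[OF a] by blast
 obtain D where D: "!!x. x : space M ==> \<bar>ps x\<bar> <= D" using bdd_obtain[OF b] by blast
 show ?thesis using a b C D
  by (intro bddI[where C="C * D"]) (auto intro!: mult_mono simp: abs_mult bdd_def less_imp_le)
qed

lemma bdd_cmult[intro]: "bdd M ph ==> bdd M (%x. c * ph x)"
 by (intro bdd_mult bdd_const)

lemma bdd_uminus[intro]: "bdd M ph ==> bdd M (%x. - ph x)"
 using bdd_cmult[of M ph "-1"] by simp

lemma bdd_diff[intro]: "bdd M ph ==> bdd M ps ==> bdd M (%x. ph x - ps x)"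
 using bdd_add[of M ph "%x. - ps x"] by auto

lemma bdd_abs[intro]: "bdd M ph ==> bdd M (%x. \<bar>ph x\<bar>)"
 unfolding bdd_def by auto

lemma bdd_sum[intro]: "(!!i. i : J ==> bdd M (ph i)) ==> bdd M (%x. \<Sum>i\<in>J. ph i x)"
 by (induction J rule: infinite_finite_induct) auto

lemma bdd_indicator[intro]: "A : sets M ==> bdd M (indicator A)"
 by (rule bddI[where C=1]) (auto simp: indicator_def)

lemma bdd_cong: "(!!x. x : space M ==> ph x = ps x) ==> bdd M ph \<longleftrightarrow> bdd M ps"
 unfolding bdd_def using measurable_cong by (metis (mono_tags, lifting))

lemma (in finite_measure) bdd_integrable[intro]: "bdd M ph ==> integrable M ph"
proof -
 assume a: "bdd M ph"
 obtain C where C: "!!x. x : space M ==> \<bar>ph x\<bar> <= C" using bdd_obtain[OF a] by blast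
 show ?thesis using a C by (intro integrable_const_bound[where B=C]) (auto simp: bdd_def)
qed

text \<open>A partition whose points may be shared between cells: a measurable map into the simplex.
  These maps form a convex set, so mixtures are available as competitors; partitions are the
  0/1-valued ones.\<close>

definition relaxed :: "'a measure => nat => (nat => 'a => real) => bool" where
 "relaxed M m f \<longleftrightarrow> (ALL i<m. f i : bm M) & (ALL i<m. ALL x:space M. 0 <= f i x) \<and>
  (ALL x:space M. (\<Sum>i<m. f i x) = 1)"

lemma relaxed_le1:
 assumes "relaxed M m f" "i < m" "x : space M"
 shows "f i x <= 1" "0 <= f i x"
proof -
 have "f i x <= (\<Sum>i<m. f i x)" using assms by (intro member_le_sum) (auto simp: relaxed_def)
 then show "f i x <= 1" "0 <= f i x" using assms by (auto simp: relaxed_def)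
qed

lemma relaxed_bdd: "relaxed M m f ==> i < m ==> bdd M (f i)"
 by (rule bddI[where C=1]) (auto simp: relaxed_le1 relaxed_def)

definition part :: "'a measure => nat => (nat => 'a set) => bool" where
 "part M m Gm \<longleftrightarrow> (ALL i<m. Gm i : sets M) & disjoint_family_on Gm {..<m} & (\<Union>i<m. Gm i) = space M"

lemma part_relaxed:
 assumes "part M m Gm"
 shows "relaxed M m (%i. indicator (Gm i))"
 unfolding relaxed_def
proof (intro conjI ballI allI impI)
 fix x assume x: "x : space M"
 then obtain i where i: "i < m" "x : Gm i" using assms unfolding part_def by blast
 have "(\<Sum>j<m. indicator (Gm j) x :: real) = (\<Sum>j<m. if j = i then 1 else 0)"
  using assms i unfolding part_def disjoint_family_on_def
  by (intro sum.cong) (auto simp: indicator_def)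
 also have "... = 1" using i by simp
 finally show "(\<Sum>j<m. indicator (Gm j) x :: real) = 1" .
qed (use assms in \<open>auto simp: part_def\<close>)

section \<open>Rounding relaxed partitions in an atomless space\<close>

locale atomless_prob = prob_space M for M :: "'a measure" +
 assumes split: "A : sets M ==> 0 <= r ==> r <= measure M A ==> EX B:sets M. B <= A & measure M B = r"
begin

lemma split_many:
 assumes "A : sets M" "ALL i<Suc m. 0 <= r i" "(\<Sum>i<Suc m. r i) = measure M A"
 shows "EX B. (ALL i<Suc m. B i : sets M) & disjoint_family_on B {..<Suc m} & (\<Union>i<Suc m. B i) = A \<and>
  (ALL i<Suc m. measure M (B i) = r i)"
 using assms
proof (induction m arbitrary: A)
 case 0
 then show ?case by (intro exI[of _ "%_. A"]) (auto simp: disjoint_family_on_def)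
next
 case (Suc m)
 have le: "r (Suc m) <= measure M A" using Suc.prems sum_nonneg[of "{..<Suc m}" r] by auto
 obtain B0 where B0: "B0 : sets M" "B0 <= A" "measure M B0 = r (Suc m)"
  using split[OF Suc.prems(1) _ le] Suc.prems(2) by blast
 have "measure M (A - B0) = measure M A - r (Suc m)"
  using B0 Suc.prems by (subst finite_measure_Diff) auto
 then have "(\<Sum>i<Suc m. r i) = measure M (A - B0)" using Suc.prems(3) by simp
 moreover have "A - B0 : sets M" using B0 Suc.prems by auto
 ultimately obtain B where B: "ALL i<Suc m. B i : sets M" "disjoint_family_on B {..<Suc m}"
   "(\<Union>i<Suc m. B i) = A - B0" "ALL i<Suc m. measure M (B i) = r i"
  using Suc.IH[of "A - B0"] Suc.prems(2) by auto
 define B' where "B' = B(Suc m := B0)"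
 have sub: "B i <= A - B0" if "i < Suc m" for i using B(3) that by blast
 show ?case
 proof (intro exI[of _ B'] conjI)
  show "disjoint_family_on B' {..<Suc (Suc m)}"
   unfolding disjoint_family_on_def
  proof (intro ballI impI)
   fix i j assume ij: "i : {..<Suc (Suc m)}" "j : {..<Suc (Suc m)}" "i ~= j"
   show "B' i \<inter> B' j = {}"
   proof (cases "i = Suc m \<or> j = Suc m")
    case True
    then show ?thesis using ij sub[of i] sub[of j] unfolding B'_def by (auto simp: less_Suc_eq)
   next
    case False
    then show ?thesis using ij B(2) unfolding B'_def disjoint_family_on_def by (auto simp: less_Suc_eq)
   qed
  qed
  have "(\<Union>i<Suc (Suc m). B' i) = (\<Union>i<Suc m. B i) \<union> B0"
   unfolding B'_def by (auto simp: less_Suc_eq)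
  then show "(\<Union>i<Suc (Suc m). B' i) = A" using B(3) B0 by auto
 qed (use B B0 in \<open>auto simp: B'_def less_Suc_eq\<close>)
qed

text \<open>Cut the space into finitely many cells on which every cost \<open>h i\<close> varies by
  at most \<open>ep\<close>, and split each cell into sets having the masses that the
  \<open>f i\<close> put there. Against a cost that is constant on cells only these masses count, so
  volumes are kept and the rounding of the costs is the only loss.\<close>

lemma bang_bang:
 assumes f: "relaxed M m f" and h: "!!i. i < m ==> bdd M (h i)" and e: "0 < ep" and m: "0 < m"
 shows "EX Gm. part M m Gm & (ALL i<m. measure M (Gm i) = (LINT x|M. f i x)) \<and>
  (\<Sum>i<m. (LINT x|M. indicator (Gm i) x * h i x)) <= (\<Sum>i<m. (LINT x|M. f i x * h i x)) + ep"
proof -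
 \<comment> \<open>A cell is a level set of the vector of rounded costs. Finitely many occur, as the
   costs are bounded.\<close>
 define key where "key x = map (%i. \<lfloor>h i x / ep\<rfloor>) [0..<m]" for x
 define Z where "Z = key ` space M"
 define cell where "cell z = {x\<in>space M. key x = z}" for z
 obtain C where C: "!!i x. i < m ==> x : space M ==> \<bar>h i x\<bar> <= C"
 proof -
  have "ALL i:{..<m}. EX C. ALL x:space M. \<bar>h i x\<bar> <= C" using h unfolding bdd_def by blast
  then obtain Cf where Cf: "!!i x. i < m ==> x : space M ==> \<bar>h i x\<bar> <= Cf i" by (metis lessThan_iff)
  show ?thesis
  proof (rule that[of "\<Sum>i<m. \<bar>Cf i\<bar>"])
   fix i x assume "i < m" "x : space M"
   then have "\<bar>h i x\<bar> <= \<bar>Cf i\<bar>" using Cf by fastforce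
   also have "... <= (\<Sum>i<m. \<bar>Cf i\<bar>)" using \<open>i < m\<close> by (intro member_le_sum) auto
   finally show "\<bar>h i x\<bar> <= (\<Sum>i<m. \<bar>Cf i\<bar>)" .
  qed
 qed
 have finZ: "finite Z"
 proof (rule finite_subset)
  show "Z <= {xs. set xs <= {\<lfloor>-C/ep\<rfloor>..\<lfloor>C/ep\<rfloor>} & length xs = m}"
  proof
   fix z assume "z : Z"
   then obtain x where x: "x : space M" "z = key x" unfolding Z_def by blast
   have "\<lfloor>h i x / ep\<rfloor> : {\<lfloor>-C/ep\<rfloor>..\<lfloor>C/ep\<rfloor>}" if "i < m" for i
   proof -
    have "-C <= h i x" "h i x <= C" using C[OF that x(1)] by auto
    then have "-C / ep <= h i x / ep" "h i x / ep <= C / ep" 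
     using divide_right_mono[of "-C" "h i x" ep] divide_right_mono[of "h i x" C ep] e by auto
    then show ?thesis by (auto intro!: floor_mono simp del: minus_divide_left)
   qed
   then show "z : {xs. set xs <= {\<lfloor>-C/ep\<rfloor>..\<lfloor>C/ep\<rfloor>} & length xs = m}"
    unfolding x(2) key_def by auto
  qed
 qed (rule finite_lists_length_eq, simp)
 have cell_sets: "cell z : sets M" if "z : Z" for z
 proof -
  have len: "length z = m" using that unfolding Z_def key_def by auto
  have "cell z = {x\<in>space M. ALL i:{..<m}. \<lfloor>h i x / ep\<rfloor> = z ! i}"
   unfolding cell_def key_def using len by (auto simp: list_eq_iff_nth_eq)
  also have "... : sets M"
  proof (rule sets.sets_Collect_finite_All)
   fix i assume "i : {..<m}"
   then have [measurable]: "h i : bm M" using h by (auto simp: bdd_def)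
   show "{x : space M. \<lfloor>h i x / ep\<rfloor> = z ! i} : sets M" by measurable
  qed simp
  finally show ?thesis .
 qed
 have fm: "f i : bm M" if "i < m" for i using f that unfolding relaxed_def by blast
 define r where "r z i = (LINT x|M. f i x * indicator (cell z) x)" for z i
 have fb: "bdd M (%x. f i x * indicator (cell z) x)" if "i < m" "z : Z" for i z
  using that cell_sets relaxed_bdd[OF f] by auto
 have rsum: "(\<Sum>i<m. r z i) = measure M (cell z)" if "z : Z" for z
 proof -
  have "(\<Sum>i<m. r z i) = (LINT x|M. (\<Sum>i<m. f i x * indicator (cell z) x))"
   unfolding r_def using fb that by (subst BI_integral_sum) auto
  also have "... = (LINT x|M. indicator (cell z) x)"
   using f by (intro BI_integral_cong) (auto simp: sum_distrib_right[symmetric] relaxed_def)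
  finally show ?thesis using cell_sets[OF that] by simp
 qed
 obtain m' where m': "m = Suc m'" using m by (cases m) auto
 have "ALL z:Z. EX B. (ALL i<m. B i : sets M) & disjoint_family_on B {..<m} & (\<Union>i<m. B i) = cell z \<and>
  (ALL i<m. measure M (B i) = r z i)"
 proof
  fix z assume z: "z : Z"
  have "ALL i<m. 0 <= r z i" unfolding r_def
   using relaxed_le1(2)[OF f] by (auto intro!: BI_integral_nonneg)
  then show "EX B. (ALL i<m. B i : sets M) & disjoint_family_on B {..<m} & (\<Union>i<m. B i) = cell z \<and>
    (ALL i<m. measure M (B i) = r z i)"
   unfolding m' using rsum[OF z] by (intro split_many cell_sets[OF z]) (auto simp: m')
 qed
 then obtain B where B: "!!z i. z : Z ==> i < m ==> B z i : sets M"
   "!!z. z : Z ==> disjoint_family_on (B z) {..<m}" "!!z. z : Z ==> (\<Union>i<m. B z i) = cell z"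
   "!!z i. z : Z ==> i < m ==> measure M (B z i) = r z i"
  using bchoice[of Z "%z B. (ALL i<m. B i : sets M) & disjoint_family_on B {..<m} & (\<Union>i<m. B i) = cell z \<and>
  (ALL i<m. measure M (B i) = r z i)"] by metis
 define Gm where "Gm i = (\<Union>z\<in>Z. B z i)" for i
 have Bsub: "B z i <= cell z" if "z : Z" "i < m" for z i using B(3) that by blast
 have ind: "indicator (Gm i) x = (\<Sum>z\<in>Z. indicator (B z i) x :: real)" if "i < m" for i x
  unfolding Gm_def
 proof (rule indicator_UN_disjoint[OF finZ])
  show "disjoint_family_on (%z. B z i) Z"
   unfolding disjoint_family_on_def using Bsub that unfolding cell_def by blast
 qed
 have part: "part M m Gm"
  unfolding part_def
 proof (intro conjI allI impI)
  fix i assume "i < m" then show "Gm i : sets M" unfolding Gm_def using B(1) finZ by auto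
 next
  show "disjoint_family_on Gm {..<m}"
   unfolding disjoint_family_on_def
  proof (intro ballI impI)
   fix i j assume ij: "i : {..<m}" "j : {..<m}" "i ~= j"
   have "B z i \<inter> B z' j = {}" if "z : Z" "z' : Z" for z z'
   proof (cases "z = z'")
    case True then show ?thesis using B(2)[OF that(1)] ij unfolding disjoint_family_on_def by auto
   next
    case False
    then show ?thesis using Bsub[OF that(1), of i] Bsub[OF that(2), of j] ij unfolding cell_def by auto
   qed
   then show "Gm i \<inter> Gm j = {}" unfolding Gm_def by blast
  qed
 next
  have "(\<Union>i<m. Gm i) = (\<Union>z\<in>Z. cell z)" unfolding Gm_def using B(3) by blast
  also have "... = space M" unfolding cell_def Z_def by auto
  finally show "(\<Union>i<m. Gm i) = space M" .
 qed
 have cells: "f i x = (\<Sum>z\<in>Z. f i x * indicator (cell z) x)" if "x : space M" for i x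
 proof -
  have "(\<Sum>z\<in>Z. f i x * indicator (cell z) x) = (\<Sum>z\<in>Z. if z = key x then f i x else 0)"
   using that by (intro sum.cong) (auto simp: cell_def indicator_def)
  also have "... = f i x" using finZ that by (simp add: Z_def)
  finally show ?thesis by simp
 qed
 have vol: "measure M (Gm i) = (LINT x|M. f i x)" if "i < m" for i
 proof -
  have "measure M (Gm i) = (LINT x|M. indicator (Gm i) x)" using part that by (auto simp: part_def)
  also have "... = (LINT x|M. (\<Sum>z\<in>Z. indicator (B z i) x))"
   using ind[OF that] by (intro BI_integral_cong) auto
  also have "... = (\<Sum>z\<in>Z. measure M (B z i))"
   using B(1) that by (subst BI_integral_sum) (auto intro!: bdd_integrable)
  also have "... = (\<Sum>z\<in>Z. (LINT x|M. f i x * indicator (cell z) x))"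
   using B(4) that unfolding r_def by auto
  also have "... = (LINT x|M. (\<Sum>z\<in>Z. f i x * indicator (cell z) x))"
   using fb that by (subst BI_integral_sum) auto
  also have "... = (LINT x|M. f i x)"
   using cells by (intro BI_integral_cong) auto
  finally show ?thesis .
 qed
 \<comment> \<open>The costs rounded down to multiples of \<open>ep\<close>, constant on cells.
   Going from \<open>h\<close> to \<open>hd\<close> loses at most \<open>ep\<close>, because the
   volumes sum to 1; going back loses nothing, because \<open>hd\<close> lies below
   \<open>h\<close>.\<close>
 define hd where "hd i x = ep * of_int \<lfloor>h i x / ep\<rfloor>" for i x
 have hd: "hd i x <= h i x" "h i x <= hd i x + ep" for i x
 proof -
  have "of_int \<lfloor>h i x / ep\<rfloor> <= h i x / ep" "h i x / ep <= of_int \<lfloor>h i x / ep\<rfloor> + 1" by linarith+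
  from this[THEN mult_left_mono, of ep] show "hd i x <= h i x" "h i x <= hd i x + ep"
   unfolding hd_def using e by (auto simp: distrib_left)
 qed
 have hdb: "bdd M (hd i)" if "i < m" for i
 proof (rule bddI[where C="C + ep"])
  have [measurable]: "h i : bm M" using h that by (auto simp: bdd_def)
  show "hd i : bm M" unfolding hd_def by measurable
  fix x assume "x : space M"
  then show "\<bar>hd i x\<bar> <= C + ep" using C[OF that, of x] hd[of i x] e by auto
 qed
 have eq: "(LINT x|M. indicator (Gm i) x * hd i x) = (LINT x|M. f i x * hd i x)" if "i < m" for i
 proof -
  have hz: "hd i x = ep * of_int (z ! i)" if "x : cell z" for x z
   using that \<open>i < m\<close> unfolding cell_def key_def hd_def by auto
  have hzB: "hd i x = ep * of_int (z ! i)" if "z : Z" "x : B z i" for x z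
   using hz[of x z] Bsub[OF that(1) \<open>i < m\<close>] that by blast
  have "(LINT x|M. indicator (Gm i) x * hd i x) = (LINT x|M. (\<Sum>z\<in>Z. ep * of_int (z ! i) * indicator (B z i) x))"
   using ind[OF that] hzB
   by (intro BI_integral_cong) (auto simp: sum_distrib_right indicator_def intro!: sum.cong)
  also have "... = (\<Sum>z\<in>Z. ep * of_int (z ! i) * measure M (B z i))"
   using B(1) that by (subst BI_integral_sum) (auto intro!: bdd_integrable)
  also have "... = (\<Sum>z\<in>Z. (LINT x|M. ep * of_int (z ! i) * (f i x * indicator (cell z) x)))"
   using B(4) that unfolding r_def by auto
  also have "... = (LINT x|M. (\<Sum>z\<in>Z. ep * of_int (z ! i) * (f i x * indicator (cell z) x)))"
   using fb that by (subst BI_integral_sum) (auto intro!: bdd_integrable bdd_cmult)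
  also have "... = (LINT x|M. (\<Sum>z\<in>Z. f i x * indicator (cell z) x) * hd i x)"
   using hz by (intro BI_integral_cong)
    (auto simp: sum_distrib_right indicator_def intro!: sum.cong)
  also have "... = (LINT x|M. f i x * hd i x)"
   using cells by (intro BI_integral_cong) auto
  finally show ?thesis .
 qed
 have Gmb: "bdd M (indicator (Gm i))" if "i < m" for i using part that unfolding part_def by auto
 have "(\<Sum>i<m. (LINT x|M. indicator (Gm i) x * h i x)) <= (\<Sum>i<m. (LINT x|M. indicator (Gm i) x * hd i x) + ep * measure M (Gm i))"
 proof (rule sum_mono)
  fix i assume "i : {..<m}" then have i: "i < m" by simp
  have "(LINT x|M. indicator (Gm i) x * h i x) <= (LINT x|M. indicator (Gm i) x * hd i x + ep * indicator (Gm i) x)"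
   using Gmb[OF i] h[OF i] hdb[OF i] hd[of i]
   by (intro integral_mono bdd_integrable bdd_mult bdd_add bdd_cmult) (auto split: split_indicator)
  also have "... = (LINT x|M. indicator (Gm i) x * hd i x) + ep * measure M (Gm i)"
   using Gmb[OF i] hdb[OF i] part i
   by (subst BI_integral_add) (auto intro!: bdd_integrable simp: part_def)
  finally show "(LINT x|M. indicator (Gm i) x * h i x) <= (LINT x|M. indicator (Gm i) x * hd i x) + ep * measure M (Gm i)" .
 qed
 also have "... = (\<Sum>i<m. (LINT x|M. f i x * hd i x)) + ep * (\<Sum>i<m. (LINT x|M. f i x))"
  using eq vol by (simp add: sum.distrib sum_distrib_left)
 also have "(\<Sum>i<m. (LINT x|M. f i x)) = (LINT x|M. (\<Sum>i<m. f i x))"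
  using relaxed_bdd[OF f] by (subst BI_integral_sum) auto
 also have "... = (LINT x|M. 1)" using f by (intro BI_integral_cong) (auto simp: relaxed_def)
 also have "... = 1" by (simp add: prob_space)
 also have "(\<Sum>i<m. (LINT x|M. f i x * hd i x)) <= (\<Sum>i<m. (LINT x|M. f i x * h i x))"
  using relaxed_bdd[OF f] h hdb hd relaxed_le1(2)[OF f]
  by (intro sum_mono integral_mono bdd_integrable) (auto intro!: mult_left_mono)
 finally have "(\<Sum>i<m. (LINT x|M. indicator (Gm i) x * h i x)) <= (\<Sum>i<m. (LINT x|M. f i x * h i x)) + ep" by simp
 then show ?thesis using part vol by blast
qed

end

section \<open>Lagrange multipliers of a linear program over partitions\<close>

text \<open>\<open>indec\<close> excludes a splitting of the indices for which the differences
  \<open>h q - h p\<close>, compared with those of \<open>lam\<close>, leave a gap of width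
  \<open>ep\<close> between their values on the cells inside \<open>S\<close> and on those outside.
  With such a gap the multipliers of one side could be moved freely, and the optimal cost would have
  a kink as a function of the volumes.\<close>

locale linprog = prob_space M for M :: "'a measure" +
 fixes m :: nat and f h :: "nat => 'a => real"
 assumes mpos: "0 < m"
  and f_relaxed: "relaxed M m f"
  and f01: "i < m ==> x : space M ==> f i x = 0 \<or> f i x = 1"
  and f_pos: "i < m ==> 0 < (LINT x|M. f i x)"
  and h_bdd: "i < m ==> bdd M (h i)"
  and opt: "relaxed M m k ==> (!!i. i < m ==> (LINT x|M. k i x) = (LINT x|M. f i x)) ==>
   (\<Sum>i<m. (LINT x|M. f i x * h i x)) <= (\<Sum>i<m. (LINT x|M. k i x * h i x))"
  and indec: "S <= {..<m} ==> S ~= {} ==> S ~= {..<m} ==> 0 < ep ==>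
   (AE x in M. ALL p:S. ALL q:{..<m} - S. (f p x = 1 --> lam q - lam p + ep <= h q x - h p x) \<and>
    (f q x = 1 --> h q x - h p x <= lam q - lam p)) ==> False"
begin

lemma f_bdd: "i < m ==> bdd M (f i)"
 using relaxed_bdd[OF f_relaxed] .

lemma hC: obtains C where "!!i x. i < m ==> x : space M ==> \<bar>h i x\<bar> <= C" "0 <= C"
proof -
 have "ALL i:{..<m}. EX C. ALL x:space M. \<bar>h i x\<bar> <= C" using h_bdd unfolding bdd_def by blast
 then obtain Cf where Cf: "!!i x. i < m ==> x : space M ==> \<bar>h i x\<bar> <= Cf i" by (metis lessThan_iff)
 show ?thesis
 proof (rule that[of "\<Sum>i<m. \<bar>Cf i\<bar>"])
  fix i x assume "i < m" "x : space M"
  then have "\<bar>h i x\<bar> <= \<bar>Cf i\<bar>" using Cf by fastforce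
  also have "... <= (\<Sum>i<m. \<bar>Cf i\<bar>)" using \<open>i < m\<close> by (intro member_le_sum) auto
  finally show "\<bar>h i x\<bar> <= (\<Sum>i<m. \<bar>Cf i\<bar>)" .
 qed (auto intro: sum_nonneg)
qed

text \<open>A feasible direction: the lower bound \<open>- C * f i\<close> keeps
  \<open>f + r * ph\<close> nonnegative as long as \<open>r * C <= 1\<close>. The volumes change by
  \<open>\<eta>\<close>, at a cost of at most \<open>c\<close>.\<close>

definition move :: "real => (nat => 'a => real) => (nat => real) => real => bool" where
 "move C ph \<eta> c \<longleftrightarrow> 0 <= C & (ALL i<m. bdd M (ph i)) & (ALL x:space M. (\<Sum>i<m. ph i x) = 0) \<and>
  (ALL i<m. ALL x:space M. - C * f i x <= ph i x) & (ALL i<m. (LINT x|M. ph i x) = \<eta> i) \<and>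
  (\<Sum>i<m. (LINT x|M. ph i x * h i x)) <= c"

lemma move_zero: "move 0 (%_ _. 0) (%_. 0) 0"
 unfolding move_def by auto

lemma move_add:
 assumes "move C ph \<eta> c" "move C' ph' \<eta>' c'"
 shows "move (C + C') (%i x. ph i x + ph' i x) (%i. \<eta> i + \<eta>' i) (c + c')"
proof -
 have b: "bdd M (ph i)" "bdd M (ph' i)" if "i < m" for i using assms that unfolding move_def by auto
 have "(\<Sum>i<m. (LINT x|M. (ph i x + ph' i x) * h i x)) = (\<Sum>i<m. (LINT x|M. ph i x * h i x) + (LINT x|M. ph' i x * h i x))"
 proof (rule sum.cong)
  fix i assume "i : {..<m}" then have i: "i < m" by simp
  show "(LINT x|M. (ph i x + ph' i x) * h i x) = (LINT x|M. ph i x * h i x) + (LINT x|M. ph' i x * h i x)"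
   using b[OF i] h_bdd[OF i] by (subst BI_integral_add[symmetric]) (auto simp: algebra_simps)
 qed simp
 moreover have "- (C + C') * f i x <= ph i x + ph' i x" if "i < m" "x : space M" for i x
 proof -
  have "- C * f i x <= ph i x" "- C' * f i x <= ph' i x" using assms that unfolding move_def by auto
  then show ?thesis by (simp add: algebra_simps)
 qed
 ultimately show ?thesis using assms b unfolding move_def
  by (auto simp: sum.distrib BI_integral_add bdd_integrable)
qed

lemma move_scale:
 assumes "move C ph \<eta> c" "0 <= r"
 shows "move (r * C) (%i x. r * ph i x) (%i. r * \<eta> i) (r * c)"
proof -
 have "- (r * C) * f i x <= r * ph i x" if "i < m" "x : space M" for i x
  using mult_left_mono[of "- C * f i x" "ph i x" r] assms that unfolding move_def by (simp add: mult.assoc)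
 moreover have "(\<Sum>i<m. (LINT x|M. r * ph i x * h i x)) <= r * c"
 proof -
  have "(\<Sum>i<m. (LINT x|M. r * ph i x * h i x)) = r * (\<Sum>i<m. (LINT x|M. ph i x * h i x))"
   by (simp add: sum_distrib_left mult.assoc)
  then show ?thesis using assms unfolding move_def by (simp add: mult_left_mono)
 qed
 ultimately show ?thesis using assms unfolding move_def by (auto simp: sum_distrib_left[symmetric])
qed

lemma move_sum:
 assumes "finite J" "!!j. j : J ==> move (C j) (ph j) (\<eta> j) (c j)"
 shows "move (\<Sum>j\<in>J. C j) (%i x. \<Sum>j\<in>J. ph j i x) (%i. \<Sum>j\<in>J. \<eta> j i) (\<Sum>j\<in>J. c j)"
 using assms
proof (induction J)
 case empty then show ?case using move_zero by simp
next
 case (insert j J)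
 then show ?case using move_add[of "C j" "ph j" "\<eta> j" "c j"] by simp
qed

lemma move_relaxed:
 assumes "move C ph \<eta> c" "C <= 1"
 shows "relaxed M m (%i x. f i x + ph i x)" "!!i. i < m ==> (LINT x|M. f i x + ph i x) = (LINT x|M. f i x) + \<eta> i"
  "(\<Sum>i<m. (LINT x|M. (f i x + ph i x) * h i x)) <= (\<Sum>i<m. (LINT x|M. f i x * h i x)) + c"
proof -
 have b: "bdd M (ph i)" if "i < m" for i using assms that unfolding move_def by auto
 have nn: "0 <= f i x + ph i x" if "i < m" "x : space M" for i x
 proof -
  have "- C * f i x <= ph i x" using assms that unfolding move_def by auto
  moreover have "C * f i x <= f i x" using assms relaxed_le1[OF f_relaxed that]
   by (simp add: mult_left_le_one_le move_def)
  ultimately show ?thesis by simp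
 qed
 show "relaxed M m (%i x. f i x + ph i x)"
  using f_relaxed assms b nn unfolding relaxed_def move_def by (auto simp: sum.distrib bdd_def)
 show "(LINT x|M. f i x + ph i x) = (LINT x|M. f i x) + \<eta> i" if "i < m" for i
  using b[OF that] f_bdd[OF that] assms that unfolding move_def
  by (subst BI_integral_add) auto
 have "(\<Sum>i<m. (LINT x|M. (f i x + ph i x) * h i x)) = (\<Sum>i<m. (LINT x|M. f i x * h i x) + (LINT x|M. ph i x * h i x))"
 proof (rule sum.cong)
  fix i assume "i : {..<m}" then have i: "i < m" by simp
  show "(LINT x|M. (f i x + ph i x) * h i x) = (LINT x|M. f i x * h i x) + (LINT x|M. ph i x * h i x)"
   using b[OF i] f_bdd[OF i] h_bdd[OF i] by (subst BI_integral_add[symmetric]) (auto simp: algebra_simps)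
 qed simp
 then show "(\<Sum>i<m. (LINT x|M. (f i x + ph i x) * h i x)) <= (\<Sum>i<m. (LINT x|M. f i x * h i x)) + c"
  using assms unfolding move_def by (auto simp: sum.distrib)
qed

lemma move_opt:
 assumes "move C ph \<eta> c" "!!i. i < m ==> \<eta> i = 0"
 shows "0 <= c"
proof -
 define r where "r = 1 / (C + 1)"
 have r: "0 < r" "r * C <= 1" using assms unfolding r_def move_def by (auto simp: field_simps)
 note mv = move_scale[OF assms(1), of r]
 have mv: "move (r * C) (%i x. r * ph i x) (%i. r * \<eta> i) (r * c)" using mv r by simp
 have "(\<Sum>i<m. (LINT x|M. f i x * h i x)) <= (\<Sum>i<m. (LINT x|M. (f i x + r * ph i x) * h i x))"
  using move_relaxed(1,2)[OF mv r(2)] assms(2) by (intro opt) auto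
 also have "... <= (\<Sum>i<m. (LINT x|M. f i x * h i x)) + r * c" using move_relaxed(3)[OF mv r(2)] .
 finally show ?thesis using r by (simp add: zero_le_mult_iff)
qed

text \<open>The change of volumes when a unit of mass passes from cell i to cell j.\<close>

abbreviation ediff :: "nat => nat => nat => real" where
 "ediff i j l \<equiv> of_bool (l = j) - of_bool (l = i)"

lemma sum_ediff: "i < m ==> j < m ==> (\<Sum>l<m. ediff i j l * X l) = X j - (X i :: real)"
 by (simp add: left_diff_distrib sum_subtractf of_bool_def if_distrib[where f="%c. c * _"] cong: if_cong)

definition lowset :: "nat => nat => real => 'a set" where
 "lowset i j c = {x\<in>space M. f i x = 1 & h j x - h i x < c}"

text \<open>The essential infimum of \<open>h j - h i\<close> on cell i: the price per unit mass of
  handing the cheapest part of cell i directly to j.\<close>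

definition d :: "nat => nat => real" where
 "d i j = Inf {c. 0 < measure M (lowset i j c)}"

lemma lowset_sets[measurable]: "i < m ==> j < m ==> lowset i j c : sets M"
proof -
 assume ij: "i < m" "j < m"
 then have [measurable]: "f i : bm M" "h i : bm M" "h j : bm M"
  using f_bdd h_bdd by (auto simp: bdd_def)
 show ?thesis unfolding lowset_def by measurable
qed

lemma lowset_ne: "i < m ==> j < m ==> {c. 0 < measure M (lowset i j c)} ~= {}"
 and lowset_bdd: "i < m ==> j < m ==> bdd_below {c. 0 < measure M (lowset i j c)}"
proof -
 assume ij: "i < m" "j < m"
 obtain C where C: "!!i x. i < m ==> x : space M ==> \<bar>h i x\<bar> <= C" using hC by blast
 have "lowset i j (2 * C + 1) = {x\<in>space M. f i x = 1}"
  unfolding lowset_def using C[OF ij(1)] C[OF ij(2)] by force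
 moreover have "0 < (LINT x|M. indicat_real {x\<in>space M. f i x = 1} x)"
 proof -
  have "(LINT x|M. f i x) = (LINT x|M. indicat_real {x\<in>space M. f i x = 1} x)"
   using f01[OF ij(1)] by (intro BI_integral_cong) (auto simp: indicator_def)
  then show ?thesis using f_pos[OF ij(1)] by argo
 qed
 ultimately have "0 < measure M (lowset i j (2 * C + 1))" using lowset_sets[OF ij, of "2*C+1"] by simp
 then show "{c. 0 < measure M (lowset i j c)} ~= {}" by blast
 show "bdd_below {c. 0 < measure M (lowset i j c)}"
 proof (rule bdd_belowI[of _ "-2 * C"])
  fix c assume "c : {c. 0 < measure M (lowset i j c)}"
  then have "lowset i j c ~= {}" by auto
  then obtain x where "x : space M" "h j x - h i x < c" unfolding lowset_def by auto
  then show "-2 * C <= c" using C[OF ij(1), of x] C[OF ij(2), of x] by linarith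
 qed
qed

lemma d_AE:
 assumes ij: "i < m" "j < m"
 shows "AE x in M. f i x = 1 --> d i j <= h j x - h i x"
proof -
 have "AE x in M. ALL n. f i x = 1 --> d i j - 1 / real (Suc n) <= h j x - h i x"
  unfolding AE_all_countable
 proof
  fix n
  have "d i j - 1 / real (Suc n) ~: {c. 0 < measure M (lowset i j c)}"
   using cInf_lower[OF _ lowset_bdd[OF ij], of "d i j - 1 / real (Suc n)"] unfolding d_def by auto
  then have "measure M (lowset i j (d i j - 1 / real (Suc n))) = 0"
   by (metis less_le measure_nonneg mem_Collect_eq)
  then have "AE x in M. x ~: lowset i j (d i j - 1 / real (Suc n))"
   using lowset_sets[OF ij] by (intro AE_not_in) (auto simp: null_sets_def emeasure_eq_measure)
  then show "AE x in M. f i x = 1 --> d i j - 1 / real (Suc n) <= h j x - h i x"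
   using AE_space by eventually_elim (auto simp: lowset_def)
 qed
 then show ?thesis
 proof (rule eventually_mono)
  fix x assume *: "ALL n. f i x = 1 --> d i j - 1 / real (Suc n) <= h j x - h i x"
  show "f i x = 1 --> d i j <= h j x - h i x"
  proof (intro impI, rule field_le_epsilon)
   fix e :: real assume fx: "f i x = 1" and e: "0 < e"
   obtain n where n: "1 / real (Suc n) < e" by (rule nat_approx_posE[OF e])
   have "d i j - 1 / real (Suc n) <= h j x - h i x" using * fx by blast
   then show "d i j <= h j x - h i x + e" using n by linarith
  qed
 qed
qed

text \<open>The prices of all ways to carry a unit of mass from i to j, detours through other cells
  included. The infimum \<open>D\<close> therefore satisfies the triangle inequality like a
  shortest-path distance, and optimality of \<open>f\<close> rules out negative cycles.\<close>

definition W :: "nat => nat => real set" where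
 "W i j = {c. EX C ph. move C ph (ediff i j) c}"

text \<open>Hand over a part \<open>E\<close> of cell i on which the price stays below some
  \<open>c' < c\<close>, normalized to unit mass.\<close>

lemma W_d:
 assumes ij: "i < m" "j < m" "i ~= j" and c: "d i j < c"
 shows "c : W i j"
proof -
 obtain c' where c': "0 < measure M (lowset i j c')" "c' < c"
  using c lowset_ne[OF ij(1,2)] lowset_bdd[OF ij(1,2)] unfolding d_def by (auto simp: cInf_less_iff)
 define E where "E = lowset i j c'"
 define p where "p = measure M E"
 have p: "0 < p" using c' unfolding p_def E_def by simp
 have E: "E : sets M" unfolding E_def using lowset_sets ij by auto
 define ph where "ph l x = ediff i j l * (indicator E x / p)" for l x
 have "move (1 / p) ph (ediff i j) c"
  unfolding move_def
 proof (intro conjI allI ballI impI)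
  fix l assume l: "l < m"
  have "bdd M (%x. ediff i j l / p * indicator E x)" using E by (intro bdd_cmult bdd_indicator)
  then show "bdd M (ph l)" unfolding ph_def by simp
  have "(LINT x|M. ph l x) = ediff i j l * (measure M E / p)"
   unfolding ph_def using E by simp
  then show "(LINT x|M. ph l x) = ediff i j l" using p unfolding p_def by simp
  fix x assume x: "x : space M"
  show "- (1 / p) * f l x <= ph l x"
   using divide_nonneg_pos[OF relaxed_le1(2)[OF f_relaxed l x] p] p ij
   by (auto simp: ph_def E_def lowset_def indicator_def intro: order_trans[of _ 0])
 next
  fix x assume "x : space M"
  show "(\<Sum>l<m. ph l x) = 0" unfolding ph_def by (subst sum_ediff[OF ij(1,2)]) simp
 next
  have hb: "bdd M (%x. indicator E x * h l x)" if "l < m" for l using E h_bdd[OF that] by auto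
  have "(\<Sum>l<m. (LINT x|M. ph l x * h l x)) = (\<Sum>l<m. ediff i j l * (LINT x|M. indicator E x * h l x / p))"
   unfolding ph_def by (simp flip: integral_mult_right_zero add: mult_ac)
  also have "... = (LINT x|M. indicator E x * h j x / p) - (LINT x|M. indicator E x * h i x / p)"
   by (rule sum_ediff[OF ij(1,2)])
  also have "... = (LINT x|M. indicator E x * h j x - indicator E x * h i x) / p"
   using hb ij by (subst BI_integral_diff) (auto simp: diff_divide_distrib)
  also have "(LINT x|M. indicator E x * h j x - indicator E x * h i x) <= (LINT x|M. c' * indicator E x)"
  proof (rule integral_mono)
   show "integrable M (%x. indicator E x * h j x - indicator E x * h i x)"
    by (intro bdd_integrable bdd_diff hb ij)
   show "integrable M (%x. c' * indicator E x)" using E by (auto intro!: bdd_integrable bdd_cmult)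
   fix x assume "x : space M"
   then show "indicator E x * h j x - indicator E x * h i x <= c' * indicator E x"
    by (auto simp: indicator_def E_def lowset_def)
  qed
  then have "(LINT x|M. indicator E x * h j x - indicator E x * h i x) / p <= c' * p / p"
   using p E unfolding p_def by (intro divide_right_mono) auto
  also have "... <= c" using p c' by simp
  finally show "(\<Sum>l<m. (LINT x|M. ph l x * h l x)) <= c" .
 qed (use p in auto)
 then show ?thesis unfolding W_def by blast
qed

lemma W_refl: "0 : W i i"
 unfolding W_def using move_zero by (auto simp: )

lemma W_add: "c : W i j ==> c' : W j l ==> c + c' : W i l"
proof -
 assume "c : W i j" "c' : W j l"
 then obtain C C' ph ph' where "move C ph (ediff i j) c" "move C' ph' (ediff j l) c'" unfolding W_def by auto
 from move_add[OF this] show ?thesis unfolding W_def by (auto simp: algebra_simps)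
qed

lemma W_nonneg: "c : W i i ==> 0 <= c"
 unfolding W_def using move_opt by fastforce

lemma W_ne: "i < m ==> j < m ==> W i j ~= {}"
 using W_d[of i j "d i j + 1"] W_refl by (cases "i = j") auto

lemma W_bdd: "i < m ==> j < m ==> bdd_below (W i j)"
proof -
 assume ij: "i < m" "j < m"
 obtain c' where "c' : W j i" using W_ne[OF ij(2,1)] by blast
 then have "0 <= c + c'" if "c : W i j" for c using W_nonneg W_add that by blast
 then have "- c' <= c" if "c : W i j" for c using that by force
 then show ?thesis by (rule bdd_belowI)
qed

definition D :: "nat => nat => real" where "D i j = Inf (W i j)"

lemma D_le: "i < m ==> j < m ==> c : W i j ==> D i j <= c"
 unfolding D_def by (rule cInf_lower[OF _ W_bdd])

lemma D_tri:
 assumes "i < m" "j < m" "l < m"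
 shows "D i l <= D i j + D j l"
proof -
 have "D i l - c <= D j l" if c: "c : W i j" for c
  unfolding D_def[of j l]
 proof (rule cInf_greatest[OF W_ne])
  fix c' assume "c' : W j l"
  then show "D i l - c <= c'" using D_le[OF assms(1,3) W_add[OF c]] by fastforce
 qed (use assms in auto)
 then have "D i l - D j l <= c" if "c : W i j" for c using that by fastforce
 then have "D i l - D j l <= D i j" unfolding D_def[of i j] using assms by (intro cInf_greatest W_ne) auto
 then show ?thesis by simp
qed

lemma D_refl: "i < m ==> D i i = 0"
 using D_le[of i i 0] W_refl cInf_greatest[of "W i i" 0] W_ne[of i i] W_nonneg
 unfolding D_def by (auto intro!: antisym)

lemma D_d: "i < m ==> j < m ==> i ~= j ==> D i j <= d i j"
 by (rule dense_ge) (use D_le W_d in blast)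

definition lam :: "nat => real" where "lam j = D 0 j"

text \<open>The triangle inequality through 0 is one direction. For the other, let \<open>S\<close>
  be the indices reached from i at the multiplier price. A transfer out of \<open>S\<close> at that
  price would enlarge \<open>S\<close>, so all of them are dearer by a common \<open>ep\<close>,
  while transfers back never undercut the multipliers: exactly the splitting excluded by
  \<open>indec\<close>. Equality says that the prices of opposite transfers cancel, i.e. the
  multipliers are unique up to a constant.\<close>

lemma D_eq:
 assumes ij: "i < m" "j < m"
 shows "D i j = lam j - lam i"
proof (rule antisym)
 show "lam j - lam i <= D i j" using D_tri[OF mpos ij] unfolding lam_def by simp
 define S where "S = {j. j < m & D i j <= lam j - lam i}"
 have iS: "i : S" unfolding S_def using ij D_refl by simp
 have "S = {..<m}"
 proof (rule ccontr)
  assume ne: "S ~= {..<m}"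
  have gap: "lam q - lam p < d p q" if p: "p : S" and q: "q : {..<m} - S" for p q
  proof (rule ccontr)
   assume "\<not> ?thesis"
   then have "D p q <= lam q - lam p" using D_d[of p q] p q unfolding S_def by fastforce
   then have "D i q <= lam q - lam i" using D_tri[of i p q] p q ij unfolding S_def by force
   then show False using q unfolding S_def by auto
  qed
  define Z where "Z = (%(p, q). d p q - (lam q - lam p)) ` (S \<times> ({..<m} - S))"
  have fin: "finite Z" unfolding Z_def S_def by auto
  have Sm: "S <= {..<m}" unfolding S_def by auto
  then obtain q where "q : {..<m} - S" using ne by blast
  then have Zne: "Z ~= {}" unfolding Z_def using iS by auto
  define ep where "ep = Min Z"
  have e: "0 < ep" unfolding ep_def using fin Zne gap by (auto simp: Min_gr_iff Z_def)
  have le: "ep <= d p q - (lam q - lam p)" if "p : S" "q : {..<m} - S" for p q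
   unfolding ep_def using fin that by (intro Min_le) (auto simp: Z_def)
  have "AE x in M. ALL p:{..<m}. ALL q:{..<m}. f p x = 1 --> d p q <= h q x - h p x"
   using d_AE by (intro AE_finite_allI) auto
  then have "AE x in M. ALL p:S. ALL q:{..<m} - S. (f p x = 1 --> lam q - lam p + ep <= h q x - h p x) \<and>
    (f q x = 1 --> h q x - h p x <= lam q - lam p)"
  proof eventually_elim
   case (elim x)
   show ?case
   proof (intro ballI conjI impI)
    fix p q assume pq: "p : S" "q : {..<m} - S"
    then have pm: "p < m" "q < m" "p ~= q" using Sm by auto
    { assume "f p x = 1"
     then have "d p q <= h q x - h p x" using elim pm by auto
     then show "lam q - lam p + ep <= h q x - h p x" using le[OF pq] by linarith }
    { assume "f q x = 1"
     then have "d q p <= h p x - h q x" using elim pm by auto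
     moreover have "lam p - lam q <= d q p"
      using D_tri[of 0 q p] D_d[of q p] pm mpos unfolding lam_def by fastforce
     ultimately show "h q x - h p x <= lam q - lam p" by linarith }
   qed
  qed
  then show False using indec[OF Sm _ ne e] iS by blast
 qed
 then show "D i j <= lam j - lam i" using ij unfolding S_def by blast
qed

lemma multiplier:
 assumes ij: "i < m" "j < m"
 shows "AE x in M. f i x = 1 --> h i x - lam i <= h j x - lam j"
proof (cases "i = j")
 case False
 have "lam j - lam i <= d i j" using D_eq[OF ij] D_d[OF ij False] by simp
 with d_AE[OF ij] show ?thesis by (auto elim!: eventually_mono)
qed simp

text \<open>Differentiability of the optimal cost in the volumes, as an upper bound. Any small
  volume change is routed through cell 0: mass gained by j comes along a nearly optimal move from 0
  to j, mass lost by j leaves along one from j to 0. Since \<open>D\<close> is a difference of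
  multipliers, both are priced by \<open>lam\<close> up to \<open>ep\<close>.\<close>

lemma taylor:
 assumes e: "0 < ep"
 shows "EX \<eta>0>0. ALL \<eta>. (\<Sum>i<m. \<eta> i) = 0 --> (\<Sum>i<m. \<bar>\<eta> i\<bar>) <= \<eta>0 -->
  (EX k. relaxed M m k & (ALL i<m. (LINT x|M. k i x) = (LINT x|M. f i x) + \<eta> i) \<and>
   (\<Sum>i<m. (LINT x|M. k i x * h i x)) <=
    (\<Sum>i<m. (LINT x|M. f i x * h i x)) + (\<Sum>i<m. lam i * \<eta> i) + ep * (\<Sum>i<m. \<bar>\<eta> i\<bar>))"
proof -
 have mv: "EX C ph. move C ph (ediff i j) (lam j - lam i + ep)" if ij: "i < m" "j < m" for i j
 proof -
  have "Inf (W i j) < lam j - lam i + ep" using D_eq[OF ij] e unfolding D_def by simp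
  then obtain c where c: "c : W i j" "c < lam j - lam i + ep"
   using W_ne[OF ij] W_bdd[OF ij] by (auto simp: cInf_less_iff)
  then obtain C ph where "move C ph (ediff i j) c" unfolding W_def by auto
  then have "move C ph (ediff i j) (lam j - lam i + ep)" using c unfolding move_def by auto
  then show ?thesis by blast
 qed
 have "ALL i:{..<m}. ALL j:{..<m}. EX C ph. move C ph (ediff i j) (lam j - lam i + ep)" using mv by simp
 then obtain C ph where mv: "!!i j. i < m ==> j < m ==> move (C i j) (ph i j) (ediff i j) (lam j - lam i + ep)"
  by (metis lessThan_iff)
 have C0: "0 <= C i j" if "i < m" "j < m" for i j using mv[OF that] unfolding move_def by blast
 \<comment> \<open>Bounds the depletion rates of all moves used, so that total transfers of at most
   \<open>1 / K\<close> leave \<open>f\<close> nonnegative.\<close>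
 define K where "K = (\<Sum>j<m. C 0 j + C j 0) + 1"
 have K: "0 < K" unfolding K_def using C0 mpos by (intro add_nonneg_pos sum_nonneg) auto
 have CK: "C 0 j <= K" "C j 0 <= K" if "j < m" for j
 proof -
  have "C 0 j + C j 0 <= (\<Sum>j<m. C 0 j + C j 0)" using that C0 mpos by (intro member_le_sum) auto
  then show "C 0 j <= K" "C j 0 <= K" unfolding K_def using C0[of 0 j] C0[of j 0] that mpos by auto
 qed
 show ?thesis
 proof (intro exI[of _ "1 / K"] conjI allI impI)
  show "0 < 1 / K" using K by simp
  fix \<eta> :: "nat => real"
  assume s0: "(\<Sum>i<m. \<eta> i) = 0" and s1: "(\<Sum>i<m. \<bar>\<eta> i\<bar>) <= 1 / K"
  define P where "P j = max (\<eta> j) 0" for j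
  define Q where "Q j = max (- \<eta> j) 0" for j
  have PQ: "0 <= P j" "0 <= Q j" "P j - Q j = \<eta> j" "P j + Q j = \<bar>\<eta> j\<bar>" for j unfolding P_def Q_def by auto
  have lam0: "lam 0 = 0" unfolding lam_def using D_refl[OF mpos] .
  have "move (P j * C 0 j + Q j * C j 0) (%i x. P j * ph 0 j i x + Q j * ph j 0 i x)
    (%i. P j * ediff 0 j i + Q j * ediff j 0 i) (P j * (lam j - lam 0 + ep) + Q j * (lam 0 - lam j + ep))"
   if "j < m" for j
   by (intro move_add move_scale mv PQ that mpos)
  then have mvs: "move (\<Sum>j<m. P j * C 0 j + Q j * C j 0) (%i x. \<Sum>j<m. P j * ph 0 j i x + Q j * ph j 0 i x)
    (%i. \<Sum>j<m. P j * ediff 0 j i + Q j * ediff j 0 i)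
    (\<Sum>j<m. P j * (lam j - lam 0 + ep) + Q j * (lam 0 - lam j + ep))"
   by (intro move_sum) auto
  have "(\<Sum>j<m. P j * C 0 j + Q j * C j 0) <= (\<Sum>j<m. \<bar>\<eta> j\<bar> * K)"
  proof (rule sum_mono)
   fix j assume "j : {..<m}"
   then have "P j * C 0 j + Q j * C j 0 <= P j * K + Q j * K"
    using CK[of j] PQ[of j] by (intro add_mono mult_left_mono) auto
   also have "... = \<bar>\<eta> j\<bar> * K" using PQ[of j] by (metis distrib_right)
   finally show "P j * C 0 j + Q j * C j 0 <= \<bar>\<eta> j\<bar> * K" .
  qed
  also have "... = (\<Sum>j<m. \<bar>\<eta> j\<bar>) * K" by (simp only: sum_distrib_right)
  also have "... <= 1" using s1 K by (simp add: pos_le_divide_eq)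
  finally have C1: "(\<Sum>j<m. P j * C 0 j + Q j * C j 0) <= 1" .
  have eta: "(\<Sum>j<m. P j * ediff 0 j i + Q j * ediff j 0 i) = \<eta> i" if "i < m" for i
  proof -
   have "(\<Sum>j<m. P j * ediff 0 j i + Q j * ediff j 0 i) = (\<Sum>j<m. (if i = j then \<eta> j else 0) - \<eta> j * of_bool (i = 0))"
    unfolding PQ(3)[symmetric] by (intro sum.cong) (auto simp: algebra_simps)
   also have "... = (\<Sum>j<m. if i = j then \<eta> j else 0) - (\<Sum>j<m. \<eta> j) * of_bool (i = 0)"
    by (simp only: sum_subtractf sum_distrib_right)
   also have "... = \<eta> i" using s0 that by simp
   finally show ?thesis .
  qed
  have cost: "(\<Sum>j<m. P j * (lam j - lam 0 + ep) + Q j * (lam 0 - lam j + ep)) =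
    (\<Sum>i<m. lam i * \<eta> i) + ep * (\<Sum>i<m. \<bar>\<eta> i\<bar>)"
  proof -
   have "(\<Sum>j<m. P j * (lam j - lam 0 + ep) + Q j * (lam 0 - lam j + ep)) =
     (\<Sum>j<m. lam j * (P j - Q j) + ep * (P j + Q j))"
    unfolding lam0 by (intro sum.cong) (auto simp: algebra_simps)
   then show ?thesis unfolding PQ(3,4) by (simp add: sum.distrib sum_distrib_left)
  qed
  note r = move_relaxed[OF mvs C1]
  show "EX k. relaxed M m k & (ALL i<m. (LINT x|M. k i x) = (LINT x|M. f i x) + \<eta> i) \<and>
   (\<Sum>i<m. (LINT x|M. k i x * h i x)) <=
    (\<Sum>i<m. (LINT x|M. f i x * h i x)) + (\<Sum>i<m. lam i * \<eta> i) + ep * (\<Sum>i<m. \<bar>\<eta> i\<bar>)"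
   by (rule exI, intro conjI allI impI, rule r(1)) (use r(2,3) eta cost in auto)
 qed
qed

end

text \<open>These two conclusions are detached from \<open>linprog\<close> so that both members of a
  pair can carry them, each with the cost induced by the other.\<close>

definition mult_prop :: "'a measure => nat => (nat => 'a => real) => (nat => 'a => real) => (nat => real) => bool" where
 "mult_prop M m f h lam \<longleftrightarrow> (ALL i<m. ALL j<m. AE x in M. f i x = 1 --> h i x - lam i <= h j x - lam j)"

definition taylor_prop :: "'a measure => nat => (nat => 'a => real) => (nat => 'a => real) => (nat => real) => bool" where
 "taylor_prop M m f h lam \<longleftrightarrow> (ALL ep>0. EX \<eta>0>0. ALL \<eta>. (\<Sum>i<m. \<eta> i) = 0 --> (\<Sum>i<m. \<bar>\<eta> i\<bar>) <= \<eta>0 -->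
  (EX k. relaxed M m k & (ALL i<m. (LINT x|M. k i x) = (LINT x|M. f i x) + \<eta> i) \<and>
   (\<Sum>i<m. (LINT x|M. k i x * h i x)) <=
    (\<Sum>i<m. (LINT x|M. f i x * h i x)) + (\<Sum>i<m. lam i * \<eta> i) + ep * (\<Sum>i<m. \<bar>\<eta> i\<bar>)))"

section \<open>Symmetric Markov kernels and their bilinear form\<close>

locale noise = prob_space M for M :: "'a measure" +
 fixes k :: "'a => 'a => real"
 assumes k_meas[measurable]: "case_prod k : bm (M \<Otimes>\<^sub>M M)"
  and k_nonneg: "x : space M ==> y : space M ==> 0 <= k x y"
  and k_sym: "x : space M ==> y : space M ==> k x y = k y x"
  and k_nn: "x : space M ==> (\<integral>\<^sup>+y. ennreal (k x y) \<partial>M) = 1"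
begin

sublocale PP: pair_sigma_finite M M
 by unfold_locales

definition T :: "('a => real) => 'a => real" where
 "T ph x = (LINT y|M. k x y * ph y)"

lemma k_section: "x : space M ==> k x : bm M"
 using measurable_compose[OF measurable_Pair1'[of x M M] k_meas] by simp

lemma k_int: "x : space M ==> integrable M (k x)" "x : space M ==> (LINT y|M. k x y) = 1"
proof -
 assume x: "x : space M"
 show i: "integrable M (k x)"
  using k_section[OF x] k_nonneg[OF x] k_nn[OF x]
  by (intro integrableI_nonneg) (auto intro: AE_I2)
 show "(LINT y|M. k x y) = 1"
  using k_section[OF x] k_nonneg[OF x] k_nn[OF x] by (subst integral_eq_nn_integral) auto
qed

lemma kf_int: "bdd M ph ==> x : space M ==> integrable M (%y. k x y * ph y)"
proof -
 assume a: "bdd M ph" and x: "x : space M"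
 obtain C where C: "0 < C" "!!x. x : space M ==> \<bar>ph x\<bar> <= C" using bdd_obtain[OF a] by blast
 show ?thesis
 proof (rule BI_integrable_bound)
  show "integrable M (%y. C * k x y)" using k_int(1)[OF x] by simp
  show "(%y. k x y * ph y) : bm M" using k_section[OF x] a by (auto simp: bdd_def)
  show "AE y in M. norm (k x y * ph y) <= norm (C * k x y)"
   using C k_nonneg[OF x] by (auto simp: abs_mult intro!: AE_I2 mult_mono simp: mult.commute[of C])
 qed
qed

lemma T_abs:
 assumes "bdd M ph" "!!y. y : space M ==> \<bar>ph y\<bar> <= C" "x : space M"
 shows "\<bar>T ph x\<bar> <= C"
proof -
 have "\<bar>T ph x\<bar> <= (LINT y|M. \<bar>k x y * ph y\<bar>)" unfolding T_def by (rule integral_abs_bound)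
 also have "... <= (LINT y|M. k x y * C)"
 proof (rule integral_mono)
  show "integrable M (%y. \<bar>k x y * ph y\<bar>)" using kf_int[OF assms(1,3)] by (rule integrable_abs)
  show "integrable M (%y. k x y * C)" using k_int(1)[OF assms(3)] by simp
  fix y assume "y : space M"
  then show "\<bar>k x y * ph y\<bar> <= k x y * C"
   using k_nonneg[OF assms(3)] assms(2) by (auto simp: abs_mult intro!: mult_left_mono)
 qed
 also have "... = C" using k_int(2)[OF assms(3)] by simp
 finally show ?thesis .
qed

lemma T_bdd[intro]: "bdd M ph ==> bdd M (T ph)"
proof -
 assume a: "bdd M ph"
 obtain C where C: "0 < C" "!!x. x : space M ==> \<bar>ph x\<bar> <= C" using bdd_obtain[OF a] by blast
 have [measurable]: "ph : bm M" using a by (auto simp: bdd_def)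
 have "(%x. (LINT y|M. k x y * ph y)) : bm M" by measurable
 then show ?thesis using T_abs[OF a C(2)] by (intro bddI[where C=C]) (auto simp: T_def[abs_def])
qed

lemma T_add: "bdd M ph ==> bdd M ps ==> x : space M ==> T (%x. ph x + ps x) x = T ph x + T ps x"
 unfolding T_def using kf_int by (subst BI_integral_add[symmetric]) (auto simp: algebra_simps)

lemma T_cmult: "T (%x. c * ph x) x = c * T ph x"
 unfolding T_def by (simp flip: integral_mult_right_zero add: mult_ac)

lemma T_diff: "bdd M ph ==> bdd M ps ==> x : space M ==> T (%x. ph x - ps x) x = T ph x - T ps x"
 using T_add[of ph "%x. (-1) * ps x" x] T_cmult[of "-1" ps x] bdd_cmult[of M ps "-1"] by simp

lemma T_const: "x : space M ==> T (%_. c) x = c"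
 unfolding T_def using k_int(2) by simp

definition pr :: "('a => real) => ('a => real) => real" where
 "pr ph ps = (LINT x|M. ph x * T ps x)"

lemma kk_int: "integrable (M \<Otimes>\<^sub>M M) (case_prod k)"
proof (rule integrableI_nonneg)
 show "AE z in M \<Otimes>\<^sub>M M. 0 <= (case z of (x, y) => k x y)"
  using k_nonneg by (intro AE_I2) (auto simp: space_pair_measure)
 have "(\<integral>\<^sup>+z. ennreal (case z of (x, y) => k x y) \<partial>(M \<Otimes>\<^sub>M M)) = (\<integral>\<^sup>+x. \<integral>\<^sup>+y. ennreal (k x y) \<partial>M \<partial>M)"
  by (subst nn_integral_fst[symmetric]) (auto simp: split_beta')
 also have "... = (\<integral>\<^sup>+x. 1 \<partial>M)" using k_nn by (intro nn_integral_cong) auto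
 also have "... < \<infinity>" by (simp add: emeasure_space_1)
 finally show "(\<integral>\<^sup>+z. ennreal (case z of (x, y) => k x y) \<partial>(M \<Otimes>\<^sub>M M)) < \<infinity>" .
qed simp

lemma kpp_int:
 assumes "bdd M ph" "bdd M ps"
 shows "integrable (M \<Otimes>\<^sub>M M) (%(x, y). ph x * k x y * ps y)"
proof -
 obtain C where C: "0 < C" "!!x. x : space M ==> \<bar>ph x\<bar> <= C" using bdd_obtain[OF assms(1)] by blast
 obtain D where D: "0 < D" "!!x. x : space M ==> \<bar>ps x\<bar> <= D" using bdd_obtain[OF assms(2)] by blast
 have [measurable]: "ph : bm M" "ps : bm M" using assms by (auto simp: bdd_def)
 show ?thesis
 proof (rule BI_integrable_bound)
  show "integrable (M \<Otimes>\<^sub>M M) (%z. C * D * case_prod k z)" using kk_int by simp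
  show "(%(x, y). ph x * k x y * ps y) : bm (M \<Otimes>\<^sub>M M)" by measurable
  show "AE z in M \<Otimes>\<^sub>M M. norm (case z of (x, y) => ph x * k x y * ps y) <= norm (C * D * case_prod k z)"
  proof (rule AE_I2, clarsimp simp: space_pair_measure abs_mult)
   fix x y assume x: "x : space M" and y: "y : space M"
   have "\<bar>ph x\<bar> * \<bar>ps y\<bar> <= C * D" using C D x y by (intro mult_mono) auto
   from mult_right_mono[OF this, of "\<bar>k x y\<bar>"]
   show "\<bar>ph x\<bar> * \<bar>k x y\<bar> * \<bar>ps y\<bar> <= \<bar>C\<bar> * \<bar>D\<bar> * \<bar>k x y\<bar>" using C D by (simp add: mult_ac)
  qed
 qed
qed

lemma pr_sym:
 assumes "bdd M ph" "bdd M ps"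
 shows "pr ph ps = pr ps ph"
proof -
 have "pr ph ps = (LINT x|M. (LINT y|M. ph x * k x y * ps y))"
  unfolding pr_def T_def by (simp flip: integral_mult_right_zero add: mult_ac)
 also have "... = (LINT y|M. (LINT x|M. ph x * k x y * ps y))"
  using PP.Fubini_integral[OF kpp_int[OF assms]] by simp
 also have "... = (LINT y|M. ps y * (LINT x|M. k y x * ph x))"
  by (intro BI_integral_cong refl)
   (auto simp flip: integral_mult_right_zero simp: mult_ac k_sym intro!: BI_integral_cong)
 finally show ?thesis unfolding pr_def T_def .
qed

lemma pr_int: "bdd M ph ==> bdd M ps ==> integrable M (%x. ph x * T ps x)"
 by (intro bdd_integrable bdd_mult T_bdd)

lemma pr_add_left: "bdd M ph ==> bdd M ph' ==> bdd M ps ==> pr (%x. ph x + ph' x) ps = pr ph ps + pr ph' ps"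
 unfolding pr_def using pr_int by (subst BI_integral_add[symmetric]) (auto simp: algebra_simps)

lemma pr_cmult_left: "pr (%x. c * ph x) ps = c * pr ph ps"
 unfolding pr_def by (simp add: mult.assoc)

lemma pr_diff_left: "bdd M ph ==> bdd M ph' ==> bdd M ps ==> pr (%x. ph x - ph' x) ps = pr ph ps - pr ph' ps"
 using pr_add_left[of ph "%x. (-1) * ph' x" ps] pr_cmult_left[of "-1" ph' ps] bdd_cmult[of M ph' "-1"] by simp

lemma pr_add_right: "bdd M ph ==> bdd M ps ==> bdd M ps' ==> pr ph (%x. ps x + ps' x) = pr ph ps + pr ph ps'"
 using pr_add_left[of ps ps' ph] by (simp add: pr_sym[of ph] bdd_add)

lemma pr_cmult_right: "bdd M ph ==> bdd M ps ==> pr ph (%x. c * ps x) = c * pr ph ps"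
 using pr_cmult_left[of c ps ph] by (simp add: pr_sym[of ph] bdd_cmult)

lemma pr_diff_right: "bdd M ph ==> bdd M ps ==> bdd M ps' ==> pr ph (%x. ps x - ps' x) = pr ph ps - pr ph ps'"
 using pr_diff_left[of ps ps' ph] by (simp add: pr_sym[of ph] bdd_diff)

lemma pr_bound:
 assumes "bdd M ph" "bdd M ps" "!!x. x : space M ==> \<bar>ph x\<bar> <= C"
 shows "\<bar>pr ph ps\<bar> <= C * (LINT x|M. \<bar>T ps x\<bar>)"
proof -
 have "\<bar>pr ph ps\<bar> <= (LINT x|M. \<bar>ph x * T ps x\<bar>)" unfolding pr_def by (rule integral_abs_bound)
 also have "... <= (LINT x|M. C * \<bar>T ps x\<bar>)"
 proof (rule integral_mono)
  show "integrable M (%x. \<bar>ph x * T ps x\<bar>)" using pr_int[OF assms(1,2)] by (rule integrable_abs)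
  show "integrable M (%x. C * \<bar>T ps x\<bar>)" using assms(2) by (intro bdd_integrable bdd_cmult bdd_abs T_bdd)
  fix x assume "x : space M"
  then show "\<bar>ph x * T ps x\<bar> <= C * \<bar>T ps x\<bar>" using assms(3) by (simp add: abs_mult mult_right_mono)
 qed
 finally show ?thesis by simp
qed

text \<open>By symmetry \<open>T\<close> can be moved onto the constant 1, which it fixes.\<close>

lemma T_L1:
 assumes "bdd M ph"
 shows "(LINT x|M. \<bar>T ph x\<bar>) <= (LINT x|M. \<bar>ph x\<bar>)"
proof -
 have "(LINT x|M. \<bar>T ph x\<bar>) <= (LINT x|M. T (%y. \<bar>ph y\<bar>) x)"
 proof (rule integral_mono)
  fix x assume x: "x : space M"
  have "\<bar>T ph x\<bar> <= (LINT y|M. \<bar>k x y * ph y\<bar>)" unfolding T_def by (rule integral_abs_bound)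
  also have "... = T (%y. \<bar>ph y\<bar>) x" unfolding T_def using k_nonneg[OF x]
   by (intro BI_integral_cong) (auto simp: abs_mult)
  finally show "\<bar>T ph x\<bar> <= T (%y. \<bar>ph y\<bar>) x" .
 qed (use assms in auto)
 also have "... = pr (%_. 1) (%y. \<bar>ph y\<bar>)" unfolding pr_def by simp
 also have "... = pr (%y. \<bar>ph y\<bar>) (%_. 1)" using assms by (intro pr_sym) auto
 also have "... = (LINT x|M. \<bar>ph x\<bar>)" unfolding pr_def
  by (intro BI_integral_cong) (auto simp: T_const)
 finally show ?thesis .
qed

definition B :: "nat => (nat => 'a => real) => (nat => 'a => real) => real" where
 "B m f g = (\<Sum>i<m. pr (f i) (g i))"

lemma B_sym: "relaxed M m f ==> relaxed M m g ==> B m f g = B m g f"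
 unfolding B_def by (intro sum.cong pr_sym) (auto simp: relaxed_bdd)

end

section \<open>Relaxed minimizing pairs: a lower bound to second order\<close>

locale rmin = noise M k for M :: "'a measure" and k +
 fixes m :: nat and f g :: "nat => 'a => real" and lam mu :: "nat => real"
 assumes f_rel: "relaxed M m f" and g_rel: "relaxed M m g"
  and f_01: "i < m ==> x : space M ==> f i x = 0 \<or> f i x = 1"
  and g_01: "i < m ==> x : space M ==> g i x = 0 \<or> g i x = 1"
  and f_vol: "i < m ==> 0 < (LINT x|M. f i x)" and g_vol: "i < m ==> 0 < (LINT x|M. g i x)"
  and rmin: "relaxed M m f' ==> relaxed M m g' ==> (!!i. i < m ==> (LINT x|M. f' i x) = (LINT x|M. f i x)) ==>
   (!!i. i < m ==> (LINT x|M. g' i x) = (LINT x|M. g i x)) ==> B m f g <= B m f' g'"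
  and mult_f: "mult_prop M m f (%i. T (g i)) lam"
  and mult_g: "mult_prop M m g (%i. T (f i)) mu"
  and taylor_f: "taylor_prop M m f (%i. T (g i)) lam"
  and taylor_g: "taylor_prop M m g (%i. T (f i)) mu"
begin

lemma swap: "rmin M k m g f mu lam"
proof (intro rmin.intro noise_axioms rmin_axioms.intro)
 show "relaxed M m g" "relaxed M m f" by (rule g_rel f_rel)+
 show "mult_prop M m g (%i. T (f i)) mu" "mult_prop M m f (%i. T (g i)) lam"
  "taylor_prop M m g (%i. T (f i)) mu" "taylor_prop M m f (%i. T (g i)) lam"
  by (rule mult_g mult_f taylor_g taylor_f)+
 show "g i x = 0 \<or> g i x = 1" "f i x = 0 \<or> f i x = 1" if "i < m" "x : space M" for i x
  using that by (rule g_01, rule f_01)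
 show "0 < (LINT x|M. g i x)" "0 < (LINT x|M. f i x)" if "i < m" for i
  using that by (rule g_vol, rule f_vol)
 show "B m g f <= B m f' g'" if "relaxed M m f'" "relaxed M m g'"
  "!!i. i < m ==> (LINT x|M. f' i x) = (LINT x|M. g i x)"
  "!!i. i < m ==> (LINT x|M. g' i x) = (LINT x|M. f i x)" for f' g'
  using rmin[OF that(2) that(1) that(4) that(3)] B_sym[OF f_rel g_rel] B_sym[OF that(1,2)] by simp
qed

text \<open>The Lagrangian of the volume constraints, which makes competitors with wrong volumes
  comparable to the minimizer.\<close>

definition L :: "(nat => 'a => real) => (nat => 'a => real) => real" where
 "L f' g' = B m f' g' - (\<Sum>i<m. lam i * (LINT x|M. f' i x)) - (\<Sum>i<m. mu i * (LINT x|M. g' i x))"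

lemma relaxed_vol_sum: "relaxed M m f' ==> (\<Sum>i<m. (LINT x|M. f' i x)) = 1"
proof -
 assume r: "relaxed M m f'"
 have "(\<Sum>i<m. (LINT x|M. f' i x)) = (LINT x|M. (\<Sum>i<m. f' i x))"
  using relaxed_bdd[OF r] by (subst BI_integral_sum) auto
 also have "... = (LINT x|M. 1)" using r by (intro BI_integral_cong) (auto simp: relaxed_def)
 finally show ?thesis by (simp add: prob_space)
qed

lemma relaxed_mix:
 assumes "relaxed M m f'" "relaxed M m k'" "0 <= de" "de <= 1"
 shows "relaxed M m (%i x. f' i x + de * (k' i x - f' i x))"
proof -
 have nn: "0 <= f' i x + de * (k' i x - f' i x)" if "i < m" "x : space M" for i x
 proof -
  have "f' i x + de * (k' i x - f' i x) = (1 - de) * f' i x + de * k' i x" by (simp add: algebra_simps)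
  then show ?thesis using assms relaxed_le1[OF assms(1) that] relaxed_le1[OF assms(2) that] by simp
 qed
 have "(\<Sum>i<m. f' i x + de * (k' i x - f' i x)) = 1" if "x : space M" for x
  using assms that by (simp add: relaxed_def sum.distrib sum_subtractf flip: sum_distrib_left)
 moreover have "(%x. f' i x + de * (k' i x - f' i x)) : bm M" if "i < m" for i
 proof -
  have [measurable]: "f' i : bm M" "k' i : bm M"
   using assms(1,2) that unfolding relaxed_def by auto
  show ?thesis by measurable
 qed
 ultimately show ?thesis using nn unfolding relaxed_def by blast
qed

text \<open>Mix \<open>f'\<close> with a fraction \<open>de\<close> of order s^2 of a relaxed
  partition whose volume defect is opposite and magnified by about \<open>1 / de\<close>. That
  defect is of order 1, made small by the choice of \<open>R\<close>, so the Taylor property prices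
  it by the multipliers up to \<open>e1\<close>. Replacing \<open>g'\<close> by \<open>g\<close> in
  the admixture costs \<open>de\<close> times O(s), hence O(s^3), because the differences are small
  after applying \<open>T\<close>; the differences themselves may be large.\<close>

lemma master:
 assumes e: "0 < ep" and C: "0 <= C"
 shows "EX s0>0. ALL s f' g'. 0 < s --> s < s0 --> relaxed M m f' --> relaxed M m g' -->
  (ALL i<m. \<bar>(LINT x|M. f' i x) - (LINT x|M. f i x)\<bar> <= C * s\<^sup>2) -->
  (ALL i<m. \<bar>(LINT x|M. g' i x) - (LINT x|M. g i x)\<bar> <= C * s\<^sup>2) -->
  (ALL i<m. (LINT x|M. \<bar>T (%y. f' i y - f i y) x\<bar>) <= C * s) -->
  (ALL i<m. (LINT x|M. \<bar>T (%y. g' i y - g i y) x\<bar>) <= C * s) -->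
  L f g - ep * s\<^sup>2 <= L f' g'"
proof -
 \<comment> \<open>Keeps the two Taylor errors together below half of \<open>ep\<close>.\<close>
 define e1 where "e1 = ep / (4 * m * C + 4)"
 have den: "0 < 4 * m * C + 4" using C by (intro add_nonneg_pos) auto
 have e1: "0 < e1" "2 * e1 * (m * C) <= ep / 2"
 proof -
  show "0 < e1" unfolding e1_def using e den by simp
  have "2 * e1 * (m * C) = (ep / 2) * ((4 * m * C) / (4 * m * C + 4))" unfolding e1_def by simp
  also have "... <= (ep / 2) * 1" using e den C by (intro mult_left_mono) (auto simp: divide_le_eq)
  finally show "2 * e1 * (m * C) <= ep / 2" by simp
 qed
 obtain \<eta>f where hf: "0 < \<eta>f" "!!\<eta>. (\<Sum>i<m. \<eta> i) = 0 ==> (\<Sum>i<m. \<bar>\<eta> i\<bar>) <= \<eta>f ==>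
  (EX k. relaxed M m k & (ALL i<m. (LINT x|M. k i x) = (LINT x|M. f i x) + \<eta> i) \<and>
   (\<Sum>i<m. pr (k i) (g i)) <= (\<Sum>i<m. pr (f i) (g i)) + (\<Sum>i<m. lam i * \<eta> i) + e1 * (\<Sum>i<m. \<bar>\<eta> i\<bar>))"
  using taylor_f e1(1) unfolding taylor_prop_def pr_def by blast
 obtain \<eta>g where hg: "0 < \<eta>g" "!!\<eta>. (\<Sum>i<m. \<eta> i) = 0 ==> (\<Sum>i<m. \<bar>\<eta> i\<bar>) <= \<eta>g ==>
  (EX k. relaxed M m k & (ALL i<m. (LINT x|M. k i x) = (LINT x|M. g i x) + \<eta> i) \<and>
   (\<Sum>i<m. pr (k i) (f i)) <= (\<Sum>i<m. pr (g i) (f i)) + (\<Sum>i<m. mu i * \<eta> i) + e1 * (\<Sum>i<m. \<bar>\<eta> i\<bar>))"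
  using taylor_g e1(1) unfolding taylor_prop_def pr_def by blast
 \<comment> \<open>Chosen so that the magnified defects, at most \<open>C / R\<close> per cell, stay
   in the range of both Taylor properties.\<close>
 define R where "R = (m * C + 1) / min \<eta>f \<eta>g"
 have mn: "0 < min \<eta>f \<eta>g" using hf hg by simp
 have R: "0 < R" "m * C / R <= \<eta>f" "m * C / R <= \<eta>g"
 proof -
  have p: "0 < m * C + 1" using C by (intro add_nonneg_pos) auto
  show R0: "0 < R" unfolding R_def using p mn by simp
  have "m * C <= R * min \<eta>f \<eta>g" unfolding R_def using mn by (simp add: less_imp_neq[symmetric])
  then have "m * C / R <= min \<eta>f \<eta>g" by (subst pos_divide_le_eq[OF R0]) (simp only: mult.commute)
  then show "m * C / R <= \<eta>f" "m * C / R <= \<eta>g" by (simp_all only: min.bounded_iff)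
 qed
 define \<Lambda> where "\<Lambda> = (\<Sum>i<m. \<bar>lam i\<bar>) + (\<Sum>i<m. \<bar>mu i\<bar>)"
 \<comment> \<open>Collects the coefficients of the error terms of order s^3 and s^4.\<close>
 define K where "K = 4 * m * C * R + R\<^sup>2 * m + R * \<Lambda> * C"
 have L0: "0 <= \<Lambda>" unfolding \<Lambda>_def by (intro add_nonneg_nonneg sum_nonneg) auto
 have K: "0 <= K" unfolding K_def using C R L0 by auto
 define s0 where "s0 = min 1 (min (1 / (R + 1)) (ep / (2 * (K + 1))))"
 show ?thesis
 proof (intro exI[of _ s0] conjI allI impI)
  show "0 < s0" unfolding s0_def using R K e by auto
  fix s f' g'
  assume s: "0 < s" "s < s0" and rf: "relaxed M m f'" and rg: "relaxed M m g'"
   and vf: "ALL i<m. \<bar>(LINT x|M. f' i x) - (LINT x|M. f i x)\<bar> <= C * s\<^sup>2"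
   and vg: "ALL i<m. \<bar>(LINT x|M. g' i x) - (LINT x|M. g i x)\<bar> <= C * s\<^sup>2"
   and tf: "ALL i<m. (LINT x|M. \<bar>T (%y. f' i y - f i y) x\<bar>) <= C * s"
   and tg: "ALL i<m. (LINT x|M. \<bar>T (%y. g' i y - g i y) x\<bar>) <= C * s"
  have s1: "s < 1" "s < 1 / (R + 1)" "s < ep / (2 * (K + 1))" using s unfolding s0_def by auto
  have ss: "s\<^sup>2 <= s" using s s1 by (simp add: power2_eq_square mult_left_le_one_le)
  define de where "de = R * s\<^sup>2"
  have d0: "0 < de" unfolding de_def using R s by simp
  have d1: "de <= 1"
  proof -
   have "R * s\<^sup>2 <= R * s" using R ss by simp
   also have "... <= R * (1 / (R + 1))" using R s1 by (intro mult_left_mono) auto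
   also have "... <= 1" using R by simp
   finally show ?thesis unfolding de_def .
  qed
  define Vf where "Vf i = (LINT x|M. f' i x) - (LINT x|M. f i x)" for i
  define Vg where "Vg i = (LINT x|M. g' i x) - (LINT x|M. g i x)" for i
  \<comment> \<open>Solves \<open>(1 - de) * Vf i + de * \<eta> i = 0\<close>, so that the mixture
    has exactly the volumes of \<open>f\<close>.\<close>
  define \<eta> where "\<eta> i = - (1 - de) * Vf i / de" for i
  define \<zeta> where "\<zeta> i = - (1 - de) * Vg i / de" for i
  have sum0: "(\<Sum>i<m. \<eta> i) = 0" "(\<Sum>i<m. \<zeta> i) = 0"
   unfolding \<eta>_def \<zeta>_def Vf_def Vg_def
   using relaxed_vol_sum[OF rf] relaxed_vol_sum[OF rg] relaxed_vol_sum[OF f_rel] relaxed_vol_sum[OF g_rel]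
   by (simp_all add: sum_subtractf flip: sum_divide_distrib sum_distrib_left sum_negf)
  have ab: "\<bar>- (1 - de) * v / de\<bar> <= C / R" if "\<bar>v\<bar> <= C * s\<^sup>2" for v
  proof -
   have "\<bar>- (1 - de) * v / de\<bar> = (1 - de) * \<bar>v\<bar> / de" using d0 d1 by (simp add: abs_mult)
   also have "... <= 1 * (C * s\<^sup>2) / de" using d0 d1 that by (intro divide_right_mono mult_mono) auto
   also have "... = C / R" unfolding de_def using s by simp
   finally show ?thesis .
  qed
  have sumf: "(\<Sum>i<m. \<bar>\<eta> i\<bar>) <= m * C / R"
   using sum_mono[of "{..<m}" "%i. \<bar>\<eta> i\<bar>" "%_. C / R"] ab vf unfolding \<eta>_def Vf_def by auto
  have sumg: "(\<Sum>i<m. \<bar>\<zeta> i\<bar>) <= m * C / R"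
   using sum_mono[of "{..<m}" "%i. \<bar>\<zeta> i\<bar>" "%_. C / R"] ab vg unfolding \<zeta>_def Vg_def by auto
  obtain k' where k': "relaxed M m k'" "ALL i<m. (LINT x|M. k' i x) = (LINT x|M. f i x) + \<eta> i"
   "(\<Sum>i<m. pr (k' i) (g i)) <= (\<Sum>i<m. pr (f i) (g i)) + (\<Sum>i<m. lam i * \<eta> i) + e1 * (\<Sum>i<m. \<bar>\<eta> i\<bar>)"
   using hf(2)[OF sum0(1)] sumf R(2) by force
  obtain l' where l': "relaxed M m l'" "ALL i<m. (LINT x|M. l' i x) = (LINT x|M. g i x) + \<zeta> i"
   "(\<Sum>i<m. pr (l' i) (f i)) <= (\<Sum>i<m. pr (g i) (f i)) + (\<Sum>i<m. mu i * \<zeta> i) + e1 * (\<Sum>i<m. \<bar>\<zeta> i\<bar>)"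
   using hg(2)[OF sum0(2)] sumg R(3) by force
  define F where "F i x = f' i x + de * (k' i x - f' i x)" for i x
  define G where "G i x = g' i x + de * (l' i x - g' i x)" for i x
  have FG: "relaxed M m F" "relaxed M m G" unfolding F_def G_def using relaxed_mix rf rg k' l' d0 d1 by auto
  have bd: "bdd M (f i)" "bdd M (g i)" "bdd M (f' i)" "bdd M (g' i)" "bdd M (k' i)" "bdd M (l' i)" if "i < m" for i
   using that relaxed_bdd f_rel g_rel rf rg k' l' by auto
  have volF: "(LINT x|M. F i x) = (LINT x|M. f i x)" if i: "i < m" for i
  proof -
   have "(LINT x|M. F i x) = (LINT x|M. f' i x) + de * ((LINT x|M. k' i x) - (LINT x|M. f' i x))"
    unfolding F_def using bd[OF i] by (simp add: bdd_integrable)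
   also have "... = (1 - de) * (LINT x|M. f' i x) + de * (LINT x|M. f i x) + de * \<eta> i"
    using k'(2) i by (simp add: algebra_simps)
   also have "de * \<eta> i = - (1 - de) * Vf i" unfolding \<eta>_def using d0 by simp
   finally show ?thesis unfolding Vf_def by (simp add: algebra_simps)
  qed
  have volG: "(LINT x|M. G i x) = (LINT x|M. g i x)" if i: "i < m" for i
  proof -
   have "(LINT x|M. G i x) = (LINT x|M. g' i x) + de * ((LINT x|M. l' i x) - (LINT x|M. g' i x))"
    unfolding G_def using bd[OF i] by (simp add: bdd_integrable)
   also have "... = (1 - de) * (LINT x|M. g' i x) + de * (LINT x|M. g i x) + de * \<zeta> i"
    using l'(2) i by (simp add: algebra_simps)
   also have "de * \<zeta> i = - (1 - de) * Vg i" unfolding \<zeta>_def using d0 by simp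
   finally show ?thesis unfolding Vg_def by (simp add: algebra_simps)
  qed
  have min: "B m f g <= B m F G" using rmin[OF FG] volF volG by blast
  have each: "pr (F i) (G i) <= pr (f' i) (g' i) + de * (pr (k' i) (g i) - pr (f i) (g i)) +
    de * (pr (l' i) (f i) - pr (g i) (f i)) + de * (4 * C * s) + de\<^sup>2" if i: "i < m" for i
  proof -
   note b = bd[OF i]
   have le1: "\<bar>k' i x - f' i x\<bar> <= 1" "\<bar>l' i x - g' i x\<bar> <= 1" "\<bar>f i x\<bar> <= 1" "\<bar>g i x\<bar> <= 1" if "x : space M" for x
    using relaxed_le1[OF rf i that] relaxed_le1[OF rg i that] relaxed_le1[OF k'(1) i that]
     relaxed_le1[OF l'(1) i that] relaxed_le1[OF f_rel i that] relaxed_le1[OF g_rel i that] by auto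
   have p1: "\<bar>pr (%x. k' i x - f' i x) (%x. g' i x - g i x)\<bar> <= 1 * (C * s)"
    by (rule order_trans[OF pr_bound[where C=1]]) (use b le1 tg i in auto)
   have p2: "\<bar>pr (g i) (%x. f' i x - f i x)\<bar> <= 1 * (C * s)"
    by (rule order_trans[OF pr_bound[where C=1]]) (use b le1 tf i in auto)
   have p3: "\<bar>pr (%x. l' i x - g' i x) (%x. f' i x - f i x)\<bar> <= 1 * (C * s)"
    by (rule order_trans[OF pr_bound[where C=1]]) (use b le1 tf i in auto)
   have p4: "\<bar>pr (f i) (%x. g' i x - g i x)\<bar> <= 1 * (C * s)"
    by (rule order_trans[OF pr_bound[where C=1]]) (use b le1 tg i in auto)
   have p5: "\<bar>pr (%x. k' i x - f' i x) (%x. l' i x - g' i x)\<bar> <= 1"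
   proof -
    have "\<bar>pr (%x. k' i x - f' i x) (%x. l' i x - g' i x)\<bar> <= 1 * (LINT x|M. \<bar>T (%x. l' i x - g' i x) x\<bar>)"
     by (rule pr_bound) (use b le1 in auto)
    also have "... <= (LINT x|M. \<bar>l' i x - g' i x\<bar>)" using T_L1[of "%x. l' i x - g' i x"] b by auto
    also have "... <= (LINT x|M. 1)" using b le1 by (intro integral_mono) (auto intro!: bdd_integrable)
    finally show ?thesis by (simp add: prob_space)
   qed
   note lin = pr_add_left pr_diff_left pr_cmult_left pr_add_right pr_diff_right pr_cmult_right
   \<comment> \<open>Apart from terms linear in \<open>de\<close>, only the product of both
     admixtures appears, and \<open>de\<^sup>2\<close> is of order s^4.\<close>
   have exp: "pr (F i) (G i) = pr (f' i) (g' i) + de * (pr (k' i) (g' i) - pr (f' i) (g' i))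
    + de * (pr (f' i) (l' i) - pr (f' i) (g' i)) + de\<^sup>2 * pr (%x. k' i x - f' i x) (%x. l' i x - g' i x)"
    unfolding F_def[abs_def] G_def[abs_def] using b
    by (simp add: lin bdd_add bdd_diff bdd_cmult power2_eq_square algebra_simps)
   \<comment> \<open>Both corrections pair a function bounded by 1 with a difference whose image
     under \<open>T\<close> is O(s) in L1.\<close>
   have a1: "pr (k' i) (g' i) - pr (f' i) (g' i) = (pr (k' i) (g i) - pr (f i) (g i)) +
     pr (%x. k' i x - f' i x) (%x. g' i x - g i x) - pr (g i) (%x. f' i x - f i x)"
    using b pr_sym[of "g i" "f' i"] pr_sym[of "g i" "f i"] by (simp add: lin bdd_diff)
   have a2: "pr (f' i) (l' i) - pr (f' i) (g' i) = (pr (l' i) (f i) - pr (g i) (f i)) +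
     pr (%x. l' i x - g' i x) (%x. f' i x - f i x) - pr (f i) (%x. g' i x - g i x)"
    using b pr_sym[of "f i" "g' i"] pr_sym[of "f i" "g i"] pr_sym[of "l' i" "f' i"] pr_sym[of "g' i" "f' i"]
    by (simp add: lin bdd_diff)
   have "de * (pr (k' i) (g' i) - pr (f' i) (g' i)) <= de * ((pr (k' i) (g i) - pr (f i) (g i)) + 2 * C * s)"
    unfolding a1 using p1 p2 d0 by (intro mult_left_mono) auto
   moreover have "de * (pr (f' i) (l' i) - pr (f' i) (g' i)) <= de * ((pr (l' i) (f i) - pr (g i) (f i)) + 2 * C * s)"
    unfolding a2 using p3 p4 d0 by (intro mult_left_mono) auto
   moreover have "de\<^sup>2 * pr (%x. k' i x - f' i x) (%x. l' i x - g' i x) <= de\<^sup>2 * 1"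
    using p5 by (intro mult_left_mono) auto
   ultimately show ?thesis unfolding exp by (simp add: algebra_simps)
  qed
  have "B m F G <= (\<Sum>i<m. pr (f' i) (g' i) + de * (pr (k' i) (g i) - pr (f i) (g i)) +
    de * (pr (l' i) (f i) - pr (g i) (f i)) + de * (4 * C * s) + de\<^sup>2)"
   unfolding B_def using each by (intro sum_mono) auto
  also have "... = B m f' g' + de * ((\<Sum>i<m. pr (k' i) (g i)) - (\<Sum>i<m. pr (f i) (g i))) +
    de * ((\<Sum>i<m. pr (l' i) (f i)) - (\<Sum>i<m. pr (g i) (f i))) + m * (de * (4 * C * s)) + m * de\<^sup>2"
   unfolding B_def by (simp add: sum.distrib sum_subtractf flip: sum_distrib_left)
  also have "... <= B m f' g' + de * ((\<Sum>i<m. lam i * \<eta> i) + e1 * (m * C / R)) +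
    de * ((\<Sum>i<m. mu i * \<zeta> i) + e1 * (m * C / R)) + m * (de * (4 * C * s)) + m * de\<^sup>2"
  proof -
   have A: "e1 * (\<Sum>i<m. \<bar>\<eta> i\<bar>) <= e1 * (m * C / R)" "e1 * (\<Sum>i<m. \<bar>\<zeta> i\<bar>) <= e1 * (m * C / R)"
    using e1(1) by (intro mult_left_mono[OF sumf] mult_left_mono[OF sumg] less_imp_le; assumption)+
   have "de * ((\<Sum>i<m. pr (k' i) (g i)) - (\<Sum>i<m. pr (f i) (g i))) <= de * ((\<Sum>i<m. lam i * \<eta> i) + e1 * (m * C / R))"
    by (rule mult_left_mono) (use k'(3) A d0 in linarith)+
   moreover have "de * ((\<Sum>i<m. pr (l' i) (f i)) - (\<Sum>i<m. pr (g i) (f i))) <= de * ((\<Sum>i<m. mu i * \<zeta> i) + e1 * (m * C / R))"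
    by (rule mult_left_mono) (use l'(3) A d0 in linarith)+
   ultimately show ?thesis by linarith
  qed
  finally have BFG: "B m F G <= B m f' g' + de * ((\<Sum>i<m. lam i * \<eta> i) + e1 * (m * C / R)) +
    de * ((\<Sum>i<m. mu i * \<zeta> i) + e1 * (m * C / R)) + m * (de * (4 * C * s)) + m * de\<^sup>2" .
  \<comment> \<open>The factor \<open>1 / de\<close> in the defect cancels against
    \<open>de\<close>, so the multipliers charge minus the volume error, up to a multiple of
    \<open>de * s\<^sup>2\<close>.\<close>
  have lamsum: "de * (\<Sum>i<m. c i * (- (1 - de) * V i / de)) <= - (\<Sum>i<m. c i * V i) + de * ((\<Sum>i<m. \<bar>c i\<bar>) * (C * s\<^sup>2))"
   if V: "!!i. i < m ==> \<bar>V i\<bar> <= C * s\<^sup>2" for c V :: "nat => real"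
  proof -
   have "de * (\<Sum>i<m. c i * (- (1 - de) * V i / de)) = (\<Sum>i<m. - (c i * V i) + de * (c i * V i))"
    unfolding sum_distrib_left using d0 by (intro sum.cong) (auto simp: field_simps)
   also have "... = - (\<Sum>i<m. c i * V i) + de * (\<Sum>i<m. c i * V i)"
    by (simp only: sum.distrib sum_negf sum_distrib_left)
   also have "(\<Sum>i<m. c i * V i) <= (\<Sum>i<m. \<bar>c i\<bar> * (C * s\<^sup>2))"
   proof (rule sum_mono)
    fix i assume "i : {..<m}"
    then have "\<bar>c i * V i\<bar> <= \<bar>c i\<bar> * (C * s\<^sup>2)" using V by (simp add: abs_mult mult_left_mono)
    then show "c i * V i <= \<bar>c i\<bar> * (C * s\<^sup>2)" by linarith
   qed
   then have "de * (\<Sum>i<m. c i * V i) <= de * ((\<Sum>i<m. \<bar>c i\<bar>) * (C * s\<^sup>2))"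
    using d0 by (intro mult_left_mono) (auto simp: sum_distrib_right)
   finally show ?thesis by linarith
  qed
  have l1: "de * (\<Sum>i<m. lam i * \<eta> i) <= - (\<Sum>i<m. lam i * Vf i) + de * ((\<Sum>i<m. \<bar>lam i\<bar>) * (C * s\<^sup>2))"
   unfolding \<eta>_def using vf by (intro lamsum) (auto simp: Vf_def)
  have l2: "de * (\<Sum>i<m. mu i * \<zeta> i) <= - (\<Sum>i<m. mu i * Vg i) + de * ((\<Sum>i<m. \<bar>mu i\<bar>) * (C * s\<^sup>2))"
   unfolding \<zeta>_def using vg by (intro lamsum) (auto simp: Vg_def)
  have dr: "de * (e1 * (m * C / R)) = e1 * (m * C) * s\<^sup>2" unfolding de_def using R by simp
  have LL: "L f g - L f' g' = B m f g - B m f' g' + (\<Sum>i<m. lam i * Vf i) + (\<Sum>i<m. mu i * Vg i)"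
   unfolding L_def Vf_def Vg_def by (simp add: right_diff_distrib sum_subtractf)
  have "L f g - L f' g' <= 2 * e1 * (m * C) * s\<^sup>2 + de * (\<Lambda> * (C * s\<^sup>2)) + m * (de * (4 * C * s)) + m * de\<^sup>2"
  proof -
   have "de * (\<Lambda> * (C * s\<^sup>2)) = de * ((\<Sum>i<m. \<bar>lam i\<bar>) * (C * s\<^sup>2)) + de * ((\<Sum>i<m. \<bar>mu i\<bar>) * (C * s\<^sup>2))"
    unfolding \<Lambda>_def by (simp only: distrib_left distrib_right)
   moreover have "2 * e1 * (m * C) * s\<^sup>2 = e1 * (m * C) * s\<^sup>2 + e1 * (m * C) * s\<^sup>2" by simp
   moreover have "B m F G <= B m f' g' + (de * (\<Sum>i<m. lam i * \<eta> i) + e1 * (m * C) * s\<^sup>2) +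
     (de * (\<Sum>i<m. mu i * \<zeta> i) + e1 * (m * C) * s\<^sup>2) + m * (de * (4 * C * s)) + m * de\<^sup>2"
    using BFG by (simp only: distrib_left[of de] dr)
   ultimately show ?thesis using min BFG l1 l2 unfolding LL by linarith
  qed
  also have "de * (\<Lambda> * (C * s\<^sup>2)) + m * (de * (4 * C * s)) + m * de\<^sup>2 =
    s\<^sup>2 * (R * \<Lambda> * C * s\<^sup>2 + 4 * m * C * R * s + R\<^sup>2 * m * s\<^sup>2)"
   unfolding de_def by (simp add: power2_eq_square algebra_simps)
  then have "2 * e1 * (m * C) * s\<^sup>2 + de * (\<Lambda> * (C * s\<^sup>2)) + m * (de * (4 * C * s)) + m * de\<^sup>2 =
    2 * e1 * (m * C) * s\<^sup>2 + s\<^sup>2 * (R * \<Lambda> * C * s\<^sup>2 + 4 * m * C * R * s + R\<^sup>2 * m * s\<^sup>2)" by linarith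
  also have "... <= ep / 2 * s\<^sup>2 + s\<^sup>2 * (ep / 2)"
  proof (intro add_mono mult_right_mono mult_left_mono e1(2))
   have "R * \<Lambda> * C * s\<^sup>2 + 4 * m * C * R * s + R\<^sup>2 * m * s\<^sup>2 <= R * \<Lambda> * C * s + 4 * m * C * R * s + R\<^sup>2 * m * s"
    using ss R L0 C by (intro add_mono mult_left_mono) auto
   also have "... = K * s" unfolding K_def by (simp add: algebra_simps)
   also have "... <= (K + 1) * (ep / (2 * (K + 1)))" using K s s1 by (intro mult_mono) auto
   also have "... = ep / 2"
   proof -
    have "K + 1 ~= 0" using K by simp
    have "(K + 1) * (ep / (2 * (K + 1))) = ((K + 1) * ep) / ((K + 1) * 2)"
     by (simp only: times_divide_eq_right mult.commute[of 2])
    also have "... = ep / 2" using \<open>K + 1 ~= 0\<close> by (rule mult_divide_mult_cancel_left)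
    finally show ?thesis .
   qed
   finally show "R * \<Lambda> * C * s\<^sup>2 + 4 * m * C * R * s + R\<^sup>2 * m * s\<^sup>2 <= ep / 2" .
  qed auto
  finally show "L f g - ep * s\<^sup>2 <= L f' g'" by simp
 qed
qed

end

section \<open>From minimizing partitions to relaxed minimizing pairs\<close>

locale noise_indec = noise M k + atomless_prob M for M :: "'a measure" and k +
 assumes indec: "relaxed M m f ==> (!!i x. i < m ==> x : space M ==> f i x = 0 \<or> f i x = 1) ==>
   (!!i. i < m ==> 0 < (LINT x|M. f i x)) ==> (!!i. i < m ==> bdd M (ph i)) ==>
   S <= {..<m} ==> S ~= {} ==> S ~= {..<m} ==> 0 < ep ==>
   (AE x in M. ALL p:S. ALL q:{..<m} - S. (f p x = 1 --> lam q - lam p + ep <= T (ph q) x - T (ph p) x) \<and>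
    (f q x = 1 --> T (ph q) x - T (ph p) x <= lam q - lam p)) ==> False"
begin

text \<open>The objective is linear in each partition, so the two are rounded one after the other:
  \<open>f\<close> against the cost \<open>T (g i)\<close>, then \<open>g\<close> against the cost
  produced by the rounded \<open>f\<close>.\<close>

lemma relaxed_min:
 assumes m: "0 < m" and min: "!!Gm Gm'. part M m Gm ==> part M m Gm' ==> (!!i. i < m ==> measure M (Gm i) = a i) ==>
   (!!i. i < m ==> measure M (Gm' i) = b i) ==> c <= B m (%i. indicator (Gm i)) (%i. indicator (Gm' i))"
  and f: "relaxed M m f" "!!i. i < m ==> (LINT x|M. f i x) = a i"
  and g: "relaxed M m g" "!!i. i < m ==> (LINT x|M. g i x) = b i"
 shows "c <= B m f g"
proof (rule field_le_epsilon)
 fix e :: real assume e: "0 < e"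
 then have e2: "0 < e / 2" by simp
 obtain Gm where G: "part M m Gm" "ALL i<m. measure M (Gm i) = (LINT x|M. f i x)"
  "(\<Sum>i<m. (LINT x|M. indicator (Gm i) x * T (g i) x)) <= (\<Sum>i<m. (LINT x|M. f i x * T (g i) x)) + e / 2"
  using bang_bang[OF f(1) _ e2 m, of "%i. T (g i)"] relaxed_bdd[OF g(1)] by blast
 have rG: "relaxed M m (%i. indicator (Gm i))" using part_relaxed[OF G(1)] .
 obtain Gm' where G': "part M m Gm'" "ALL i<m. measure M (Gm' i) = (LINT x|M. g i x)"
  "(\<Sum>i<m. (LINT x|M. indicator (Gm' i) x * T (indicator (Gm i)) x)) <= (\<Sum>i<m. (LINT x|M. g i x * T (indicator (Gm i)) x)) + e / 2"
  using bang_bang[OF g(1) _ e2 m, of "%i. T (indicator (Gm i))"] relaxed_bdd[OF rG] by blast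
 have rG': "relaxed M m (%i. indicator (Gm' i))" using part_relaxed[OF G'(1)] .
 have "c <= B m (%i. indicator (Gm i)) (%i. indicator (Gm' i))" using min G G' f(2) g(2) by auto
 also have "... = B m (%i. indicator (Gm' i)) (%i. indicator (Gm i))" by (rule B_sym[OF rG rG'])
 also have "... <= B m g (%i. indicator (Gm i)) + e / 2" using G'(3) unfolding B_def pr_def .
 also have "B m g (%i. indicator (Gm i)) = B m (%i. indicator (Gm i)) g" by (rule B_sym[OF g(1) rG])
 also have "... <= B m f g + e / 2" using G(3) unfolding B_def pr_def .
 finally show "c <= B m f g + e" by simp
qed

lemma rmin_exists:
 assumes m: "0 < m" and O: "part M m \<Omega>" "part M m \<Omega>'"
  and pos: "!!i. i < m ==> 0 < measure M (\<Omega> i)" "!!i. i < m ==> 0 < measure M (\<Omega>' i)"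
  and min: "!!Gm Gm'. part M m Gm ==> part M m Gm' ==> (!!i. i < m ==> measure M (Gm i) = measure M (\<Omega> i)) ==>
   (!!i. i < m ==> measure M (Gm' i) = measure M (\<Omega>' i)) ==>
   B m (%i. indicator (\<Omega> i)) (%i. indicator (\<Omega>' i)) <= B m (%i. indicator (Gm i)) (%i. indicator (Gm' i))"
 shows "EX lam mu. rmin M k m (%i. indicator (\<Omega> i)) (%i. indicator (\<Omega>' i)) lam mu"
proof -
 define f :: "nat => 'a => real" where "f = (%i. indicator (\<Omega> i))"
 define g :: "nat => 'a => real" where "g = (%i. indicator (\<Omega>' i))"
 have rf: "relaxed M m f" "relaxed M m g" unfolding f_def g_def by (rule part_relaxed[OF O(1)], rule part_relaxed[OF O(2)])
 have v: "(LINT x|M. f i x) = measure M (\<Omega> i)" "(LINT x|M. g i x) = measure M (\<Omega>' i)" if "i < m" for i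
  unfolding f_def g_def using O that unfolding part_def by auto
 have rm: "B m f g <= B m f' g'" if "relaxed M m f'" "relaxed M m g'" "!!i. i < m ==> (LINT x|M. f' i x) = (LINT x|M. f i x)"
  "!!i. i < m ==> (LINT x|M. g' i x) = (LINT x|M. g i x)" for f' g'
 proof (rule relaxed_min[OF m _ that(1) _ that(2), of "%i. measure M (\<Omega> i)" "%i. measure M (\<Omega>' i)"])
  show "B m f g <= B m (%i. indicator (Gm i)) (%i. indicator (Gm' i))" if "part M m Gm" "part M m Gm'"
   "!!i. i < m ==> measure M (Gm i) = measure M (\<Omega> i)" "!!i. i < m ==> measure M (Gm' i) = measure M (\<Omega>' i)" for Gm Gm'
   unfolding f_def g_def by (rule min[OF that])
 qed (simp_all add: that(3,4) v)
 have f01: "f i x = 0 \<or> f i x = 1" "g i x = 0 \<or> g i x = 1" for i x unfolding f_def g_def by (auto simp: indicator_def)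
 interpret F: linprog M m f "%i. T (g i)"
 proof unfold_locales
  show "(\<Sum>i<m. (LINT x|M. f i x * T (g i) x)) <= (\<Sum>i<m. (LINT x|M. f' i x * T (g i) x))"
   if "relaxed M m f'" "!!i. i < m ==> (LINT x|M. f' i x) = (LINT x|M. f i x)" for f'
   using rm[OF that(1) rf(2)] that(2) unfolding B_def pr_def by auto

  show "0 < (LINT x|M. f i x)" if "i < m" for i using pos v that by auto
  show "bdd M (T (g i))" if "i < m" for i using relaxed_bdd[OF rf(2) that] by (rule T_bdd)
  show False if "S <= {..<m}" "S ~= {}" "S ~= {..<m}" "0 < ep"
   "AE x in M. ALL p:S. ALL q:{..<m} - S. (f p x = 1 --> lam q - lam p + ep <= T (g q) x - T (g p) x) \<and>
    (f q x = 1 --> T (g q) x - T (g p) x <= lam q - lam p)" for S ep lam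
   using pos v by (intro indec[OF rf(1) f01(1) _ _ that] relaxed_bdd[OF rf(2)]) auto
 qed (rule m rf f01)+
 interpret G: linprog M m g "%i. T (f i)"
 proof unfold_locales
  show "(\<Sum>i<m. (LINT x|M. g i x * T (f i) x)) <= (\<Sum>i<m. (LINT x|M. f' i x * T (f i) x))"
   if "relaxed M m f'" "!!i. i < m ==> (LINT x|M. f' i x) = (LINT x|M. g i x)" for f'
   using rm[OF rf(1) that(1)] that(2) B_sym[OF rf] B_sym[OF rf(1) that(1)] unfolding B_def pr_def by auto

  show "0 < (LINT x|M. g i x)" if "i < m" for i using pos v that by auto
  show "bdd M (T (f i))" if "i < m" for i using relaxed_bdd[OF rf(1) that] by (rule T_bdd)
  show False if "S <= {..<m}" "S ~= {}" "S ~= {..<m}" "0 < ep"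
   "AE x in M. ALL p:S. ALL q:{..<m} - S. (g p x = 1 --> lam q - lam p + ep <= T (f q) x - T (f p) x) \<and>
    (g q x = 1 --> T (f q) x - T (f p) x <= lam q - lam p)" for S ep lam
   using pos v by (intro indec[OF rf(2) f01(2) _ _ that] relaxed_bdd[OF rf(1)]) auto
 qed (rule m rf f01)+
 have "rmin M k m f g F.lam G.lam"
 proof (intro rmin.intro noise_axioms rmin_axioms.intro)
  show "mult_prop M m f (%i. T (g i)) F.lam" "mult_prop M m g (%i. T (f i)) G.lam"
   unfolding mult_prop_def by (intro allI impI F.multiplier G.multiplier; assumption)+
  show "taylor_prop M m f (%i. T (g i)) F.lam" "taylor_prop M m g (%i. T (f i)) G.lam"
   unfolding taylor_prop_def by (intro allI impI F.taylor G.taylor; assumption)+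
  show "0 < (LINT x|M. f i x)" "0 < (LINT x|M. g i x)" if "i < m" for i
   using pos v that by auto
  show "B m f g <= B m f' g'" if "relaxed M m f'" "relaxed M m g'"
   "!!i. i < m ==> (LINT x|M. f' i x) = (LINT x|M. f i x)"
   "!!i. i < m ==> (LINT x|M. g' i x) = (LINT x|M. g i x)" for f' g'
   by (rule rm[OF that])
 qed (rule rf f01)+
 then show ?thesis unfolding f_def g_def by blast
qed

end

section \<open>The Gaussian line and the Mehler kernel\<close>

definition N01 :: "real measure" where
 "N01 = density lborel (%x. ennreal (std_normal_density x))"

lemma sets_N01[measurable_cong, simp]: "sets N01 = sets borel" and space_N01[simp]: "space N01 = UNIV"
 unfolding N01_def by auto

lemma prob_space_N01: "prob_space N01"
 unfolding N01_def by (rule prob_space_normal_density) simp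

interpretation N01: prob_space N01 by (rule prob_space_N01)

interpretation NP: product_sigma_finite "%_::nat. N01"
 by unfold_locales

lemma nn_N01: "ph : bm borel ==> (\<integral>\<^sup>+x. ph x \<partial>N01) = (\<integral>\<^sup>+x. ennreal (std_normal_density x) * ph x \<partial>lborel)"
 unfolding N01_def by (rule nn_integral_density) auto

lemma AE_N01: "(AE x in N01. P x) \<longleftrightarrow> (AE x in lborel. P x)"
 unfolding N01_def by (subst AE_density) (auto simp: normal_density_pos)

lemma nn_N01_shift:
 assumes [measurable]: "ph : bm borel"
 shows "(\<integral>\<^sup>+t. ph (t - s) \<partial>N01) = (\<integral>\<^sup>+t. ph t * ennreal (exp (- s * t - s\<^sup>2 / 2)) \<partial>N01)"
proof -
 have "(\<integral>\<^sup>+t. ph (t - s) \<partial>N01) = (\<integral>\<^sup>+t. ennreal (std_normal_density t) * ph (t - s) \<partial>lborel)"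
  by (rule nn_N01) measurable
 also have "... = (\<integral>\<^sup>+t. ennreal (std_normal_density (s + t)) * ph t \<partial>lborel)"
  by (subst nn_integral_real_affine[where c=1 and t=s]) auto
 also have "... = (\<integral>\<^sup>+t. ennreal (std_normal_density t) * (ph t * ennreal (exp (- s * t - s\<^sup>2 / 2))) \<partial>lborel)"
 proof (rule nn_integral_cong)
  fix t
  have "std_normal_density (s + t) = std_normal_density t * exp (- s * t - s\<^sup>2 / 2)"
   unfolding std_normal_density_def by (simp add: power2_eq_square field_simps flip: exp_add)
  then show "ennreal (std_normal_density (s + t)) * ph t = ennreal (std_normal_density t) * (ph t * ennreal (exp (- s * t - s\<^sup>2 / 2)))"
   by (simp add: ennreal_mult mult_ac)
 qed
 also have "... = (\<integral>\<^sup>+t. ph t * ennreal (exp (- s * t - s\<^sup>2 / 2)) \<partial>N01)"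
  by (rule nn_N01[symmetric]) measurable
 finally show ?thesis .
qed

text \<open>The Mehler kernel: the density, relative to the Gaussian, of the law of
  \<open>t * rh + z * sqrt (1 - rh\<^sup>2)\<close> for Gaussian \<open>z\<close>.\<close>

definition k1 :: "real => real => real => real" where
 "k1 rh t r = exp ((2 * rh * t * r - rh\<^sup>2 * t\<^sup>2 - rh\<^sup>2 * r\<^sup>2) / (2 * (1 - rh\<^sup>2))) / sqrt (1 - rh\<^sup>2)"

lemma k1_sym: "k1 rh t r = k1 rh r t"
 unfolding k1_def by (simp add: algebra_simps)

lemma k1_pos: "0 < rh ==> rh < 1 ==> 0 < k1 rh t r"
 unfolding k1_def by (simp add: power_less_one_iff)

lemma k1_meas[measurable]: "(%x. k1 rh (f x) (g x)) : bm M"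
 if "f : bm M" "g : bm M"
 using that unfolding k1_def by measurable

lemma nn_k1:
 assumes rho: "0 < rh" "rh < 1" and [measurable]: "ph : bm borel"
 shows "(\<integral>\<^sup>+z. ph (t * rh + z * sqrt (1 - rh\<^sup>2)) \<partial>N01) = (\<integral>\<^sup>+r. ennreal (k1 rh t r) * ph r \<partial>N01)"
proof -
 define s where "s = sqrt (1 - rh\<^sup>2)"
 have r2: "rh\<^sup>2 < 1" using rho by (simp add: power_less_one_iff)
 have s: "0 < s" "s\<^sup>2 = 1 - rh\<^sup>2" unfolding s_def using r2 by auto
 have sq: "sqrt (1 - rh\<^sup>2) = s" by (simp add: s_def)
 have dens: "std_normal_density r * k1 rh t r = normal_density (t * rh) s r" for r
 proof -
  have "std_normal_density r * k1 rh t r = (1 / (sqrt (2 * pi) * s)) *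
    (exp (- r\<^sup>2 / 2) * exp ((2 * rh * t * r - rh\<^sup>2 * t\<^sup>2 - rh\<^sup>2 * r\<^sup>2) / (2 * s\<^sup>2)))"
   unfolding std_normal_density_def k1_def sq by (simp add: s(2) sq)
  also have "exp (- r\<^sup>2 / 2) * exp ((2 * rh * t * r - rh\<^sup>2 * t\<^sup>2 - rh\<^sup>2 * r\<^sup>2) / (2 * s\<^sup>2)) =
    exp (- (r - t * rh)\<^sup>2 / (2 * s\<^sup>2))"
  proof -
   have "- r\<^sup>2 / 2 = - (s\<^sup>2 * r\<^sup>2) / (2 * s\<^sup>2)" using s(1) by simp
   then have "- r\<^sup>2 / 2 + (2 * rh * t * r - rh\<^sup>2 * t\<^sup>2 - rh\<^sup>2 * r\<^sup>2) / (2 * s\<^sup>2) =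
     (- (s\<^sup>2 * r\<^sup>2) + (2 * rh * t * r - rh\<^sup>2 * t\<^sup>2 - rh\<^sup>2 * r\<^sup>2)) / (2 * s\<^sup>2)"
    by (simp only: add_divide_distrib)
   also have "- (s\<^sup>2 * r\<^sup>2) + (2 * rh * t * r - rh\<^sup>2 * t\<^sup>2 - rh\<^sup>2 * r\<^sup>2) = - (r - t * rh)\<^sup>2"
    unfolding s(2) by (simp add: power2_eq_square algebra_simps)
   finally show ?thesis by (simp flip: exp_add)
  qed
  also have "(1 / (sqrt (2 * pi) * s)) = 1 / sqrt (2 * pi * s\<^sup>2)" using s(1) by (simp add: real_sqrt_mult)
  finally show ?thesis unfolding normal_density_def .
 qed
 have sc: "s * normal_density (t * rh) s (t * rh + s * z) = std_normal_density z" for z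
  unfolding normal_density_def std_normal_density_def using s(1)
  by (simp add: real_sqrt_mult power_mult_distrib)
 have "(\<integral>\<^sup>+r. ennreal (k1 rh t r) * ph r \<partial>N01) = (\<integral>\<^sup>+r. ennreal (std_normal_density r) * (ennreal (k1 rh t r) * ph r) \<partial>lborel)"
  by (rule nn_N01) measurable
 also have "... = (\<integral>\<^sup>+r. ennreal (normal_density (t * rh) s r) * ph r \<partial>lborel)"
  using k1_pos[OF rho, of t] by (intro nn_integral_cong) (simp flip: dens add: ennreal_mult less_imp_le mult.assoc)
 also have "... = ennreal \<bar>s\<bar> * (\<integral>\<^sup>+z. ennreal (normal_density (t * rh) s (t * rh + s * z)) * ph (t * rh + s * z) \<partial>lborel)"
  using s by (intro nn_integral_real_affine) auto
 also have "... = (\<integral>\<^sup>+z. ennreal s * (ennreal (normal_density (t * rh) s (t * rh + s * z)) * ph (t * rh + s * z)) \<partial>lborel)"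
  using s by (subst nn_integral_cmult) auto
 also have "... = (\<integral>\<^sup>+z. ennreal (std_normal_density z) * ph (t * rh + z * s) \<partial>lborel)"
  using s by (intro nn_integral_cong) (simp flip: sc add: ennreal_mult mult_ac)
 also have "... = (\<integral>\<^sup>+z. ph (t * rh + z * s) \<partial>N01)"
  by (rule nn_N01[symmetric]) measurable
 finally show ?thesis unfolding s_def by simp
qed

lemma nn_k1_1: "0 < rh ==> rh < 1 ==> (\<integral>\<^sup>+r. ennreal (k1 rh t r) \<partial>N01) = 1"
 using nn_k1[of rh "%_. 1" t] by (simp add: N01.emeasure_space_1[simplified])

text \<open>The noise law started at \<open>t\<close> is centred at \<open>t * rh\<close>, so moving
  \<open>r\<close> by \<open>s\<close> amounts to moving \<open>t\<close> by \<open>s / rh\<close>;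
  the exponential is the Cameron-Martin factor of the reference measure. The two different speeds of
  translation originate here.\<close>

lemma k1_shift:
 assumes "0 < rh" "rh < 1"
 shows "k1 rh t (r + s) * exp (- s * r - s\<^sup>2 / 2) = k1 rh (t - s / rh) r"
proof -
 have r2: "1 - rh\<^sup>2 ~= 0" using assms by (simp add: power2_eq_1_iff)
 have "(2 * rh * t * (r + s) - rh\<^sup>2 * t\<^sup>2 - rh\<^sup>2 * (r + s)\<^sup>2) / (2 * (1 - rh\<^sup>2)) + (- s * r - s\<^sup>2 / 2) =
  (2 * rh * t * (r + s) - rh\<^sup>2 * t\<^sup>2 - rh\<^sup>2 * (r + s)\<^sup>2 + (- s * r - s\<^sup>2 / 2) * (2 * (1 - rh\<^sup>2))) / (2 * (1 - rh\<^sup>2))"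
  using r2 by (simp add: add_divide_distrib)
 also have "2 * rh * t * (r + s) - rh\<^sup>2 * t\<^sup>2 - rh\<^sup>2 * (r + s)\<^sup>2 + (- s * r - s\<^sup>2 / 2) * (2 * (1 - rh\<^sup>2)) =
  2 * rh * (t - s / rh) * r - rh\<^sup>2 * (t - s / rh)\<^sup>2 - rh\<^sup>2 * r\<^sup>2"
  using assms(1) by (simp add: power2_eq_square field_simps)
 finally show ?thesis unfolding k1_def by (simp flip: exp_add)
qed

text \<open>The exponent is quadratic in \<open>t\<close>, so the squared kernel at \<open>t\<close>
  divided by the kernel at \<open>t'\<close> is again a kernel, started at the reflected point
  \<open>2 * t - t'\<close>, up to a constant. Its integral gives the chi-square divergence of two
  noise laws.\<close>

lemma k1_chi:
 assumes "0 < rh" "rh < 1"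
 shows "(k1 rh t r)\<^sup>2 = k1 rh (2 * t - t') r * k1 rh t' r * exp ((rh * (t - t'))\<^sup>2 / (1 - rh\<^sup>2))"
proof -
 define c where "c = 2 * (1 - rh\<^sup>2)"
 define E where "E t = 2 * rh * t * r - rh\<^sup>2 * t\<^sup>2 - rh\<^sup>2 * r\<^sup>2" for t
 have r2: "c ~= 0" "1 - rh\<^sup>2 = c / 2" using assms by (auto simp: c_def power2_eq_1_iff)
 have "2 * E t = E (2 * t - t') + E t' + 2 * (rh * (t - t'))\<^sup>2"
  unfolding E_def by (simp add: power2_eq_square algebra_simps)
 then have "2 * E t / c = E (2 * t - t') / c + E t' / c + (rh * (t - t'))\<^sup>2 / (c / 2)"
  by (simp add: add_divide_distrib)
 then have "exp (E t / c) * exp (E t / c) = exp (E (2 * t - t') / c) * exp (E t' / c) * exp ((rh * (t - t'))\<^sup>2 / (1 - rh\<^sup>2))"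
  unfolding r2(2) by (simp flip: exp_add)
 then show ?thesis
  unfolding k1_def c_def[symmetric] E_def[symmetric] by (simp add: power2_eq_square)
qed

section \<open>Products of Gaussians: resampling and shifting one coordinate\<close>

abbreviation GG :: "nat set => (nat => real) measure" where "GG I \<equiv> PiM I (%_. N01)"

definition kk :: "real => nat set => (nat => real) => (nat => real) => real" where
 "kk rh I x y = (\<Prod>i\<in>I. k1 rh (x i) (y i))"

text \<open>The sign makes \<open>ph (sh j s x)\<close> the translate of \<open>ph\<close> by
  \<open>+ s\<close> along axis j.\<close>

definition sh :: "nat => real => (nat => real) => nat => real" where
 "sh j s x = x(j := x j - s)"

lemma meas_comp[measurable]: "j : I ==> (%x. x j) : bm (GG I)"
 using measurable_component_singleton[of j I "%_. N01"] by simp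

lemma meas_upd:
 assumes "j : I" "f : M \<rightarrow>\<^sub>M GG I" "g : bm M"
 shows "(%x. (f x)(j := g x)) : M \<rightarrow>\<^sub>M GG I"
proof -
 have "insert j I = I" using assms by auto
 then have a: "(%(f, y). f(j := y)) : GG I \<Otimes>\<^sub>M N01 \<rightarrow>\<^sub>M GG I"
  using measurable_add_dim[of j I "%_. N01"] by simp
 have b: "(%x. (f x, g x)) : M \<rightarrow>\<^sub>M GG I \<Otimes>\<^sub>M N01" using assms by simp
 from measurable_compose[OF b a] show ?thesis by simp
qed

lemma space_upd: "j : I ==> x : space (GG I) ==> x(j := t) : space (GG I)"
 by (auto simp: space_PiM PiE_iff extensional_def)

lemma sh_meas[measurable]: "j : I ==> sh j s : GG I \<rightarrow>\<^sub>M GG I"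
 unfolding sh_def[abs_def] by (rule meas_upd) auto

lemma space_sh: "j : I ==> x : space (GG I) ==> sh j s x : space (GG I)"
 unfolding sh_def by (rule space_upd)

text \<open>Integrating over \<open>t\<close> forgets the old value of coordinate j. Arguments on
  single lines can thus be made without changing the index set.\<close>

lemma nn_resample:
 assumes I: "finite I" "j : I" and F[measurable]: "F : bm (GG I)"
 shows "(\<integral>\<^sup>+x. F x \<partial>GG I) = (\<integral>\<^sup>+x. \<integral>\<^sup>+t. F (x(j := t)) \<partial>N01 \<partial>GG I)"
proof -
 define J where "J = I - {j}"
 have J: "finite J" "j ~: J" "I = insert j J" unfolding J_def using I by auto
 have mF: "(%x. \<integral>\<^sup>+t. F (x(j := t)) \<partial>N01) : bm (GG I)"
 proof -
  have "(%z. F ((fst z)(j := snd z))) : bm (GG I \<Otimes>\<^sub>M N01)"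
   by (rule measurable_compose[OF meas_upd F]) (use I in auto)
  then show ?thesis by (intro N01.borel_measurable_nn_integral) (simp add: split_beta')
 qed
 have "(\<integral>\<^sup>+x. \<integral>\<^sup>+t. F (x(j := t)) \<partial>N01 \<partial>GG I) = (\<integral>\<^sup>+x. \<integral>\<^sup>+y. \<integral>\<^sup>+t. F (x(j := y, j := t)) \<partial>N01 \<partial>N01 \<partial>GG J)"
  unfolding J(3) by (rule NP.product_nn_integral_insert[OF J(1,2) mF[unfolded J(3)]])
 also have "... = (\<integral>\<^sup>+x. \<integral>\<^sup>+t. F (x(j := t)) \<partial>N01 \<partial>GG J)"
  by (simp add: N01.emeasure_space_1[simplified])
 also have "... = (\<integral>\<^sup>+x. F x \<partial>GG I)"
  unfolding J(3) by (rule NP.product_nn_integral_insert[OF J(1,2) F[unfolded J(3)], symmetric])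
 finally show ?thesis ..
qed

lemma distr_resample:
 assumes I: "finite I" "j : I"
 shows "distr (GG I \<Otimes>\<^sub>M N01) (GG I) (%(x, t). x(j := t)) = GG I"
proof (rule measure_eqI)
 fix A assume "A : sets (distr (GG I \<Otimes>\<^sub>M N01) (GG I) (%(x, t). x(j := t)))"
 then have A[measurable]: "A : sets (GG I)" by simp
 have mu[measurable]: "(%(x, t). x(j := t)) : GG I \<Otimes>\<^sub>M N01 \<rightarrow>\<^sub>M GG I"
  using meas_upd[of j I fst "GG I \<Otimes>\<^sub>M N01" snd] I by (simp add: split_beta')
 have "emeasure (distr (GG I \<Otimes>\<^sub>M N01) (GG I) (%(x, t). x(j := t))) A =
  (\<integral>\<^sup>+z. indicator A z \<partial>distr (GG I \<Otimes>\<^sub>M N01) (GG I) (%(x, t). x(j := t)))" by simp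
 also have "... = (\<integral>\<^sup>+z. indicator A (case z of (x, t) => x(j := t)) \<partial>(GG I \<Otimes>\<^sub>M N01))"
  by (rule nn_integral_distr) auto
 also have "... = (\<integral>\<^sup>+x. \<integral>\<^sup>+t. indicator A (x(j := t)) \<partial>N01 \<partial>GG I)"
  by (subst N01.nn_integral_fst[symmetric]) (use measurable_compose[OF mu, of "indicator A" borel] in \<open>auto simp: split_beta'\<close>)
 also have "... = (\<integral>\<^sup>+x. indicator A x \<partial>GG I)" using I by (intro nn_resample[symmetric]) auto
 finally show "emeasure (distr (GG I \<Otimes>\<^sub>M N01) (GG I) (%(x, t). x(j := t))) A = emeasure (GG I) A" by simp
qed simp

lemma AE_resample:
 assumes I: "finite I" "j : I" and P: "{x\<in>space (GG I). P x} : sets (GG I)"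
 shows "(AE x in GG I. P x) \<longleftrightarrow> (AE x in GG I. AE t in N01. P (x(j := t)))"
proof -
 have mu: "(%(x, t). x(j := t)) : GG I \<Otimes>\<^sub>M N01 \<rightarrow>\<^sub>M GG I"
  using meas_upd[of j I fst "GG I \<Otimes>\<^sub>M N01" snd] I by (simp add: split_beta')
 have "(AE x in GG I. P x) \<longleftrightarrow> (AE x in distr (GG I \<Otimes>\<^sub>M N01) (GG I) (%(x, t). x(j := t)). P x)"
  unfolding distr_resample[OF I] ..
 also have "... \<longleftrightarrow> (AE z in GG I \<Otimes>\<^sub>M N01. P (case z of (x, t) => x(j := t)))"
  by (rule AE_distr_iff[OF mu]) (use P in simp)
 also have "... \<longleftrightarrow> (AE x in GG I. AE t in N01. P (x(j := t)))"
 proof -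
  interpret pair_sigma_finite "GG I" N01
   using NP.sigma_finite[OF I(1)] by (intro pair_sigma_finite.intro) (auto intro: N01.sigma_finite_measure_axioms)
  have "{z : space (GG I \<Otimes>\<^sub>M N01). P (case z of (x, t) => x(j := t))} : sets (GG I \<Otimes>\<^sub>M N01)"
  proof -
   have "{z : space (GG I \<Otimes>\<^sub>M N01). P (case z of (x, t) => x(j := t))} =
    (%(x, t). x(j := t)) -` {x\<in>space (GG I). P x} \<inter> space (GG I \<Otimes>\<^sub>M N01)"
    using space_upd[OF I(2)] by (auto simp: space_pair_measure)
   then show ?thesis using measurable_sets[OF mu P] by simp
  qed
  then show ?thesis using AE_pair_iff[of "%x t. P (x(j := t))"] by (simp add: split_beta')
 qed
 finally show ?thesis .
qed

text \<open>Cameron-Martin for a shift along one axis; resampling reduces it to the line.\<close>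

lemma distr_sh:
 assumes I: "finite I" "j : I"
 shows "distr (GG I) (GG I) (sh j s) = density (GG I) (%x. ennreal (exp (- s * x j - s\<^sup>2 / 2)))"
proof (rule measure_eqI)
 fix A assume "A : sets (distr (GG I) (GG I) (sh j s))"
 then have A[measurable]: "A : sets (GG I)" by simp
 have m1[measurable]: "(%t. indicator A (x(j := t)) :: ennreal) : bm borel" if "x : space (GG I)" for x
 proof -
  have "(%t. x(j := t)) : borel \<rightarrow>\<^sub>M GG I" by (rule meas_upd) (use I that in auto)
  then show ?thesis by (rule measurable_compose) simp
 qed
 note [measurable] = I(2)
 have "emeasure (distr (GG I) (GG I) (sh j s)) A = (\<integral>\<^sup>+x. indicator A x \<partial>distr (GG I) (GG I) (sh j s))" by simp
 also have "... = (\<integral>\<^sup>+x. indicator A (sh j s x) \<partial>GG I)"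
  using sh_meas[OF I(2)] by (subst nn_integral_distr) auto
 also have "... = (\<integral>\<^sup>+x. \<integral>\<^sup>+t. indicator A (sh j s (x(j := t))) \<partial>N01 \<partial>GG I)"
  by (rule nn_resample[OF I]) (rule measurable_compose[OF sh_meas[OF I(2)]], simp)
 also have "... = (\<integral>\<^sup>+x. \<integral>\<^sup>+t. indicator A (x(j := t)) * ennreal (exp (- s * t - s\<^sup>2 / 2)) \<partial>N01 \<partial>GG I)"
 proof (rule nn_integral_cong)
  fix x assume "x : space (GG I)"
  from nn_N01_shift[OF m1[OF this], of s]
  show "(\<integral>\<^sup>+t. indicator A (sh j s (x(j := t))) \<partial>N01) =
   (\<integral>\<^sup>+t. indicator A (x(j := t)) * ennreal (exp (- s * t - s\<^sup>2 / 2)) \<partial>N01)" by (simp add: sh_def)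
 qed
 also have "... = (\<integral>\<^sup>+x. \<integral>\<^sup>+t. indicator A (x(j := t)) * ennreal (exp (- s * (x(j := t)) j - s\<^sup>2 / 2)) \<partial>N01 \<partial>GG I)"
  by simp
 also have "... = (\<integral>\<^sup>+x. indicator A x * ennreal (exp (- s * x j - s\<^sup>2 / 2)) \<partial>GG I)"
  by (rule nn_resample[OF I, symmetric]) measurable
 also have "... = emeasure (density (GG I) (%x. ennreal (exp (- s * x j - s\<^sup>2 / 2)))) A"
  by (subst emeasure_density) (auto simp: mult.commute)
 finally show "emeasure (distr (GG I) (GG I) (sh j s)) A = emeasure (density (GG I) (%x. ennreal (exp (- s * x j - s\<^sup>2 / 2)))) A" .
qed simp

lemma AE_sh:
 assumes I: "finite I" "j : I" and P: "AE x in GG I. P x"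
 shows "AE x in GG I. P (sh j s x)"
proof -
 note [measurable] = I(2)
 have "AE x in density (GG I) (%x. ennreal (exp (- s * x j - s\<^sup>2 / 2))). P x"
  using P by (subst AE_density) auto
 then have "AE x in distr (GG I) (GG I) (sh j s). P x" unfolding distr_sh[OF I] .
 then show ?thesis by (rule AE_distrD[OF sh_meas[OF I(2)]])
qed

lemma integral_sh:
 assumes I: "finite I" "j : I" and F[measurable]: "F : bm (GG I)"
 shows "(LINT x|GG I. F (sh j s x)) = (LINT x|GG I. exp (- s * x j - s\<^sup>2 / 2) * F x)"
proof -
 note [measurable] = I(2)
 have "(LINT x|GG I. F (sh j s x)) = (\<integral>x. F x \<partial>distr (GG I) (GG I) (sh j s))"
  by (rule integral_distr[symmetric, OF sh_meas[OF I(2)] F])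
 also have "... = (LINT x|GG I. exp (- s * x j - s\<^sup>2 / 2) * F x)"
  unfolding distr_sh[OF I] by (subst integral_density) auto
 finally show ?thesis .
qed

lemma sets_AE:
 assumes P: "{p : space (N \<Otimes>\<^sub>M GG I). P (fst p) (snd p)} : sets (N \<Otimes>\<^sub>M GG I)"
 shows "{x : space N. AE z in GG I. P x z} : sets N"
proof -
 interpret prob_space "GG I" by (rule prob_space_PiM) (rule prob_space_N01)
 define Q where "Q = space (N \<Otimes>\<^sub>M GG I) - {p : space (N \<Otimes>\<^sub>M GG I). P (fst p) (snd p)}"
 have Q[measurable]: "Q : sets (N \<Otimes>\<^sub>M GG I)" unfolding Q_def using P by auto
 have "(AE z in GG I. P x z) \<longleftrightarrow> emeasure (GG I) (Pair x -` Q) = 0" if x: "x : space N" for x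
 proof -
  have "Pair x -` Q = {z\<in>space (GG I). \<not> P x z}" unfolding Q_def using x by (auto simp: space_pair_measure)
  then show ?thesis by (intro AE_iff_measurable sets_Pair1[OF Q]) simp
 qed
 then have "{x : space N. AE z in GG I. P x z} = {x : space N. emeasure (GG I) (Pair x -` Q) = 0}" by auto
 also have "... : sets N" using measurable_emeasure_Pair[OF Q] by measurable
 finally show ?thesis .
qed

lemma open_AE_N01:
 assumes "open U" "t : U" "AE t in N01. t ~: U"
 shows False
proof -
 obtain e where e: "0 < e" "ball t e <= U" using assms openE by blast
 have "AE t in lborel. t ~: ball t' e" if "ball t' e <= U" for t'
  using assms(3) that unfolding AE_N01 by (auto elim!: eventually_mono)
 from this[OF e(2)] have "emeasure lborel (ball t e) = 0"
  by (subst (asm) AE_iff_measurable[of "ball t e"]) auto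
 moreover have "ball t e = {t - e<..<t + e}" by (auto simp: dist_real_def)
 ultimately show False using e(1) by simp
qed

section \<open>The Gaussian noise operator\<close>

locale gauss =
 fixes I :: "nat set" and rh :: real
 assumes fin: "finite I" and ne: "I ~= {}" and rho: "0 < rh" "rh < 1"
begin

lemma kk_meas: "case_prod (kk rh I) : bm (GG I \<Otimes>\<^sub>M GG I)"
proof -
 have "(%z. \<Prod>i\<in>I. k1 rh (fst z i) (snd z i)) : bm (GG I \<Otimes>\<^sub>M GG I)"
 proof (rule borel_measurable_prod)
  fix i assume i: "i : I"
  have "(%z. fst z i) : bm (GG I \<Otimes>\<^sub>M GG I)" "(%z. snd z i) : bm (GG I \<Otimes>\<^sub>M GG I)"
   using measurable_compose[OF measurable_fst meas_comp[OF i]] measurable_compose[OF measurable_snd meas_comp[OF i]] by auto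
  then show "(%z. k1 rh (fst z i) (snd z i)) : bm (GG I \<Otimes>\<^sub>M GG I)" by (rule k1_meas)
 qed
 then show ?thesis unfolding kk_def by (simp add: split_beta')
qed

lemma kk_pos: "0 < kk rh J x y"
 unfolding kk_def by (intro prod_pos) (auto intro: k1_pos rho)

lemma kk_sym: "kk rh J x y = kk rh J y x"
 unfolding kk_def by (intro prod.cong) (auto simp: k1_sym)

lemma kk_split: "j : I ==> kk rh I x y = k1 rh (x j) (y j) * kk rh (I - {j}) x y"
 unfolding kk_def by (rule prod.remove[OF fin])

lemma kk_upd1: "j ~: J ==> kk rh J (x(j := t)) y = kk rh J x y"
 unfolding kk_def by (intro prod.cong) auto

lemma kk_upd2: "j ~: J ==> kk rh J x (y(j := t)) = kk rh J x y"
 unfolding kk_def by (intro prod.cong) auto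

lemma kk_nn: "(\<integral>\<^sup>+y. ennreal (kk rh I x y) \<partial>GG I) = 1"
proof -
 have "(\<integral>\<^sup>+y. ennreal (kk rh I x y) \<partial>GG I) = (\<integral>\<^sup>+y. (\<Prod>i\<in>I. ennreal (k1 rh (x i) (y i))) \<partial>GG I)"
  unfolding kk_def using k1_pos[OF rho] by (subst prod_ennreal) (auto intro: less_imp_le)
 also have "... = (\<Prod>i\<in>I. \<integral>\<^sup>+r. ennreal (k1 rh (x i) r) \<partial>N01)"
  by (rule NP.product_nn_integral_prod[OF fin]) (rule measurable_compose[OF k1_meas measurable_ennreal], auto intro: measurable_ident_sets)
 also have "... = 1" using nn_k1_1[OF rho] by simp
 finally show ?thesis .
qed

lemma prob_space_GG: "prob_space (GG J)"
 by (rule prob_space_PiM) (rule prob_space_N01)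

sublocale noise "GG I" "kk rh I"
proof (intro noise.intro prob_space_GG noise_axioms.intro kk_meas kk_nn)
 show "0 <= kk rh I x y" for x y using kk_pos[of I x y] by simp
 show "kk rh I x y = kk rh I y x" for x y by (rule kk_sym)
qed

lemma std_le1: "std_normal_density x <= 1"
proof -
 have "exp (- x\<^sup>2 / 2) <= 1" by simp
 moreover have "1 <= sqrt (2 * pi)" using pi_gt3 by simp
 ultimately show ?thesis unfolding std_normal_density_def
  by (simp add: divide_le_eq_1 order_trans[OF _ \<open>1 <= sqrt (2 * pi)\<close>] le_divide_eq)
qed

lemma N01_interval: "a <= b ==> measure N01 {a<..b} <= b - a"
proof -
 assume ab: "a <= b"
 have "emeasure N01 {a<..b} = (\<integral>\<^sup>+x. ennreal (std_normal_density x) * indicator {a<..b} x \<partial>lborel)"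
  unfolding N01_def by (rule emeasure_density) auto
 also have "... <= (\<integral>\<^sup>+x. indicator {a<..b} x \<partial>lborel)"
  using std_le1 by (intro nn_integral_mono) (auto simp: indicator_def)
 also have "... = ennreal (b - a)" using ab by simp
 finally show ?thesis using ab by (simp add: N01.emeasure_eq_measure)
qed

lemma measure_comp:
 assumes j: "j : I" and S: "S : sets borel"
 shows "measure (GG I) {x\<in>space (GG I). x j : S} = measure N01 S"
proof -
 have "distr (GG I) N01 (%x. x j) = N01"
  using distr_PiM_component[of I "%_. N01" j] j prob_space_N01 by simp
 then have "measure N01 S = measure (distr (GG I) N01 (%x. x j)) S" by simp
 also have "... = measure (GG I) ((%x. x j) -` S \<inter> space (GG I))"
  using j S by (intro measure_distr) (auto intro: measurable_component_singleton)
 also have "(%x. x j) -` S \<inter> space (GG I) = {x\<in>space (GG I). x j : S}" by auto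
 finally show ?thesis by simp
qed

text \<open>The mass of \<open>A\<close> below height t in one coordinate is 1-Lipschitz in t, as
  the Gaussian density is at most 1, so every intermediate value is attained.\<close>

lemma split_GG:
 assumes A: "A : sets (GG I)" and r: "0 <= r" "r <= measure (GG I) A"
 shows "EX B:sets (GG I). B <= A & measure (GG I) B = r"
proof -
 obtain j where j: "j : I" using ne by blast
 note [measurable] = j A
 define H where "H t = A \<inter> {x\<in>space (GG I). x j <= t}" for t
 have H[measurable]: "H t : sets (GG I)" for t unfolding H_def by measurable
 define F where "F t = measure (GG I) (H t)" for t
 consider "r = 0" | "r = measure (GG I) A" | "0 < r" "r < measure (GG I) A" using r by linarith
 then show ?thesis
 proof cases
  case 1 then show ?thesis by (intro bexI[of _ "{}"]) auto
 next
  case 2 then show ?thesis using A by blast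
 next
  case 3
  have mono: "F t <= F t'" if "t <= t'" for t t'
   unfolding F_def using that by (intro finite_measure_mono H) (auto simp: H_def)
  have lip: "F t' - F t <= t' - t" if tt: "t <= t'" for t t'
  proof -
   have sub: "H t <= H t'" using tt unfolding H_def by auto
   have "F t' - F t = measure (GG I) (H t' - H t)"
    unfolding F_def using finite_measure_Diff[OF H H sub] by simp
   also have "... <= measure (GG I) {x\<in>space (GG I). x j : {t<..t'}}"
    by (rule finite_measure_mono) (auto simp: H_def)
   also have "... <= t' - t" using measure_comp[OF j, of "{t<..t'}"] N01_interval[OF tt] by simp
   finally show ?thesis .
  qed
  have cont: "continuous_on UNIV F"
  proof (rule continuous_onI)
   fix x e :: real assume "0 < e"
   then show "EX d>0. ALL x':UNIV. dist x' x < d --> dist (F x') (F x) <= e"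
   proof (intro exI[of _ e] conjI ballI impI)
    fix x' assume "dist x' x < e"
    then show "dist (F x') (F x) <= e"
     using lip[of x x'] lip[of x' x] mono[of x x'] mono[of x' x] unfolding dist_real_def by (cases "x <= x'") auto
   qed
  qed
  have "(%n. F (real n)) \<longlonglongrightarrow> measure (GG I) (\<Union>n. H (real n))"
   unfolding F_def using H by (intro finite_Lim_measure_incseq) (auto simp: incseq_def H_def)
  moreover have "(\<Union>n. H (real n)) = A"
   using sets.sets_into_space[OF A] real_arch_simple unfolding H_def by blast
  ultimately have "eventually (%n. r < F (real n)) sequentially" using 3 by (auto intro: order_tendstoD)
  then obtain n where n: "r < F (real n)" by (auto simp: eventually_sequentially)
  have "(%n. F (- real n)) \<longlonglongrightarrow> measure (GG I) (\<Inter>n. H (- real n))"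
   unfolding F_def using H by (intro finite_Lim_measure_decseq) (auto simp: decseq_def H_def)
  moreover have "(\<Inter>n. H (- real n)) = {}"
  proof (rule ccontr)
   assume "(\<Inter>n. H (- real n)) ~= {}"
   then obtain x where x: "!!n. x j <= - real n" unfolding H_def by auto
   obtain n where "- x j < real n" using reals_Archimedean2 by blast
   then show False using x[of n] by linarith
  qed
  ultimately have "eventually (%n. F (- real n) < r) sequentially" using 3 by (auto intro: order_tendstoD)
  then obtain n' where n': "F (- real n') < r" by (auto simp: eventually_sequentially)
  have "EX t. - real n' <= t & t <= real n & F t = r"
   using n n' by (intro IVT' continuous_on_subset[OF cont]) auto
  then obtain t where "F t = r" by blast
  then show ?thesis using H unfolding F_def H_def by blast
 qed
qed

sublocale atomless_prob "GG I"
 by unfold_locales (rule split_GG)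

text \<open>Lipschitz constant, in L1, of the noise law as one coordinate of its starting point
  moves.\<close>

definition Kr :: real where "Kr = 2 * rh / sqrt (1 - rh\<^sup>2)"

lemma rho2: "0 < 1 - rh\<^sup>2" using rho by (simp add: power_less_one_iff)

lemma Kr_pos: "0 < Kr" unfolding Kr_def using rho rho2 by simp

text \<open>For distant points the trivial bound 2 suffices. For close ones the arithmetic-geometric
  mean inequality bounds the difference \<open>u\<close> by \<open>u\<^sup>2 / v\<close> and
  \<open>v\<close>, weighted with \<open>c\<close>, where \<open>v\<close> is the kernel at
  \<open>t'\<close>; \<open>k1_chi\<close> evaluates the integral of the former.\<close>

lemma kk_L1:
 assumes j: "j : I" and x: "x : space (GG I)"
 shows "(LINT y|GG I. \<bar>kk rh I (x(j := t)) y - kk rh I (x(j := t')) y\<bar>) <= Kr * \<bar>t - t'\<bar>"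
proof -
 define c where "c = rh * \<bar>t - t'\<bar> / sqrt (1 - rh\<^sup>2)"
 have Kc: "Kr * \<bar>t - t'\<bar> = 2 * c" unfolding Kr_def c_def by simp
 have c0: "0 <= c" unfolding c_def using rho rho2 by simp
 have c2: "c\<^sup>2 = (rh * (t - t'))\<^sup>2 / (1 - rh\<^sup>2)"
  unfolding c_def using rho2 by (simp add: power_mult_distrib power_divide)
 define u where "u y = kk rh I (x(j := t)) y - kk rh I (x(j := t')) y" for y
 have sp: "x(j := q) : space (GG I)" for q using space_upd[OF j x] .
 note ki = k_int[OF sp]
 have ui: "integrable (GG I) (%y. \<bar>u y\<bar>)" unfolding u_def using ki by auto
 consider "c = 0" | "1 <= c" | "0 < c" "c < 1" using c0 by linarith
 then have "(LINT y|GG I. \<bar>u y\<bar>) <= 2 * c"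
 proof cases
  case 1
  then have "t = t'" unfolding c_def using rho rho2 by auto
  then show ?thesis using 1 unfolding u_def by simp
 next
  case 2
  have "(LINT y|GG I. \<bar>u y\<bar>) <= (LINT y|GG I. kk rh I (x(j := t)) y + kk rh I (x(j := t')) y)"
  proof (rule integral_mono[OF ui])
   show "\<bar>u y\<bar> <= kk rh I (x(j := t)) y + kk rh I (x(j := t')) y" for y
    using kk_pos[of I "x(j := t)" y] kk_pos[of I "x(j := t')" y] unfolding u_def by linarith
  qed (use ki in auto)
  also have "... = 2" using ki by simp
  finally show ?thesis using 2 by simp
 next
  case 3
  \<comment> \<open>This is \<open>u\<^sup>2\<close> divided by the kernel at \<open>t'\<close>,
    written as a combination of kernels so that its integral is visibly
    \<open>exp (c\<^sup>2) - 1\<close>.\<close>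
  define w where "w y = kk rh I (x(j := 2 * t - t')) y * exp (c\<^sup>2) - 2 * kk rh I (x(j := t)) y + kk rh I (x(j := t')) y" for y
  have pw: "\<bar>u y\<bar> <= (w y / c + c * kk rh I (x(j := t')) y) / 2" for y
  proof -
   define v where "v = kk rh I (x(j := t')) y"
   define a where "a = kk rh I (x(j := t)) y"
   have v: "0 < v" unfolding v_def by (rule kk_pos)
   have sq: "a\<^sup>2 = kk rh I (x(j := 2 * t - t')) y * v * exp (c\<^sup>2)"
    unfolding a_def v_def kk_split[OF j] c2
    using k1_chi[OF rho, of t "y j" t']
    by (simp add: kk_upd1 power_mult_distrib) (simp add: power2_eq_square algebra_simps)
   have "0 <= (\<bar>u y\<bar> - c * v)\<^sup>2" by simp
   then have "2 * c * \<bar>u y\<bar> * v <= (u y)\<^sup>2 + c\<^sup>2 * v\<^sup>2" by (simp add: power2_eq_square algebra_simps)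
   also have "(u y)\<^sup>2 = w y * v"
    unfolding u_def w_def a_def[symmetric] v_def[symmetric] power2_diff using sq
    by (simp add: power2_eq_square algebra_simps)
   finally have "(2 * c * \<bar>u y\<bar>) * v <= (w y + c\<^sup>2 * v) * v" by (simp add: power2_eq_square algebra_simps)
   then have "2 * c * \<bar>u y\<bar> <= w y + c\<^sup>2 * v" using v by (simp add: mult_le_cancel_right)
   then show ?thesis unfolding v_def[symmetric] using 3(1) by (simp add: field_simps power2_eq_square)
  qed
  have "(LINT y|GG I. \<bar>u y\<bar>) <= (LINT y|GG I. (w y / c + c * kk rh I (x(j := t')) y) / 2)"
   using pw ui ki unfolding w_def by (intro integral_mono) auto
  also have "... = ((exp (c\<^sup>2) - 1) / c + c) / 2" unfolding w_def using ki by simp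
  also have "... <= ((2 * c\<^sup>2) / c + c) / 2"
  proof -
   have "c\<^sup>2 <= 1" using 3 by (simp add: power_le_one)
   then have "exp (c\<^sup>2) <= 1 + c\<^sup>2 + (c\<^sup>2)\<^sup>2" by (intro exp_bound) auto
   also have "(c\<^sup>2)\<^sup>2 <= c\<^sup>2" using power_decreasing[of 2 4 c] 3 by simp
   finally have "exp (c\<^sup>2) - 1 <= 2 * c\<^sup>2" by simp
   then show ?thesis using 3(1) by (intro divide_right_mono add_right_mono) auto
  qed
  also have "... <= 2 * c" using 3 by (simp add: power2_eq_square)
  finally show ?thesis .
 qed
 then show ?thesis unfolding u_def Kc .
qed

lemma T_lip:
 assumes j: "j : I" and x: "x : space (GG I)" and b: "bdd (GG I) ph" and C: "!!y. y : space (GG I) ==> \<bar>ph y\<bar> <= C"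
 shows "\<bar>T ph (x(j := t)) - T ph (x(j := t'))\<bar> <= C * (Kr * \<bar>t - t'\<bar>)"
proof -
 have sp: "x(j := q) : space (GG I)" for q using space_upd[OF j x] .
 have C0: "0 <= C" using C[OF x] by simp
 have eq: "T ph (x(j := t)) - T ph (x(j := t')) = (LINT y|GG I. (kk rh I (x(j := t)) y - kk rh I (x(j := t')) y) * ph y)"
  unfolding T_def using kf_int[OF b sp[of t]] kf_int[OF b sp[of t']]
  by (subst BI_integral_diff[symmetric]) (auto simp: algebra_simps)
 have "\<bar>T ph (x(j := t)) - T ph (x(j := t'))\<bar> <= (LINT y|GG I. \<bar>(kk rh I (x(j := t)) y - kk rh I (x(j := t')) y) * ph y\<bar>)" unfolding eq by (rule integral_abs_bound)
 also have "(LINT y|GG I. \<bar>(kk rh I (x(j := t)) y - kk rh I (x(j := t')) y) * ph y\<bar>) <=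
   (LINT y|GG I. C * \<bar>kk rh I (x(j := t)) y - kk rh I (x(j := t')) y\<bar>)"
 proof -
  define u where "u y = kk rh I (x(j := t)) y - kk rh I (x(j := t')) y" for y
  have iu: "integrable (GG I) u" unfolding u_def by (intro BI_integrable_diff k_int(1) sp)
  have "integrable (GG I) (%y. kk rh I (x(j := t)) y * ph y - kk rh I (x(j := t')) y * ph y)"
   by (intro BI_integrable_diff kf_int[OF b] sp)
  then have iu2: "integrable (GG I) (%y. u y * ph y)" unfolding u_def left_diff_distrib .
  have "(LINT y|GG I. \<bar>u y * ph y\<bar>) <= (LINT y|GG I. C * \<bar>u y\<bar>)"
  proof (rule integral_mono)
   show "integrable (GG I) (%y. \<bar>u y * ph y\<bar>)" using iu2 by (rule integrable_abs)
   show "integrable (GG I) (%y. C * \<bar>u y\<bar>)" by (intro integrable_mult_right integrable_abs iu)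
   fix y assume y: "y : space (GG I)"
   show "\<bar>u y * ph y\<bar> <= C * \<bar>u y\<bar>"
    unfolding abs_mult mult.commute[of _ "\<bar>ph y\<bar>"] by (rule mult_right_mono[OF C[OF y] abs_ge_zero])
  qed
  then show ?thesis unfolding u_def .
 qed
 also have "... = C * (LINT y|GG I. \<bar>kk rh I (x(j := t)) y - kk rh I (x(j := t')) y\<bar>)" by simp
 also have "... <= C * (Kr * \<bar>t - t'\<bar>)" using kk_L1[OF j x] C0 by (intro mult_left_mono)
 finally show ?thesis .
qed

text \<open>Cameron-Martin moves the shift onto the kernel, where \<open>k1_shift\<close> turns it
  into a shift of the starting point.\<close>

lemma T_sh:
 assumes j: "j : I" and x: "x : space (GG I)" and b: "bdd (GG I) ph"
 shows "T (%y. ph (sh j s y)) x = T ph (sh j (s / rh) x)"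
proof -
 note [measurable] = j
 have bm[measurable]: "ph : bm (GG I)" using b by (auto simp: bdd_def)
 define F where "F y = kk rh I x (y(j := y j + s)) * ph y" for y
 have "kk rh I x : bm (GG I)" by (rule k_section[OF x])
 moreover have "(%y. y(j := y j + s)) : GG I \<rightarrow>\<^sub>M GG I" by (rule meas_upd) (use j in auto)
 ultimately have Fm: "F : bm (GG I)" unfolding F_def[abs_def] by measurable
 have "T (%y. ph (sh j s y)) x = (LINT y|GG I. F (sh j s y))"
  unfolding T_def F_def by (simp add: sh_def)
 also have "... = (LINT y|GG I. exp (- s * y j - s\<^sup>2 / 2) * F y)" by (rule integral_sh[OF fin j Fm])
 also have "... = (LINT y|GG I. kk rh I (sh j (s / rh) x) y * ph y)"
 proof (rule BI_integral_cong[OF refl])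
  fix y
  have "exp (- s * y j - s\<^sup>2 / 2) * kk rh I x (y(j := y j + s)) = kk rh I (sh j (s / rh) x) y"
   unfolding kk_split[OF j] sh_def using k1_shift[OF rho, of "x j" "y j" s]
   by (simp add: kk_upd1 kk_upd2 mult_ac)
  then show "exp (- s * y j - s\<^sup>2 / 2) * F y = kk rh I (sh j (s / rh) x) y * ph y"
   unfolding F_def by (metis mult.assoc)
 qed
 finally show ?thesis unfolding T_def .
qed

section \<open>Independence of coordinates and indecomposability of Gaussian noise\<close>

definition mg :: "nat set => (nat => real) => (nat => real) => nat => real" where
 "mg J x z = (\<lambda>i\<in>I. if i : J then z i else x i)"

lemma mg_meas[measurable]: "(%p. mg J (fst p) (snd p)) : GG I \<Otimes>\<^sub>M GG I \<rightarrow>\<^sub>M GG I"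
 unfolding mg_def
proof (rule measurable_restrict)
 fix i assume i: "i : I"
 have "(%p. fst p i) : bm (GG I \<Otimes>\<^sub>M GG I)" "(%p. snd p i) : bm (GG I \<Otimes>\<^sub>M GG I)"
  using measurable_compose[OF measurable_fst meas_comp[OF i]] measurable_compose[OF measurable_snd meas_comp[OF i]] by auto
 then show "(%p. if i : J then snd p i else fst p i) : GG I \<Otimes>\<^sub>M GG I \<rightarrow>\<^sub>M N01"
  by (cases "i : J") (simp_all cong: measurable_cong_sets)
qed

text \<open>Essential independence of coordinate j, phrased through resampling so that it ignores
  null sets.\<close>

definition inv_in :: "(nat => real) set => nat => bool" where
 "inv_in V j \<longleftrightarrow> (AE x in GG I. AE t in N01. x(j := t) : V \<longleftrightarrow> x : V)"

text \<open>Coordinates are resampled one at a time; Fubini exchanges the a.e. quantifiers between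
  the new coordinate and those already treated.\<close>

lemma inv_in_mg:
 assumes V: "V : sets (GG I)" and J: "finite J" "J <= I" and inv: "!!j. j : J ==> inv_in V j"
 shows "AE x in GG I. AE z in GG I. mg J x z : V \<longleftrightarrow> x : V"
 using J inv
proof (induction J)
 case empty
 have "mg {} x z = x" if "x : space (GG I)" for x z
  using that unfolding mg_def by (auto simp: space_PiM PiE_iff extensional_def)
 then show ?case by (auto intro!: AE_I2)
next
 case (insert j J)
 note jI = insert.prems(1)
 have j: "j : I" using jI by auto
 have IH: "AE x in GG I. AE z in GG I. mg J x z : V \<longleftrightarrow> x : V" using insert by auto
 have ms: "{p : space (GG I \<Otimes>\<^sub>M GG I). mg K (fst p) (snd p) : V \<longleftrightarrow> fst p : V} : sets (GG I \<Otimes>\<^sub>M GG I)" for K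
  using V by measurable
 have mx: "{x : space (GG I). AE z in GG I. mg J x z : V \<longleftrightarrow> x : V} : sets (GG I)"
  using sets_AE[OF ms[of J]] by simp
 from IH have "AE x in GG I. AE t in N01. AE z in GG I. mg J (x(j := t)) z : V \<longleftrightarrow> x(j := t) : V"
  using AE_resample[OF fin j mx] by simp
 moreover have "AE x in GG I. AE t in N01. x(j := t) : V \<longleftrightarrow> x : V"
  using insert.prems(2)[of j] unfolding inv_in_def by simp
 ultimately show ?case using AE_space
 proof eventually_elim
  case (elim x)
  interpret pair_sigma_finite N01 "GG I"
   by (intro pair_sigma_finite.intro N01.sigma_finite_measure_axioms sigma_finite_measure_axioms)
  have eq: "mg J (x(j := t)) z = mg (insert j J) x (z(j := t))" for t z
   using insert.hyps unfolding mg_def by auto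
  have sec: "{z : space (GG I). mg K x z : V \<longleftrightarrow> x : V} : sets (GG I)" for K
  proof -
   have "{z : space (GG I). mg K x z : V \<longleftrightarrow> x : V} =
    Pair x -` {p : space (GG I \<Otimes>\<^sub>M GG I). mg K (fst p) (snd p) : V \<longleftrightarrow> fst p : V}"
    using elim(3) by (auto simp: space_pair_measure)
   then show ?thesis using sets_Pair1[OF ms[of K], of x] by simp
  qed
  have "AE t in N01. AE z in GG I. mg (insert j J) x (z(j := t)) : V \<longleftrightarrow> x : V"
   using elim(1,2) by eventually_elim (auto simp: eq elim!: eventually_mono)
  moreover have "{p : space (N01 \<Otimes>\<^sub>M GG I). mg (insert j J) x ((snd p)(j := fst p)) : V \<longleftrightarrow> x : V} : sets (N01 \<Otimes>\<^sub>M GG I)"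
  proof -
   have "(%p. (snd p)(j := fst p)) : N01 \<Otimes>\<^sub>M GG I \<rightarrow>\<^sub>M GG I" by (rule meas_upd) (use j in auto)
   from measurable_sets[OF this sec[of "insert j J"]] show ?thesis
    by (rule back_subst[where P="%A. A : _"]) (auto simp: space_pair_measure space_upd[OF j])
  qed
  ultimately have "AE z in GG I. AE t in N01. mg (insert j J) x (z(j := t)) : V \<longleftrightarrow> x : V"
   using AE_commute[of "%t z. mg (insert j J) x (z(j := t)) : V \<longleftrightarrow> x : V"] by (simp add: split_beta')
  then show ?case using AE_resample[OF fin j sec[of "insert j J"]] by simp
 qed
qed

text \<open>Resampling every coordinate replaces \<open>x\<close> by an independent
  \<open>z\<close>, so membership of almost every \<open>z\<close> agrees with that of one fixed
  \<open>x\<close>.\<close>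

lemma inv_all_const:
 assumes V: "V : sets (GG I)" and inv: "!!j. j : I ==> inv_in V j"
 shows "(AE x in GG I. x : V) \<or> (AE x in GG I. x ~: V)"
proof -
 have "AE x in GG I. AE z in GG I. mg I x z : V \<longleftrightarrow> x : V"
  by (rule inv_in_mg[OF V fin _ inv]) auto
 moreover have "mg I x z = z" if "z : space (GG I)" for x z
  using that unfolding mg_def by (auto simp: space_PiM PiE_iff extensional_def)
 ultimately have "AE x in GG I. AE z in GG I. z : V \<longleftrightarrow> x : V"
  by (auto elim!: eventually_mono simp: eventually_conj_iff cong: AE_cong_simp)
 then have "EX x. AE z in GG I. z : V \<longleftrightarrow> x : V"
  using eventually_happens[of _ "ae_filter (GG I)"] by (auto simp: ae_filter_eq_bot_iff emeasure_space_1)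
 then obtain x where "AE z in GG I. z : V \<longleftrightarrow> x : V" by blast
 then show ?thesis by (cases "x : V") auto
qed

text \<open>On almost every axis-parallel line the function is continuous and cannot jump across the
  gap. So the superlevel set is independent of each coordinate, hence null or of full
  measure.\<close>

lemma conn:
 fixes \<Delta> :: "(nat => real) => real"
 assumes m: "\<Delta> : bm (GG I)"
  and cont: "!!x j. x : space (GG I) ==> j : I ==> continuous_on UNIV (%t. \<Delta> (x(j := t)))"
  and e: "0 < ep" and ae: "AE x in GG I. \<Delta> x <= 0 \<or> ep <= \<Delta> x"
 shows "(AE x in GG I. \<Delta> x <= 0) \<or> (AE x in GG I. ep <= \<Delta> x)"
proof -
 note [measurable] = m
 define V where "V = {x\<in>space (GG I). ep <= \<Delta> x}"
 have V: "V : sets (GG I)" unfolding V_def using borel_measurable_iff_ge[of \<Delta>] m by blast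
 have "inv_in V j" if j: "j : I" for j
 proof -
  have "AE x in GG I. AE t in N01. \<Delta> (x(j := t)) <= 0 \<or> ep <= \<Delta> (x(j := t))"
   using ae AE_resample[OF fin j, of "%x. \<Delta> x <= 0 \<or> ep <= \<Delta> x"] by simp
  then have "AE x in GG I. ALL t. x(j := t) : V \<longleftrightarrow> x : V" using AE_space
  proof eventually_elim
   case (elim x)
   let ?D = "%t. \<Delta> (x(j := t))"
   have c: "continuous_on UNIV ?D" using cont[OF elim(2) j] .
   have all: "?D t <= 0 \<or> ep <= ?D t" for t
   proof (rule ccontr)
    assume nt: "\<not> ?thesis"
    define U where "U = ?D -` {0<..<ep}"
    have "open U" unfolding U_def using c by (intro open_vimage) auto
    moreover have "t : U" unfolding U_def using nt by auto
    moreover have "AE t in N01. t ~: U" using elim(1) by (auto elim!: eventually_mono simp: U_def)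
    ultimately show False by (rule open_AE_N01)
   qed
   have "ep <= ?D t \<longleftrightarrow> ep <= ?D t'" if "t <= t'" for t t'
   proof (rule ccontr)
    assume neq: "\<not> ?thesis"
    have "EX q. t <= q & q <= t' & ?D q = ep / 2"
    proof (cases "ep <= ?D t")
     case True
     then have "?D t' <= 0" using neq all[of t'] by auto
     then show ?thesis using True e that by (intro IVT2' continuous_on_subset[OF c]) auto
    next
     case False
     then have "?D t <= 0" "ep <= ?D t'" using neq all[of t] by auto
     then show ?thesis using e that by (intro IVT' continuous_on_subset[OF c]) auto
    qed
    then obtain q where "?D q = ep / 2" by blast
    then show False using all[of q] e by auto
   qed
   then have "ep <= ?D t \<longleftrightarrow> ep <= ?D t'" for t t' by (metis linear)
   from this[of _ "x j"] show ?case unfolding V_def using elim(2) space_upd[OF j elim(2)] by auto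
  qed
  then show ?thesis unfolding inv_in_def by (auto elim!: eventually_mono)
 qed
 then have "(AE x in GG I. x : V) \<or> (AE x in GG I. x ~: V)" by (rule inv_all_const[OF V])
 then show ?thesis
 proof
  assume "AE x in GG I. x : V"
  then have "AE x in GG I. ep <= \<Delta> x" unfolding V_def by (auto elim!: eventually_mono)
  then show ?thesis ..
 next
  assume "AE x in GG I. x ~: V"
  then have "AE x in GG I. \<Delta> x <= 0" using ae AE_space unfolding V_def by eventually_elim auto
  then show ?thesis ..
 qed
qed

lemma T_cont:
 assumes "x : space (GG I)" "j : I" "bdd (GG I) ph"
 shows "continuous_on UNIV (%t. T ph (x(j := t)))"
proof -
 obtain C where C: "0 < C" "!!y. y : space (GG I) ==> \<bar>ph y\<bar> <= C" using bdd_obtain[OF assms(3)] by blast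
 have "(C * Kr)-lipschitz_on UNIV (%t. T ph (x(j := t)))"
  using T_lip[OF assms(2,1,3) C(2)] C(1) Kr_pos
  by (intro lipschitz_onI) (auto simp: dist_real_def mult.assoc)
 then show ?thesis by (rule lipschitz_on_continuous_on)
qed

lemma cont_Min:
 assumes "finite S" "S ~= {}" "!!p. p : S ==> continuous_on U (F p)"
 shows "continuous_on U (%t. Min ((%p. F p t) ` S) :: real)"
 using assms
proof (induction S rule: finite_ne_induct)
 case (insert p S)
 have "continuous_on U (%t. min (F p t) (Min ((%p. F p t) ` S)))"
  using insert by (intro continuous_on_min) auto
 then show ?case using insert by simp
qed simp

text \<open>Compare the least potential outside \<open>S\<close> with the least one inside. On cells
  of \<open>S\<close> the difference \<open>\<Delta>\<close> is at least \<open>ep\<close>, on the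
  other cells at most 0. By connectedness one of the alternatives has measure 0, whereas every cell
  has positive volume.\<close>

lemma indec_GG:
 assumes f: "relaxed (GG I) m f" "!!i x. i < m ==> x : space (GG I) ==> f i x = 0 \<or> f i x = 1"
   "!!i. i < m ==> 0 < (LINT x|GG I. f i x)" and b: "!!i. i < m ==> bdd (GG I) (ph i)"
  and S: "S <= {..<m}" "S ~= {}" "S ~= {..<m}" and e: "0 < ep"
  and ae: "AE x in GG I. ALL p:S. ALL q:{..<m} - S. (f p x = 1 --> lam q - lam p + ep <= T (ph q) x - T (ph p) x) \<and>
    (f q x = 1 --> T (ph q) x - T (ph p) x <= lam q - lam p)"
 shows False
proof -
 define S' where "S' = {..<m} - S"
 have fin: "finite S" "finite S'" "S' ~= {}" "S' <= {..<m}" using S finite_subset unfolding S'_def by auto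
 define h where "h p x = T (ph p) x - lam p" for p x
 define \<Delta> where "\<Delta> x = Min ((%q. h q x) ` S') - Min ((%p. h p x) ` S)" for x
 have hm: "h p : bm (GG I)" if "p < m" for p
  unfolding h_def[abs_def] using T_bdd[OF b[OF that]] by (auto simp: bdd_def)
 have Minm: "(%x. Min ((%p. h p x) ` R)) : bm (GG I)" if "finite R" "R <= {..<m}" for R
  using that by (intro borel_measurable_Min hm) auto
 have m: "\<Delta> : bm (GG I)"
  unfolding \<Delta>_def[abs_def] using fin S(1) by (intro borel_measurable_diff Minm)
 have c: "continuous_on UNIV (%t. \<Delta> (x(j := t)))" if "x : space (GG I)" "j : I" for x j
  unfolding \<Delta>_def h_def using fin S that b
  by (intro continuous_on_diff cont_Min continuous_on_const T_cont) auto
 have lo: "ep <= \<Delta> x" if p: "p : S" and le: "!!q. q : S' ==> h p x + ep <= h q x" for p x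
 proof -
  have "h p x + ep <= Min ((%q. h q x) ` S')" using fin le by (simp add: Min_ge_iff)
  moreover have "Min ((%p. h p x) ` S) <= h p x" using fin p by (intro Min_le) auto
  ultimately show ?thesis unfolding \<Delta>_def by simp
 qed
 have hi: "\<Delta> x <= 0" if q: "q : S'" and le: "!!p. p : S ==> h q x <= h p x" for q x
 proof -
  have "h q x <= Min ((%p. h p x) ` S)" using fin S le by (simp add: Min_ge_iff)
  moreover have "Min ((%p. h p x) ` S') <= h q x" using fin q by (intro Min_le) auto
  ultimately show ?thesis unfolding \<Delta>_def by simp
 qed
 have AE1: "AE x in GG I. (ALL p:S. f p x = 1 --> ep <= \<Delta> x) & (ALL q:S'. f q x = 1 --> \<Delta> x <= 0)"
  using ae
 proof eventually_elim
  case (elim x)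
  have "h p x + ep <= h q x" if "p : S" "f p x = 1" "q : S'" for p q
   using bspec[OF bspec[OF elim that(1)], of q] that unfolding S'_def h_def by auto
  moreover have "h q x <= h p x" if "p : S" "f q x = 1" "q : S'" for p q
   using bspec[OF bspec[OF elim that(1)], of q] that unfolding S'_def h_def by auto
  ultimately show ?case using lo hi by blast
 qed
 have ex1: "EX i<m. f i x = 1" if x: "x : space (GG I)" for x
 proof (rule ccontr)
  assume "\<not> ?thesis"
  then have "f i x = 0" if "i < m" for i using f(2)[OF that x] that by auto
  then have "(\<Sum>i<m. f i x) = 0" by simp
  then show False using f(1) x unfolding relaxed_def by auto
 qed
 have "AE x in GG I. \<Delta> x <= 0 \<or> ep <= \<Delta> x"
  using AE1 AE_space
 proof eventually_elim
  case (elim x)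
  obtain i where "i < m" "f i x = 1" using ex1[OF elim(2)] by blast
  then show ?case using elim(1) unfolding S'_def by (cases "i : S") auto
 qed
 from conn[OF m c e this] have disj: "(AE x in GG I. \<Delta> x <= 0) \<or> (AE x in GG I. ep <= \<Delta> x)" .
 have zero: False if i: "i < m" and "AE x in GG I. f i x ~= 1" for i
 proof -
  have "AE x in GG I. f i x = 0" using that(2) AE_space by eventually_elim (use f(2)[OF i] in blast)
  then have "(LINT x|GG I. f i x) = 0" by (rule integral_eq_zero_AE)
  then show False using f(3)[OF i] by simp
 qed
 from disj show False
 proof
  assume a: "AE x in GG I. \<Delta> x <= 0"
  obtain p where p: "p : S" using S by blast
  have "AE x in GG I. f p x ~= 1" using a AE1 by eventually_elim (use e p in fastforce)
  then show False using zero p S by auto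
 next
  assume a: "AE x in GG I. ep <= \<Delta> x"
  obtain q where q: "q : S'" using fin by blast
  have "AE x in GG I. f q x ~= 1" using a AE1 by eventually_elim (use e q in fastforce)
  then show False using zero q fin by auto
 qed
qed

sublocale noise_indec "GG I" "kk rh I"
 by (intro noise_indec.intro noise_axioms atomless_prob_axioms noise_indec_axioms.intro indec_GG)

end

section \<open>Translating both partitions\<close>

locale gmin = gauss I rh + rmin "GG I" "kk rh I" m f g lam mu
 for I rh m f g lam mu
begin

lemma gswap: "gmin I rh m g f mu lam"
 by (intro gmin.intro gauss_axioms swap)

definition fs :: "(nat => (nat => real) => real) => nat => real => nat => (nat => real) => real" where
 "fs q j s i x = q i (sh j s x)"

text \<open>The potential of the cell containing the point, which the multiplier rule makes the
  least of all potentials a.e. Then \<open>ex i\<close> is the loss per unit mass when the point is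
  assigned to cell i.\<close>

definition ww :: "(nat => real) => real" where
 "ww x = (\<Sum>i<m. f i x * (T (g i) x - lam i))"

definition ex :: "nat => (nat => real) => real" where
 "ex i x = T (g i) x - lam i - ww x"

lemma bdd_sh: "j : I ==> bdd (GG I) ph ==> bdd (GG I) (%x. ph (sh j s x))"
proof -
 assume j: "j : I" and b: "bdd (GG I) ph"
 obtain C where "0 < C" "!!y. y : space (GG I) ==> \<bar>ph y\<bar> <= C" using bdd_obtain[OF b] by blast
 moreover have "(%x. ph (sh j s x)) : bm (GG I)"
  using measurable_compose[OF sh_meas[OF j] bdd_meas[OF b]] .
 ultimately show ?thesis using space_sh[OF j] by (intro bddI[where C=C]) auto
qed

lemma relaxed_fs: "j : I ==> relaxed (GG I) m q ==> relaxed (GG I) m (fs q j s)"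
proof -
 assume j: "j : I" and r: "relaxed (GG I) m q"
 show ?thesis
  unfolding relaxed_def
 proof (intro conjI allI impI ballI)
  fix i assume "i < m"
  then have "q i : bm (GG I)" using r unfolding relaxed_def by blast
  from measurable_compose[OF sh_meas[OF j] this] show "fs q j s i : bm (GG I)"
   unfolding fs_def[abs_def] .
  fix x assume "x : space (GG I)"
  then show "0 <= fs q j s i x"
   using r space_sh[OF j] \<open>i < m\<close> unfolding relaxed_def fs_def by blast
 next
  fix x assume "x : space (GG I)"
  then show "(\<Sum>i<m. fs q j s i x) = 1" using r space_sh[OF j] unfolding relaxed_def fs_def by blast
 qed
qed

lemma fb: "i < m ==> bdd (GG I) (f i)" and gb: "i < m ==> bdd (GG I) (g i)"
 using relaxed_bdd f_rel g_rel by auto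

lemma f1: "i < m ==> x : space (GG I) ==> \<bar>f i x\<bar> <= 1" and g1: "i < m ==> x : space (GG I) ==> \<bar>g i x\<bar> <= 1"
 using relaxed_le1[OF f_rel] relaxed_le1[OF g_rel] by fastforce+

lemma Tgb: "i < m ==> bdd (GG I) (T (g i))"
 using gb by blast

lemma ww_bdd: "bdd (GG I) ww"
 unfolding ww_def[abs_def] by (intro bdd_sum bdd_mult fb bdd_diff Tgb bdd_const) auto

lemma ex_bdd: "i < m ==> bdd (GG I) (ex i)"
 unfolding ex_def[abs_def] by (intro bdd_diff Tgb bdd_const ww_bdd)

lemma f_unique: "x : space (GG I) ==> EX! p. p < m & f p x = 1"
proof -
 assume x: "x : space (GG I)"
 have ex: "EX i<m. f i x = 1"
 proof (rule ccontr)
  assume "\<not> ?thesis"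
  then have "f i x = 0" if "i < m" for i using f_01[OF that x] that by auto
  then have "(\<Sum>i<m. f i x) = 0" by simp
  then show False using f_rel x unfolding relaxed_def by auto
 qed
 moreover have "p = q" if "p < m" "q < m" "f p x = 1" "f q x = 1" for p q
 proof (rule ccontr)
  assume pq: "p ~= q"
  have "(\<Sum>i\<in>{p, q}. f i x) <= (\<Sum>i<m. f i x)"
   using that relaxed_le1(2)[OF f_rel _ x] by (intro sum_mono2) auto
  then show False using that pq f_rel x unfolding relaxed_def by auto
 qed
 ultimately show ?thesis by blast
qed

lemma f_zero: "x : space (GG I) ==> p < m ==> f p x = 1 ==> q < m ==> q ~= p ==> f q x = 0"
 using f_unique[of x] f_01[of q x] by blast

lemma ww_val:
 assumes "x : space (GG I)" "p < m" "f p x = 1"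
 shows "ww x = T (g p) x - lam p"
proof -
 have "ww x = (\<Sum>i<m. if i = p then T (g p) x - lam p else 0)"
  unfolding ww_def using assms f_zero[OF assms(1,2,3)] by (intro sum.cong) auto
 then show ?thesis using assms by simp
qed

lemma ex_nonneg: "AE x in GG I. ALL i<m. 0 <= ex i x"
proof -
 have "AE x in GG I. ALL p:{..<m}. ALL q:{..<m}. f p x = 1 --> T (g p) x - lam p <= T (g q) x - lam q"
  using mult_f unfolding mult_prop_def by (intro AE_finite_allI) auto
 then show ?thesis using AE_space
 proof eventually_elim
  case (elim x)
  obtain p where "p < m" "f p x = 1" using f_unique[OF elim(2)] by blast
  then show ?case using elim ww_val[OF elim(2)] unfolding ex_def by auto
 qed
qed

lemma fs_vol_L: "relaxed (GG I) m q ==> L q g' = (LINT x|GG I. (\<Sum>i<m. q i x * (T (g' i) x - lam i))) - (\<Sum>i<m. mu i * (LINT x|GG I. g' i x))"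
 if "relaxed (GG I) m g'" for q g'
proof -
 assume q: "relaxed (GG I) m q"
 have b: "bdd (GG I) (q i)" "bdd (GG I) (g' i)" if "i < m" for i using relaxed_bdd that \<open>relaxed (GG I) m g'\<close> q by auto
 have "(LINT x|GG I. (\<Sum>i<m. q i x * (T (g' i) x - lam i))) = (\<Sum>i<m. (LINT x|GG I. q i x * (T (g' i) x - lam i)))"
  using b by (intro BI_integral_sum bdd_integrable bdd_mult bdd_diff T_bdd bdd_const) auto
 also have "... = (\<Sum>i<m. pr (q i) (g' i) - lam i * (LINT x|GG I. q i x))"
 proof (rule sum.cong[OF refl])
  fix i assume "i : {..<m}" then have i: "i < m" by simp
  have "(LINT x|GG I. q i x * (T (g' i) x - lam i)) = (LINT x|GG I. q i x * T (g' i) x - lam i * q i x)"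
   by (simp add: algebra_simps)
  also have "... = pr (q i) (g' i) - lam i * (LINT x|GG I. q i x)"
   unfolding pr_def using b[OF i] by (subst BI_integral_diff) (auto intro!: bdd_integrable)
  finally show "(LINT x|GG I. q i x * (T (g' i) x - lam i)) = pr (q i) (g' i) - lam i * (LINT x|GG I. q i x)" .
 qed
 finally show ?thesis unfolding L_def B_def by (simp add: sum_subtractf)
qed

text \<open>Against \<open>g\<close> shifted by \<open>s\<close>, the first partition sees its old
  cost shifted by \<open>s / rh\<close>, by \<open>T_sh\<close>. The pointwise minimizer of that
  cost is \<open>f\<close> shifted by \<open>s / rh\<close>; any other \<open>q\<close> pays the
  shifted excess.\<close>

lemma L_gap:
 assumes j: "j : I" and q: "relaxed (GG I) m q"
 shows "L q (fs g j s) = L (fs f j (s / rh)) (fs g j s) + (LINT x|GG I. (\<Sum>i<m. q i x * ex i (sh j (s / rh) x)))"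
proof -
 have rg: "relaxed (GG I) m (fs g j s)" by (rule relaxed_fs[OF j g_rel])
 have rf: "relaxed (GG I) m (fs f j (s / rh))" by (rule relaxed_fs[OF j f_rel])
 have Ts: "T (fs g j s i) x = T (g i) (sh j (s / rh) x)" if "i < m" "x : space (GG I)" for i x
  unfolding fs_def[abs_def] using T_sh[OF j that(2) gb[OF that(1)]] .
 have qb: "bdd (GG I) (q i)" if "i < m" for i using relaxed_bdd[OF q that] .
 have "(LINT x|GG I. (\<Sum>i<m. q i x * (T (fs g j s i) x - lam i))) =
  (LINT x|GG I. ww (sh j (s / rh) x) + (\<Sum>i<m. q i x * ex i (sh j (s / rh) x)))"
 proof (rule BI_integral_cong[OF refl])
  fix x assume x: "x : space (GG I)"
  have "(\<Sum>i<m. q i x * (T (fs g j s i) x - lam i)) = (\<Sum>i<m. q i x * ww (sh j (s / rh) x) + q i x * ex i (sh j (s / rh) x))"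
   using Ts x unfolding ex_def by (intro sum.cong) (auto simp: algebra_simps)
  also have "... = ww (sh j (s / rh) x) + (\<Sum>i<m. q i x * ex i (sh j (s / rh) x))"
   using q x by (simp add: sum.distrib relaxed_def flip: sum_distrib_right)
  finally show "(\<Sum>i<m. q i x * (T (fs g j s i) x - lam i)) = ww (sh j (s / rh) x) + (\<Sum>i<m. q i x * ex i (sh j (s / rh) x))" .
 qed
 also have "... = (LINT x|GG I. ww (sh j (s / rh) x)) + (LINT x|GG I. (\<Sum>i<m. q i x * ex i (sh j (s / rh) x)))"
  using qb by (intro BI_integral_add bdd_integrable bdd_sum bdd_mult bdd_sh[OF j] ww_bdd ex_bdd) auto
 also have "(LINT x|GG I. ww (sh j (s / rh) x)) = (LINT x|GG I. (\<Sum>i<m. fs f j (s / rh) i x * (T (fs g j s i) x - lam i)))"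
  using Ts by (intro BI_integral_cong refl) (auto simp: ww_def fs_def intro!: sum.cong)
 finally show ?thesis unfolding fs_vol_L[OF rg q] fs_vol_L[OF rg rf] by simp
qed

lemma gap_nonneg:
 assumes j: "j : I" and q: "relaxed (GG I) m q"
 shows "0 <= (LINT x|GG I. (\<Sum>i<m. q i x * ex i (sh j s x)))"
proof (rule integral_nonneg_AE)
 show "AE x in GG I. 0 <= (\<Sum>i<m. q i x * ex i (sh j s x))"
  using AE_sh[OF fin j ex_nonneg, of s] AE_space
  by eventually_elim (use relaxed_le1(2)[OF q] in \<open>auto intro!: sum_nonneg mult_nonneg_nonneg\<close>)
qed

lemma sh_zero[simp]: "sh j 0 x = x"
 unfolding sh_def by simp

lemma fs_zero[simp]: "fs q j 0 = q"
 unfolding fs_def[abs_def] by simp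

lemma L_excess:
 assumes q: "relaxed (GG I) m q"
 shows "L q g = L f g + (LINT x|GG I. (\<Sum>i<m. q i x * ex i x))"
proof -
 obtain j where "j : I" using ne by blast
 from L_gap[OF this q, of 0] show ?thesis by simp
qed

text \<open>A shift of a merely measurable function becomes, behind \<open>T\<close>, a move of the
  starting point of the kernel, in which \<open>T ph\<close> is Lipschitz.\<close>

lemma T_sh_L1:
 assumes j: "j : I" and b: "bdd (GG I) ph" and 1: "!!x. x : space (GG I) ==> \<bar>ph x\<bar> <= 1"
 shows "(LINT x|GG I. \<bar>T (%y. ph (sh j s y) - ph y) x\<bar>) <= Kr / rh * \<bar>s\<bar>"
proof -
 have b': "bdd (GG I) (%y. ph (sh j s y) - ph y)" using bdd_sh[OF j b] b by auto
 have "(LINT x|GG I. \<bar>T (%y. ph (sh j s y) - ph y) x\<bar>) <= (LINT x|GG I. Kr / rh * \<bar>s\<bar>)"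
 proof (rule integral_mono)
  show "integrable (GG I) (%x. \<bar>T (%y. ph (sh j s y) - ph y) x\<bar>)" using b' by (intro bdd_integrable bdd_abs T_bdd)
  fix x assume x: "x : space (GG I)"
  have eq: "T (%y. ph (sh j s y) - ph y) x = T ph (x(j := x j - s / rh)) - T ph (x(j := x j))"
   using T_diff[OF bdd_sh[OF j b] b x] T_sh[OF j x b] by (simp add: sh_def)
  have "\<bar>T (%y. ph (sh j s y) - ph y) x\<bar> <= 1 * (Kr * \<bar>x j - s / rh - x j\<bar>)"
   unfolding eq by (rule T_lip[OF j x b 1])
  then show "\<bar>T (%y. ph (sh j s y) - ph y) x\<bar> <= Kr / rh * \<bar>s\<bar>" using rho by simp
 qed simp
 then show ?thesis by (simp add: prob_space)
qed

lemma integral_T: "bdd (GG I) ph ==> (LINT x|GG I. T ph x) = (LINT x|GG I. ph x)"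
proof -
 assume b: "bdd (GG I) ph"
 have "(LINT x|GG I. T ph x) = pr (%_. 1) ph" unfolding pr_def by simp
 also have "... = pr ph (%_. 1)" by (rule pr_sym) (use b in auto)
 also have "... = (LINT x|GG I. ph x)" unfolding pr_def
  by (intro BI_integral_cong) (auto simp: T_const)
 finally show ?thesis .
qed

lemma L_cont:
 assumes j: "j : I"
 shows "EX C>=0. ALL \<sigma> s. L (fs f j \<sigma>) (fs g j s) >= L f g - C * (\<bar>\<sigma>\<bar> + \<bar>s\<bar>) & L (fs f j \<sigma>) (fs g j s) <= L f g + C * (\<bar>\<sigma>\<bar> + \<bar>s\<bar>)"
proof -
 define K where "K = Kr / rh"
 have K: "0 <= K" unfolding K_def using Kr_pos rho by simp
 define C where "C = m * K + (\<Sum>i<m. \<bar>lam i\<bar>) * K + (\<Sum>i<m. \<bar>mu i\<bar>) * K"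
 have s0: "0 <= (\<Sum>i<m. \<bar>lam i\<bar>)" "0 <= (\<Sum>i<m. \<bar>mu i\<bar>)" by (auto intro: sum_nonneg)
 have C0: "0 <= C" unfolding C_def using K s0 by auto
 have main: "\<bar>L (fs f j \<sigma>) (fs g j s) - L f g\<bar> <= C * (\<bar>\<sigma>\<bar> + \<bar>s\<bar>)" for \<sigma> s
 proof -
  have bs: "bdd (GG I) (fs f j \<sigma> i)" "bdd (GG I) (fs g j s i)" if "i < m" for i
   using relaxed_bdd[OF relaxed_fs[OF j f_rel] that] relaxed_bdd[OF relaxed_fs[OF j g_rel] that] by auto
  have l1: "\<bar>fs f j \<sigma> i x\<bar> <= 1" if "i < m" "x : space (GG I)" for i x
   unfolding fs_def using f1[OF that(1) space_sh[OF j that(2)]] .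
  have Lf: "(LINT x|GG I. \<bar>T (%y. fs f j \<sigma> i y - f i y) x\<bar>) <= K * \<bar>\<sigma>\<bar>" if "i < m" for i
   unfolding fs_def K_def using T_sh_L1[OF j fb[OF that] f1[OF that]] .
  have Lg: "(LINT x|GG I. \<bar>T (%y. fs g j s i y - g i y) x\<bar>) <= K * \<bar>s\<bar>" if "i < m" for i
   unfolding fs_def K_def using T_sh_L1[OF j gb[OF that] g1[OF that]] .
  have vol: "\<bar>(LINT x|GG I. ph' x) - (LINT x|GG I. ph x)\<bar> <= (LINT x|GG I. \<bar>T (%y. ph' y - ph y) x\<bar>)"
   if "bdd (GG I) ph" "bdd (GG I) ph'" for ph ph'
  proof -
   have "(LINT x|GG I. ph' x) - (LINT x|GG I. ph x) = (LINT x|GG I. ph' x - ph x)"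
    using that by (simp add: bdd_integrable)
   also have "... = (LINT x|GG I. T (%y. ph' y - ph y) x)" using that by (intro integral_T[symmetric]) auto
   finally have eq: "(LINT x|GG I. ph' x) - (LINT x|GG I. ph x) = (LINT x|GG I. T (%y. ph' y - ph y) x)" .
   show ?thesis unfolding eq by (rule integral_abs_bound)
  qed
  have pri: "\<bar>pr (fs f j \<sigma> i) (fs g j s i) - pr (f i) (g i)\<bar> <= K * (\<bar>\<sigma>\<bar> + \<bar>s\<bar>)" if i: "i < m" for i
  proof -
   have "pr (fs f j \<sigma> i) (fs g j s i) - pr (f i) (g i) =
    pr (fs f j \<sigma> i) (%x. fs g j s i x - g i x) + pr (g i) (%x. fs f j \<sigma> i x - f i x)"
    using bs[OF i] fb[OF i] gb[OF i] pr_sym[of "g i" "fs f j \<sigma> i"] pr_sym[of "g i" "f i"]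
    by (simp add: pr_diff_right)
   moreover have "\<bar>pr (fs f j \<sigma> i) (%x. fs g j s i x - g i x)\<bar> <= 1 * (K * \<bar>s\<bar>)"
    by (rule order_trans[OF pr_bound[where C=1]]) (use bs[OF i] gb[OF i] l1[OF i] Lg[OF i] in auto)
   moreover have "\<bar>pr (g i) (%x. fs f j \<sigma> i x - f i x)\<bar> <= 1 * (K * \<bar>\<sigma>\<bar>)"
    by (rule order_trans[OF pr_bound[where C=1]]) (use bs[OF i] fb[OF i] gb[OF i] g1[OF i] Lf[OF i] in auto)
   ultimately show ?thesis by (simp add: distrib_left)
  qed
  have sumabs: "\<bar>\<Sum>i<m. c i * d i\<bar> <= (\<Sum>i<m. \<bar>c i\<bar>) * D" if "!!i. i < m ==> \<bar>d i\<bar> <= D" for c d :: "nat => real" and D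
  proof -
   have "\<bar>\<Sum>i<m. c i * d i\<bar> <= (\<Sum>i<m. \<bar>c i * d i\<bar>)" by (rule sum_abs)
   also have "... <= (\<Sum>i<m. \<bar>c i\<bar> * D)" using that by (intro sum_mono) (auto simp: abs_mult intro!: mult_left_mono)
   finally show ?thesis by (simp add: sum_distrib_right)
  qed
  have d1: "\<bar>\<Sum>i<m. 1 * (pr (fs f j \<sigma> i) (fs g j s i) - pr (f i) (g i))\<bar> <= (\<Sum>i<m. \<bar>1\<bar>) * (K * (\<bar>\<sigma>\<bar> + \<bar>s\<bar>))"
   using pri by (intro sumabs) auto
  have d2: "\<bar>\<Sum>i<m. lam i * ((LINT x|GG I. fs f j \<sigma> i x) - (LINT x|GG I. f i x))\<bar> <= (\<Sum>i<m. \<bar>lam i\<bar>) * (K * \<bar>\<sigma>\<bar>)"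
   using order_trans[OF vol[OF fb bs(1)] Lf] by (intro sumabs) auto
  have d3: "\<bar>\<Sum>i<m. mu i * ((LINT x|GG I. fs g j s i x) - (LINT x|GG I. g i x))\<bar> <= (\<Sum>i<m. \<bar>mu i\<bar>) * (K * \<bar>s\<bar>)"
   using order_trans[OF vol[OF gb bs(2)] Lg] by (intro sumabs) auto
  have m2: "(\<Sum>i<m. \<bar>lam i\<bar>) * (K * \<bar>\<sigma>\<bar>) <= (\<Sum>i<m. \<bar>lam i\<bar>) * (K * (\<bar>\<sigma>\<bar> + \<bar>s\<bar>))"
   "(\<Sum>i<m. \<bar>mu i\<bar>) * (K * \<bar>s\<bar>) <= (\<Sum>i<m. \<bar>mu i\<bar>) * (K * (\<bar>\<sigma>\<bar> + \<bar>s\<bar>))"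
   using s0 K by (auto intro!: mult_left_mono)
  have "L (fs f j \<sigma>) (fs g j s) - L f g = (\<Sum>i<m. 1 * (pr (fs f j \<sigma> i) (fs g j s i) - pr (f i) (g i)))
   - (\<Sum>i<m. lam i * ((LINT x|GG I. fs f j \<sigma> i x) - (LINT x|GG I. f i x)))
   - (\<Sum>i<m. mu i * ((LINT x|GG I. fs g j s i x) - (LINT x|GG I. g i x)))"
   unfolding L_def B_def by (simp add: sum_subtractf right_diff_distrib)
  then have "\<bar>L (fs f j \<sigma>) (fs g j s) - L f g\<bar> <= (\<Sum>i<m. \<bar>1\<bar>) * (K * (\<bar>\<sigma>\<bar> + \<bar>s\<bar>)) + (\<Sum>i<m. \<bar>lam i\<bar>) * (K * (\<bar>\<sigma>\<bar> + \<bar>s\<bar>))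
   + (\<Sum>i<m. \<bar>mu i\<bar>) * (K * (\<bar>\<sigma>\<bar> + \<bar>s\<bar>))" using d1 d2 d3 m2 by linarith
  also have "... = C * (\<bar>\<sigma>\<bar> + \<bar>s\<bar>)" unfolding C_def by (simp add: algebra_simps)
  finally show ?thesis .
 qed
 show ?thesis
 proof (intro exI[of _ C] conjI allI C0)
  fix \<sigma> s
  show "L (fs f j \<sigma>) (fs g j s) >= L f g - C * (\<bar>\<sigma>\<bar> + \<bar>s\<bar>)"
   "L (fs f j \<sigma>) (fs g j s) <= L f g + C * (\<bar>\<sigma>\<bar> + \<bar>s\<bar>)"
   using main[of \<sigma> s] by linarith+
 qed
qed

text \<open>What \<open>f\<close> shifted by \<open>rh * s\<close> loses against a cost shifted by
  \<open>s / rh\<close>.\<close>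

definition gap :: "nat => real => real" where
 "gap j s = (LINT x|GG I. (\<Sum>i<m. f i (sh j (rh * s) x) * ex i (sh j (s / rh) x)))"

lemma L_swap: "relaxed (GG I) m f' ==> relaxed (GG I) m g' ==> rmin.L (GG I) (kk rh I) m mu lam g' f' = L f' g'"
 unfolding L_def rmin.L_def[OF swap] using B_sym by simp

text \<open>Consider the pair of \<open>f\<close> shifted by \<open>s / rh\<close> and
  \<open>g\<close> shifted by \<open>s\<close>. Changing the first shift to \<open>rh * s\<close>
  raises the Lagrangian by exactly \<open>gap j s\<close>. Now \<open>g\<close> shifted by
  \<open>s\<close> is optimal for that \<open>f\<close>, so changing its shift to
  \<open>rh\<^sup>2 * s\<close> can only raise the Lagrangian again, and this is the pair with
  parameter \<open>rh\<^sup>2 * s\<close>.\<close>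

lemma psi_step:
 assumes j: "j : I"
 shows "L (fs f j (s / rh)) (fs g j s) <= L (fs f j ((rh\<^sup>2 * s) / rh)) (fs g j (rh\<^sup>2 * s)) - gap j s"
  and "0 <= gap j s"
proof -
 interpret S: gmin I rh m g f mu lam by (rule gswap)
 have r: "relaxed (GG I) m (fs q j s)" if "relaxed (GG I) m q" for q s using relaxed_fs[OF j that] .
 have gp: "gap j s = (LINT x|GG I. (\<Sum>i<m. fs f j (rh * s) i x * ex i (sh j (s / rh) x)))" unfolding gap_def fs_def ..
 show "0 <= gap j s" unfolding gp by (rule gap_nonneg[OF j r[OF f_rel]])
 have first: "L (fs f j (s / rh)) (fs g j s) = L (fs f j (rh * s)) (fs g j s) - gap j s"
  using L_gap[OF j r[OF f_rel], of "rh * s" s] unfolding gp by simp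
 have "L (fs f j (rh * s)) (fs g j s) = S.L (fs g j ((rh * s) / rh)) (fs f j (rh * s))"
 proof -
  have "rh * s / rh = s" using rho by simp
  then show ?thesis using L_swap[OF r[OF f_rel, of "rh * s"] r[OF g_rel, of s]] by (simp only:)
 qed
 also have "... <= S.L (fs g j (rh\<^sup>2 * s)) (fs f j (rh * s))"
  using S.L_gap[OF j r[OF g_rel], of "rh\<^sup>2 * s" "rh * s"] S.gap_nonneg[OF j r[OF g_rel]]
  unfolding S.fs_def fs_def by simp
 also have "... = L (fs f j ((rh\<^sup>2 * s) / rh)) (fs g j (rh\<^sup>2 * s))"
 proof -
  have "rh\<^sup>2 * s / rh = rh * s" using rho by (simp add: power2_eq_square)
  then show ?thesis using L_swap[OF r[OF f_rel, of "rh * s"] r[OF g_rel, of "rh\<^sup>2 * s"]] by (simp only:)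
 qed
 finally show "L (fs f j (s / rh)) (fs g j s) <= L (fs f j ((rh\<^sup>2 * s) / rh)) (fs g j (rh\<^sup>2 * s)) - gap j s"
  unfolding first by (rule diff_right_mono)
qed

text \<open>Iterating shrinks the parameter by \<open>rh\<^sup>2\<close> each time, and the
  Lagrangian is continuous at parameter 0; so translated pairs never exceed the minimizer, and one
  gap can be kept.\<close>

lemma psi_le:
 assumes j: "j : I"
 shows "L (fs f j (s / rh)) (fs g j s) <= L f g - gap j s"
proof -
 define ps where "ps s = L (fs f j (s / rh)) (fs g j s)" for s
 have step: "ps s <= ps (rh\<^sup>2 * s)" for s using psi_step[OF j, of s] unfolding ps_def by linarith
 have chain: "ps s <= ps ((rh\<^sup>2) ^ n * s)" for s n
 proof (induction n)
  case (Suc n)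
  then show ?case using step[of "(rh\<^sup>2) ^ n * s"] by (simp add: mult.assoc)
 qed simp
 obtain C where C: "0 <= C" "!!\<sigma> s. L (fs f j \<sigma>) (fs g j s) <= L f g + C * (\<bar>\<sigma>\<bar> + \<bar>s\<bar>)" using L_cont[OF j] by blast
 have le: "ps s <= L f g" for s
 proof (rule LIMSEQ_le_const)
  define r where "r n = (rh\<^sup>2) ^ n" for n
  have lim: "r \<longlonglongrightarrow> 0" unfolding r_def using rho rho2 by (intro LIMSEQ_realpow_zero) auto
  have "(%n. L f g + C * (\<bar>(r n * s) / rh\<bar> + \<bar>r n * s\<bar>)) \<longlonglongrightarrow> L f g + C * (\<bar>(0 * s) / rh\<bar> + \<bar>0 * s\<bar>)"
   using rho by (intro tendsto_intros lim) simp
  then show "(%n. L f g + C * (\<bar>(r n * s) / rh\<bar> + \<bar>r n * s\<bar>)) \<longlonglongrightarrow> L f g" by simp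
  show "EX N. ALL n>=N. ps s <= L f g + C * (\<bar>(r n * s) / rh\<bar> + \<bar>r n * s\<bar>)"
  proof (intro exI allI impI)
   fix n
   show "ps s <= L f g + C * (\<bar>(r n * s) / rh\<bar> + \<bar>r n * s\<bar>)"
    using chain[of s n] C(2)[of "(r n * s) / rh" "r n * s"] unfolding ps_def r_def by linarith
  qed
 qed
 show ?thesis using psi_step(1)[OF j, of s] le[of "rh\<^sup>2 * s"] unfolding ps_def by linarith
qed

lemma exp_shift_int:
 assumes j: "j : I"
 shows "integrable (GG I) (%x. exp (- s * x j - s\<^sup>2 / 2))" "(LINT x|GG I. exp (- s * x j - s\<^sup>2 / 2)) = 1"
proof -
 note [measurable] = j
 have "emeasure (density (GG I) (%x. ennreal (exp (- s * x j - s\<^sup>2 / 2)))) (space (GG I)) = 1"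
  unfolding distr_sh[OF fin j, symmetric]
  using prob_space.emeasure_space_1[OF prob_space_distr[OF sh_meas[OF j]]] by simp
 then have nn: "(\<integral>\<^sup>+x. ennreal (exp (- s * x j - s\<^sup>2 / 2)) \<partial>GG I) = 1"
  by (subst (asm) emeasure_density) (auto cong: nn_integral_cong)
 show "integrable (GG I) (%x. exp (- s * x j - s\<^sup>2 / 2))" using nn by (intro integrableI_nonneg) auto
 show "(LINT x|GG I. exp (- s * x j - s\<^sup>2 / 2)) = 1" using nn by (subst integral_eq_nn_integral) auto
qed

lemma moment_int:
 assumes j: "j : I"
 shows "integrable (GG I) (%x. x j)" "integrable (GG I) (%x. (x j)\<^sup>2)"
  "(LINT x|GG I. x j) = 0" "(LINT x|GG I. (x j)\<^sup>2) = 1"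
proof -
 have d: "distr (GG I) N01 (%x. x j) = N01"
  using distr_PiM_component[of I "%_. N01" j] j prob_space_N01 by simp
 have mj: "(%x. x j) : GG I \<rightarrow>\<^sub>M N01" using measurable_component_singleton[OF j, of "%_. N01"] .
 have mt: "(%t::real. t ^ n) : bm N01" for n
  by (simp add: measurable_cong_sets[OF sets_N01 refl] borel_measurable_continuous_onI continuous_intros)
 have ii: "integrable N01 (%t. t ^ n)" for n
  unfolding N01_def using integrable_std_normal_moment[of n] by (subst integrable_density) auto
 have vv: "(LINT t|N01. t ^ n) = (LINT t|lborel. std_normal_density t * t ^ n)" for n
  unfolding N01_def by (subst integral_density) auto
 have v1: "(LINT t|N01. t ^ 1) = 0"
  unfolding vv using integral_std_normal_moment_odd[of 0] by simp
 have v2: "(LINT t|N01. t ^ 2) = 1"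
  unfolding vv using integral_std_normal_moment_even[of 1] by (simp add: fact_numeral)
 have "integrable (distr (GG I) N01 (%x. x j)) (%t. t ^ n)" for n using ii d by simp
 then have i: "integrable (GG I) (%x. (x j) ^ n)" for n
  by (simp add: integrable_distr_eq[OF mj mt])
 have v: "(LINT x|GG I. (x j) ^ n) = (LINT t|N01. t ^ n)" for n
  using integral_distr[OF mj mt] d by simp
 show "integrable (GG I) (%x. x j)" "integrable (GG I) (%x. (x j)\<^sup>2)"
  "(LINT x|GG I. x j) = 0" "(LINT x|GG I. (x j)\<^sup>2) = 1"
  using i[of 1] i[of 2] v[of 1] v[of 2] v1 v2 by simp_all
qed

text \<open>Shifting multiplies the density by \<open>e\<close>. The term of \<open>e\<close> linear
  in \<open>s\<close> is killed by the vanishing first moment, which is where the choice of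
  coordinates enters. The remainder \<open>u\<close> satisfies that the integral of
  \<open>u\<^sup>2\<close> is \<open>exp (s\<^sup>2) - 1 - s\<^sup>2\<close>, of order s^4, so its
  L1 norm is of order s^2.\<close>

lemma vol_second_order:
 assumes j: "j : I" and b: "bdd (GG I) ph" and 1: "!!x. x : space (GG I) ==> \<bar>ph x\<bar> <= 1"
  and mom: "(LINT x|GG I. ph x * x j) = 0" and s: "\<bar>s\<bar> <= 1"
 shows "\<bar>(LINT x|GG I. ph (sh j s x)) - (LINT x|GG I. ph x)\<bar> <= s\<^sup>2"
proof (cases "s = 0")
 case False
 note [measurable] = j
 have bm[measurable]: "ph : bm (GG I)" using b by (auto simp: bdd_def)
 define e where "e x = exp (- s * x j - s\<^sup>2 / 2)" for x :: "nat => real"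
 have em[measurable]: "e : bm (GG I)" unfolding e_def[abs_def] by measurable
 define u where "u x = e x - 1 + s * x j" for x
 have ei: "integrable (GG I) e" "(LINT x|GG I. e x) = 1" unfolding e_def using exp_shift_int[OF j] by auto
 have e2: "(e x)\<^sup>2 = exp (s\<^sup>2) * exp (- (2 * s) * x j - (2 * s)\<^sup>2 / 2)" for x
  unfolding e_def by (simp add: power2_eq_square flip: exp_add)
 have e2i: "integrable (GG I) (%x. (e x)\<^sup>2)" "(LINT x|GG I. (e x)\<^sup>2) = exp (s\<^sup>2)"
  unfolding e2 using exp_shift_int[OF j, of "2 * s"] by auto
 have exi: "integrable (GG I) (%x. e x * x j)"
 proof (rule BI_integrable_bound)
  show "integrable (GG I) (%x. (e x)\<^sup>2 + (x j)\<^sup>2)" using e2i moment_int[OF j] by simp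
  show "AE x in GG I. norm (e x * x j) <= norm ((e x)\<^sup>2 + (x j)\<^sup>2)"
  proof (rule AE_I2)
   fix x
   have "0 <= (\<bar>e x\<bar> - \<bar>x j\<bar>)\<^sup>2" by simp
   then have "2 * (\<bar>e x\<bar> * \<bar>x j\<bar>) <= (e x)\<^sup>2 + (x j)\<^sup>2" by (simp add: power2_diff)
   moreover have "0 <= \<bar>e x\<bar> * \<bar>x j\<bar>" by simp
   ultimately have "\<bar>e x\<bar> * \<bar>x j\<bar> <= (e x)\<^sup>2 + (x j)\<^sup>2" by linarith
   then show "norm (e x * x j) <= norm ((e x)\<^sup>2 + (x j)\<^sup>2)" by (simp add: abs_mult)
  qed
 qed measurable
 have exv: "(LINT x|GG I. e x * x j) = - s"
 proof -
  have "(LINT x|GG I. (sh j s x) j) = (LINT x|GG I. e x * x j)"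
   unfolding e_def using integral_sh[OF fin j, of "%x. x j" s] by simp
  moreover have "(LINT x|GG I. (sh j s x) j) = - s"
   using moment_int[OF j] unfolding sh_def by (simp add: prob_space)
  ultimately show ?thesis by simp
 qed
 have u2: "(u x)\<^sup>2 = (e x)\<^sup>2 + 1 + s\<^sup>2 * (x j)\<^sup>2 - 2 * e x + 2 * s * (e x * x j) - 2 * s * x j" for x
  unfolding u_def by (simp add: power2_eq_square algebra_simps)
 have u2i: "integrable (GG I) (%x. (u x)\<^sup>2)" unfolding u2 using e2i ei exi moment_int[OF j] by simp
 have u2v: "(LINT x|GG I. (u x)\<^sup>2) = exp (s\<^sup>2) - 1 - s\<^sup>2"
  unfolding u2 using e2i ei exi exv moment_int[OF j] by (simp add: prob_space power2_eq_square)
 have s2: "0 < s\<^sup>2" "s\<^sup>2 <= 1" using False s by (auto simp: abs_square_le_1)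
 have ui: "integrable (GG I) u" unfolding u_def[abs_def] using ei moment_int[OF j] by simp
 have uv: "(LINT x|GG I. \<bar>u x\<bar>) <= s\<^sup>2"
 proof -
  have "(LINT x|GG I. \<bar>u x\<bar>) <= (LINT x|GG I. ((u x)\<^sup>2 / s\<^sup>2 + s\<^sup>2) / 2)"
  proof (rule integral_mono)
   show "integrable (GG I) (%x. \<bar>u x\<bar>)" using ui by simp
   show "integrable (GG I) (%x. ((u x)\<^sup>2 / s\<^sup>2 + s\<^sup>2) / 2)" using u2i by simp
   fix x
   have "0 <= (\<bar>u x\<bar> - s\<^sup>2)\<^sup>2" by simp
   then have "\<bar>u x\<bar> * (2 * s\<^sup>2) <= (u x)\<^sup>2 + s\<^sup>2 * s\<^sup>2" by (simp add: power2_eq_square algebra_simps)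
   then show "\<bar>u x\<bar> <= ((u x)\<^sup>2 / s\<^sup>2 + s\<^sup>2) / 2" using s2(1) by (simp add: field_simps)
  qed
  also have "... = ((exp (s\<^sup>2) - 1 - s\<^sup>2) / s\<^sup>2 + s\<^sup>2) / 2" using u2i u2v by (simp add: prob_space)
  also have "... <= ((s\<^sup>2 * s\<^sup>2) / s\<^sup>2 + s\<^sup>2) / 2"
  proof -
   have "exp (s\<^sup>2) - 1 - s\<^sup>2 <= s\<^sup>2 * s\<^sup>2" using exp_bound[of "s\<^sup>2"] s2 by (simp add: power2_eq_square[of "s\<^sup>2"])
   then show ?thesis using s2(1) by (intro divide_right_mono add_right_mono) auto
  qed
  also have "... = s\<^sup>2"
  proof -
   have q: "s\<^sup>2 * s\<^sup>2 / s\<^sup>2 = s\<^sup>2" using s2(1) by (intro nonzero_mult_div_cancel_right) simp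
   show ?thesis unfolding q by simp
  qed
  finally show ?thesis .
 qed
 have phi: "integrable (GG I) (%x. ph x * v x)" if "integrable (GG I) v" for v
 proof (rule BI_integrable_bound[OF that])
  show "(%x. ph x * v x) : bm (GG I)" using that by measurable
  show "AE x in GG I. norm (ph x * v x) <= norm (v x)"
   using 1 by (intro AE_I2) (auto simp: abs_mult intro!: mult_left_le_one_le)
 qed
 have eq: "(LINT x|GG I. ph (sh j s x)) - (LINT x|GG I. ph x) = (LINT x|GG I. ph x * u x)"
 proof -
  have "(LINT x|GG I. ph x * u x) = (LINT x|GG I. ph x * e x - ph x + s * (ph x * x j))"
   unfolding u_def by (simp add: algebra_simps)
  also have "... = (LINT x|GG I. ph x * e x) - (LINT x|GG I. ph x) + s * (LINT x|GG I. ph x * x j)"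
   using phi[OF ei(1)] phi[OF moment_int(1)[OF j]] bdd_integrable[OF b] by simp
  also have "(LINT x|GG I. ph x * e x) = (LINT x|GG I. ph (sh j s x))"
   unfolding e_def using integral_sh[OF fin j bm, of s] by (simp add: mult.commute)
  finally show ?thesis using mom by simp
 qed
 have "\<bar>(LINT x|GG I. ph x * u x)\<bar> <= (LINT x|GG I. \<bar>ph x * u x\<bar>)" by (rule integral_abs_bound)
 also have "... <= (LINT x|GG I. \<bar>u x\<bar>)"
 proof (rule integral_mono)
  show "integrable (GG I) (%x. \<bar>ph x * u x\<bar>)" using phi[OF ui] by (rule integrable_abs)
  show "integrable (GG I) (%x. \<bar>u x\<bar>)" using ui by (rule integrable_abs)
  show "\<bar>ph x * u x\<bar> <= \<bar>u x\<bar>" if "x : space (GG I)" for x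
   using 1[OF that] by (simp add: abs_mult mult_left_le_one_le)
 qed
 finally show ?thesis unfolding eq using uv by linarith
qed simp

text \<open>Recentre at the shifted cost. The Gaussian weight that this produces is bounded below
  only for bounded \<open>x j\<close>, hence the slab of half-width \<open>R\<close>.\<close>

lemma gap_ge:
 assumes j: "j : I" and R: "0 <= R" and s: "\<bar>s\<bar> <= rh"
 shows "exp (- R - 1) * (LINT x|GG I. indicator {x. \<bar>x j\<bar> <= R} x * (\<Sum>i<m. f i (sh j ((rh - 1 / rh) * s) x) * ex i x)) <= gap j s"
proof -
 note [measurable] = j
 define \<Xi> where "\<Xi> x = (\<Sum>i<m. f i (sh j ((rh - 1 / rh) * s) x) * ex i x)" for x
 have Xb: "bdd (GG I) \<Xi>" unfolding \<Xi>_def[abs_def] by (intro bdd_sum bdd_mult bdd_sh[OF j] fb ex_bdd) auto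
 have Xm[measurable]: "\<Xi> : bm (GG I)" using Xb by (auto simp: bdd_def)
 have Xn: "AE x in GG I. 0 <= \<Xi> x"
  using ex_nonneg AE_space
  by eventually_elim (use relaxed_le1(2)[OF f_rel] space_sh[OF j] in \<open>auto simp: \<Xi>_def intro!: sum_nonneg mult_nonneg_nonneg\<close>)
 have "gap j s = (LINT x|GG I. \<Xi> (sh j (s / rh) x))"
  unfolding gap_def \<Xi>_def sh_def using rho by (simp add: algebra_simps)
 also have "... = (LINT x|GG I. exp (- (s / rh) * x j - (s / rh)\<^sup>2 / 2) * \<Xi> x)" by (rule integral_sh[OF fin j Xm])
 also have "... >= (LINT x|GG I. exp (- R - 1) * (indicator {x. \<bar>x j\<bar> <= R} x * \<Xi> x))"
 proof (rule integral_mono_AE)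
  have "bdd (GG I) (%x. indicator {x\<in>space (GG I). \<bar>x j\<bar> <= R} x * \<Xi> x)"
   by (intro bdd_mult bdd_indicator Xb) measurable
  then have "bdd (GG I) (%x. indicator {x. \<bar>x j\<bar> <= R} x * \<Xi> x)"
   by (rule iffD1[OF bdd_cong, rotated]) (auto simp: indicator_def)
  then show "integrable (GG I) (%x. exp (- R - 1) * (indicator {x. \<bar>x j\<bar> <= R} x * \<Xi> x))" by auto
  obtain C where C: "0 < C" "!!x. x : space (GG I) ==> \<bar>\<Xi> x\<bar> <= C" using bdd_obtain[OF Xb] by blast
  show "integrable (GG I) (%x. exp (- (s / rh) * x j - (s / rh)\<^sup>2 / 2) * \<Xi> x)"
  proof (rule BI_integrable_bound)
   show "integrable (GG I) (%x. C * exp (- (s / rh) * x j - (s / rh)\<^sup>2 / 2))"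
    by (rule integrable_mult_right[OF exp_shift_int(1)[OF j]])
   show "AE x in GG I. norm (exp (- (s / rh) * x j - (s / rh)\<^sup>2 / 2) * \<Xi> x) <= norm (C * exp (- (s / rh) * x j - (s / rh)\<^sup>2 / 2))"
    using C by (intro AE_I2) (auto simp: abs_mult mult.commute[of C] intro!: mult_left_mono)
  qed measurable
  show "AE x in GG I. exp (- R - 1) * (indicator {x. \<bar>x j\<bar> <= R} x * \<Xi> x) <= exp (- (s / rh) * x j - (s / rh)\<^sup>2 / 2) * \<Xi> x"
   using Xn
  proof eventually_elim
   case (elim x)
   show ?case
   proof (cases "\<bar>x j\<bar> <= R")
    case True
    have r: "\<bar>s / rh\<bar> <= 1" using s rho by simp
    define q p where "q = (s / rh) * x j" and "p = (s / rh)\<^sup>2"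
    have "\<bar>q\<bar> <= 1 * R" unfolding q_def abs_mult using r True by (intro mult_mono) auto
    moreover have "p <= 1" unfolding p_def using r by (simp add: abs_square_le_1)
    ultimately have "- R - 1 <= - q - p / 2" by linarith
    then have "- R - 1 <= - (s / rh) * x j - (s / rh)\<^sup>2 / 2" unfolding q_def p_def by simp
    then show ?thesis using True elim by (auto intro!: mult_right_mono)
   qed (use elim in auto)
  qed
 qed
 finally show ?thesis unfolding \<Xi>_def by simp
qed

text \<open>\<open>psi_le\<close> bounds the Lagrangian of the translated pair from above,
  \<open>master\<close> from below, and the gap is squeezed in between. After recentring,
  \<open>f\<close> is shifted by \<open>rh - 1 / rh\<close> times the parameter; this factor is
  nonzero, so every small shift of \<open>f\<close> against the unshifted cost is covered.\<close>

lemma cheap: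
 assumes j: "j : I" and R: "0 <= R" and e: "0 < ep"
  and mf: "!!i. i < m ==> (LINT x|GG I. f i x * x j) = 0" and mg: "!!i. i < m ==> (LINT x|GG I. g i x * x j) = 0"
 shows "EX s0>0. ALL s. \<bar>s\<bar> < s0 -->
  (LINT x|GG I. indicator {x. \<bar>x j\<bar> <= R} x * (\<Sum>i<m. f i (sh j s x) * ex i x)) <= ep * s\<^sup>2"
proof -
 define c where "c = 1 / rh - rh"
 have c: "0 < c" "rh - 1 / rh = - c"
 proof -
  have "rh * rh < 1 * 1" using rho by (intro mult_strict_mono) auto
  then show "0 < c" unfolding c_def using rho by (simp add: field_simps)
 qed (simp add: c_def)
 \<comment> \<open>Compensates the weight lost in \<open>gap_ge\<close> and the rescaling of the
   shift by \<open>c\<close>.\<close>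
 define ep' where "ep' = exp (- R - 1) * ep * c\<^sup>2"
 have e': "0 < ep'" unfolding ep'_def using e c by simp
 \<comment> \<open>Covers the volume errors, at most \<open>(s / rh)\<^sup>2\<close>, and the L1
   differences after \<open>T\<close>, at most \<open>Kr / rh * \<bar>s / rh\<bar>\<close>, for both
   shifts at once.\<close>
 define C where "C = 1 / rh\<^sup>2 + Kr / rh\<^sup>2"
 have C0: "0 <= C" unfolding C_def using Kr_pos rho by simp
 obtain s1 where s1: "0 < s1" "!!s f' g'. 0 < s ==> s < s1 ==> relaxed (GG I) m f' ==> relaxed (GG I) m g' ==>
  (ALL i<m. \<bar>(LINT x|GG I. f' i x) - (LINT x|GG I. f i x)\<bar> <= C * s\<^sup>2) ==>
  (ALL i<m. \<bar>(LINT x|GG I. g' i x) - (LINT x|GG I. g i x)\<bar> <= C * s\<^sup>2) ==>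
  (ALL i<m. (LINT x|GG I. \<bar>T (%y. f' i y - f i y) x\<bar>) <= C * s) ==>
  (ALL i<m. (LINT x|GG I. \<bar>T (%y. g' i y - g i y) x\<bar>) <= C * s) ==>
  L f g - ep' * s\<^sup>2 <= L f' g'"
  using master[OF e' C0] by blast
 define s2 where "s2 = min s1 rh"
 have s2: "0 < s2" using s1 rho unfolding s2_def by simp
 have rr: "1 <= 1 / rh" "1 / rh <= 1 / rh\<^sup>2" "1 <= 1 / rh\<^sup>2"
  using rho by (auto simp: power2_eq_square divide_le_eq le_divide_eq mult_left_le_one_le mult_le_one less_imp_le)
 have gap: "gap j s <= ep' * s\<^sup>2" if s: "\<bar>s\<bar> < s2" "s ~= 0" for s
 proof -
  have sr: "\<bar>s\<bar> < s1" "\<bar>s\<bar> <= rh" using s unfolding s2_def by auto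
  have le1: "\<bar>s / rh\<bar> <= 1" "\<bar>s\<bar> <= 1" using sr rho by auto
  have "L f g - ep' * \<bar>s\<bar>\<^sup>2 <= L (fs f j (s / rh)) (fs g j s)"
  proof (rule s1(2)[OF _ sr(1)])
   show "0 < \<bar>s\<bar>" using s by simp
   show "relaxed (GG I) m (fs f j (s / rh))" by (rule relaxed_fs[OF j f_rel])
   show "relaxed (GG I) m (fs g j s)" by (rule relaxed_fs[OF j g_rel])
   have a: "(s / rh)\<^sup>2 <= C * \<bar>s\<bar>\<^sup>2" "s\<^sup>2 <= C * \<bar>s\<bar>\<^sup>2"
   proof -
    have "0 <= Kr / rh\<^sup>2 * s\<^sup>2" using Kr_pos by simp
    moreover have "s\<^sup>2 <= 1 / rh\<^sup>2 * s\<^sup>2" using mult_right_mono[OF rr(3), of "s\<^sup>2"] by simp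
    moreover have "(s / rh)\<^sup>2 = 1 / rh\<^sup>2 * s\<^sup>2" by (simp add: power_divide)
    moreover have "C * \<bar>s\<bar>\<^sup>2 = 1 / rh\<^sup>2 * s\<^sup>2 + Kr / rh\<^sup>2 * s\<^sup>2" unfolding C_def by (simp add: distrib_right)
    ultimately show "(s / rh)\<^sup>2 <= C * \<bar>s\<bar>\<^sup>2" "s\<^sup>2 <= C * \<bar>s\<bar>\<^sup>2" by linarith+
   qed
   have b: "Kr / rh * \<bar>s / rh\<bar> <= C * \<bar>s\<bar>" "Kr / rh * \<bar>s\<bar> <= C * \<bar>s\<bar>"
   proof -
    have "Kr / rh * \<bar>s / rh\<bar> = Kr / rh\<^sup>2 * \<bar>s\<bar>" using rho by (simp add: power2_eq_square)
    moreover have "0 <= 1 / rh\<^sup>2 * \<bar>s\<bar>" by simp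
    ultimately show "Kr / rh * \<bar>s / rh\<bar> <= C * \<bar>s\<bar>" unfolding C_def distrib_right by linarith
    have "Kr * (1 / rh) <= Kr * (1 / rh\<^sup>2)" using rr(2) Kr_pos by (intro mult_left_mono) auto
    moreover have "0 <= 1 / rh\<^sup>2" by simp
    ultimately have "Kr / rh <= C" unfolding C_def times_divide_eq_right mult_1_right by linarith
    then show "Kr / rh * \<bar>s\<bar> <= C * \<bar>s\<bar>" by (intro mult_right_mono) auto
   qed
   show "ALL i<m. \<bar>(LINT x|GG I. fs f j (s / rh) i x) - (LINT x|GG I. f i x)\<bar> <= C * \<bar>s\<bar>\<^sup>2"
    unfolding fs_def using order_trans[OF vol_second_order[OF j fb f1 mf le1(1)] a(1)] by blast
   show "ALL i<m. \<bar>(LINT x|GG I. fs g j s i x) - (LINT x|GG I. g i x)\<bar> <= C * \<bar>s\<bar>\<^sup>2"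
    unfolding fs_def using order_trans[OF vol_second_order[OF j gb g1 mg le1(2)] a(2)] by blast
   show "ALL i<m. (LINT x|GG I. \<bar>T (%y. fs f j (s / rh) i y - f i y) x\<bar>) <= C * \<bar>s\<bar>"
    unfolding fs_def using order_trans[OF T_sh_L1[OF j fb f1] b(1)] by blast
   show "ALL i<m. (LINT x|GG I. \<bar>T (%y. fs g j s i y - g i y) x\<bar>) <= C * \<bar>s\<bar>"
    unfolding fs_def using order_trans[OF T_sh_L1[OF j gb g1] b(2)] by blast
  qed
  then show ?thesis using psi_le[OF j, of s] by simp
 qed
 show ?thesis
 proof (intro exI[of _ "c * s2"] conjI allI impI)
  show "0 < c * s2" using c s2 by simp
  fix s :: real assume s: "\<bar>s\<bar> < c * s2"
  define r where "r = - s / c"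
  have sr: "s = (rh - 1 / rh) * r" unfolding r_def c(2) using c(1) by simp
  have ra: "\<bar>r\<bar> < s2" unfolding r_def using s c(1) by (simp add: field_simps)
  show "(LINT x|GG I. indicator {x. \<bar>x j\<bar> <= R} x * (\<Sum>i<m. f i (sh j s x) * ex i x)) <= ep * s\<^sup>2"
  proof (cases "r = 0")
   case True
   have "(LINT x|GG I. indicator {x. \<bar>x j\<bar> <= R} x * (\<Sum>i<m. f i x * ex i x)) = 0"
   proof (rule integral_eq_zero_AE, rule AE_I2)
    fix x assume x: "x : space (GG I)"
    obtain p where p: "p < m" "f p x = 1" using f_unique[OF x] by blast
    have "f i x * ex i x = 0" if "i < m" for i
     using f_zero[OF x p that] ww_val[OF x p] unfolding ex_def by (cases "i = p") auto
    then have "(\<Sum>i<m. f i x * ex i x) = 0" by (intro sum.neutral) auto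
    then show "indicator {x. \<bar>x j\<bar> <= R} x * (\<Sum>i<m. f i x * ex i x) = 0" by simp
   qed
   then show ?thesis using True sr by simp
  next
   case False
   have "exp (- R - 1) * (LINT x|GG I. indicator {x. \<bar>x j\<bar> <= R} x * (\<Sum>i<m. f i (sh j s x) * ex i x)) <= gap j r"
    unfolding sr using ra by (intro gap_ge[OF j R]) (simp add: s2_def)
   also have "... <= ep' * r\<^sup>2" by (rule gap[OF ra False])
   also have "... = exp (- R - 1) * (ep * s\<^sup>2)" unfolding ep'_def sr c(2) by (simp add: power_mult_distrib)
   finally show ?thesis by simp
  qed
 qed
qed

end

section \<open>Laplace transforms and isolated zeros\<close>

text \<open>Integrability against every exponential, so that the Laplace transform under the
  Gaussian is an entire function.\<close>

definition lapl :: "(real => real) => bool" where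
 "lapl ph \<longleftrightarrow> ph : bm borel & (ALL s. integrable N01 (%r. \<bar>ph r\<bar> * exp (s * \<bar>r\<bar>)))"

lemma N01_meas: "(ph : bm N01) = (ph : bm borel)"
 by (simp add: measurable_cong_sets[OF sets_N01 refl])

lemma N01_exp_int: "integrable N01 (%t. exp (a * t))"
proof -
 have "(\<integral>\<^sup>+t. 1 * ennreal (exp (- (- a) * t - (- a)\<^sup>2 / 2)) \<partial>N01) = (\<integral>\<^sup>+t. 1 \<partial>N01)"
  by (rule nn_N01_shift[symmetric]) simp
 then have "(\<integral>\<^sup>+t. ennreal (exp (a * t - a\<^sup>2 / 2)) \<partial>N01) = 1" by (simp add: N01.emeasure_space_1[simplified])
 then have "integrable N01 (%t. exp (a * t - a\<^sup>2 / 2))"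
  by (intro integrableI_nonneg) (auto simp: N01_meas)
 then have "integrable N01 (%t. exp (a\<^sup>2 / 2) * exp (a * t - a\<^sup>2 / 2))" by (rule integrable_mult_right)
 then show ?thesis by (simp flip: exp_add)
qed

lemma lapl_dom:
 assumes "lapl ph" "ps : bm borel" "!!r. \<bar>ps r\<bar> <= C * \<bar>ph r\<bar> * exp (b * \<bar>r\<bar>)"
 shows "lapl ps"
 unfolding lapl_def
proof (intro conjI allI assms(2))
 fix s
 have [measurable]: "ps : bm borel" by fact
 show "integrable N01 (%r. \<bar>ps r\<bar> * exp (s * \<bar>r\<bar>))"
 proof (rule BI_integrable_bound)
  show "integrable N01 (%r. C * (\<bar>ph r\<bar> * exp ((b + s) * \<bar>r\<bar>)))" using assms(1) unfolding lapl_def by (intro integrable_mult_right) blast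
  show "(%r. \<bar>ps r\<bar> * exp (s * \<bar>r\<bar>)) : bm N01" unfolding N01_meas by measurable
  show "AE r in N01. norm (\<bar>ps r\<bar> * exp (s * \<bar>r\<bar>)) <= norm (C * (\<bar>ph r\<bar> * exp ((b + s) * \<bar>r\<bar>)))"
  proof (rule AE_I2)
   fix r
   have "\<bar>ps r\<bar> * exp (s * \<bar>r\<bar>) <= (C * \<bar>ph r\<bar> * exp (b * \<bar>r\<bar>)) * exp (s * \<bar>r\<bar>)"
    using assms(3) by (intro mult_right_mono) auto
   also have "... = C * (\<bar>ph r\<bar> * exp ((b + s) * \<bar>r\<bar>))" by (simp only: distrib_right exp_add mult.assoc)
   finally show "norm (\<bar>ps r\<bar> * exp (s * \<bar>r\<bar>)) <= norm (C * (\<bar>ph r\<bar> * exp ((b + s) * \<bar>r\<bar>)))"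
    by (simp del: abs_mult)
  qed
 qed
qed

lemma lapl_one: "lapl (%_. 1)"
 unfolding lapl_def
proof (intro conjI allI)
 fix s :: real
 show "integrable N01 (%r. \<bar>1\<bar> * exp (s * \<bar>r\<bar>))"
 proof (rule BI_integrable_bound)
  show "integrable N01 (%r. exp (s * r) + exp ((- s) * r))" by (intro BI_integrable_add N01_exp_int)
  show "(%r. \<bar>1\<bar> * exp (s * \<bar>r\<bar>)) : bm N01" unfolding N01_meas by measurable
  show "AE r in N01. norm (\<bar>1\<bar> * exp (s * \<bar>r\<bar>)) <= norm (exp (s * r) + exp ((- s) * r))"
  proof (rule AE_I2)
   fix r
   have "exp (s * \<bar>r\<bar>) <= exp (s * r) + exp ((- s) * r)" by (cases "r < 0") auto
   then show "norm (\<bar>1\<bar> * exp (s * \<bar>r\<bar>)) <= norm (exp (s * r) + exp ((- s) * r))" by simp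
  qed
 qed
qed simp

lemma lapl_bdd: "ph : bm borel ==> (!!r. \<bar>ph r\<bar> <= C) ==> lapl ph"
 by (rule lapl_dom[OF lapl_one, where C=C and b=0]) auto

lemma lapl_mult_exp: "lapl ph ==> lapl (%r. ph r * exp (a * r))"
proof (rule lapl_dom[where C=1 and b="\<bar>a\<bar>"])
 assume l: "lapl ph"
 then have [measurable]: "ph : bm borel" unfolding lapl_def by blast
 show "(%r. ph r * exp (a * r)) : bm borel" by measurable
 fix r
 have "a * r <= \<bar>a\<bar> * \<bar>r\<bar>" by (metis abs_ge_self abs_mult)
 then show "\<bar>ph r * exp (a * r)\<bar> <= 1 * \<bar>ph r\<bar> * exp (\<bar>a\<bar> * \<bar>r\<bar>)" by (simp add: abs_mult mult_left_mono)
qed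

lemma pow_le_exp: "0 <= x ==> x ^ n <= fact n * exp (x :: real)"
proof -
 assume x: "0 <= x"
 have "(\<Sum>k\<in>{n}. x ^ k /\<^sub>R fact k) <= (\<Sum>k. x ^ k /\<^sub>R fact k)"
  using x by (intro sum_le_suminf summable_exp_generic) auto
 then have "x ^ n / fact n <= exp x" unfolding exp_def by (simp add: divide_inverse mult.commute)
 then show ?thesis by (simp add: field_simps)
qed

lemma lapl_int: "lapl ph ==> integrable N01 ph"
proof -
 assume l: "lapl ph"
 then have "integrable N01 (%r. \<bar>ph r\<bar> * exp (0 * \<bar>r\<bar>))" unfolding lapl_def by blast
 then have "integrable N01 (%r. \<bar>ph r\<bar>)" by simp
 moreover have "ph : bm N01" using l unfolding lapl_def N01_meas by blast
 ultimately show ?thesis by (simp add: integrable_abs_iff)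
qed

text \<open>The same for a general statistic \<open>Y\<close>; later \<open>Y\<close> is a
  coordinate of a product space.\<close>

definition glap :: "'a measure => ('a => real) => ('a => real) => bool" where
 "glap M ph Y \<longleftrightarrow> ph : bm M & Y : bm M & (ALL s. integrable M (%r. \<bar>ph r\<bar> * exp (s * \<bar>Y r\<bar>)))"

lemma glap_int: "glap M ph Y ==> integrable M ph"
proof -
 assume l: "glap M ph Y"
 then have "integrable M (%r. \<bar>ph r\<bar> * exp (0 * \<bar>Y r\<bar>))" unfolding glap_def by blast
 then have "integrable M (%r. \<bar>ph r\<bar>)" by simp
 moreover have "ph : bm M" using l unfolding glap_def by blast
 ultimately show ?thesis by (simp add: integrable_abs_iff)
qed

lemma glap_mult_pow: "glap M ph Y ==> glap M (%r. ph r * Y r ^ n) Y"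
 unfolding glap_def
proof (intro conjI allI)
 assume l: "ph : bm M & Y : bm M & (ALL s. integrable M (%r. \<bar>ph r\<bar> * exp (s * \<bar>Y r\<bar>)))"
 then have [measurable]: "ph : bm M" "Y : bm M" by auto
 show "(%r. ph r * Y r ^ n) : bm M" "Y : bm M" by measurable
 fix s
 show "integrable M (%r. \<bar>ph r * Y r ^ n\<bar> * exp (s * \<bar>Y r\<bar>))"
 proof (rule BI_integrable_bound)
  show "integrable M (%r. fact n * (\<bar>ph r\<bar> * exp ((1 + s) * \<bar>Y r\<bar>)))" using l by (intro integrable_mult_right) blast
  show "(%r. \<bar>ph r * Y r ^ n\<bar> * exp (s * \<bar>Y r\<bar>)) : bm M" by measurable
  show "AE r in M. norm (\<bar>ph r * Y r ^ n\<bar> * exp (s * \<bar>Y r\<bar>)) <= norm (fact n * (\<bar>ph r\<bar> * exp ((1 + s) * \<bar>Y r\<bar>)))"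
  proof (rule AE_I2)
   fix r
   have "\<bar>ph r\<bar> * \<bar>Y r\<bar> ^ n * exp (s * \<bar>Y r\<bar>) <= \<bar>ph r\<bar> * (fact n * exp \<bar>Y r\<bar>) * exp (s * \<bar>Y r\<bar>)"
    using pow_le_exp[of "\<bar>Y r\<bar>" n] by (intro mult_right_mono mult_left_mono) auto
   also have "... = fact n * (\<bar>ph r\<bar> * exp ((1 + s) * \<bar>Y r\<bar>))"
    by (simp only: distrib_right exp_add mult_1_left mult.assoc mult.left_commute)
   finally show "norm (\<bar>ph r * Y r ^ n\<bar> * exp (s * \<bar>Y r\<bar>)) <= norm (fact n * (\<bar>ph r\<bar> * exp ((1 + s) * \<bar>Y r\<bar>)))"
    by (simp add: abs_mult power_abs)
  qed
 qed
qed

lemma glap_series: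
 fixes z :: complex
 assumes l: "glap M ph Y"
 shows "(%n. z ^ n / fact n * complex_of_real (LINT r|M. ph r * Y r ^ n)) sums
  (LINT r|M. complex_of_real (ph r) * exp (z * complex_of_real (Y r)))"
proof -
 define F where "F n r = (z ^ n / fact n) * complex_of_real (ph r * Y r ^ n)" for n r
 have Fi: "integrable M (F n)" for n
  unfolding F_def by (intro integrable_mult_right integrable_of_real glap_int[OF glap_mult_pow[OF l]])
 have Fe: "F n r = complex_of_real (ph r) * ((z * complex_of_real (Y r)) ^ n /\<^sub>R fact n)" for n r
  unfolding F_def by (simp add: power_mult_distrib scaleR_conv_of_real divide_inverse mult_ac)
 have Fn: "norm (F n r) = \<bar>ph r\<bar> * ((norm z * \<bar>Y r\<bar>) ^ n /\<^sub>R fact n)" for n r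
  unfolding Fe by (simp add: norm_mult norm_power)
 have sm: "summable (%n. norm (F n r))" for r
  unfolding Fn by (intro summable_mult summable_exp_generic)
 have si: "summable (%n. (LINT r|M. norm (F n r)))"
 proof (rule summableI_nonneg_bounded)
  fix n show "0 <= (LINT r|M. norm (F n r))" by simp
 next
  fix n
  have "(\<Sum>i<n. (LINT r|M. norm (F i r))) = (LINT r|M. (\<Sum>i<n. norm (F i r)))"
   using Fi by (subst BI_integral_sum) auto
  also have "... <= (LINT r|M. \<bar>ph r\<bar> * exp (norm z * \<bar>Y r\<bar>))"
  proof (rule integral_mono)
   show "integrable M (%r. \<Sum>i<n. norm (F i r))" using Fi by auto
   show "integrable M (%r. \<bar>ph r\<bar> * exp (norm z * \<bar>Y r\<bar>))" using l unfolding glap_def by blast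
   fix r
   have "(\<Sum>i<n. (norm z * \<bar>Y r\<bar>) ^ i /\<^sub>R fact i) <= exp (norm z * \<bar>Y r\<bar>)"
    unfolding exp_def by (intro sum_le_suminf summable_exp_generic) auto
   then show "(\<Sum>i<n. norm (F i r)) <= \<bar>ph r\<bar> * exp (norm z * \<bar>Y r\<bar>)"
    unfolding Fn sum_distrib_left[symmetric] by (intro mult_left_mono) auto
  qed
  finally show "(\<Sum>i<n. (LINT r|M. norm (F i r))) <= (LINT r|M. \<bar>ph r\<bar> * exp (norm z * \<bar>Y r\<bar>))" .
 qed
 have "(%n. integral\<^sup>L M (F n)) sums (LINT r|M. (\<Sum>n. F n r))"
  by (rule sums_integral[OF Fi _ si]) (use sm in auto)
 moreover have "(\<Sum>n. F n r) = complex_of_real (ph r) * exp (z * complex_of_real (Y r))" for r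
  unfolding Fe exp_def by (rule suminf_mult[OF summable_exp_generic])
 moreover have "integral\<^sup>L M (F n) = z ^ n / fact n * complex_of_real (LINT r|M. ph r * Y r ^ n)" for n
  unfolding F_def by (simp only: integral_mult_right_zero integral_complex_of_real)
 ultimately show ?thesis by simp
qed

lemma glap_series_real:
 assumes l: "glap M ph Y"
 shows "(%n. (LINT r|M. ph r * Y r ^ n) / fact n * u ^ n) sums (LINT r|M. ph r * exp (u * Y r))"
proof -
 have "(LINT r|M. complex_of_real (ph r) * exp (complex_of_real u * complex_of_real (Y r))) = complex_of_real (LINT r|M. ph r * exp (u * Y r))"
  by (simp add: exp_of_real flip: of_real_mult integral_complex_of_real)
 with glap_series[OF l, of "complex_of_real u"]
 have "(%n. complex_of_real ((LINT r|M. ph r * Y r ^ n) / fact n * u ^ n)) sums complex_of_real (LINT r|M. ph r * exp (u * Y r))"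
  by (simp add: mult_ac)
 then show ?thesis by (simp only: sums_of_real_iff)
qed

lemma lapl_glap: "lapl ph ==> glap N01 ph (%r. r)"
 unfolding lapl_def glap_def by (simp add: N01_meas)

lemma lapl_series:
 fixes z :: complex
 assumes l: "lapl ph"
 shows "(%n. z ^ n / fact n * complex_of_real (LINT r|N01. ph r * r ^ n)) sums
  (LINT r|N01. complex_of_real (ph r) * exp (z * complex_of_real r))"
 by (rule glap_series[OF lapl_glap[OF l]])

text \<open>If all moments vanish, so does the transform, in particular on the imaginary axis. The
  normalized positive and negative parts are then probability laws with the same characteristic
  function.\<close>

lemma lapl_moments:
 assumes l: "lapl ph" and z: "!!n. (LINT r|N01. ph r * r ^ n) = 0"
 shows "AE r in N01. ph r = 0"
proof -
 have [measurable]: "ph : bm borel" using l unfolding lapl_def by blast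
 have four: "(LINT r|N01. complex_of_real (ph r) * exp (w * complex_of_real r)) = 0" for w
  using lapl_series[OF l, of w] sums_unique2[OF _ sums_zero] unfolding z by simp
 define p q where "p r = max (ph r) 0" and "q r = max (- ph r) 0" for r
 have pq: "0 <= p r" "0 <= q r" "ph r = p r - q r" for r unfolding p_def q_def by auto
 have pm[measurable]: "p : bm borel" "q : bm borel" unfolding p_def[abs_def] q_def[abs_def] by measurable
 have pmN: "p : bm N01" "q : bm N01" using pm by (auto simp: N01_meas)
 have ip: "integrable N01 p" "integrable N01 q"
  by (rule BI_integrable_bound[OF lapl_int[OF l]]; use pmN in \<open>auto simp: p_def q_def\<close>)+
 define c where "c = (LINT r|N01. p r)"
 have cq: "(LINT r|N01. q r) = c"
  using z[of 0] ip unfolding c_def pq(3) by simp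
 have c0: "0 <= c" unfolding c_def using pq by simp
 show ?thesis
 proof (cases "c = 0")
  case True
  have "(LINT r|N01. p r) = 0" "(LINT r|N01. q r) = 0" using True cq unfolding c_def by auto
  then have "AE r in N01. p r = 0" "AE r in N01. q r = 0"
   using integral_nonneg_eq_0_iff_AE[OF ip(1)] integral_nonneg_eq_0_iff_AE[OF ip(2)] pq by auto
  then show ?thesis by eventually_elim (simp add: pq(3))
 next
  case False
  then have c: "0 < c" using c0 by simp
  define D where "D h = density N01 (%r. ennreal (h r / c))" for h
  have real: "real_distribution (D h)" if "h : bm N01" "!!r. 0 <= h r" "integrable N01 h" "(LINT r|N01. h r) = c" for h
  proof -
   have "emeasure (D h) (space (D h)) = (\<integral>\<^sup>+r. ennreal (h r / c) \<partial>N01)"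
    unfolding D_def using that by (subst emeasure_density) (auto cong: nn_integral_cong)
   also have "... = ennreal (LINT r|N01. h r / c)"
    using that c by (intro nn_integral_eq_integral) auto
   also have "... = 1" using that c by simp
   finally have "prob_space (D h)" by (intro prob_spaceI)
   then show ?thesis unfolding real_distribution_def real_distribution_axioms_def by (simp add: D_def)
  qed
  have ch: "char (D h) t = (1 / c) *\<^sub>R (LINT r|N01. complex_of_real (h r) * exp (\<i> * complex_of_real t * complex_of_real r))"
   if "h : bm N01" "!!r. 0 <= h r" for h t
  proof -
   have "char (D h) t = (LINT r|N01. (h r / c) *\<^sub>R exp (\<i> * complex_of_real (t * r)))"
    unfolding char_def D_def using that c
    by (subst integral_density) (auto simp: N01_meas)
   also have "... = (LINT r|N01. (1 / c) *\<^sub>R (complex_of_real (h r) * exp (\<i> * complex_of_real t * complex_of_real r)))"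
    by (intro BI_integral_cong) (auto simp: scaleR_conv_of_real mult_ac)
   finally show ?thesis by simp
  qed
  have ie: "integrable N01 (%r. complex_of_real (h r) * exp (\<i> * complex_of_real t * complex_of_real r))"
   if "integrable N01 h" "h : bm borel" for h t
  proof (rule BI_integrable_bound[OF that(1)])
   have [measurable]: "h : bm N01" using that(2) by (simp add: N01_meas)
   show "(%r. complex_of_real (h r) * exp (\<i> * complex_of_real t * complex_of_real r)) : bm N01"
    using that(2) by (simp add: measurable_cong_sets[OF sets_N01 refl])
  qed (auto simp: norm_mult)
  have "char (D p) = char (D q)"
  proof
   fix t
   have "(LINT r|N01. complex_of_real (p r) * exp (\<i> * complex_of_real t * complex_of_real r)) -
    (LINT r|N01. complex_of_real (q r) * exp (\<i> * complex_of_real t * complex_of_real r)) =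
    (LINT r|N01. complex_of_real (ph r) * exp ((\<i> * complex_of_real t) * complex_of_real r))"
    using ie[OF ip(1) pm(1)] ie[OF ip(2) pm(2)] unfolding pq(3)
    by (subst BI_integral_diff[symmetric]) (auto simp: left_diff_distrib mult.assoc)
   also have "... = 0" by (rule four)
   finally show "char (D p) t = char (D q) t" using ch[OF pmN(1)] ch[OF pmN(2)] pq by simp
  qed
  then have "D p = D q" using real[OF pmN(1)] real[OF pmN(2)] ip pq cq c_def by (intro Levy_uniqueness) auto
  then have "AE r in N01. ennreal (p r / c) = ennreal (q r / c)"
   unfolding D_def using pmN by (intro N01.density_unique) auto
  then show ?thesis
  proof eventually_elim
   case (elim r)
   then have "p r / c = q r / c" using pq c by (subst (asm) ennreal_inj) auto
   then show ?case using c by (simp add: pq(3))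
  qed
 qed
qed

text \<open>Divide the power series by \<open>u ^ n\<close>, where \<open>n\<close> is the order of
  the first nonzero moment: the quotient has a nonzero limit at 0, so the transform has no other
  zero near 0.\<close>

lemma glap_order:
 assumes l: "glap M ph Y" and nz: "EX n. (LINT r|M. ph r * Y r ^ n) ~= 0"
 obtains n ep where "(LINT r|M. ph r * Y r ^ n) ~= 0" "!!i. i < n ==> (LINT r|M. ph r * Y r ^ i) = 0"
  "0 < ep" "!!u. 0 < \<bar>u\<bar> ==> \<bar>u\<bar> < ep ==> (LINT r|M. ph r * exp (u * Y r)) ~= 0"
proof -
 define a where "a n = (LINT r|M. ph r * Y r ^ n)" for n
 define n where "n = (LEAST n. a n ~= 0)"
 have "EX n. a n ~= 0" using nz unfolding a_def .
 then have an: "a n ~= 0" unfolding n_def by (rule LeastI_ex)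
 have small: "a i = 0" if "i < n" for i using not_less_Least[OF that[unfolded n_def]] by simp
 define F where "F u = (LINT r|M. ph r * exp (u * Y r))" for u
 have ser: "(%i. a (i + n) / fact (i + n) * u ^ i) sums (F u / u ^ n)" if "u ~= 0" for u
 proof -
  have "(%i. a i / fact i * u ^ i) sums F u" unfolding a_def F_def by (rule glap_series_real[OF l])
  then have "(%i. a (i + n) / fact (i + n) * u ^ (i + n)) sums (F u - (\<Sum>i<n. a i / fact i * u ^ i))"
   by (rule sums_split_initial_segment)
  then have "(%i. (a (i + n) / fact (i + n) * u ^ (i + n)) / u ^ n) sums (F u / u ^ n)"
   using small by (intro sums_divide) simp
  then show ?thesis using that by (simp add: power_add)
 qed
 have "((%u. F u / u ^ n) \<longlongrightarrow> a (0 + n) / fact (0 + n)) (at 0)"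
  by (rule powser_limit_0_strong[where s=1]) (use ser in auto)
 then have "((%u. F u / u ^ n) \<longlongrightarrow> a n / fact n) (at 0)" by simp
 moreover have "a n / fact n ~= 0" using an by simp
 ultimately have "eventually (%u. F u / u ^ n ~= 0) (at 0)" by (rule tendsto_imp_eventually_ne)
 then obtain e where e: "0 < e" "!!u. u ~= 0 ==> dist u 0 < e ==> F u / u ^ n ~= 0"
  unfolding eventually_at by blast
 show ?thesis
  by (rule that[of n e]) (use an small e in \<open>auto simp: a_def F_def dist_real_def\<close>)
qed

lemma lapl_order:
 assumes l: "lapl ph" and nz: "\<not> (AE r in N01. ph r = 0)"
 obtains n ep where "(LINT r|N01. ph r * r ^ n) ~= 0" "!!i. i < n ==> (LINT r|N01. ph r * r ^ i) = 0"
  "0 < ep" "!!u. 0 < \<bar>u\<bar> ==> \<bar>u\<bar> < ep ==> (LINT r|N01. ph r * exp (u * r)) ~= 0"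
proof -
 have "EX n. (LINT r|N01. ph r * r ^ n) ~= 0" using lapl_moments[OF l] nz by blast
 from glap_order[OF lapl_glap[OF l] this] show ?thesis using that by blast
qed

text \<open>The coefficient of \<open>t * r\<close> in the Mehler exponent: moving \<open>t\<close>
  by h tilts the kernel by \<open>exp (kap rh * h * r)\<close>, up to a factor that does not involve
  \<open>r\<close>.\<close>

definition kap :: "real => real" where "kap rh = rh / (1 - rh\<^sup>2)"

lemma k1_factor:
 assumes "0 < rh" "rh < 1"
 shows "k1 rh t r = exp (- rh\<^sup>2 * t\<^sup>2 / (2 * (1 - rh\<^sup>2))) / sqrt (1 - rh\<^sup>2) * (exp (- rh\<^sup>2 * r\<^sup>2 / (2 * (1 - rh\<^sup>2))) * exp (kap rh * t * r))"
proof -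
 define D where "D = 1 - rh\<^sup>2"
 have eq: "(2 * rh * t * r - rh\<^sup>2 * t\<^sup>2 - rh\<^sup>2 * r\<^sup>2) / (2 * (1 - rh\<^sup>2)) =
  - rh\<^sup>2 * t\<^sup>2 / (2 * (1 - rh\<^sup>2)) + (- rh\<^sup>2 * r\<^sup>2 / (2 * (1 - rh\<^sup>2)) + kap rh * t * r)"
  unfolding kap_def D_def[symmetric] by (simp add: diff_divide_distrib)
 show ?thesis unfolding k1_def eq by (simp only: exp_add times_divide_eq_left)
qed

text \<open>Up to a positive factor the integral is the Laplace transform of \<open>ps\<close> at
  \<open>kap rh * (t - t0)\<close>; recentring at \<open>t0\<close> only tilts the function by an
  exponential.\<close>

lemma k1_zero_isolated:
 assumes rho: "0 < rh" "rh < 1" and m: "ph : bm borel" and C: "!!r. \<bar>ph r\<bar> <= C"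
  and nz: "\<not> (AE r in N01. ph r = 0)"
 shows "EX ep>0. ALL t. 0 < \<bar>t - t0\<bar> --> \<bar>t - t0\<bar> < ep --> (LINT r|N01. k1 rh t r * ph r) ~= 0"
proof -
 note [measurable] = m
 have r2: "0 < 1 - rh\<^sup>2" using rho by (simp add: power_less_one_iff)
 define ps where "ps r = ph r * exp (- rh\<^sup>2 * r\<^sup>2 / (2 * (1 - rh\<^sup>2))) * exp (kap rh * t0 * r)" for r
 have l: "lapl ps"
  unfolding ps_def
 proof (rule lapl_mult_exp, rule lapl_bdd[where C=C])
  fix r
  have "\<bar>ph r * exp (- rh\<^sup>2 * r\<^sup>2 / (2 * (1 - rh\<^sup>2)))\<bar> <= C * 1"
   unfolding abs_mult using C r2 by (intro mult_mono) (auto intro: order_trans[OF abs_ge_zero C])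
  then show "\<bar>ph r * exp (- rh\<^sup>2 * r\<^sup>2 / (2 * (1 - rh\<^sup>2)))\<bar> <= C" by simp
 qed measurable
 have "\<not> (AE r in N01. ps r = 0)" using nz unfolding ps_def by simp
 from lapl_order[OF l this] obtain e where e: "0 < e" "!!u. 0 < \<bar>u\<bar> ==> \<bar>u\<bar> < e ==> (LINT r|N01. ps r * exp (u * r)) ~= 0"
  by metis
 have k: "0 < kap rh" unfolding kap_def using rho r2 by simp
 show ?thesis
 proof (intro exI[of _ "e / kap rh"] conjI allI impI)
  show "0 < e / kap rh" using e k by simp
  fix t assume t: "0 < \<bar>t - t0\<bar>" "\<bar>t - t0\<bar> < e / kap rh"
  have "(LINT r|N01. k1 rh t r * ph r) = (LINT r|N01. (exp (- rh\<^sup>2 * t\<^sup>2 / (2 * (1 - rh\<^sup>2))) / sqrt (1 - rh\<^sup>2)) * (ps r * exp ((kap rh * (t - t0)) * r)))"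
   unfolding k1_factor[OF rho] ps_def
   by (intro BI_integral_cong) (auto simp: algebra_simps simp flip: exp_add)
  also have "... = (exp (- rh\<^sup>2 * t\<^sup>2 / (2 * (1 - rh\<^sup>2))) / sqrt (1 - rh\<^sup>2)) * (LINT r|N01. ps r * exp ((kap rh * (t - t0)) * r))"
   by (rule integral_mult_right_zero)
  also have "... ~= 0"
  proof -
   have "\<bar>kap rh * (t - t0)\<bar> = kap rh * \<bar>t - t0\<bar>" using k by (metis abs_mult abs_of_pos)
   moreover have "kap rh * \<bar>t - t0\<bar> < e" using t(2) k by (simp add: pos_less_divide_eq mult.commute)
   ultimately have "\<bar>kap rh * (t - t0)\<bar> < e" "0 < \<bar>kap rh * (t - t0)\<bar>" using t(1) k by (linarith, simp)
   then show ?thesis using e(2) r2 by simp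
  qed
  finally show "(LINT r|N01. k1 rh t r * ph r) ~= 0" .
 qed
qed

lemma isolated_AE:
 fixes P :: "real => bool"
 assumes "!!t0. EX ep>0. ALL t. 0 < \<bar>t - t0\<bar> --> \<bar>t - t0\<bar> < ep --> P t"
 shows "AE t in N01. P t"
proof -
 define S where "S = {t. \<not> P t}"
 have fin: "finite ({-real n..real n} \<inter> S)" for n :: nat
 proof (rule finite_not_islimpt_in_compact)
  fix z
  obtain e where "0 < e" "ALL t. 0 < \<bar>t - z\<bar> --> \<bar>t - z\<bar> < e --> P t" using assms[of z] by blast
  then show "\<not> z islimpt S" unfolding islimpt_approachable S_def by (auto simp: dist_real_def)
 qed simp
 have eq: "S = (\<Union>n::nat. {-real n..real n} \<inter> S)"
 proof (intro equalityI subsetI)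
  fix t assume "t : S"
  moreover obtain n :: nat where "\<bar>t\<bar> <= real n" using real_arch_simple by blast
  ultimately show "t : (\<Union>n::nat. {-real n..real n} \<inter> S)" by (auto intro!: exI[of _ n])
 qed auto
 have "countable (\<Union>n::nat. {-real n..real n} \<inter> S)"
  by (intro countable_UN countableI_type countable_finite fin)
 then have "countable S" using eq by argo
 then have "AE t in lborel. t ~: S" using countable_imp_null_set_lborel AE_not_in by blast
 then show ?thesis unfolding AE_N01 S_def by simp
qed

lemma AE_insert:
 assumes J: "finite J" "j ~: J" and P: "{z\<in>space (GG (insert j J)). P z} : sets (GG (insert j J))"
 shows "(AE z in GG (insert j J). P z) \<longleftrightarrow> (AE q in GG J. AE t in N01. P (q(j := t)))"
proof -
 define Q where "Q = {z\<in>space (GG (insert j J)). \<not> P z}"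
 have Q[measurable]: "Q : sets (GG (insert j J))" 
 proof -
  have "Q = space (GG (insert j J)) - {z\<in>space (GG (insert j J)). P z}" unfolding Q_def by auto
  then show ?thesis using P by (metis sets.compl_sets)
 qed
 have addm: "(%(f, y). f(j := y)) : GG J \<Otimes>\<^sub>M N01 \<rightarrow>\<^sub>M GG (insert j J)" by (rule measurable_add_dim)
 have mq: "(%p. indicator Q ((fst p)(j := snd p)) :: ennreal) : bm (GG J \<Otimes>\<^sub>M N01)"
  using measurable_compose[OF addm, of "indicator Q" "borel :: ennreal measure"] by (simp add: split_beta')
 have "(AE z in GG (insert j J). P z) \<longleftrightarrow> (AE z in GG (insert j J). (indicator Q z :: ennreal) = 0)"
  by (intro AE_cong) (auto simp: Q_def indicator_def)
 also have "... \<longleftrightarrow> (\<integral>\<^sup>+z. indicator Q z \<partial>GG (insert j J)) = 0" by (subst nn_integral_0_iff_AE) auto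
 also have "(\<integral>\<^sup>+z. indicator Q z \<partial>GG (insert j J)) = (\<integral>\<^sup>+q. \<integral>\<^sup>+t. indicator Q (q(j := t)) \<partial>N01 \<partial>GG J)"
  by (rule NP.product_nn_integral_insert[OF J]) simp
 also have "... = 0 \<longleftrightarrow> (AE q in GG J. (\<integral>\<^sup>+t. indicator Q (q(j := t)) \<partial>N01) = 0)"
  by (rule nn_integral_0_iff_AE) (use N01.borel_measurable_nn_integral[of "%q t. indicator Q (q(j := t))" "GG J"] mq in \<open>simp add: split_beta'\<close>)
 also have "... \<longleftrightarrow> (AE q in GG J. AE t in N01. P (q(j := t)))"
 proof (rule AE_cong)
  fix q assume q: "q : space (GG J)"
  have m: "(%t. indicator Q (q(j := t)) :: ennreal) : bm N01"
   using measurable_compose[OF measurable_Pair1'[OF q] mq] by simp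
  have sp: "q(j := t) : space (GG (insert j J))" for t using q J by (auto simp: space_PiM PiE_iff extensional_def)
  show "((\<integral>\<^sup>+t. indicator Q (q(j := t)) \<partial>N01) = 0) = (AE t in N01. P (q(j := t)))"
   by (subst nn_integral_0_iff_AE[OF m]) (use sp in \<open>auto simp: Q_def indicator_def intro!: AE_cong\<close>)
 qed
 finally show ?thesis .
qed

text \<open>The real-analyticity of \<open>T \<theta>\<close> and the injectivity of \<open>T\<close> are obtained together, by induction on
 the set of coordinates.\<close>

lemma T_zero_null:
 assumes rho: "0 < rh" "rh < 1" and I: "finite I"
  and m: "\<theta> : bm (GG I)" and C: "!!y. y : space (GG I) ==> \<bar>\<theta> y\<bar> <= C"
  and nz: "\<not> (AE y in GG I. \<theta> y = 0)"
 shows "AE x in GG I. (LINT y|GG I. kk rh I x y * \<theta> y) ~= 0"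
 using I m C nz
proof (induction I arbitrary: \<theta>)
 case empty
 have "\<theta> (%_. undefined) ~= 0"
  using empty(3) AE_I2[of "GG {}" "%y. \<theta> y = 0"] by (auto simp: space_PiM)
 moreover have "(\<integral>y. kk rh {} x y * \<theta> y \<partial>GG {}) = \<theta> (%_. undefined)" for x
  by (simp add: kk_def PiM_empty lebesgue_integral_count_space_finite)
 ultimately show ?case by simp
next
 case (insert j J)
 let ?I = "insert j J"
 interpret gauss ?I rh by unfold_locales (use insert rho in auto)
 interpret J: prob_space "GG J" by (rule prob_space_PiM) (rule prob_space_N01)
 interpret pair_sigma_finite N01 "GG J"
  by (intro pair_sigma_finite.intro N01.sigma_finite_measure_axioms J.sigma_finite_measure_axioms)
 have j: "j : ?I" "j ~: J" using insert by auto
 have thb: "bdd (GG ?I) \<theta>" using insert.prems by (intro bddI[where C=C]) auto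
 have sp: "q(j := t) : space (GG ?I)" if "q : space (GG J)" for q t
  using that j by (auto simp: space_PiM PiE_iff extensional_def)
 have addm: "(%(f, y). f(j := y)) : GG J \<Otimes>\<^sub>M N01 \<rightarrow>\<^sub>M GG ?I" by (rule measurable_add_dim)
 have thmm: "(%p. \<theta> ((fst p)(j := snd p))) : bm (GG J \<Otimes>\<^sub>M N01)"
  using measurable_compose[OF addm insert.prems(1)] by (simp add: split_beta' fun_upd_def)
 have line: "(%r. \<theta> (q(j := r))) : bm borel" if "q : space (GG J)" for q
  using measurable_compose[OF measurable_Pair1'[OF that] thmm] by (simp add: N01_meas)
 \<comment> \<open>Noise applied to coordinate j only. On the slice at height \<open>t\<close>,
   Fubini writes \<open>T \<theta>\<close> as the noise of \<open>\<Theta> t\<close> in the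
   remaining coordinates, to which the induction hypothesis applies unless \<open>\<Theta> t\<close>
   vanishes a.e.\<close>
 define \<Theta> where "\<Theta> t q = (LINT r|N01. k1 rh t r * \<theta> (q(j := r)))" for t q
 have C0: "0 <= C" using insert.prems(2)[OF sp] J.not_empty by (metis abs_ge_zero all_not_in_conv order_trans)
 have k1i: "integrable N01 (k1 rh t)" and k1v: "(LINT r|N01. k1 rh t r) = 1" for t
 proof -
  have m: "k1 rh t : bm N01" unfolding N01_meas by measurable
  show "integrable N01 (k1 rh t)" using nn_k1_1[OF rho, of t] m k1_pos[OF rho, of t]
   by (intro integrableI_nonneg) (auto intro: less_imp_le)
  show "(LINT r|N01. k1 rh t r) = 1" using nn_k1_1[OF rho, of t] m k1_pos[OF rho, of t]
   by (subst integral_eq_nn_integral) (auto intro: less_imp_le)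
 qed
 have ThC: "\<bar>\<Theta> t q\<bar> <= C" if q: "q : space (GG J)" for t q
 proof -
  have "\<bar>\<Theta> t q\<bar> <= (LINT r|N01. \<bar>k1 rh t r * \<theta> (q(j := r))\<bar>)" unfolding \<Theta>_def by (rule integral_abs_bound)
  also have "... <= (LINT r|N01. k1 rh t r * C)"
  proof (rule integral_mono')
   show "integrable N01 (%r. k1 rh t r * C)" using k1i by simp
   show "\<bar>k1 rh t r * \<theta> (q(j := r))\<bar> <= k1 rh t r * C" for r
    unfolding abs_mult using k1_pos[OF rho, of t r]
    by (intro mult_mono insert.prems(2)[OF sp[OF q]]) auto
   show "0 <= k1 rh t r * C" for r using k1_pos[OF rho, of t r] C0 by simp
  qed
  finally show ?thesis using k1v by simp
 qed
 have Thm2: "(%p. \<Theta> (fst p) (snd p)) : bm (N01 \<Otimes>\<^sub>M GG J)"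
 proof -
  have "(%z. \<theta> ((snd (fst z))(j := snd z))) : bm ((N01 \<Otimes>\<^sub>M GG J) \<Otimes>\<^sub>M N01)"
   using measurable_compose[OF _ thmm, of "%z. (snd (fst z), snd z)" "(N01 \<Otimes>\<^sub>M GG J) \<Otimes>\<^sub>M N01"] by simp
  moreover have "(%z. k1 rh (fst (fst z)) (snd z)) : bm ((N01 \<Otimes>\<^sub>M GG J) \<Otimes>\<^sub>M N01)"
  proof (rule k1_meas)
   have "fst : N01 \<Otimes>\<^sub>M GG J \<rightarrow>\<^sub>M N01" "snd : (N01 \<Otimes>\<^sub>M GG J) \<Otimes>\<^sub>M N01 \<rightarrow>\<^sub>M N01" by measurable
   then show "(%z. fst (fst z)) : bm ((N01 \<Otimes>\<^sub>M GG J) \<Otimes>\<^sub>M N01)" "(%z. snd z) : bm ((N01 \<Otimes>\<^sub>M GG J) \<Otimes>\<^sub>M N01)"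
    by (simp_all add: measurable_cong_sets[OF refl sets_N01] measurable_compose[OF measurable_fst])
  qed
  ultimately have "(%z. k1 rh (fst (fst z)) (snd z) * \<theta> ((snd (fst z))(j := snd z))) : bm ((N01 \<Otimes>\<^sub>M GG J) \<Otimes>\<^sub>M N01)"
   by measurable
  then show ?thesis unfolding \<Theta>_def by (intro N01.borel_measurable_lebesgue_integral) (simp add: split_beta')
 qed
 have Thm: "\<Theta> t : bm (GG J)" for t
  using measurable_compose[OF measurable_Pair1'[of t N01 "GG J"] Thm2] by simp
 have red: "T \<theta> (x(j := t)) = (LINT q|GG J. kk rh J x q * \<Theta> t q)" if x: "x : space (GG J)" for x t
 proof -
  have "T \<theta> (x(j := t)) = (LINT q|GG J. (LINT r|N01. kk rh ?I (x(j := t)) (q(j := r)) * \<theta> (q(j := r))))"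
   unfolding T_def by (rule NP.product_integral_insert[OF insert.hyps(1,2) kf_int[OF thb sp[OF x]]])
  also have "... = (LINT q|GG J. kk rh J x q * \<Theta> t q)"
  proof (rule BI_integral_cong[OF refl])
   fix q
   have "kk rh ?I (x(j := t)) (q(j := r)) = kk rh J x q * k1 rh t r" for r
    using kk_split[OF j(1), of "x(j := t)" "q(j := r)"] j by (simp add: kk_upd1 kk_upd2 mult.commute)
   then show "(LINT r|N01. kk rh ?I (x(j := t)) (q(j := r)) * \<theta> (q(j := r))) = kk rh J x q * \<Theta> t q"
    unfolding \<Theta>_def by (simp flip: integral_mult_right_zero add: mult.assoc)
  qed
  finally show ?thesis .
 qed
 \<comment> \<open>The exceptional heights. If \<open>Z\<close> had positive measure, then for
   almost every \<open>q\<close> the one-dimensional transform would vanish on a nonnull set; its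
   zeros being isolated, \<open>\<theta>\<close> would vanish on almost every line.\<close>
 define Z where "Z = {t. AE q in GG J. \<Theta> t q = 0}"
 have IH: "AE x in GG J. T \<theta> (x(j := t)) ~= 0" if t: "t ~: Z" for t
 proof -
  have "AE x in GG J. (LINT q|GG J. kk rh J x q * \<Theta> t q) ~= 0"
   by (rule insert.IH[OF Thm ThC]) (use t in \<open>auto simp: Z_def\<close>)
  then show ?thesis using AE_space by eventually_elim (simp add: red)
 qed
 have Zb: "Z : sets N01"
 proof -
  have "{p : space (N01 \<Otimes>\<^sub>M GG J). \<Theta> (fst p) (snd p) = 0} : sets (N01 \<Otimes>\<^sub>M GG J)" using Thm2 by measurable
  from sets_AE[OF this] show ?thesis unfolding Z_def by simp
 qed
 have "AE t in N01. t ~: Z"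
 proof (rule ccontr)
  assume nZ: "\<not> (AE t in N01. t ~: Z)"
  have "AE t in N01. AE q in GG J. t : Z --> \<Theta> t q = 0" by (rule AE_I2) (auto simp: Z_def)
  moreover have "{p : space (N01 \<Otimes>\<^sub>M GG J). fst p : Z --> \<Theta> (fst p) (snd p) = 0} : sets (N01 \<Otimes>\<^sub>M GG J)"
   using Thm2 Zb by measurable
  ultimately have "AE q in GG J. AE t in N01. t : Z --> \<Theta> t q = 0"
   using AE_commute[of "%t q. t : Z --> \<Theta> t q = 0"] by (simp add: split_beta')
  then have "AE q in GG J. AE r in N01. \<theta> (q(j := r)) = 0" using AE_space
  proof eventually_elim
   case (elim q)
   show ?case
   proof (rule ccontr)
    assume na: "\<not> ?case"
    have "AE t in N01. \<Theta> t q ~= 0"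
     unfolding \<Theta>_def
     by (rule isolated_AE, rule k1_zero_isolated[OF rho line[OF elim(2)] insert.prems(2)[OF sp[OF elim(2)]] na])
    with elim(1) have "AE t in N01. t ~: Z" by eventually_elim auto
    then show False using nZ by simp
   qed
  qed
  then have "AE y in GG ?I. \<theta> y = 0"
   using AE_insert[OF insert.hyps(1,2), of "%y. \<theta> y = 0"] insert.prems(1) by simp
  then show False using insert.prems(3) by simp
 qed
 then have "AE t in N01. AE x in GG J. T \<theta> (x(j := t)) ~= 0" by eventually_elim (use IH in auto)
 moreover have Tm: "T \<theta> : bm (GG ?I)" using T_bdd[OF thb] by (auto simp: bdd_def)
 moreover have "{p : space (N01 \<Otimes>\<^sub>M GG J). T \<theta> ((snd p)(j := fst p)) ~= 0} : sets (N01 \<Otimes>\<^sub>M GG J)"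
 proof -
  have "(%p. T \<theta> ((snd p)(j := fst p))) : bm (N01 \<Otimes>\<^sub>M GG J)"
   using measurable_compose[OF _ measurable_compose[OF addm Tm], of "%p. (snd p, fst p)" "N01 \<Otimes>\<^sub>M GG J"] by simp
  then show ?thesis by measurable
 qed
 ultimately have "AE x in GG J. AE t in N01. T \<theta> (x(j := t)) ~= 0"
  using AE_commute[of "%t x. T \<theta> (x(j := t)) ~= 0"] by (simp add: split_beta')
 then have "AE x in GG ?I. T \<theta> x ~= 0"
  using AE_insert[OF insert.hyps(1,2), of "%y. T \<theta> y ~= 0"] Tm by simp
 then show ?case unfolding T_def .
qed

section \<open>The minimal potential along a line\<close>

lemma sets_AE_N01:
 assumes P: "{p : space (N \<Otimes>\<^sub>M N01). P (fst p) (snd p)} : sets (N \<Otimes>\<^sub>M N01)"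
 shows "{x : space N. AE z in N01. P x z} : sets N"
proof -
 define Q where "Q = space (N \<Otimes>\<^sub>M N01) - {p : space (N \<Otimes>\<^sub>M N01). P (fst p) (snd p)}"
 have Q[measurable]: "Q : sets (N \<Otimes>\<^sub>M N01)" unfolding Q_def by (rule sets.compl_sets[OF P])
 have "(AE z in N01. P x z) \<longleftrightarrow> emeasure N01 (Pair x -` Q) = 0" if x: "x : space N" for x
 proof -
  have "Pair x -` Q = {z\<in>space N01. \<not> P x z}" unfolding Q_def using x by (auto simp: space_pair_measure)
  then show ?thesis by (intro AE_iff_measurable sets_Pair1[OF Q]) simp
 qed
 then have "{x : space N. AE z in N01. P x z} = {x : space N. emeasure N01 (Pair x -` Q) = 0}" by auto
 also have "... : sets N" using N01.measurable_emeasure_Pair[OF Q] by measurable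
 finally show ?thesis .
qed

lemma AE_N01_open:
 assumes "a < b" "AE t in N01. a < t & t < b --> P t"
 shows "EX t. a < t & t < b & P t"
proof (rule ccontr)
 assume n: "\<not> ?thesis"
 have "AE t in N01. t ~: {a<..<b}" using assms(2) by eventually_elim (use n in auto)
 then show False using open_AE_N01[of "{a<..<b}" "(a + b) / 2"] assms(1) by auto
qed

text \<open>As ties are isolated, no two potentials meet in a punctured neighbourhood of
  \<open>t0\<close>. By continuity their order is fixed on either side, so a single index is minimal
  there.\<close>

lemma line_one_sided:
 fixes F U :: "nat => real => real"
 assumes cont: "!!i. i < m ==> continuous_on UNIV (U i)"
  and iso: "!!k l t0. k < m ==> l < m ==> k ~= l ==> EX ep>0. ALL t. 0 < \<bar>t - t0\<bar> --> \<bar>t - t0\<bar> < ep --> U k t ~= U l t"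
  and ae: "AE t in N01. EX k<m. F k t = 1 & (ALL l<m. U k t <= U l t)"
  and s: "s = 1 \<or> s = -1"
 shows "EX ep>0. EX k<m. AE t in N01. 0 < s * (t - t0) & s * (t - t0) < ep --> F k t = 1"
proof -
 have "ALL p:{(k, l). k < m & l < m & k ~= l}. EX ep>0. ALL t. 0 < \<bar>t - t0\<bar> --> \<bar>t - t0\<bar> < ep --> U (fst p) t ~= U (snd p) t"
  using iso by auto
 then obtain e where e: "!!k l. k < m ==> l < m ==> k ~= l ==> 0 < e (k, l)"
  "!!k l t. k < m ==> l < m ==> k ~= l ==> 0 < \<bar>t - t0\<bar> ==> \<bar>t - t0\<bar> < e (k, l) ==> U k t ~= U l t"
  using bchoice[of "{(k, l). k < m & l < m & k ~= l}" "%p e. e > 0 & (ALL t. 0 < \<bar>t - t0\<bar> --> \<bar>t - t0\<bar> < e --> U (fst p) t ~= U (snd p) t)"]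
  by (metis (mono_tags, lifting) case_prodI fst_conv mem_Collect_eq snd_conv)
 define E where "E = Min (insert 1 (e ` {(k, l). k < m & l < m & k ~= l}))"
 have "{(k, l). k < m & l < m & k ~= l} <= {..<m} \<times> {..<m}" by auto
 then have fin: "finite {(k, l). k < m & l < m & k ~= l}" by (rule finite_subset) simp
 have E: "0 < E" unfolding E_def using fin e(1) by (auto simp: Min_gr_iff)
 have Ele: "E <= e (k, l)" if "k < m" "l < m" "k ~= l" for k l
  unfolding E_def using fin that by (intro Min_le) auto
 define J where "J = {t. 0 < s * (t - t0) & s * (t - t0) < E}"
 have Jint: "J = (if s = 1 then {t0<..<t0 + E} else {t0 - E<..<t0})" unfolding J_def using s by auto
 have Jconv: "c : J" if "a : J" "b : J" "a <= c" "c <= b" for a b c using that unfolding Jint by (auto split: if_splits)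
 have ne: "U k t ~= U l t" if "t : J" "k < m" "l < m" "k ~= l" for k l t
  using e(2)[OF that(2-4), of t] Ele[OF that(2-4)] that(1) s unfolding J_def by (auto simp: abs_if split: if_splits)
 have same: "U k b < U l b" if "a : J" "b : J" "k < m" "l < m" "U k a < U l a" for a b k l
 proof (rule ccontr)
  assume "\<not> ?thesis"
  moreover have kl: "k ~= l" using that by auto
  ultimately have b: "U l b <= U k b" by simp
  have c: "continuous_on S (%t. U l t - U k t)" for S
   using that by (intro continuous_on_diff continuous_on_subset[OF cont]) auto
  have "EX t:J. U l t - U k t = 0"
  proof (cases "a <= b")
   case True
   have "EX t>=a. t <= b & U l t - U k t = 0"
    by (rule IVT2') (use that b True c in auto)
   then show ?thesis using Jconv that by blast
  next
   case False
   have "EX t>=b. t <= a & U l t - U k t = 0"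
    by (rule IVT') (use that b False c in auto)
   then show ?thesis using Jconv that by blast
  qed
  then show False using ne that kl by fastforce
 qed
 have "EX t:J. EX k<m. ALL l<m. U k t <= U l t"
 proof (rule ccontr)
  assume n: "\<not> ?thesis"
  have "AE t in N01. t ~: J" using ae by eventually_elim (use n in blast)
  moreover have "open J" "(if s = 1 then t0 + E / 2 else t0 - E / 2) : J" unfolding Jint using E by auto
  ultimately show False using open_AE_N01 by blast
 qed
 then obtain t1 k where t1: "t1 : J" "k < m" "!!l. l < m ==> U k t1 <= U l t1" by blast
 have "AE t in N01. t : J --> F k t = 1" using ae
 proof eventually_elim
  case (elim t)
  then obtain p where p: "p < m" "F p t = 1" "!!l. l < m ==> U p t <= U l t" by blast
  show ?case
  proof
   assume t: "t : J"
   have "p = k"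
   proof (rule ccontr)
    assume pk: "p ~= k"
    then have "U k t1 < U p t1" using t1(3)[OF p(1)] ne[OF t1(1) p(1) t1(2) pk] by simp
    then have "U k t < U p t" by (rule same[OF t1(1) t t1(2) p(1)])
    then show False using p(3)[OF t1(2)] by simp
   qed
   then show "F k t = 1" using p by simp
  qed
 qed
 then show ?thesis using E t1(2) unfolding J_def by auto
qed

text \<open>The local values form a locally constant function on a connected line, hence a single
  value.\<close>

lemma locally_AE_const:
 fixes ph :: "real => real"
 assumes loc: "!!t0. EX ep>0. EX v. AE t in N01. \<bar>t - t0\<bar> < ep --> ph t = v"
 shows "EX v. AE t in N01. ph t = v"
proof -
 have "ALL t0. EX e v. 0 < e & (AE t in N01. \<bar>t - t0\<bar> < e --> ph t = v)" using loc by blast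
 then obtain e V where eV: "!!t0. 0 < e t0" "!!t0. AE t in N01. \<bar>t - t0\<bar> < e t0 --> ph t = V t0"
  by metis
 have "V constant_on UNIV"
 proof (rule locally_constant_imp_constant)
  fix a :: real
  show "EX T. openin (top_of_set UNIV) T & a : T & (ALL x:T. V x = V a)"
  proof (intro exI[of _ "ball a (e a)"] conjI ballI)
   fix x assume x: "x : ball a (e a)"
   define U where "U = ball a (e a) \<inter> ball x (e x)"
   have "AE t in N01. t : U --> V x = V a"
    using eV(2)[of a] eV(2)[of x] by eventually_elim (auto simp: U_def dist_real_def abs_minus_commute)
   moreover have "open U" "x : U" unfolding U_def using x eV(1) by auto
   ultimately show "V x = V a" using open_AE_N01[of U x] by (cases "V x = V a") (auto elim: eventually_mono)
  qed (use eV(1) in auto)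
 qed simp
 then obtain v where v: "!!t. V t = v" unfolding constant_on_def by blast
 \<comment> \<open>There are countably many rational intervals, so the exceptional null sets of the
   local statements can be united.\<close>
 define B where "B = {p :: rat \<times> rat. AE t in N01. of_rat (fst p) < t & t < of_rat (snd p) --> ph t = v}"
 have "AE t in N01. ALL p:B. of_rat (fst p) < t & t < of_rat (snd p) --> ph t = v"
  by (subst AE_ball_countable) (auto simp: B_def)
 then have "AE t in N01. ph t = v"
 proof eventually_elim
  case (elim t)
  obtain a where a: "t - e t < of_rat a" "of_rat a < t" using of_rat_dense[of "t - e t" t] eV(1)[of t] by auto
  obtain b where b: "t < of_rat b" "of_rat b < t + e t" using of_rat_dense[of t "t + e t"] eV(1)[of t] by auto
  have "AE x in N01. of_rat a < x & x < of_rat b --> ph x = v"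
   using eV(2)[of t] by eventually_elim (use a b v in auto)
  then have "(a, b) : B" unfolding B_def by simp
  then show ?case using bspec[OF elim \<open>(a, b) : B\<close>] a b by simp
 qed
 then show ?thesis by blast
qed

section \<open>The noise operator on a line as a Laplace transform\<close>

context gauss
begin

definition aa :: real where "aa = rh\<^sup>2 / (2 * (1 - rh\<^sup>2))"

text \<open>What is left of the kernel once the factors in \<open>x\<close> alone are split off as
  \<open>cst\<close>. Moving \<open>x j\<close> multiplies it by an exponential of
  \<open>y j\<close>, which turns \<open>T\<close> on a line into a Laplace transform.\<close>

definition wt :: "(nat => real) => (nat => real) => real" where
 "wt x y = exp (- aa * (\<Sum>i\<in>I. (y i)\<^sup>2) + kap rh * (\<Sum>i\<in>I. x i * y i))"

definition cst :: "(nat => real) => real" where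
 "cst x = (\<Prod>i\<in>I. exp (- aa * (x i)\<^sup>2) / sqrt (1 - rh\<^sup>2))"

lemma cst_pos: "0 < cst x"
 unfolding cst_def using rho2 by (intro prod_pos) auto

lemma kap_pos: "0 < kap rh"
 unfolding kap_def using rho rho2 by simp

lemma kk_wt: "kk rh I x y = cst x * wt x y"
proof -
 have a: "- rh\<^sup>2 * t / (2 * (1 - rh\<^sup>2)) = - aa * t" for t unfolding aa_def by simp
 have "kk rh I x y = (\<Prod>i\<in>I. exp (- aa * (x i)\<^sup>2) / sqrt (1 - rh\<^sup>2) * (exp (- aa * (y i)\<^sup>2) * exp (kap rh * x i * y i)))"
  unfolding kk_def k1_factor[OF rho] a ..
 also have "... = cst x * (\<Prod>i\<in>I. exp (- aa * (y i)\<^sup>2 + kap rh * (x i * y i)))"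
  unfolding cst_def by (simp only: prod.distrib exp_add mult.assoc)
 also have "(\<Prod>i\<in>I. exp (- aa * (y i)\<^sup>2 + kap rh * (x i * y i))) = wt x y"
  unfolding wt_def exp_sum[OF fin, symmetric] by (simp add: sum.distrib sum_distrib_left sum_subtractf sum_negf)
 finally show ?thesis .
qed

lemma wt_int: "x : space (GG I) ==> integrable (GG I) (wt x)"
proof -
 assume x: "x : space (GG I)"
 have "integrable (GG I) (%y. (1 / cst x) * kk rh I x y)" using k_int(1)[OF x] by simp
 then show ?thesis using cst_pos[of x] by (simp add: kk_wt)
qed

lemma wt_upd: "j : I ==> wt (x(j := x j + s / kap rh)) y = wt x y * exp (s * y j)"
proof -
 assume j: "j : I"
 have "(\<Sum>i\<in>I. (x(j := x j + s / kap rh)) i * y i) = (\<Sum>i\<in>I. x i * y i + (if i = j then s / kap rh * y j else 0))"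
  by (intro sum.cong) (auto simp: algebra_simps)
 also have "... = (\<Sum>i\<in>I. x i * y i) + s / kap rh * y j" using j fin by (simp add: sum.distrib)
 finally show ?thesis unfolding wt_def using kap_pos by (simp add: distrib_left flip: exp_add)
qed

lemma wt_exp_int:
 assumes "x : space (GG I)" "j : I" "c : I"
 shows "integrable (GG I) (%y. wt x y * exp (s * y j) * exp (s' * y c))"
proof -
 have "integrable (GG I) (wt ((x(j := x j + s / kap rh))(c := (x(j := x j + s / kap rh)) c + s' / kap rh)))"
  by (intro wt_int space_upd assms)
 moreover have "wt ((x(j := x j + s / kap rh))(c := (x(j := x j + s / kap rh)) c + s' / kap rh)) = (%y. wt x y * exp (s * y j) * exp (s' * y c))"
  by (rule ext) (simp only: wt_upd[OF assms(3)] wt_upd[OF assms(2)])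
 ultimately show ?thesis by simp
qed

lemma wt_pos: "0 < wt x y" unfolding wt_def by simp

lemma wt_abs_int:
 assumes "x : space (GG I)" "j : I" "c : I" and b: "bdd (GG I) \<theta>"
 shows "integrable (GG I) (%y. \<bar>\<theta> y * wt x y\<bar> * exp (s * \<bar>y j\<bar>) * exp (s' * \<bar>y c\<bar>))"
proof -
 obtain C where C: "0 < C" "!!y. y : space (GG I) ==> \<bar>\<theta> y\<bar> <= C" using bdd_obtain[OF b] by blast
 have tm[measurable]: "\<theta> : bm (GG I)" using b by (auto simp: bdd_def)
 have wm[measurable]: "wt x : bm (GG I)" using wt_int[OF assms(1)] by auto
 note [measurable] = assms(2,3)
 let ?W = "%e e' y. wt x y * exp (e * y j) * exp (e' * y c)"
 show ?thesis
 proof (rule BI_integrable_bound)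
  show "integrable (GG I) (%y. C * (?W s s' y + ?W (- s) s' y + ?W s (- s') y + ?W (- s) (- s') y))"
   by (intro integrable_mult_right BI_integrable_add wt_exp_int assms)
  show "(%y. \<bar>\<theta> y * wt x y\<bar> * exp (s * \<bar>y j\<bar>) * exp (s' * \<bar>y c\<bar>)) : bm (GG I)" by measurable
  show "AE y in GG I. norm (\<bar>\<theta> y * wt x y\<bar> * exp (s * \<bar>y j\<bar>) * exp (s' * \<bar>y c\<bar>)) <=
    norm (C * (?W s s' y + ?W (- s) s' y + ?W s (- s') y + ?W (- s) (- s') y))"
  proof (rule AE_I2)
   fix y assume y: "y : space (GG I)"
   have e: "exp (q * \<bar>t\<bar>) <= exp (q * t) + exp (- q * t)" for q t :: real by (cases "t < 0") auto
   have "\<bar>\<theta> y * wt x y\<bar> * exp (s * \<bar>y j\<bar>) * exp (s' * \<bar>y c\<bar>) <=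
    (C * wt x y) * (exp (s * y j) + exp (- s * y j)) * (exp (s' * y c) + exp (- s' * y c))"
    unfolding abs_mult using C(2)[OF y] wt_pos[of x y] C(1)
    by (intro mult_mono e mult_nonneg_nonneg) auto
   also have "... = C * (?W s s' y + ?W (- s) s' y + ?W s (- s') y + ?W (- s) (- s') y)"
    by (simp only: distrib_left distrib_right mult.assoc add.assoc add.left_commute)
   finally show "norm (\<bar>\<theta> y * wt x y\<bar> * exp (s * \<bar>y j\<bar>) * exp (s' * \<bar>y c\<bar>)) <=
    norm (C * (?W s s' y + ?W (- s) s' y + ?W s (- s') y + ?W (- s) (- s') y))" by simp
  qed
 qed
qed

definition LL :: "((nat => real) => real) => nat => nat => (nat => real) => real" where
 "LL \<theta> j n x = (LINT y|GG I. \<theta> y * wt x y * (y j) ^ n)"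

lemma T_LL: "T \<theta> x = cst x * LL \<theta> j 0 x"
 unfolding T_def LL_def kk_wt by (simp flip: integral_mult_right_zero add: mult_ac)

lemma glap_wt: "x : space (GG I) ==> j : I ==> bdd (GG I) \<theta> ==> glap (GG I) (%y. \<theta> y * wt x y) (%y. y j)"
 unfolding glap_def using wt_abs_int[of x j j \<theta> _ 0] wt_int[of x] by (auto simp: bdd_def)

text \<open>If all weighted moments of \<open>y j\<close> vanished, the transform, and with it
  \<open>T \<theta>\<close>, would be 0 on the whole line. Otherwise the first nonzero moment makes
  a zero at \<open>x j\<close> isolated.\<close>

lemma line_order:
 assumes x: "x : space (GG I)" and j: "j : I" and b: "bdd (GG I) \<theta>" and nz: "EX t. T \<theta> (x(j := t)) ~= 0"
 shows "EX n. LL \<theta> j n x ~= 0 & (ALL i<n. LL \<theta> j i x = 0)"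
  and "EX ep>0. ALL t. 0 < \<bar>t - x j\<bar> --> \<bar>t - x j\<bar> < ep --> T \<theta> (x(j := t)) ~= 0"
proof -
 note gl = glap_wt[OF x j b]
 have Tl: "T \<theta> (x(j := t)) = cst (x(j := t)) * (LINT y|GG I. \<theta> y * wt x y * exp ((kap rh * (t - x j)) * y j))" for t
 proof -
  have "x(j := t) = x(j := x j + (kap rh * (t - x j)) / kap rh)" using kap_pos by simp
  then have "wt (x(j := t)) y = wt x y * exp ((kap rh * (t - x j)) * y j)" for y using wt_upd[OF j, of x] by metis
  then show ?thesis unfolding T_LL[of _ _ j] LL_def by (simp add: mult.assoc)
 qed
 have ex: "EX n. LL \<theta> j n x ~= 0"
 proof (rule ccontr)
  assume "\<not> ?thesis"
  then have z: "(LINT y|GG I. \<theta> y * wt x y * (y j) ^ n) = 0" for n using LL_def by metis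
  have zz: "(LINT y|GG I. \<theta> y * wt x y * exp (u * y j)) = 0" for u
  proof -
   have "(%n. 0) sums (LINT y|GG I. \<theta> y * wt x y * exp (u * y j))"
    using glap_series_real[OF gl, of u] unfolding z by simp
   then show ?thesis using sums_unique2[OF _ sums_zero] by blast
  qed
  obtain t where "T \<theta> (x(j := t)) ~= 0" using nz by blast
  then show False unfolding Tl zz by simp
 qed
 have ex': "EX n. (LINT y|GG I. \<theta> y * wt x y * (y j) ^ n) ~= 0" using ex LL_def by metis
 obtain n e where ne': "(LINT y|GG I. \<theta> y * wt x y * (y j) ^ n) ~= 0" "!!i. i < n ==> (LINT y|GG I. \<theta> y * wt x y * (y j) ^ i) = 0" "0 < e"
  "!!u. 0 < \<bar>u\<bar> ==> \<bar>u\<bar> < e ==> (LINT y|GG I. \<theta> y * wt x y * exp (u * y j)) ~= 0"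
  by (rule glap_order[OF gl ex']) (rule that)
 have ne: "LL \<theta> j n x ~= 0" "!!i. i < n ==> LL \<theta> j i x = 0" using ne'(1,2) unfolding LL_def .
 show "EX n. LL \<theta> j n x ~= 0 & (ALL i<n. LL \<theta> j i x = 0)" using ne by blast
 show "EX ep>0. ALL t. 0 < \<bar>t - x j\<bar> --> \<bar>t - x j\<bar> < ep --> T \<theta> (x(j := t)) ~= 0"
 proof (intro exI[of _ "e / kap rh"] conjI allI impI)
  show "0 < e / kap rh" using ne'(3) kap_pos by simp
  fix t assume t: "0 < \<bar>t - x j\<bar>" "\<bar>t - x j\<bar> < e / kap rh"
  have "\<bar>kap rh * (t - x j)\<bar> = kap rh * \<bar>t - x j\<bar>" using kap_pos by (metis abs_mult abs_of_pos)
  moreover have "kap rh * \<bar>t - x j\<bar> < e" using t(2) kap_pos by (simp add: pos_less_divide_eq mult.commute)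
  moreover have "0 < kap rh * \<bar>t - x j\<bar>" using t(1) kap_pos by simp
  ultimately show "T \<theta> (x(j := t)) ~= 0" unfolding Tl using ne'(4)[of "kap rh * (t - x j)"] cst_pos[of "x(j := t)"] by simp
 qed
qed

end

lemma zero_less_one_real: "(0::real) < 1" by simp

lemma k1_int:
 assumes rho: "0 < rh" "rh < 1"
 shows "integrable N01 (k1 rh t)" "(LINT r|N01. k1 rh t r) = 1"
proof -
 have m: "k1 rh t : bm N01" by (intro k1_meas) (auto intro: measurable_ident_sets)
 have p: "0 <= k1 rh t r" for r using k1_pos[OF rho, of t r] by simp
 show "integrable N01 (k1 rh t)" using m p nn_k1_1[OF rho, of t] by (intro integrableI_nonneg) (auto intro: AE_I2)
 show "(LINT r|N01. k1 rh t r) = 1" using m p nn_k1_1[OF rho, of t] by (subst integral_eq_nn_integral) auto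
qed

section \<open>Crossings: interfaces seen along lines\<close>

locale gminj = gmin I rh m f g lam mu for I rh m f g lam mu +
 fixes j :: nat
 assumes jI: "j : I" and J_ne: "I - {j} ~= {}"
  and mom_f: "!!i. i < m ==> (LINT x|GG I. f i x * x j) = 0"
  and mom_g: "!!i. i < m ==> (LINT x|GG I. g i x * x j) = 0"
begin

lemma jswap: "gminj I rh m g f mu lam j"
 by (intro gminj.intro gswap gminj_axioms.intro jI J_ne mom_f mom_g)

abbreviation J where "J \<equiv> I - {j}"

lemma insJ: "insert j J = I" "finite J" "j ~: J" using jI fin by auto

lemma spJ: "q : space (GG J) ==> q(j := t) : space (GG I)"
 using jI by (auto simp: space_PiM PiE_iff extensional_def)

lemma measJ[measurable]:
 assumes "h : M \<rightarrow>\<^sub>M GG J" "u : bm M"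
 shows "(%x. (h x)(j := u x)) : M \<rightarrow>\<^sub>M GG I"
proof -
 have a: "(%(f, y). f(j := y)) : GG J \<Otimes>\<^sub>M N01 \<rightarrow>\<^sub>M GG I"
  using measurable_add_dim[of j J "%_. N01"] insJ by simp
 have b: "(%x. (h x, u x)) : M \<rightarrow>\<^sub>M GG J \<Otimes>\<^sub>M N01" using assms by simp
 from measurable_compose[OF b a] show ?thesis by simp
qed

lemma AE_J:
 assumes "{x\<in>space (GG I). P x} : sets (GG I)"
 shows "(AE x in GG I. P x) \<longleftrightarrow> (AE q in GG J. AE t in N01. P (q(j := t)))"
 using AE_insert[OF insJ(2,3), of P] assms unfolding insJ .

lemma AE_J_fwd:
 assumes "AE x in GG I. P x"
 shows "AE q in GG J. AE t in N01. P (q(j := t))"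
proof -
 obtain N where N: "{x\<in>space (GG I). \<not> P x} <= N" "emeasure (GG I) N = 0" "N : sets (GG I)"
  using AE_E[OF assms] .
 have "AE x in GG I. x ~: N" using AE_not_in[of N "GG I"] N by auto
 moreover have "{x\<in>space (GG I). x ~: N} : sets (GG I)" using N by auto
 ultimately have "AE q in GG J. AE t in N01. q(j := t) ~: N" using AE_J[of "%x. x ~: N"] by blast
 then show ?thesis using AE_space
 proof eventually_elim
  case (elim q)
  show ?case using elim(1) by eventually_elim (use N(1) spJ[OF elim(2)] in auto)
 qed
qed

lemma int_J:
 fixes F :: "(nat => real) => real"
 assumes "integrable (GG I) F"
 shows "(LINT x|GG I. F x) = (LINT q|GG J. (LINT t|N01. F (q(j := t))))"
 using NP.product_integral_insert[OF insJ(2,3), of F] assms unfolding insJ by simp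

lemma kk_J: "kk rh I (x(j := t)) (q(j := r)) = k1 rh t r * kk rh J x q"
 using kk_split[OF jI, of "x(j := t)" "q(j := r)"] by (simp add: kk_upd1 kk_upd2)

definition jinv :: "((nat => real) => real) => bool" where
 "jinv ph \<longleftrightarrow> (AE q in GG J. EX v. AE t in N01. ph (q(j := t)) = v)"

text \<open>\<open>T\<close> fixes constants, so the multipliers can be put under it:
  \<open>T (th k l)\<close> is the difference of the potentials k and l.\<close>

definition th :: "nat => nat => (nat => real) => real" where
 "th k l y = g k y - g l y - (lam k - lam l)"

lemma th_bdd: "k < m ==> l < m ==> bdd (GG I) (th k l)"
 unfolding th_def[abs_def] by (intro bdd_diff gb bdd_const)

lemma T_th: "k < m ==> l < m ==> x : space (GG I) ==> T (th k l) x = (T (g k) x - lam k) - (T (g l) x - lam l)"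
 unfolding th_def[abs_def] by (simp add: T_diff T_const gb bdd_diff)

text \<open>By \<open>T_zero_null\<close> it is enough that \<open>th k l\<close> does not vanish
  a.e. On cell k of \<open>g\<close> its value exceeds the value on cell l by 2, so it cannot be 0
  on both, and both have positive volume.\<close>

lemma tie_null:
 assumes kl: "k < m" "l < m" "k ~= l"
 shows "AE x in GG I. T (th k l) x ~= 0"
proof -
 interpret S: gmin I rh m g f mu lam by (rule gswap)
 have nz: "\<not> (AE x in GG I. g i x = 0)" if "i < m" for i
 proof
  assume "AE x in GG I. g i x = 0"
  then have "(LINT x|GG I. g i x) = 0" by (rule integral_eq_zero_AE)
  then show False using g_vol[OF that] by simp
 qed
 have "\<not> (AE y in GG I. th k l y = 0)"
 proof
  assume z: "AE y in GG I. th k l y = 0"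
  have c: "lam k - lam l = 1"
  proof (rule ccontr)
   assume n: "lam k - lam l ~= 1"
   have "AE y in GG I. g k y = 0" using z AE_space
   proof eventually_elim
    case (elim y)
    show ?case
    proof (rule ccontr)
     assume "g k y ~= 0"
     then have "g k y = 1" using g_01[OF kl(1) elim(2)] by auto
     moreover from this have "g l y = 0" using S.f_zero[OF elim(2) kl(1) _ kl(2)] kl(3) by auto
     ultimately show False using elim(1) n unfolding th_def by simp
    qed
   qed
   then show False using nz kl by blast
  qed
  have "AE y in GG I. g l y = 0" using z AE_space
  proof eventually_elim
   case (elim y)
   show ?case
   proof (rule ccontr)
    assume "g l y ~= 0"
    then have 1: "g l y = 1" using g_01[OF kl(2) elim(2)] by auto
    have "g k y = 0" using S.f_zero[OF elim(2) kl(2) 1 kl(1) kl(3)] .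
    then show False using elim(1) c 1 unfolding th_def by simp
   qed
  qed
  then show False using nz kl by blast
 qed
 moreover obtain C where "!!y. y : space (GG I) ==> \<bar>th k l y\<bar> <= C" using bdd_obtain[OF th_bdd[OF kl(1,2)]] by blast
 ultimately show ?thesis
  unfolding T_def using T_zero_null[OF rho fin bdd_meas[OF th_bdd[OF kl(1,2)]]] by blast
qed

lemma tie_isolated:
 assumes kl: "k < m" "l < m" "k ~= l"
 shows "AE q in GG J. ALL t0. EX ep>0. ALL t. 0 < \<bar>t - t0\<bar> --> \<bar>t - t0\<bar> < ep --> T (g k) (q(j := t)) - lam k ~= T (g l) (q(j := t)) - lam l"
 using AE_J_fwd[OF tie_null[OF kl]] AE_space
proof eventually_elim
 case (elim q)
 have A: "AE t in N01. (0::real) < t & t < 1 --> T (th k l) (q(j := t)) ~= 0" using elim(1) by eventually_elim simp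
 obtain t1 where t1: "T (th k l) (q(j := t1)) ~= 0" using AE_N01_open[OF zero_less_one_real A] by blast
 show ?case
 proof
  fix t0
  have "EX ep>0. ALL t. 0 < \<bar>t - (q(j := t0)) j\<bar> --> \<bar>t - (q(j := t0)) j\<bar> < ep --> T (th k l) ((q(j := t0))(j := t)) ~= 0"
   by (rule line_order(2)[OF spJ[OF elim(2)] jI th_bdd[OF kl(1,2)]]) (use t1 in auto)
  then show "EX ep>0. ALL t. 0 < \<bar>t - t0\<bar> --> \<bar>t - t0\<bar> < ep --> T (g k) (q(j := t)) - lam k ~= T (g l) (q(j := t)) - lam l"
   using T_th[OF kl(1,2) spJ[OF elim(2)]] by simp
 qed
qed

text \<open>If the line over \<open>q\<close> passes once from cell k to cell l within the window,
  the length spent in cell k locates the passage. Being an integral, this height is measurable in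
  \<open>q\<close>.\<close>

definition tau :: "nat => real => real => (nat => real) => real" where
 "tau k al be q = al + (LINT t|lborel. indicator {al<..<be} t * f k (q(j := t)))"

text \<open>The margin \<open>\<iota>\<close> leaves room on both sides of the passage for layers of
  thickness below \<open>\<iota>\<close>.\<close>

definition cross :: "nat => nat => real => real => real => (nat => real) set" where
 "cross k l al be \<iota> = {q : space (GG J). al + \<iota> < tau k al be q & tau k al be q < be - \<iota> \<and>
  (AE t in N01. (al < t & t < tau k al be q --> f k (q(j := t)) = 1) & (tau k al be q < t & t < be --> f l (q(j := t)) = 1))}"

lemma fm: "k < m ==> f k : bm (GG I)" and gm: "k < m ==> g k : bm (GG I)"
 using fb gb by (auto simp: bdd_def)

lemma tau_meas[measurable]: "k < m ==> tau k al be : bm (GG J)"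
proof -
 assume k: "k < m"
 note [measurable] = fm[OF k]
 have "(%p. indicator {al<..<be} (snd p) * f k ((fst p)(j := snd p))) : bm (GG J \<Otimes>\<^sub>M lborel)" by measurable
 then have "(%q. (LINT t|lborel. indicator {al<..<be} t * f k (q(j := t)))) : bm (GG J)"
  by (intro lborel.borel_measurable_lebesgue_integral) (simp add: split_beta')
 then show ?thesis unfolding tau_def[abs_def] by simp
qed

lemma cross_sets: "k < m ==> l < m ==> cross k l al be \<iota> : sets (GG J)"
proof -
 assume k: "k < m" "l < m"
 note [measurable] = fm[OF k(1)] fm[OF k(2)] tau_meas[OF k(1)]
 have [measurable]: "{q : space (GG J). AE t in N01. (al < t & t < tau k al be q --> f k (q(j := t)) = 1) & (tau k al be q < t & t < be --> f l (q(j := t)) = 1)} : sets (GG J)"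
  by (rule sets_AE_N01) measurable
 have "cross k l al be \<iota> = {q : space (GG J). al + \<iota> < tau k al be q} \<inter> {q : space (GG J). tau k al be q < be - \<iota>} \<inter>
  {q : space (GG J). AE t in N01. (al < t & t < tau k al be q --> f k (q(j := t)) = 1) & (tau k al be q < t & t < be --> f l (q(j := t)) = 1)}"
  unfolding cross_def by auto
 also have "... : sets (GG J)" by (intro sets.Int) measurable
 finally show ?thesis .
qed

lemma mem_cross:
 assumes q: "q : space (GG J)" and kl: "k < m" "l < m" "k ~= l"
  and ab: "al + \<iota> < t0" "t0 < be - \<iota>" "0 < \<iota>"
  and L: "AE t in N01. al < t & t < t0 --> f k (q(j := t)) = 1"
  and R: "AE t in N01. t0 < t & t < be --> f l (q(j := t)) = 1"
 shows "q : cross k l al be \<iota>"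
proof -
 note [measurable] = fm[OF kl(1)]
 have qc: "(%_. q) : borel \<rightarrow>\<^sub>M GG J" using q by simp
 have m1: "(%t. f k (q(j := t))) : bm borel"
  by (rule measurable_compose[OF measJ[OF qc] fm[OF kl(1)]]) simp
 have "(LINT t|lborel. indicator {al<..<be} t * f k (q(j := t))) = (LINT t|lborel. indicator {al<..<t0} t)"
 proof (rule integral_cong_AE)
  have "AE t in lborel. t ~= t0" by (rule AE_lborel_singleton)
  then show "AE t in lborel. indicator {al<..<be} t * f k (q(j := t)) = (indicator {al<..<t0} t :: real)"
   using L[unfolded AE_N01] R[unfolded AE_N01]
  proof eventually_elim
   case (elim t)
   consider "t <= al" | "al < t" "t < t0" | "t0 < t" "t < be" | "be <= t" using elim(1) by linarith
   then show ?case
   proof cases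
    case 3
    then have "f l (q(j := t)) = 1" using elim by auto
    then have "f k (q(j := t)) = 0" using f_zero[OF spJ[OF q] kl(2) _ kl(1,3)] by blast
    then show ?thesis using 3 by auto
   qed (use elim ab in auto)
  qed
  show "(%t. indicator {al<..<be} t * f k (q(j := t))) : bm lborel" using m1 by (intro borel_measurable_times) auto
  show "(indicator {al<..<t0} :: real => real) : bm lborel" by simp
 qed
 also have "... = t0 - al" using ab by simp
 finally have t: "tau k al be q = t0" unfolding tau_def by simp
 have "AE t in N01. (al < t & t < t0 --> f k (q(j := t)) = 1) & (t0 < t & t < be --> f l (q(j := t)) = 1)"
  using L R by eventually_elim simp
 then show ?thesis unfolding cross_def mem_Collect_eq t using q ab by blast
qed

lemma mult_line: "AE q in GG J. AE t in N01. EX k<m. f k (q(j := t)) = 1 & (ALL l<m. T (g k) (q(j := t)) - lam k <= T (g l) (q(j := t)) - lam l)"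
proof (rule AE_J_fwd)
 show "AE x in GG I. EX k<m. f k x = 1 & (ALL l<m. T (g k) x - lam k <= T (g l) x - lam l)"
  using ex_nonneg AE_space
 proof eventually_elim
  case (elim x)
  obtain p where p: "p < m" "f p x = 1" using f_unique[OF elim(2)] by blast
  then show ?case using elim(1) ww_val[OF elim(2) p] unfolding ex_def by (intro exI[of _ p]) auto
 qed
qed

text \<open>On a typical line, near every point, one cell prevails on each side. If the two always
  had equal weights \<open>c\<close>, the weighted sum would be locally constant, hence constant, on
  almost every line. Windows with rational ends and margins \<open>1 / (n + 1)\<close> form a
  countable family, so one of its crossing sets is not null.\<close>

lemma crossing:
 assumes n: "\<not> jinv (%x. \<Sum>i<m. c i * f i x)"
 shows "EX k l al be \<iota>. k < m & l < m & c k ~= c l & 0 < \<iota> & \<not> (AE q in GG J. q ~: cross k l al be \<iota>)"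
proof (rule ccontr)
 assume no: "\<not> ?thesis"
 have "AE q in GG J. ALL al::rat. ALL be::rat. ALL n::nat. ALL k::nat. ALL l::nat. k < m & l < m & c k ~= c l --> q ~: cross k l (of_rat al) (of_rat be) (inverse (of_nat (Suc n)))"
  unfolding AE_all_countable
 proof (intro allI)
  fix al be :: rat and n k l :: nat
  show "AE q in GG J. k < m & l < m & c k ~= c l --> q ~: cross k l (of_rat al) (of_rat be) (inverse (of_nat (Suc n)))"
  proof (cases "k < m & l < m & c k ~= c l")
   case True
   have "0 < inverse (of_nat (Suc n) :: real)" by simp
   then have "AE q in GG J. q ~: cross k l (of_rat al) (of_rat be) (inverse (of_nat (Suc n)))" using no True by blast
   then show ?thesis by (rule eventually_mono) simp
  next
   case False
   show ?thesis by (rule AE_I2) (use False in blast)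
  qed
 qed
 moreover have "AE q in GG J. ALL k:{..<m}. ALL l:{..<m}. k ~= l --> (ALL t0. EX ep>0. ALL t. 0 < \<bar>t - t0\<bar> --> \<bar>t - t0\<bar> < ep --> T (g k) (q(j := t)) - lam k ~= T (g l) (q(j := t)) - lam l)"
 proof (intro AE_finite_allI finite_lessThan)
  fix k l assume kl: "k : {..<m}" "l : {..<m}"
  show "AE q in GG J. k ~= l --> (ALL t0. EX ep>0. ALL t. 0 < \<bar>t - t0\<bar> --> \<bar>t - t0\<bar> < ep --> T (g k) (q(j := t)) - lam k ~= T (g l) (q(j := t)) - lam l)"
  proof (cases "k = l")
   case False
   have "AE q in GG J. ALL t0. EX ep>0. ALL t. 0 < \<bar>t - t0\<bar> --> \<bar>t - t0\<bar> < ep --> T (g k) (q(j := t)) - lam k ~= T (g l) (q(j := t)) - lam l"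
    by (rule tie_isolated) (use kl False in auto)
   then show ?thesis by (rule eventually_mono) simp
  qed simp
 qed
 ultimately have "jinv (%x. \<Sum>i<m. c i * f i x)"
  unfolding jinv_def using mult_line AE_space
 proof eventually_elim
  case (elim q)
  have one: "EX ep>0. EX k<m. AE t in N01. 0 < s * (t - t0) & s * (t - t0) < ep --> f k (q(j := t)) = 1" if "s = 1 \<or> s = -1" for s t0 :: real
  proof (rule line_one_sided[where U="%i t. T (g i) (q(j := t)) - lam i" and F="%i t. f i (q(j := t))"])
   fix i assume i: "i < m"
   have "continuous_on UNIV (%t. T (g i) ((q(j := 0))(j := t)))" by (rule T_cont[OF spJ[OF elim(4)] jI gb[OF i]])
   then show "continuous_on UNIV (%t. T (g i) (q(j := t)) - lam i)" by (auto intro!: continuous_intros)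
  next
   fix k l and t0 :: real assume "k < m" "l < m" "k ~= l"
   then show "EX ep>0. ALL t. 0 < \<bar>t - t0\<bar> --> \<bar>t - t0\<bar> < ep --> T (g k) (q(j := t)) - lam k ~= T (g l) (q(j := t)) - lam l"
    using elim(2) by blast
  qed (use elim(3) that in auto)
  show ?case
  proof (rule locally_AE_const)
   fix t0 :: real
   obtain e1 k where k: "0 < e1" "k < m" and k1: "AE t in N01. 0 < (-1) * (t - t0) & (-1) * (t - t0) < e1 --> f k (q(j := t)) = 1"
    using one[of "-1" t0] by blast
   obtain e2 l where l: "0 < e2" "l < m" and l1: "AE t in N01. 0 < 1 * (t - t0) & 1 * (t - t0) < e2 --> f l (q(j := t)) = 1"
    using one[of "1" t0] by blast
   define e where "e = min e1 e2"
   have e: "0 < e" "e <= e1" "e <= e2" unfolding e_def using k l by auto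
   have L: "AE t in N01. t0 - e < t & t < t0 --> f k (q(j := t)) = 1" using k1 by eventually_elim (use e in auto)
   have R: "AE t in N01. t0 < t & t < t0 + e --> f l (q(j := t)) = 1" using l1 by eventually_elim (use e in auto)
   have ckl: "c k = c l"
   proof (rule ccontr)
    assume ne: "c k ~= c l"
    obtain al where a: "t0 - e < of_rat al" "of_rat al < t0" using of_rat_dense[of "t0 - e" t0] e by auto
    obtain be where b: "t0 < of_rat be" "of_rat be < t0 + e" using of_rat_dense[of t0 "t0 + e"] e by auto
    have "0 < min (t0 - of_rat al) (of_rat be - t0)" using a b by simp
    then obtain n where n: "inverse (of_nat (Suc n)) < min (t0 - of_rat al) (of_rat be - t0)" using reals_Archimedean by blast
    have "q : cross k l (of_rat al) (of_rat be) (inverse (of_nat (Suc n)))"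
    proof (rule mem_cross[OF elim(4) k(2) l(2), where ?t0.0=t0])
     show "k ~= l" using ne by auto
     show "of_rat al + inverse (of_nat (Suc n)) < t0" "t0 < of_rat be - inverse (of_nat (Suc n))" using n by linarith+
     show "0 < inverse (of_nat (Suc n) :: real)" by simp
     show "AE t in N01. of_rat al < t & t < t0 --> f k (q(j := t)) = 1" using L by eventually_elim (use a in auto)
     show "AE t in N01. t0 < t & t < of_rat be --> f l (q(j := t)) = 1" using R by eventually_elim (use b in auto)
    qed
    then show False using elim(1) k(2) l(2) ne by blast
   qed
   have val: "(\<Sum>i<m. c i * f i (q(j := t))) = c p" if "p < m" "f p (q(j := t)) = 1" for p t
   proof -
    have "(\<Sum>i<m. c i * f i (q(j := t))) = (\<Sum>i<m. if i = p then c p else 0)"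
     using that f_zero[OF spJ[OF elim(4)] that] by (intro sum.cong) auto
    then show ?thesis using that by simp
   qed
   have "AE t in N01. t ~= t0" unfolding AE_N01 by (rule AE_lborel_singleton)
   then have "AE t in N01. \<bar>t - t0\<bar> < e --> (\<Sum>i<m. c i * f i (q(j := t))) = c k" using L R
   proof eventually_elim
    case (elim t)
    show ?case
    proof
     assume t: "\<bar>t - t0\<bar> < e"
     show "(\<Sum>i<m. c i * f i (q(j := t))) = c k"
     proof (cases "t < t0")
      case True
      then show ?thesis using val[OF k(2)] elim t by (auto simp: abs_if)
     next
      case False
      then have "t0 < t" using elim(1) by simp
      then show ?thesis using val[OF l(2)] elim t ckl by (auto simp: abs_if)
     qed
    qed
   qed
   then show "EX ep>0. EX v. AE t in N01. \<bar>t - t0\<bar> < ep --> (\<Sum>i<m. c i * f i (q(j := t))) = v" using e(1) by blast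
  qed
 qed
 then show False using n by blast
qed

text \<open>Where \<open>ph\<close> is constant on the line, the kernel in coordinate j integrates
  to 1 and the height \<open>t\<close> drops out.\<close>

lemma jinv_T:
 assumes b: "bdd (GG I) ph" and i: "jinv ph" and x: "x : space (GG J)"
 shows "T ph (x(j := t)) = (LINT q|GG J. kk rh J x q * (LINT r|N01. ph (q(j := r))))"
proof -
 have [measurable]: "ph : bm (GG I)" using b by (auto simp: bdd_def)
 interpret GJ: gauss J rh by (intro gauss.intro insJ(2) J_ne rho)
 have [measurable]: "kk rh J x : bm (GG J)" using GJ.k_section[OF x] .
 have "T ph (x(j := t)) = (LINT q|GG J. (LINT r|N01. kk rh I (x(j := t)) (q(j := r)) * ph (q(j := r))))"
  unfolding T_def by (rule int_J[OF kf_int[OF b spJ[OF x]]])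
 also have "... = (LINT q|GG J. (LINT r|N01. k1 rh t r * kk rh J x q * ph (q(j := r))))" unfolding kk_J ..
 also have "... = (LINT q|GG J. kk rh J x q * (LINT r|N01. ph (q(j := r))))"
 proof (rule integral_cong_AE)
  show "(%q. (LINT r|N01. k1 rh t r * kk rh J x q * ph (q(j := r)))) : bm (GG J)"
   by (intro N01.borel_measurable_lebesgue_integral) (simp add: split_beta')
  show "(%q. kk rh J x q * (LINT r|N01. ph (q(j := r)))) : bm (GG J)"
   by (intro borel_measurable_times N01.borel_measurable_lebesgue_integral) (simp_all add: split_beta')
  show "AE q in GG J. (LINT r|N01. k1 rh t r * kk rh J x q * ph (q(j := r))) = kk rh J x q * (LINT r|N01. ph (q(j := r)))"
   using i[unfolded jinv_def] AE_space
  proof eventually_elim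
   case (elim q)
   then obtain v where v: "AE r in N01. ph (q(j := r)) = v" by blast
   have qc: "(%_. q) : N01 \<rightarrow>\<^sub>M GG J" using elim by simp
   have [measurable]: "(%r. ph (q(j := r))) : bm N01"
    by (rule measurable_compose[OF measJ[OF qc]]) (simp_all add: N01_meas)
   have 1: "(LINT r|N01. ph (q(j := r))) = (LINT r|N01. v)" by (rule integral_cong_AE) (use v in auto)
   have "(LINT r|N01. k1 rh t r * kk rh J x q * ph (q(j := r))) = (LINT r|N01. (kk rh J x q * v) * k1 rh t r)"
   proof (rule integral_cong_AE)
    show "AE r in N01. k1 rh t r * kk rh J x q * ph (q(j := r)) = (kk rh J x q * v) * k1 rh t r"
     using v by eventually_elim simp
    show "(%r. k1 rh t r * kk rh J x q * ph (q(j := r))) : bm N01"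
     by (intro borel_measurable_times borel_measurable_const \<open>(%r. ph (q(j := r))) : bm N01\<close>
      borel_measurable_integrable[OF k1_int(1)[OF rho]])
    show "(%r. kk rh J x q * v * k1 rh t r) : bm N01"
     by (intro borel_measurable_times borel_measurable_const borel_measurable_integrable[OF k1_int(1)[OF rho]])
   qed
   also have "... = kk rh J x q * v" using k1_int(2)[OF rho] by simp
   finally show ?case using 1 N01.prob_space by simp
  qed
 qed
 finally show ?thesis .
qed

text \<open>Otherwise the difference of the potentials k and l would be constant on lines. The
  multiplier rule makes it at most 0 before a passage from k to l and at least 0 after it, so it
  would be 0; but ties are null.\<close>

lemma cross_not_inv:
 assumes kl: "k < m" "l < m" "k ~= l" and i: "0 < \<iota>" and c: "\<not> (AE q in GG J. q ~: cross k l al be \<iota>)"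
 shows "\<not> jinv (%x. g k x - g l x)"
proof
 assume inv: "jinv (%x. g k x - g l x)"
 have inv': "jinv (th k l)"
  unfolding jinv_def using inv[unfolded jinv_def]
 proof eventually_elim
  case (elim q)
  then obtain v where "AE t in N01. g k (q(j := t)) - g l (q(j := t)) = v" by blast
  then have "AE t in N01. th k l (q(j := t)) = v - (lam k - lam l)" by eventually_elim (simp add: th_def)
  then show ?case by blast
 qed
 have "AE q in GG J. q ~: cross k l al be \<iota>"
  using AE_J_fwd[OF tie_null[OF kl]] mult_line AE_space
 proof eventually_elim
  case (elim q)
  show ?case
  proof
   assume q: "q : cross k l al be \<iota>"
   define v where "v = T (th k l) (q(j := 0))"
   have v: "T (th k l) (q(j := t)) = v" for t
    unfolding v_def jinv_T[OF th_bdd[OF kl(1,2)] inv' elim(3)] ..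
   let ?t = "tau k al be q"
   have ab: "al < ?t" "?t < be" using q i unfolding cross_def by auto
   have cr: "AE t in N01. (al < t & t < ?t --> f k (q(j := t)) = 1) & (?t < t & t < be --> f l (q(j := t)) = 1)"
    using q unfolding cross_def by blast
   have u: "p = p'" if "f p (q(j := t)) = 1" "f p' (q(j := t)) = 1" "p < m" "p' < m" for p p' t
    using f_unique[OF spJ[OF elim(3), of t]] that by blast
   have "AE t in N01. al < t & t < ?t --> v <= 0" using cr elim(2)
   proof eventually_elim
    case (elim t)
    show ?case
    proof
     assume "al < t & t < ?t"
     then have "f k (q(j := t)) = 1" using elim by blast
     then have "T (g k) (q(j := t)) - lam k <= T (g l) (q(j := t)) - lam l" using elim(2) u kl by blast
     then show "v <= 0" using T_th[OF kl(1,2) spJ[OF \<open>q : space (GG J)\<close>], of t] v[of t] by simp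
    qed
   qed
   then have "v <= 0" using AE_N01_open[OF ab(1), of "%_. v <= 0"] by blast
   moreover have "AE t in N01. ?t < t & t < be --> 0 <= v" using cr elim(2)
   proof eventually_elim
    case (elim t)
    show ?case
    proof
     assume "?t < t & t < be"
     then have "f l (q(j := t)) = 1" using elim by blast
     then have "T (g l) (q(j := t)) - lam l <= T (g k) (q(j := t)) - lam k" using elim(2) u kl by blast
     then show "0 <= v" using T_th[OF kl(1,2) spJ[OF \<open>q : space (GG J)\<close>], of t] v[of t] by simp
    qed
   qed
   then have "0 <= v" using AE_N01_open[OF ab(2), of "%_. 0 <= v"] by blast
   moreover have "v ~= 0"
   proof -
    have A: "AE t in N01. (0::real) < t & t < 1 --> v ~= 0" using elim(1) unfolding v by (rule eventually_mono) blast
    show ?thesis using AE_N01_open[OF zero_less_one_real A] by blast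
   qed
   ultimately show False by simp
  qed
 qed
 then show False using c by blast
qed

text \<open>The jump of the vector of indicators when cell l is replaced by cell k.\<close>

definition dk :: "nat => nat => nat => real" where
 "dk k l i = (if i = k then 1 else 0) - (if i = l then 1 else 0)"

text \<open>A passage of \<open>f\<close> between k and l makes \<open>g k - g l\<close> vary along
  lines; applying \<open>crossing\<close> to \<open>g\<close> with the weights \<open>dk k l\<close>
  yields a passage between cells of different weight. The final inequality says that the inner
  product of the two jump vectors is not 0, so that layers at the two interfaces interact.\<close>

lemma two_crossings:
 assumes i0: "i0 < m" "\<not> jinv (f i0)"
 shows "EX k l al be \<iota> k' l' al' be' \<iota>'. k < m & l < m & k ~= l & 0 < \<iota> & \<not> (AE q in GG J. q ~: cross k l al be \<iota>) \<and>
  k' < m & l' < m & k' ~= l' & 0 < \<iota>' & \<not> (AE q in GG J. q ~: gminj.cross I g j k' l' al' be' \<iota>') & dk k l k' ~= dk k l l'"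
proof -
 interpret S: gminj I rh m g f mu lam j by (rule jswap)
 have "(\<Sum>i<m. (if i = i0 then 1 else 0) * f i x) = f i0 x" for x
 proof -
  have "(\<Sum>i<m. (if i = i0 then 1 else 0) * f i x) = (\<Sum>i<m. if i = i0 then f i x else 0)" by (intro sum.cong) auto
  then show ?thesis using i0 by simp
 qed
 then have "\<not> jinv (%x. \<Sum>i<m. (if i = i0 then 1 else 0) * f i x)" using i0 by simp
 from crossing[OF this] obtain k l al be \<iota> where kl: "k < m" "l < m" "k ~= l" "0 < \<iota>" and c: "\<not> (AE q in GG J. q ~: cross k l al be \<iota>)"
  by metis
 have e: "(\<Sum>i<m. dk k l i * g i x) = g k x - g l x" for x
 proof -
  have "(\<Sum>i<m. dk k l i * g i x) = (\<Sum>i<m. (if i = k then g i x else 0) - (if i = l then g i x else 0))"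
   unfolding dk_def by (intro sum.cong) auto
  then show ?thesis using kl by (simp add: sum_subtractf)
 qed
 have "\<not> jinv (%x. g k x - g l x)" by (rule cross_not_inv[OF kl c])
 then have "\<not> S.jinv (%x. \<Sum>i<m. dk k l i * g i x)" unfolding e S.jinv_def jinv_def .
 from S.crossing[OF this] obtain k' l' al' be' \<iota>' where kl': "k' < m" "l' < m" "dk k l k' ~= dk k l l'" "0 < \<iota>'"
  and c': "\<not> (AE q in GG J. q ~: S.cross k' l' al' be' \<iota>')" by metis
 have "k' ~= l'" using kl'(3) by auto
 then show ?thesis using kl c kl' c' by blast
qed

end

section \<open>Thin windows at a given height\<close>

abbreviation nd :: "real => real" where "nd \<equiv> std_normal_density"

lemma nd_lip: "\<bar>nd t - nd r\<bar> <= \<bar>t - r\<bar>"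
proof -
 define c where "c = 1 / sqrt (2 * pi)"
 have e: "nd = (%x. c * exp (- x\<^sup>2 / 2))" by (rule ext) (simp add: std_normal_density_def c_def)
 have d: "(nd has_field_derivative (- x * nd x)) (at x)" for x
  unfolding e by (auto intro!: derivative_eq_intros)
 have b: "norm (- x * nd x) <= 1" for x
 proof -
  have "0 <= (\<bar>x\<bar> - 1)\<^sup>2" by simp
  then have "\<bar>x\<bar> <= 1 + x\<^sup>2 / 2" by (simp add: power2_diff)
  also have "... <= exp (x\<^sup>2 / 2)" by (rule exp_ge_add_one_self)
  finally have x: "\<bar>x\<bar> <= exp (x\<^sup>2 / 2)" .
  have "1 <= sqrt (2 * pi)" using pi_gt3 by simp
  then have "nd x <= exp (- x\<^sup>2 / 2)" unfolding std_normal_density_def by (simp add: divide_le_eq)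
  then have "\<bar>x\<bar> * nd x <= exp (x\<^sup>2 / 2) * exp (- x\<^sup>2 / 2)"
   using x by (intro mult_mono) (auto intro: less_imp_le normal_density_pos)
  also have "... = 1" by (simp flip: exp_add)
  finally show ?thesis using normal_density_pos[of 1 0 x] by (simp add: abs_mult)
 qed
 have "norm (nd t - nd r) <= 1 * norm (t - r)"
  by (rule field_differentiable_bound[where S=UNIV and f'="%x. - x * nd x"]) (use d b in auto)
 then show ?thesis by simp
qed

text \<open>The window lies above the height for positive \<open>v\<close> and, in
  \<open>wd\<close>, below it for negative \<open>v\<close>. The thickness is always
  \<open>s\<close> and the modulus of \<open>v\<close> is the fraction of mass exchanged, so that
  only the shifts by \<open>s\<close> and \<open>- s\<close>, whose cost is known, will
  occur.\<close>

definition wu :: "real => real => real => real => real" where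
 "wu s v \<tau> t = (if \<tau> < t & t < \<tau> + s then max v 0 else 0)"

definition wd :: "real => real => real => real => real" where
 "wd s v \<tau> t = (if \<tau> - s < t & t < \<tau> then max (- v) 0 else 0)"

definition win :: "real => real => real => real => real" where
 "win s v \<tau> t = wu s v \<tau> t - wd s v \<tau> t"

lemma wu_meas[measurable (raw)]:
 assumes [measurable]: "a : bm M" "b : bm M" "c : bm M"
 shows "(%x. wu s (a x) (b x) (c x)) : bm M" "(%x. wd s (a x) (b x) (c x)) : bm M"
  "(%x. win s (a x) (b x) (c x)) : bm M"
 unfolding win_def wu_def wd_def by measurable

lemma wu_nonneg: "0 <= wu s v \<tau> t" "0 <= wd s v \<tau> t" unfolding wu_def wd_def by auto

lemma wu_wd: "wu s v \<tau> t + wd s v \<tau> t <= \<bar>v\<bar>" unfolding wu_def wd_def by auto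

lemma win_abs: "\<bar>win s v \<tau> t\<bar> <= \<bar>v\<bar>" unfolding win_def wu_def wd_def by auto

lemma win_supp: "win s v \<tau> t ~= 0 ==> \<bar>t - \<tau>\<bar> < s" unfolding win_def wu_def wd_def by (auto split: if_splits)

lemma win_zero[simp]: "win s 0 \<tau> t = 0" unfolding win_def wu_def wd_def by auto

lemma wud_int:
 assumes s: "0 < s"
 shows "integrable lborel (wu s v \<tau>)" "integrable lborel (wd s v \<tau>)" "(LINT t|lborel. wu s v \<tau> t) = s * max v 0"
  "(LINT t|lborel. wd s v \<tau> t) = s * max (- v) 0"
proof -
 have e: "wu s v \<tau> = (%t. max v 0 * indicator {\<tau><..<\<tau> + s} t)" "wd s v \<tau> = (%t. max (- v) 0 * indicator {\<tau> - s<..<\<tau>} t)"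
  unfolding wu_def wd_def by (auto simp: fun_eq_iff)
 have i: "integrable lborel (indicator {a<..<b} :: real => real)" for a b :: real
  by (cases "a <= b") (auto intro!: integrable_real_indicator simp: not_le)
 show "integrable lborel (wu s v \<tau>)" "integrable lborel (wd s v \<tau>)" unfolding e using i by (auto intro!: integrable_mult_right)
 show "(LINT t|lborel. wu s v \<tau> t) = s * max v 0" "(LINT t|lborel. wd s v \<tau> t) = s * max (- v) 0"
  unfolding e using s by (simp_all add: mult.commute)
qed

text \<open>The signed mass of the window is \<open>s * v\<close> for either sign, and the integrand
  is frozen at its value at the height.\<close>

lemma win_lim:
 assumes s: "0 < s" and h: "h : bm borel" and d: "!!t. \<bar>t - \<tau>\<bar> < s ==> \<bar>nd t * h t - c\<bar> <= de"
 shows "\<bar>(LINT t|N01. win s v \<tau> t * h t) - s * v * c\<bar> <= s * \<bar>v\<bar> * de"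
proof -
 note [measurable] = h
 have w: "integrable lborel (win s v \<tau>)" "(LINT t|lborel. win s v \<tau> t) = s * v"
 proof -
  show "integrable lborel (win s v \<tau>)" unfolding win_def[abs_def] by (intro BI_integrable_diff wud_int s)
  have "(LINT t|lborel. win s v \<tau> t) = s * max v 0 - s * max (- v) 0"
   unfolding win_def using wud_int[OF s, of v \<tau>] by simp
  then show "(LINT t|lborel. win s v \<tau> t) = s * v" by (auto simp: max_def)
 qed
 define w' where "w' t = wu s v \<tau> t + wd s v \<tau> t" for t
 have w': "integrable lborel w'" "(LINT t|lborel. w' t) = s * \<bar>v\<bar>"
 proof -
  show "integrable lborel w'" unfolding w'_def[abs_def] by (intro BI_integrable_add wud_int s)
  have "(LINT t|lborel. w' t) = s * max v 0 + s * max (- v) 0"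
   unfolding w'_def using wud_int[OF s, of v \<tau>] by simp
  then show "(LINT t|lborel. w' t) = s * \<bar>v\<bar>" by (auto simp: max_def)
 qed
 have ww: "\<bar>win s v \<tau> t\<bar> <= w' t" for t unfolding w'_def win_def using wu_nonneg[where s=s and v=v and \<tau>=\<tau> and t=t] by linarith
 have d0: "0 <= de" using d[of \<tau>] s by (smt (verit) abs_ge_zero)
 have p: "\<bar>nd t * (win s v \<tau> t * h t) - win s v \<tau> t * c\<bar> <= w' t * de" for t
 proof (cases "win s v \<tau> t = 0")
  case True
  have "0 <= w' t" unfolding w'_def using wu_nonneg[where s=s and v=v and \<tau>=\<tau> and t=t] by simp
  then show ?thesis using True d0 by simp
 next
  case False
  have "nd t * (win s v \<tau> t * h t) - win s v \<tau> t * c = win s v \<tau> t * (nd t * h t - c)" by (simp add: algebra_simps)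
  then have "\<bar>nd t * (win s v \<tau> t * h t) - win s v \<tau> t * c\<bar> = \<bar>win s v \<tau> t\<bar> * \<bar>nd t * h t - c\<bar>" by (simp only: abs_mult)
  then show ?thesis using ww[of t] d[OF win_supp[OF False]] by (simp add: mult_mono)
 qed
 have di: "integrable lborel (%t. nd t * (win s v \<tau> t * h t) - win s v \<tau> t * c)"
 proof (rule BI_integrable_bound)
  show "integrable lborel (%t. w' t * de)" using w' by simp
  show "(%t. nd t * (win s v \<tau> t * h t) - win s v \<tau> t * c) : bm lborel"
   using h by (intro borel_measurable_diff borel_measurable_times wu_meas) auto
  show "AE t in lborel. norm (nd t * (win s v \<tau> t * h t) - win s v \<tau> t * c) <= norm (w' t * de)"
  proof (rule AE_I2)
   fix t show "norm (nd t * (win s v \<tau> t * h t) - win s v \<tau> t * c) <= norm (w' t * de)"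
    using p[of t] by (simp only: real_norm_def)
  qed
 qed
 have "(LINT t|N01. win s v \<tau> t * h t) = (LINT t|lborel. nd t * (win s v \<tau> t * h t))"
  unfolding N01_def by (subst integral_density) auto
 also have "... = (LINT t|lborel. (nd t * (win s v \<tau> t * h t) - win s v \<tau> t * c) + win s v \<tau> t * c)" by simp
 also have "... = (LINT t|lborel. nd t * (win s v \<tau> t * h t) - win s v \<tau> t * c) + (LINT t|lborel. win s v \<tau> t * c)"
  by (rule BI_integral_add[OF di]) (use w in simp)
 also have "(LINT t|lborel. win s v \<tau> t * c) = s * v * c" using w by simp
 finally have eq: "(LINT t|N01. win s v \<tau> t * h t) - s * v * c = (LINT t|lborel. nd t * (win s v \<tau> t * h t) - win s v \<tau> t * c)" by simp
 have "\<bar>(LINT t|lborel. nd t * (win s v \<tau> t * h t) - win s v \<tau> t * c)\<bar> <= (LINT t|lborel. \<bar>nd t * (win s v \<tau> t * h t) - win s v \<tau> t * c\<bar>)"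
  by (rule integral_abs_bound)
 moreover have "(LINT t|lborel. \<bar>nd t * (win s v \<tau> t * h t) - win s v \<tau> t * c\<bar>) <= (LINT t|lborel. w' t * de)"
  by (rule integral_mono) (use w' p integrable_abs[OF di] in auto)
 moreover have "(LINT t|lborel. w' t * de) = s * \<bar>v\<bar> * de" using w' by simp
 ultimately show ?thesis unfolding eq by linarith
qed

lemma unif2:
 fixes F :: "real => real => real"
 assumes c: "continuous_on UNIV (%p. F (fst p) (snd p))" and e: "0 < de"
 shows "EX \<eta>>0. ALL t:{a..b}. ALL t':{a..b}. ALL r:{a'..b'}. ALL r':{a'..b'}. \<bar>t - t'\<bar> < \<eta> --> \<bar>r - r'\<bar> < \<eta> --> \<bar>F t r - F t' r'\<bar> <= de"
  and "EX C. ALL t:{a..b}. ALL r:{a'..b'}. \<bar>F t r\<bar> <= C"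
proof -
 have K: "compact ({a..b} \<times> {a'..b'})" by (intro compact_Times compact_Icc)
 have ck: "continuous_on ({a..b} \<times> {a'..b'}) (%p. F (fst p) (snd p))" by (rule continuous_on_subset[OF c]) simp
 have "uniformly_continuous_on ({a..b} \<times> {a'..b'}) (%p. F (fst p) (snd p))" by (rule compact_uniformly_continuous[OF ck K])
 then obtain \<eta> where h: "0 < \<eta>" "!!p p'. p : {a..b} \<times> {a'..b'} ==> p' : {a..b} \<times> {a'..b'} ==> dist p' p < \<eta> ==> dist (F (fst p') (snd p')) (F (fst p) (snd p)) < de"
  using e unfolding uniformly_continuous_on_def by metis
 show "EX \<eta>>0. ALL t:{a..b}. ALL t':{a..b}. ALL r:{a'..b'}. ALL r':{a'..b'}. \<bar>t - t'\<bar> < \<eta> --> \<bar>r - r'\<bar> < \<eta> --> \<bar>F t r - F t' r'\<bar> <= de"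
 proof (intro exI[of _ "\<eta> / 2"] conjI ballI impI)
  fix t t' r r' assume m: "t : {a..b}" "t' : {a..b}" "r : {a'..b'}" "r' : {a'..b'}" and d: "\<bar>t - t'\<bar> < \<eta> / 2" "\<bar>r - r'\<bar> < \<eta> / 2"
  have "dist (t, r) (t', r') = sqrt ((t - t')\<^sup>2 + (r - r')\<^sup>2)" unfolding dist_Pair_Pair dist_real_def by simp
  also have "... <= \<bar>t - t'\<bar> + \<bar>r - r'\<bar>" by (rule sqrt_sum_squares_le_sum_abs)
  finally have "dist (t, r) (t', r') < \<eta>" using d by linarith
  then have "dist (F t r) (F t' r') < de" using h(2)[of "(t', r')" "(t, r)"] m by simp
  then show "\<bar>F t r - F t' r'\<bar> <= de" unfolding dist_real_def by simp
 qed (use h in simp)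
 have "bounded ((%p. F (fst p) (snd p)) ` ({a..b} \<times> {a'..b'}))"
  by (intro compact_imp_bounded compact_continuous_image ck K)
 then obtain C where C: "!!p. p : {a..b} \<times> {a'..b'} ==> norm (F (fst p) (snd p)) <= C" unfolding bounded_iff by blast
 show "EX C. ALL t:{a..b}. ALL r:{a'..b'}. \<bar>F t r\<bar> <= C"
  by (intro exI[of _ C] ballI) (use C[of "(_, _)"] in auto)
qed

lemma AE_N01_shift: "AE t in N01. P t ==> AE t in N01. P (t + s)"
proof -
 assume "AE t in N01. P t"
 then have "AE t in lborel. P t" unfolding AE_N01 .
 then have "AE t in distr lborel borel ((+) s). P t" unfolding lborel_distr_plus .
 then have "AE t in lborel. P (s + t)" by (rule AE_distrD[rotated]) simp
 then show ?thesis unfolding AE_N01 by (simp add: add.commute)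
qed

section \<open>The interaction of two layers to second order\<close>

context gminj
begin

lemma restr: "q : space (GG J) ==> restrict (q(j := t)) J = q"
 by (auto simp: space_PiM PiE_iff extensional_def restrict_def fun_eq_iff)

lemma restr_meas[measurable]: "(%x. restrict x J) : GG I \<rightarrow>\<^sub>M GG J"
 by (rule measurable_restrict_subset) auto

lemma restr_space: "x : space (GG I) ==> restrict x J : space (GG J)"
 using measurable_space[OF restr_meas] .

definition lay :: "((nat => real) => real) => ((nat => real) => real) => real => (nat => real) => real" where
 "lay \<tau> a s x = win s (a (restrict x J)) (\<tau> (restrict x J)) (x j)"

lemma lay_upd: "q : space (GG J) ==> lay \<tau> a s (q(j := t)) = win s (a q) (\<tau> q) t"
 unfolding lay_def by (simp only: restr fun_upd_same)

lemma lay_bdd: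
 assumes "\<tau> : bm (GG J)" "a : bm (GG J)" "!!q. q : space (GG J) ==> \<bar>a q\<bar> <= 1"
 shows "bdd (GG I) (lay \<tau> a s)"
proof (rule bddI)
 have "(%x. win s (a (restrict x J)) (\<tau> (restrict x J)) (x j)) : bm (GG I)"
  by (intro wu_meas measurable_compose[OF restr_meas] assms meas_comp jI)
 then show "lay \<tau> a s : bm (GG I)" unfolding lay_def[abs_def] .
 fix x assume "x : space (GG I)"
 then show "\<bar>lay \<tau> a s x\<bar> <= 1" unfolding lay_def using win_abs assms(3)[OF restr_space] by (meson order_trans)
qed

text \<open>The Mehler kernel relative to Lebesgue measure in \<open>r\<close>.\<close>

definition Ph :: "real => real => real" where "Ph t r = nd r * k1 rh t r"

lemma Ph_cont: "continuous_on UNIV (%p. Ph (fst p) (snd p))" "continuous_on UNIV (%p. nd (fst p) * Ph (fst p) (snd p))"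
 unfolding Ph_def std_normal_density_def k1_def using rho2 by (auto intro!: continuous_intros)

lemma Ph_meas[measurable (raw)]: "u : bm M ==> v : bm M ==> (%x. Ph (u x) (v x)) : bm M"
 unfolding Ph_def by (intro borel_measurable_times k1_meas measurable_compose[of v M borel nd]) auto

text \<open>The noise form concentrated on the graphs of \<open>\<tau>\<close> and
  \<open>\<tau>'\<close>: once heights are integrated out, the Gaussian densities at the two heights
  remain as weights.\<close>

definition KB :: "((nat => real) => real) => ((nat => real) => real) => ((nat => real) => real) => ((nat => real) => real) => real" where
 "KB \<tau> \<tau>' a b = (LINT x|GG J. a x * nd (\<tau> x) * (LINT y|GG J. kk rh J x y * (b y * Ph (\<tau> x) (\<tau>' y))))"

lemma pr_lay:
 assumes t: "\<tau> : bm (GG J)" "\<tau>' : bm (GG J)"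
  and a: "a : bm (GG J)" "b : bm (GG J)"
  and a1: "!!q. q : space (GG J) ==> \<bar>a q\<bar> <= 1" "!!q. q : space (GG J) ==> \<bar>b q\<bar> <= 1"
  and sa: "!!q. q : space (GG J) ==> a q ~= 0 ==> al + \<iota> < \<tau> q & \<tau> q < be - \<iota>"
  and sb: "!!q. q : space (GG J) ==> b q ~= 0 ==> al' + \<iota>' < \<tau>' q & \<tau>' q < be' - \<iota>'"
  and i: "0 < \<iota>" "0 < \<iota>'" and d: "0 < de"
 shows "EX s1>0. ALL s. 0 < s --> s < s1 --> \<bar>pr (lay \<tau> a s) (lay \<tau>' b s) - s\<^sup>2 * KB \<tau> \<tau>' a b\<bar> <= de * s\<^sup>2"
proof -
 interpret GJ: gauss J rh by (intro gauss.intro insJ(2) J_ne rho)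
 note [measurable] = t a
 define d1 where "d1 = de / 2"
 have d1: "0 < d1" "2 * d1 = de" unfolding d1_def using d by auto
 obtain e1 where e1: "0 < e1" "!!t t' r r'. t : {al..be} ==> t' : {al..be} ==> r : {al'..be'} ==> r' : {al'..be'} ==> \<bar>t - t'\<bar> < e1 ==> \<bar>r - r'\<bar> < e1 ==> \<bar>Ph t r - Ph t' r'\<bar> <= d1"
  using unif2(1)[OF Ph_cont(1) d1(1), of al be al' be'] by blast
 obtain e2 where e2: "0 < e2" "!!t t' r r'. t : {al..be} ==> t' : {al..be} ==> r : {al'..be'} ==> r' : {al'..be'} ==> \<bar>t - t'\<bar> < e2 ==> \<bar>r - r'\<bar> < e2 ==> \<bar>nd t * Ph t r - nd t' * Ph t' r'\<bar> <= d1"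
  using unif2(1)[OF Ph_cont(2) d1(1), of al be al' be'] by blast
 obtain C where C: "!!t r. t : {al..be} ==> r : {al'..be'} ==> \<bar>Ph t r\<bar> <= C"
  using unif2(2)[OF Ph_cont(1) d1(1), of al be al' be'] by blast
 define bP where "bP t y = b y * Ph t (\<tau>' y)" for t y
 have bPm[measurable (raw)]: "(%p. bP (u p) (v p)) : bm M'" if [measurable]: "u : bm M'" "v : M' \<rightarrow>\<^sub>M GG J" for u v M'
  unfolding bP_def by (intro borel_measurable_times Ph_meas that measurable_compose[OF that(2)] t a)
 have bPb: "\<bar>bP t y\<bar> <= \<bar>C\<bar>" if "y : space (GG J)" "t : {al..be}" for t y
 proof (cases "b y = 0")
  case False
  have "\<bar>Ph t (\<tau>' y)\<bar> <= \<bar>C\<bar>" using C[OF that(2), of "\<tau>' y"] sb[OF that(1) False] i by auto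
  then have "\<bar>b y\<bar> * \<bar>Ph t (\<tau>' y)\<bar> <= 1 * \<bar>C\<bar>" using a1(2)[OF that(1)] by (intro mult_mono) auto
  then show ?thesis unfolding bP_def by (simp add: abs_mult)
 qed (simp add: bP_def)
 have bPbdd: "bdd (GG J) (bP t)" if "t : {al..be}" for t
  by (rule bddI[where C="\<bar>C\<bar>"]) (use bPb that in \<open>auto intro!: bPm\<close>)
 define H where "H x t = GJ.T (bP t) x" for x t
 have KBe: "KB \<tau> \<tau>' a b = (LINT x|GG J. a x * (nd (\<tau> x) * H x (\<tau> x)))"
  unfolding KB_def H_def GJ.T_def bP_def by (simp add: mult.assoc)
 have nd01: "0 <= nd t" "nd t <= 1" for t using std_le1[of t] normal_density_pos[of 1 0 t] by auto
 have main: "\<bar>pr (lay \<tau> a s) (lay \<tau>' b s) - s\<^sup>2 * KB \<tau> \<tau>' a b\<bar> <= de * s\<^sup>2"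
  if s: "0 < s" "s < min (min e1 e2) (min \<iota> \<iota>')" for s
 proof -
  define V where "V t y = (LINT r|N01. win s (b y) (\<tau>' y) r * k1 rh t r)" for t y
  have Vm: "V t : bm (GG J)" for t
   unfolding V_def[abs_def] by (intro N01.borel_measurable_lebesgue_integral) (simp add: split_beta')
  have V: "\<bar>V t y - s * bP t y\<bar> <= s * d1" if y: "y : space (GG J)" and tt: "t : {al..be}" for t y
  proof (cases "b y = 0")
   case False
   note sy = sb[OF y False]
   have "\<bar>V t y - s * b y * (Ph t (\<tau>' y))\<bar> <= s * \<bar>b y\<bar> * d1"
    unfolding V_def
   proof (rule win_lim[OF s(1)])
    show "(%r. k1 rh t r) : bm borel" by (intro k1_meas) auto
    fix r assume r: "\<bar>r - \<tau>' y\<bar> < s"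
    show "\<bar>nd r * k1 rh t r - Ph t (\<tau>' y)\<bar> <= d1"
     unfolding Ph_def[of t r, symmetric] by (rule e1(2)) (use tt sy r s i e1(1) in auto)
   qed
   also have "s * \<bar>b y\<bar> * d1 <= s * 1 * d1" using a1(2)[OF y] s d1 by (intro mult_right_mono mult_left_mono) auto
   finally show ?thesis unfolding bP_def by (simp add: mult.assoc)
  qed (use s d1 in \<open>simp add: V_def bP_def\<close>)
  have lb: "bdd (GG I) (lay \<tau> a s)" "bdd (GG I) (lay \<tau>' b s)" by (rule lay_bdd[OF t(1) a(1) a1(1)], simp, rule lay_bdd[OF t(2) a(2) a1(2)], simp)
  have TV: "T (lay \<tau>' b s) (x(j := t)) = GJ.T (V t) x" if x: "x : space (GG J)" for x t
  proof -
   have "T (lay \<tau>' b s) (x(j := t)) = (LINT y|GG J. (LINT r|N01. kk rh I (x(j := t)) (y(j := r)) * lay \<tau>' b s (y(j := r))))"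
    unfolding T_def by (rule int_J[OF kf_int[OF lb(2) spJ[OF x]]])
   also have "... = (LINT y|GG J. kk rh J x y * V t y)"
   proof (rule BI_integral_cong[OF refl])
    fix y assume y: "y : space (GG J)"
    have "(LINT r|N01. kk rh I (x(j := t)) (y(j := r)) * lay \<tau>' b s (y(j := r))) = (LINT r|N01. kk rh J x y * (win s (b y) (\<tau>' y) r * k1 rh t r))"
     unfolding kk_J lay_upd[OF y] by (intro BI_integral_cong refl) (simp only: mult.assoc mult.left_commute mult.commute)
    then show "(LINT r|N01. kk rh I (x(j := t)) (y(j := r)) * lay \<tau>' b s (y(j := r))) = kk rh J x y * V t y" unfolding V_def by simp
   qed
   finally show ?thesis unfolding GJ.T_def .
  qed
  have TH: "\<bar>T (lay \<tau>' b s) (x(j := t)) - s * H x t\<bar> <= s * d1" if x: "x : space (GG J)" and tt: "t : {al..be}" for x t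
  proof -
   have b1: "bdd (GG J) (%y. s * bP t y)" by (intro bdd_cmult bPbdd tt)
   have b2: "bdd (GG J) (V t)"
   proof (rule bddI[OF Vm, where C="s * d1 + s * \<bar>C\<bar>"])
    fix y assume y: "y : space (GG J)"
    have "\<bar>s * bP t y\<bar> <= s * \<bar>C\<bar>" using bPb[OF y tt] s by (simp add: abs_mult)
    then show "\<bar>V t y\<bar> <= s * d1 + s * \<bar>C\<bar>" using V[OF y tt] by linarith
   qed
   have "T (lay \<tau>' b s) (x(j := t)) - s * H x t = GJ.T (%y. V t y - s * bP t y) x"
    unfolding TV[OF x] H_def using GJ.T_diff[OF b2 b1 x] GJ.T_cmult[of s "bP t" x] by simp
   moreover have "\<bar>GJ.T (%y. V t y - s * bP t y) x\<bar> <= s * d1"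
    by (rule GJ.T_abs[OF bdd_diff[OF b2 b1] _ x]) (rule V[OF _ tt])
   ultimately show ?thesis by simp
  qed
  have HH: "\<bar>nd t * H x t - nd t' * H x t'\<bar> <= d1" if x: "x : space (GG J)" and tt: "t : {al..be}" "t' : {al..be}" "\<bar>t - t'\<bar> < e2" for x t t'
  proof -
   have b: "bdd (GG J) (%y. nd t * bP t y)" if "t : {al..be}" for t using bPbdd[OF that] by (rule bdd_cmult)
   have "nd t * H x t - nd t' * H x t' = GJ.T (%y. nd t * bP t y - nd t' * bP t' y) x"
    unfolding H_def using GJ.T_diff[OF b[OF tt(1)] b[OF tt(2)] x] GJ.T_cmult by simp
   moreover have "\<bar>GJ.T (%y. nd t * bP t y - nd t' * bP t' y) x\<bar> <= d1"
   proof (rule GJ.T_abs[OF bdd_diff[OF b[OF tt(1)] b[OF tt(2)]] _ x])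
    fix y assume y: "y : space (GG J)"
    show "\<bar>nd t * bP t y - nd t' * bP t' y\<bar> <= d1"
    proof (cases "b y = 0")
     case False
     have "\<bar>nd t * Ph t (\<tau>' y) - nd t' * Ph t' (\<tau>' y)\<bar> <= d1"
      by (rule e2(2)) (use tt sb[OF y False] i e2(1) in auto)
     then have "\<bar>b y\<bar> * \<bar>nd t * Ph t (\<tau>' y) - nd t' * Ph t' (\<tau>' y)\<bar> <= 1 * d1"
      using a1(2)[OF y] by (intro mult_mono) auto
     moreover have "nd t * bP t y - nd t' * bP t' y = b y * (nd t * Ph t (\<tau>' y) - nd t' * Ph t' (\<tau>' y))"
      unfolding bP_def by (simp add: algebra_simps)
     ultimately show ?thesis by (simp only: abs_mult)
    qed (use d1 in \<open>simp add: bP_def\<close>)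
   qed
   ultimately show ?thesis by simp
  qed
  have est: "\<bar>(LINT t|N01. lay \<tau> a s (x(j := t)) * T (lay \<tau>' b s) (x(j := t))) - s\<^sup>2 * (a x * (nd (\<tau> x) * H x (\<tau> x)))\<bar> <= de * s\<^sup>2"
   if x: "x : space (GG J)" for x
  proof (cases "a x = 0")
   case True
   then show ?thesis using d unfolding lay_upd[OF x] by simp
  next
   case False
   note sx = sa[OF x False]
   have xc: "(%_. x) : borel \<rightarrow>\<^sub>M GG J" using x by simp
   have "\<bar>(LINT t|N01. win s (a x) (\<tau> x) t * T (lay \<tau>' b s) (x(j := t))) - s * a x * (s * (nd (\<tau> x) * H x (\<tau> x)))\<bar> <= s * \<bar>a x\<bar> * (2 * s * d1)"
   proof (rule win_lim[OF s(1)])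
    show "(%t. T (lay \<tau>' b s) (x(j := t))) : bm borel"
     by (rule measurable_compose[OF measJ[OF xc]]) (use T_bdd[OF lb(2)] in \<open>auto simp: bdd_def\<close>)
    fix t assume t: "\<bar>t - \<tau> x\<bar> < s"
    have tt: "t : {al..be}" "\<tau> x : {al..be}" "\<bar>t - \<tau> x\<bar> < e2" using t s sx i by auto
    have "\<bar>nd t * (T (lay \<tau>' b s) (x(j := t)) - s * H x t)\<bar> <= 1 * (s * d1)"
     unfolding abs_mult using TH[OF x tt(1)] nd01[of t] by (intro mult_mono) auto
    moreover have "\<bar>s * (nd t * H x t - nd (\<tau> x) * H x (\<tau> x))\<bar> <= s * d1"
     unfolding abs_mult using HH[OF x tt] s by (intro mult_mono) auto
    moreover have "nd t * T (lay \<tau>' b s) (x(j := t)) - s * (nd (\<tau> x) * H x (\<tau> x)) =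
     nd t * (T (lay \<tau>' b s) (x(j := t)) - s * H x t) + s * (nd t * H x t - nd (\<tau> x) * H x (\<tau> x))" by (simp add: algebra_simps)
    ultimately show "\<bar>nd t * T (lay \<tau>' b s) (x(j := t)) - s * (nd (\<tau> x) * H x (\<tau> x))\<bar> <= 2 * s * d1" by linarith
   qed
   also have "s * \<bar>a x\<bar> * (2 * s * d1) <= s * 1 * (2 * s * d1)" using a1(1)[OF x] s d1 by (intro mult_right_mono mult_left_mono) auto
   also have "... = de * s\<^sup>2" unfolding d1(2)[symmetric] by (simp add: power2_eq_square)
   finally show ?thesis unfolding lay_upd[OF x] by (simp add: power2_eq_square mult_ac)
  qed
  define E where "E x = (LINT t|N01. lay \<tau> a s (x(j := t)) * T (lay \<tau>' b s) (x(j := t)))" for x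
  have Em: "E : bm (GG J)"
  proof -
   have [measurable]: "lay \<tau> a s : bm (GG I)" "T (lay \<tau>' b s) : bm (GG I)" using lb T_bdd by (auto simp: bdd_def)
   show ?thesis unfolding E_def[abs_def] by (intro N01.borel_measurable_lebesgue_integral) (simp add: split_beta')
  qed
  define Z where "Z x = a x * (nd (\<tau> x) * H x (\<tau> x))" for x
  have Zb: "bdd (GG J) Z"
  proof (rule bddI[where C="\<bar>C\<bar>"])
   have "(%x. H x (\<tau> x)) : bm (GG J)"
    unfolding H_def GJ.T_def by (intro GJ.borel_measurable_lebesgue_integral) (simp add: split_beta')
   then show "Z : bm (GG J)" unfolding Z_def[abs_def] by measurable
   fix x assume x: "x : space (GG J)"
   show "\<bar>Z x\<bar> <= \<bar>C\<bar>"
   proof (cases "a x = 0")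
    case False
    have tt: "\<tau> x : {al..be}" using sa[OF x False] i by auto
    have "\<bar>H x (\<tau> x)\<bar> <= \<bar>C\<bar>" unfolding H_def by (rule GJ.T_abs[OF bPbdd[OF tt] _ x]) (rule bPb[OF _ tt])
    then have "\<bar>a x\<bar> * (\<bar>nd (\<tau> x)\<bar> * \<bar>H x (\<tau> x)\<bar>) <= 1 * (1 * \<bar>C\<bar>)" using a1(1)[OF x] nd01[of "\<tau> x"] by (intro mult_mono) auto
    then show ?thesis unfolding Z_def by (simp add: abs_mult)
   qed (simp add: Z_def)
  qed
  have Ee: "\<bar>E x - s\<^sup>2 * Z x\<bar> <= de * s\<^sup>2" if "x : space (GG J)" for x unfolding E_def Z_def by (rule est[OF that])
  have Eb: "bdd (GG J) E"
  proof -
   obtain D where D: "!!x. x : space (GG J) ==> \<bar>Z x\<bar> <= D" using bdd_obtain[OF Zb] by blast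
   show ?thesis
   proof (rule bddI[OF Em, where C="de * s\<^sup>2 + s\<^sup>2 * D"])
    fix x assume x: "x : space (GG J)"
    have "\<bar>s\<^sup>2 * Z x\<bar> <= s\<^sup>2 * D" unfolding abs_mult using D[OF x] by (intro mult_mono) auto
    then show "\<bar>E x\<bar> <= de * s\<^sup>2 + s\<^sup>2 * D" using Ee[OF x] by linarith
   qed
  qed
  have "pr (lay \<tau> a s) (lay \<tau>' b s) = (LINT x|GG J. E x)"
   unfolding pr_def E_def by (rule int_J[OF pr_int[OF lb]])
  moreover have "s\<^sup>2 * KB \<tau> \<tau>' a b = (LINT x|GG J. s\<^sup>2 * Z x)" unfolding KBe Z_def by simp
  moreover have "(LINT x|GG J. E x) - (LINT x|GG J. s\<^sup>2 * Z x) = (LINT x|GG J. E x - s\<^sup>2 * Z x)"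
   using GJ.bdd_integrable[OF Eb] GJ.bdd_integrable[OF bdd_cmult[OF Zb]] by simp
  moreover have "\<bar>(LINT x|GG J. E x - s\<^sup>2 * Z x)\<bar> <= (LINT x|GG J. \<bar>E x - s\<^sup>2 * Z x\<bar>)" by (rule integral_abs_bound)
  moreover have "(LINT x|GG J. \<bar>E x - s\<^sup>2 * Z x\<bar>) <= (LINT x|GG J. de * s\<^sup>2)"
  proof (rule integral_mono)
   show "integrable (GG J) (%x. \<bar>E x - s\<^sup>2 * Z x\<bar>)" by (intro GJ.bdd_integrable bdd_abs bdd_diff Eb bdd_cmult Zb)
  qed (use Ee in auto)
  moreover have "(LINT x|GG J. de * s\<^sup>2) = de * s\<^sup>2" using GJ.prob_space by simp
  ultimately show ?thesis by linarith
 qed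
 show ?thesis
  by (intro exI[of _ "min (min e1 e2) (min \<iota> \<iota>')"] conjI) (use main e1 e2 i in auto)
qed

end

section \<open>Competitors that move an interface by a layer\<close>

context gminj
begin

text \<open>At each point a convex combination of \<open>f\<close> and its translates by
  \<open>s\<close> and \<open>- s\<close>. Being made of translates, it has a cost governed by
  \<open>cheap\<close>; at a passage it displaces the interface.\<close>

definition mv :: "((nat => real) => real) => ((nat => real) => real) => real => nat => (nat => real) => real" where
 "mv \<tau> a s i x = f i x + wu s (a (restrict x J)) (\<tau> (restrict x J)) (x j) * (f i (sh j s x) - f i x) +
  wd s (a (restrict x J)) (\<tau> (restrict x J)) (x j) * (f i (sh j (- s) x) - f i x)"

lemma mv_relaxed:
 assumes t: "\<tau> : bm (GG J)" and a: "a : bm (GG J)" and a1: "!!q. q : space (GG J) ==> \<bar>a q\<bar> <= 1"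
 shows "relaxed (GG I) m (mv \<tau> a s)"
 unfolding relaxed_def
proof (intro conjI allI impI ballI)
 have sm: "(%x. f i (sh j r x)) : bm (GG I)" if "i < m" for i r
  using bdd_meas[OF bdd_sh[OF jI fb[OF that]]] .
 have wm: "(%x. wu s (a (restrict x J)) (\<tau> (restrict x J)) (x j)) : bm (GG I)"
  "(%x. wd s (a (restrict x J)) (\<tau> (restrict x J)) (x j)) : bm (GG I)"
  by (intro wu_meas measurable_compose[OF restr_meas] t a meas_comp jI)+
 show "mv \<tau> a s i : bm (GG I)" if "i < m" for i
  unfolding mv_def[abs_def] by (intro borel_measurable_add borel_measurable_times borel_measurable_diff wm sm fm that)
 fix x assume x: "x : space (GG I)"
 define U where "U = wu s (a (restrict x J)) (\<tau> (restrict x J)) (x j)"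
 define D where "D = wd s (a (restrict x J)) (\<tau> (restrict x J)) (x j)"
 have UD: "0 <= U" "0 <= D" "U + D <= 1"
  using wu_nonneg wu_wd[of s "a (restrict x J)" "\<tau> (restrict x J)" "x j"] a1[OF restr_space[OF x]] unfolding U_def D_def by (auto intro: order_trans)
 have mvx: "mv \<tau> a s i x = (1 - U - D) * f i x + U * f i (sh j s x) + D * f i (sh j (- s) x)" for i
  unfolding mv_def U_def D_def by (simp add: algebra_simps)
 show "0 <= mv \<tau> a s i x" if "i < m" for i
  unfolding mvx using UD relaxed_le1(2)[OF f_rel that] x space_sh[OF jI x] by (intro add_nonneg_nonneg mult_nonneg_nonneg) auto
 have "(\<Sum>i<m. mv \<tau> a s i x) = (1 - U - D) * (\<Sum>i<m. f i x) + U * (\<Sum>i<m. f i (sh j s x)) + D * (\<Sum>i<m. f i (sh j (- s) x))"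
  unfolding mvx by (simp add: sum.distrib sum_distrib_left)
 also have "... = 1" using f_rel x space_sh[OF jI x] unfolding relaxed_def by simp
 finally show "(\<Sum>i<m. mv \<tau> a s i x) = 1" .
qed

lemma f_val: "x : space (GG I) ==> p < m ==> f p x = 1 ==> i < m ==> f i x = (if i = p then 1 else 0)"
 using f_zero[of x p i] by (cases "i = p") simp_all

text \<open>Above the passage the translate by \<open>s\<close> shows k where \<open>f\<close> shows
  l; below it the translate by \<open>- s\<close> shows l where \<open>f\<close> shows k. Both jumps
  are multiples of \<open>dk k l\<close>, with the signs built into \<open>win\<close>.\<close>

lemma mv_eq:
 assumes kl: "k < m" "l < m" and i: "i < m"
  and a: "a : bm (GG J)" "!!q. q : space (GG J) ==> \<bar>a q\<bar> <= 1" and sa: "!!q. q : space (GG J) ==> a q ~= 0 ==> q : cross k l al be \<iota>"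
  and s: "0 < s" "s < \<iota>"
 shows "AE x in GG I. mv (tau k al be) a s i x - f i x = dk k l i * lay (tau k al be) a s x"
proof -
 let ?\<tau> = "tau k al be"
 have lb: "lay ?\<tau> a s : bm (GG I)" using lay_bdd[OF tau_meas[OF kl(1)] a] by (auto simp: bdd_def)
 have mm: "mv ?\<tau> a s i : bm (GG I)" using mv_relaxed[OF tau_meas[OF kl(1)] a] i unfolding relaxed_def by blast
 note [measurable] = lb mm fm[OF i]
 have m1: "{x\<in>space (GG I). mv ?\<tau> a s i x - f i x = dk k l i * lay ?\<tau> a s x} : sets (GG I)" by measurable
 have m2: "AE q in GG J. AE t in N01. mv ?\<tau> a s i (q(j := t)) - f i (q(j := t)) = dk k l i * lay ?\<tau> a s (q(j := t))"
 proof (rule AE_I2)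
  fix q assume q: "q : space (GG J)"
  have mvq: "mv ?\<tau> a s i (q(j := t)) = f i (q(j := t)) + wu s (a q) (?\<tau> q) t * (f i (q(j := t - s)) - f i (q(j := t))) +
    wd s (a q) (?\<tau> q) t * (f i (q(j := t + s)) - f i (q(j := t)))" for t
   unfolding mv_def sh_def by (simp only: restr[OF q] fun_upd_same fun_upd_upd diff_minus_eq_add)
  show "AE t in N01. mv ?\<tau> a s i (q(j := t)) - f i (q(j := t)) = dk k l i * lay ?\<tau> a s (q(j := t))"
  proof (cases "a q = 0")
   case True
   then have "wu s (a q) (?\<tau> q) t = 0" "wd s (a q) (?\<tau> q) t = 0" for t unfolding wu_def wd_def by auto
   then show ?thesis unfolding mvq lay_upd[OF q] win_def by simp
  next
   case False
   define P where "P t \<longleftrightarrow> (al < t & t < ?\<tau> q --> f k (q(j := t)) = 1) & (?\<tau> q < t & t < be --> f l (q(j := t)) = 1)" for t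
   have P: "AE t in N01. P t" and tw: "al + \<iota> < ?\<tau> q" "?\<tau> q < be - \<iota>" using sa[OF q False] unfolding cross_def P_def by auto
   show ?thesis using P AE_N01_shift[OF P, of s] AE_N01_shift[OF P, of "- s"]
   proof eventually_elim
    case (elim t)
    consider "?\<tau> q < t" "t < ?\<tau> q + s" | "?\<tau> q - s < t" "t < ?\<tau> q" | "wu s (a q) (?\<tau> q) t = 0" "wd s (a q) (?\<tau> q) t = 0"
     unfolding wu_def wd_def by force
    then show ?case
    proof cases
     case 1
     have "f l (q(j := t)) = 1" "f k (q(j := t - s)) = 1" using elim 1 tw s unfolding P_def by auto
     then have "f i (q(j := t)) = (if i = l then 1 else 0)" "f i (q(j := t - s)) = (if i = k then 1 else 0)"
      using f_val[OF spJ[OF q] kl(2) _ i] f_val[OF spJ[OF q] kl(1) _ i] by blast+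
     moreover have "wd s (a q) (?\<tau> q) t = 0" unfolding wd_def using 1 by auto
     ultimately show ?thesis unfolding mvq lay_upd[OF q] win_def dk_def by simp
    next
     case 2
     have "f k (q(j := t)) = 1" "f l (q(j := t + s)) = 1" using elim 2 tw s unfolding P_def by auto
     then have "f i (q(j := t)) = (if i = k then 1 else 0)" "f i (q(j := t + s)) = (if i = l then 1 else 0)"
      using f_val[OF spJ[OF q] kl(2) _ i] f_val[OF spJ[OF q] kl(1) _ i] by blast+
     moreover have "wu s (a q) (?\<tau> q) t = 0" unfolding wu_def using 2 by auto
     ultimately show ?thesis unfolding mvq lay_upd[OF q] win_def dk_def by (simp add: algebra_simps)
    next
     case 3
     then show ?thesis unfolding mvq lay_upd[OF q] win_def by simp
    qed
   qed
  qed
 qed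
 show ?thesis unfolding AE_J[OF m1] by (rule m2)
qed

lemma f_ex: "x : space (GG I) ==> (\<Sum>i<m. f i x * ex i x) = 0"
proof -
 assume x: "x : space (GG I)"
 have "(\<Sum>i<m. f i x * ex i x) = (\<Sum>i<m. f i x * (T (g i) x - lam i)) - (\<Sum>i<m. f i x) * ww x"
  unfolding ex_def by (simp add: right_diff_distrib sum_subtractf sum_distrib_right)
 also have "... = 0" using f_rel x unfolding ww_def relaxed_def by simp
 finally show ?thesis .
qed

text \<open>\<open>f\<close> itself carries no excess, so only the translated parts are charged.
  Their fractions are at most 1 and they live in the window, so \<open>cheap\<close>, applied at
  \<open>s\<close> and at \<open>- s\<close>, bounds them uniformly in \<open>a\<close>.\<close>

lemma mv_cost:
 assumes kl: "k < m" "l < m" and i: "0 < \<iota>" and e: "0 < ep"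
 shows "EX s0>0. ALL s a. 0 < s --> s < s0 --> a : bm (GG J) --> (ALL q:space (GG J). \<bar>a q\<bar> <= 1) -->
  (ALL q:space (GG J). a q ~= 0 --> q : cross k l al be \<iota>) --> L (mv (tau k al be) a s) g <= L f g + ep * s\<^sup>2"
proof -
 \<comment> \<open>Half-width of a slab that contains the window between \<open>al\<close> and
   \<open>be\<close>.\<close>
 define R where "R = max \<bar>al\<bar> \<bar>be\<bar>"
 have R: "0 <= R" unfolding R_def by simp
 define c where "c s = (LINT x|GG I. indicator {x. \<bar>x j\<bar> <= R} x * (\<Sum>i<m. f i (sh j s x) * ex i x))" for s
 have "EX s0>0. ALL s. \<bar>s\<bar> < s0 --> c s <= (ep / 2) * s\<^sup>2"
  unfolding c_def by (rule cheap[OF jI R half_gt_zero[OF e] mom_f mom_g])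
 then obtain s1 where s1: "0 < s1" "!!s. \<bar>s\<bar> < s1 ==> c s <= (ep / 2) * s\<^sup>2" by blast
 have main: "L (mv (tau k al be) a s) g <= L f g + ep * s\<^sup>2"
  if s: "0 < s" "s < min s1 \<iota>" and a: "a : bm (GG J)" and a1: "!!q. q : space (GG J) ==> \<bar>a q\<bar> <= 1"
   and sa: "!!q. q : space (GG J) ==> a q ~= 0 ==> q : cross k l al be \<iota>" for s a
 proof -
  let ?\<tau> = "tau k al be"
  have mr: "relaxed (GG I) m (mv ?\<tau> a s)" by (rule mv_relaxed[OF tau_meas[OF kl(1)] a a1])
  define S where "S r x = (\<Sum>i<m. f i (sh j r x) * ex i x)" for r x
  have Sb: "bdd (GG I) (%x. indicator {x. \<bar>x j\<bar> <= R} x * S r x)" for r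
  proof (rule bdd_mult)
   have "(%x. (if \<bar>x j\<bar> <= R then 1 else 0)::real) : bm (GG I)" using meas_comp[OF jI] by measurable
   moreover have "(indicator {x. \<bar>x j\<bar> <= R} :: (nat => real) => real) = (%x. if \<bar>x j\<bar> <= R then 1 else 0)" by (auto simp: fun_eq_iff)
   ultimately show "bdd (GG I) (indicator {x. \<bar>x j\<bar> <= R})" by (intro bddI[where C=1]) auto
   show "bdd (GG I) (S r)" unfolding S_def[abs_def] by (intro bdd_sum bdd_mult bdd_sh[OF jI] fb ex_bdd) auto
  qed
  have "(LINT x|GG I. (\<Sum>i<m. mv ?\<tau> a s i x * ex i x)) <= (LINT x|GG I. indicator {x. \<bar>x j\<bar> <= R} x * S s x + indicator {x. \<bar>x j\<bar> <= R} x * S (- s) x)"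
  proof (rule integral_mono_AE)
   show "integrable (GG I) (%x. \<Sum>i<m. mv ?\<tau> a s i x * ex i x)"
    by (intro bdd_integrable bdd_sum bdd_mult ex_bdd relaxed_bdd[OF mr]) auto
   show "integrable (GG I) (%x. indicator {x. \<bar>x j\<bar> <= R} x * S s x + indicator {x. \<bar>x j\<bar> <= R} x * S (- s) x)"
    by (intro bdd_integrable bdd_add Sb)
   show "AE x in GG I. (\<Sum>i<m. mv ?\<tau> a s i x * ex i x) <= indicator {x. \<bar>x j\<bar> <= R} x * S s x + indicator {x. \<bar>x j\<bar> <= R} x * S (- s) x"
    using ex_nonneg AE_space
   proof eventually_elim
    case (elim x)
    define q where "q = restrict x J"
    have q: "q : space (GG J)" unfolding q_def by (rule restr_space[OF elim(2)])
    define U where "U = wu s (a q) (?\<tau> q) (x j)"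
    define D where "D = wd s (a q) (?\<tau> q) (x j)"
    have UD: "0 <= U" "0 <= D" "U <= 1" "D <= 1"
     using wu_nonneg[where s=s and v="a q" and \<tau>="?\<tau> q" and t="x j"] wu_wd[of s "a q" "?\<tau> q" "x j"] a1[OF q] unfolding U_def D_def by linarith+
    have S0: "0 <= S r x" for r unfolding S_def
     using elim relaxed_le1(2)[OF f_rel _ space_sh[OF jI elim(2)]] by (auto intro!: sum_nonneg mult_nonneg_nonneg)
    have "(\<Sum>i<m. mv ?\<tau> a s i x * ex i x) = (1 - U - D) * (\<Sum>i<m. f i x * ex i x) + U * S s x + D * S (- s) x"
     unfolding mv_def q_def[symmetric] U_def[symmetric] D_def[symmetric] S_def sum_distrib_left sum.distrib[symmetric]
     by (intro sum.cong refl) (simp add: algebra_simps)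
    also have "... = U * S s x + D * S (- s) x" using f_ex[OF elim(2)] by simp
    finally have e: "(\<Sum>i<m. mv ?\<tau> a s i x * ex i x) = U * S s x + D * S (- s) x" .
    show ?case
    proof (cases "U = 0 & D = 0")
     case True
     then show ?thesis unfolding e using S0[of s] S0[of "- s"] by simp
    next
     case False
     then have "a q ~= 0" unfolding U_def D_def wu_def wd_def by (auto split: if_splits)
     from sa[OF q this] have tw: "al + \<iota> < ?\<tau> q" "?\<tau> q < be - \<iota>" unfolding cross_def by auto
     have "\<bar>x j - ?\<tau> q\<bar> < s" using False unfolding U_def D_def wu_def wd_def by (auto split: if_splits)
     then have "\<bar>x j\<bar> <= R" using tw s unfolding R_def by auto
     then have "x : {x. \<bar>x j\<bar> <= R}" by simp
     moreover have "U * S s x <= 1 * S s x" "D * S (- s) x <= 1 * S (- s) x" by (rule mult_right_mono[OF UD(3) S0], rule mult_right_mono[OF UD(4) S0])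
     ultimately show ?thesis unfolding e by simp
    qed
   qed
  qed
  also have "... = c s + c (- s)"
   unfolding c_def S_def[symmetric] by (rule BI_integral_add) (intro bdd_integrable Sb)+
  also have "... <= (ep / 2) * s\<^sup>2 + (ep / 2) * (- s)\<^sup>2" using s by (intro add_mono s1(2)) auto
  also have "... = ep * s\<^sup>2" by simp
  finally show ?thesis unfolding L_excess[OF mr] by simp
 qed
 show ?thesis by (intro exI[of _ "min s1 \<iota>"] conjI allI impI main) (use s1 i in auto)
qed

text \<open>To first order the volume is \<open>s\<close> times the integral in \<open>z\<close>,
  which vanishes; as the Gaussian density is 1-Lipschitz, the error is of order s^2.\<close>

lemma lay_vol:
 assumes t: "\<tau> : bm (GG J)" and a: "a : bm (GG J)" and a1: "!!q. q : space (GG J) ==> \<bar>a q\<bar> <= 1"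
  and z: "(LINT q|GG J. a q * nd (\<tau> q)) = 0" and s: "0 < s"
 shows "\<bar>(LINT x|GG I. lay \<tau> a s x)\<bar> <= s\<^sup>2"
proof -
 interpret GJ: gauss J rh by (intro gauss.intro insJ(2) J_ne rho)
 note [measurable] = t a
 have lb: "bdd (GG I) (lay \<tau> a s)" by (rule lay_bdd[OF t a a1])
 define E where "E q = (LINT t|N01. win s (a q) (\<tau> q) t * 1)" for q
 have Em: "E : bm (GG J)"
  unfolding E_def[abs_def] by (intro N01.borel_measurable_lebesgue_integral) (simp add: split_beta')
 have E: "\<bar>E q - s * a q * nd (\<tau> q)\<bar> <= s\<^sup>2" if q: "q : space (GG J)" for q
 proof -
  have "\<bar>E q - s * a q * nd (\<tau> q)\<bar> <= s * \<bar>a q\<bar> * s"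
   unfolding E_def by (rule win_lim[OF s]) (auto intro: order_trans[OF nd_lip] less_imp_le)
  also have "... <= s * 1 * s" using a1[OF q] s by (intro mult_right_mono mult_left_mono) auto
  finally show ?thesis by (simp add: power2_eq_square)
 qed
 have nb: "bdd (GG J) (%q. s * (a q * nd (\<tau> q)))"
 proof (rule bddI[where C=s])
  fix q assume q: "q : space (GG J)"
  have "\<bar>a q\<bar> * \<bar>nd (\<tau> q)\<bar> <= 1 * 1" using a1[OF q] std_le1[of "\<tau> q"] normal_density_pos[of 1 0 "\<tau> q"] by (intro mult_mono) auto
  then have "s * (\<bar>a q\<bar> * \<bar>nd (\<tau> q)\<bar>) <= s * 1" using s by (intro mult_left_mono) auto
  then show "\<bar>s * (a q * nd (\<tau> q))\<bar> <= s" using s by (simp add: abs_mult)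
 qed measurable
 have Eb: "bdd (GG J) E"
 proof -
  obtain D where D: "!!x. x : space (GG J) ==> \<bar>s * (a x * nd (\<tau> x))\<bar> <= D" using bdd_obtain[OF nb] by blast
  show ?thesis
  proof (rule bddI[OF Em, where C="s\<^sup>2 + D"])
   fix x assume x: "x : space (GG J)"
   show "\<bar>E x\<bar> <= s\<^sup>2 + D" using E[OF x] D[OF x] by (simp add: mult.assoc)
  qed
 qed
 have "(LINT x|GG I. lay \<tau> a s x) = (LINT q|GG J. (LINT t|N01. lay \<tau> a s (q(j := t))))" by (rule int_J[OF bdd_integrable[OF lb]])
 also have "... = (LINT q|GG J. E q)" unfolding E_def by (intro BI_integral_cong refl) (simp add: lay_upd)
 finally have 1: "(LINT x|GG I. lay \<tau> a s x) = (LINT q|GG J. E q)" .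
 have 2: "(LINT q|GG J. s * (a q * nd (\<tau> q))) = 0" using z by simp
 have "(LINT q|GG J. E q) - (LINT q|GG J. s * (a q * nd (\<tau> q))) = (LINT q|GG J. E q - s * (a q * nd (\<tau> q)))"
  using GJ.bdd_integrable[OF Eb] GJ.bdd_integrable[OF nb] by simp
 moreover have "\<bar>(LINT q|GG J. E q - s * (a q * nd (\<tau> q)))\<bar> <= (LINT q|GG J. \<bar>E q - s * (a q * nd (\<tau> q))\<bar>)" by (rule integral_abs_bound)
 moreover have "(LINT q|GG J. \<bar>E q - s * (a q * nd (\<tau> q))\<bar>) <= (LINT q|GG J. s\<^sup>2)"
 proof (rule integral_mono)
  show "integrable (GG J) (%q. \<bar>E q - s * (a q * nd (\<tau> q))\<bar>)" by (intro GJ.bdd_integrable bdd_abs bdd_diff Eb nb)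
 qed (use E in \<open>auto simp: mult.assoc\<close>)
 moreover have "(LINT q|GG J. s\<^sup>2) = s\<^sup>2" using GJ.prob_space by simp
 ultimately show ?thesis unfolding 1 2 by linarith
qed

lemma lay_L1:
 assumes t: "\<tau> : bm (GG J)" and a: "a : bm (GG J)" and a1: "!!q. q : space (GG J) ==> \<bar>a q\<bar> <= 1"
  and s: "0 < s"
 shows "(LINT x|GG I. \<bar>lay \<tau> a s x\<bar>) <= 2 * s"
proof -
 interpret GJ: gauss J rh by (intro gauss.intro insJ(2) J_ne rho)
 note [measurable] = t a
 have lb: "bdd (GG I) (lay \<tau> a s)" by (rule lay_bdd[OF t a a1])
 have [measurable]: "lay \<tau> a s : bm (GG I)" using lb by (auto simp: bdd_def)
 have "(LINT x|GG I. \<bar>lay \<tau> a s x\<bar>) = (LINT q|GG J. (LINT t|N01. \<bar>lay \<tau> a s (q(j := t))\<bar>))" by (rule int_J) (intro bdd_integrable bdd_abs lb)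
 also have "... <= (LINT q|GG J. 2 * s)"
 proof (rule integral_mono_AE')
  show "AE q in GG J. (LINT t|N01. \<bar>lay \<tau> a s (q(j := t))\<bar>) <= 2 * s"
  proof (rule AE_I2)
   fix q assume q: "q : space (GG J)"
   have "(LINT t|N01. \<bar>lay \<tau> a s (q(j := t))\<bar>) <= (LINT t|N01. indicator {\<tau> q - s<..\<tau> q + s} t)"
   proof (rule integral_mono_AE')
    show "AE t in N01. \<bar>lay \<tau> a s (q(j := t))\<bar> <= indicator {\<tau> q - s<..\<tau> q + s} t"
    proof (rule AE_I2)
     fix t show "\<bar>lay \<tau> a s (q(j := t))\<bar> <= indicator {\<tau> q - s<..\<tau> q + s} t"
     proof (cases "win s (a q) (\<tau> q) t = 0")
      case False
      have "t : {\<tau> q - s<..\<tau> q + s}" using win_supp[OF False] by auto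
      then show ?thesis unfolding lay_upd[OF q] using win_abs[of s "a q" "\<tau> q" t] a1[OF q] by simp
     qed (simp add: lay_upd[OF q])
    qed
    show "integrable N01 (indicator {\<tau> q - s<..\<tau> q + s} :: real => real)" by (intro N01.bdd_integrable bdd_indicator) simp
   qed auto
   also have "... = measure N01 {\<tau> q - s<..\<tau> q + s}" by simp
   also have "... <= (\<tau> q + s) - (\<tau> q - s)" using s by (intro N01_interval) simp
   finally show "(LINT t|N01. \<bar>lay \<tau> a s (q(j := t))\<bar>) <= 2 * s" by simp
  qed
 qed (use s in \<open>auto intro!: AE_I2 BI_integral_nonneg\<close>)
 also have "... = 2 * s" using GJ.prob_space by simp
 finally show ?thesis .
qed

lemma T_cong_AE:
 assumes "bdd (GG I) ph" "bdd (GG I) ps" "AE x in GG I. ph x = ps x" "x : space (GG I)"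
 shows "T ph x = T ps x"
 unfolding T_def
proof (rule integral_cong_AE)
 show "AE y in GG I. kk rh I x y * ph y = kk rh I x y * ps y" using assms(3) by eventually_elim simp
qed (use kf_int[OF assms(1,4)] kf_int[OF assms(2,4)] in auto)

lemma pr_cong_AE:
 assumes b: "bdd (GG I) ph" "bdd (GG I) ph'" "bdd (GG I) ps" "bdd (GG I) ps'" and e: "AE x in GG I. ph x = ph' x" "AE x in GG I. ps x = ps' x"
 shows "pr ph ps = pr ph' ps'"
 unfolding pr_def
proof (rule integral_cong_AE)
 show "AE x in GG I. ph x * T ps x = ph' x * T ps' x"
  using e(1) AE_space by eventually_elim (simp add: T_cong_AE[OF b(3,4) e(2)])
qed (use pr_int[OF b(1,3)] pr_int[OF b(2,4)] in auto)

text \<open>The objective is bilinear and the volume terms are linear, so the expansion is exact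
  with a single interaction term.\<close>

lemma L_bilin:
 assumes r: "relaxed (GG I) m f'" "relaxed (GG I) m g'"
 shows "L f' g' = L f' g + L f g' - L f g + (\<Sum>i<m. pr (%x. f' i x - f i x) (%x. g' i x - g i x))"
proof -
 have "pr (%x. f' i x - f i x) (%x. g' i x - g i x) = pr (f' i) (g' i) - pr (f' i) (g i) - pr (f i) (g' i) + pr (f i) (g i)" if i: "i < m" for i
 proof -
  note b = relaxed_bdd[OF r(1) i] relaxed_bdd[OF r(2) i] fb[OF i] gb[OF i]
  show ?thesis using pr_diff_left[OF b(1,3) bdd_diff[OF b(2,4)]] pr_diff_right[OF b(1,2,4)] pr_diff_right[OF b(3,2,4)] by simp
 qed
 then have "(\<Sum>i<m. pr (%x. f' i x - f i x) (%x. g' i x - g i x)) = (\<Sum>i<m. pr (f' i) (g' i) - pr (f' i) (g i) - pr (f i) (g' i) + pr (f i) (g i))"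
  by (intro sum.cong) auto
 also have "... = B m f' g' - B m f' g - B m f g' + B m f g" unfolding B_def by (simp add: sum.distrib sum_subtractf)
 finally show ?thesis unfolding L_def by simp
qed

end

context gminj
begin

lemma dk_abs: "\<bar>dk k l i\<bar> <= 1" unfolding dk_def by auto

lemma mv_est:
 assumes kl: "k < m" "l < m" and i: "i < m"
  and a: "a : bm (GG J)" "!!q. q : space (GG J) ==> \<bar>a q\<bar> <= 1" and sa: "!!q. q : space (GG J) ==> a q ~= 0 ==> q : cross k l al be \<iota>"
  and s: "0 < s" "s < \<iota>" and z: "(LINT q|GG J. a q * nd (tau k al be q)) = 0"
 shows "\<bar>(LINT x|GG I. mv (tau k al be) a s i x) - (LINT x|GG I. f i x)\<bar> <= 2 * s\<^sup>2"
  and "(LINT x|GG I. \<bar>T (%y. mv (tau k al be) a s i y - f i y) x\<bar>) <= 2 * s"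
proof -
 let ?\<tau> = "tau k al be"
 have lb: "bdd (GG I) (lay ?\<tau> a s)" by (rule lay_bdd[OF tau_meas[OF kl(1)] a])
 have mb: "bdd (GG I) (mv ?\<tau> a s i)" using relaxed_bdd[OF mv_relaxed[OF tau_meas[OF kl(1)] a] i] .
 note db = bdd_diff[OF mb fb[OF i]]
 have e: "AE x in GG I. mv ?\<tau> a s i x - f i x = dk k l i * lay ?\<tau> a s x" by (rule mv_eq[OF kl i a sa s])
 have "(LINT x|GG I. mv ?\<tau> a s i x) - (LINT x|GG I. f i x) = (LINT x|GG I. mv ?\<tau> a s i x - f i x)"
  using bdd_integrable[OF mb] bdd_integrable[OF fb[OF i]] by simp
 also have "... = (LINT x|GG I. dk k l i * lay ?\<tau> a s x)"
  by (rule integral_cong_AE) (use e bdd_meas[OF db] bdd_meas[OF bdd_cmult[OF lb]] in auto)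
 also have "... = dk k l i * (LINT x|GG I. lay ?\<tau> a s x)" by simp
 finally have v: "(LINT x|GG I. mv ?\<tau> a s i x) - (LINT x|GG I. f i x) = dk k l i * (LINT x|GG I. lay ?\<tau> a s x)" .
 have "\<bar>dk k l i\<bar> * \<bar>(LINT x|GG I. lay ?\<tau> a s x)\<bar> <= 1 * s\<^sup>2"
  by (intro mult_mono dk_abs lay_vol[OF tau_meas[OF kl(1)] a z s(1)]) auto
 moreover have "0 <= s\<^sup>2" by simp
 ultimately show "\<bar>(LINT x|GG I. mv (tau k al be) a s i x) - (LINT x|GG I. f i x)\<bar> <= 2 * s\<^sup>2" unfolding v abs_mult by linarith
 have "(LINT x|GG I. \<bar>T (%y. mv ?\<tau> a s i y - f i y) x\<bar>) <= (LINT x|GG I. \<bar>mv ?\<tau> a s i x - f i x\<bar>)" by (rule T_L1[OF db])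
 also have "... <= (LINT x|GG I. \<bar>lay ?\<tau> a s x\<bar>)"
 proof (rule integral_mono_AE)
  show "integrable (GG I) (%x. \<bar>mv ?\<tau> a s i x - f i x\<bar>)" "integrable (GG I) (%x. \<bar>lay ?\<tau> a s x\<bar>)"
   by (intro bdd_integrable bdd_abs db lb)+
  show "AE x in GG I. \<bar>mv ?\<tau> a s i x - f i x\<bar> <= \<bar>lay ?\<tau> a s x\<bar>"
   using e
  proof eventually_elim
   case (elim x)
   have "\<bar>dk k l i\<bar> * \<bar>lay ?\<tau> a s x\<bar> <= 1 * \<bar>lay ?\<tau> a s x\<bar>" by (intro mult_right_mono dk_abs) simp
   then show ?case unfolding elim abs_mult by simp
  qed
 qed
 also have "... <= 2 * s" by (rule lay_L1[OF tau_meas[OF kl(1)] a s(1)])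
 finally show "(LINT x|GG I. \<bar>T (%y. mv (tau k al be) a s i y - f i y) x\<bar>) <= 2 * s" .
qed

text \<open>Put layers on both partitions. Each alone raises the Lagrangian by at most
  \<open>ep * s\<^sup>2\<close>, and by \<open>master\<close> the pair lowers it by at most
  \<open>ep * s\<^sup>2\<close>. The rest is the interaction: s^2 times the inner product of the
  jump vectors times \<open>KB\<close>, up to a small error, so it cannot be negative.\<close>

lemma bilin_nonneg:
 assumes kl: "k < m" "l < m" "k' < m" "l' < m" and i: "0 < \<iota>" "0 < \<iota>'"
  and a: "a : bm (GG J)" "!!q. q : space (GG J) ==> \<bar>a q\<bar> <= 1" and sa: "!!q. q : space (GG J) ==> a q ~= 0 ==> q : cross k l al be \<iota>"
  and b: "b : bm (GG J)" "!!q. q : space (GG J) ==> \<bar>b q\<bar> <= 1" and sb: "!!q. q : space (GG J) ==> b q ~= 0 ==> q : gminj.cross I g j k' l' al' be' \<iota>'"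
  and za: "(LINT q|GG J. a q * nd (tau k al be q)) = 0" and zb: "(LINT q|GG J. b q * nd (gminj.tau g j k' al' be' q)) = 0"
 shows "0 <= (dk k l k' - dk k l l') * KB (tau k al be) (gminj.tau g j k' al' be') a b"
proof (rule ccontr)
 interpret S: gminj I rh m g f mu lam j by (rule jswap)
 define \<sigma> where "\<sigma> = dk k l k' - dk k l l'"
 let ?\<tau> = "tau k al be" and ?\<tau>' = "S.tau k' al' be'"
 define K where "K = KB ?\<tau> ?\<tau>' a b"
 assume "\<not> ?thesis"
 then have neg: "\<sigma> * K < 0" unfolding \<sigma>_def K_def by simp
 \<comment> \<open>A tenth of the supposed deficit: after an error of 1 in the interaction and 1 for
   each layer, the pair would still fall by 7 times \<open>ep * s\<^sup>2\<close>, while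
   \<open>master\<close> allows 1.\<close>
 define ep where "ep = - (\<sigma> * K) / 10"
 have e: "0 < ep" "\<sigma> * K = - 10 * ep" using neg unfolding ep_def by auto
 have tm: "?\<tau> : bm (GG J)" "?\<tau>' : bm (GG J)" by (rule tau_meas[OF kl(1)], rule S.tau_meas[OF kl(3)])
 have de: "0 < ep / (\<bar>\<sigma>\<bar> + 1)" using e by (intro divide_pos_pos) auto
 have "EX s0>0. ALL s f' g'. 0 < s --> s < s0 --> relaxed (GG I) m f' --> relaxed (GG I) m g' -->
  (ALL i<m. \<bar>(LINT x|GG I. f' i x) - (LINT x|GG I. f i x)\<bar> <= 2 * s\<^sup>2) -->
  (ALL i<m. \<bar>(LINT x|GG I. g' i x) - (LINT x|GG I. g i x)\<bar> <= 2 * s\<^sup>2) -->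
  (ALL i<m. (LINT x|GG I. \<bar>T (%y. f' i y - f i y) x\<bar>) <= 2 * s) -->
  (ALL i<m. (LINT x|GG I. \<bar>T (%y. g' i y - g i y) x\<bar>) <= 2 * s) -->
  L f g - ep * s\<^sup>2 <= L f' g'" by (rule master[OF e(1)]) simp
 then obtain s0 where s0: "0 < s0" and ms: "!!s f' g'. 0 < s ==> s < s0 ==> relaxed (GG I) m f' ==> relaxed (GG I) m g' ==>
  (ALL i<m. \<bar>(LINT x|GG I. f' i x) - (LINT x|GG I. f i x)\<bar> <= 2 * s\<^sup>2) ==>
  (ALL i<m. \<bar>(LINT x|GG I. g' i x) - (LINT x|GG I. g i x)\<bar> <= 2 * s\<^sup>2) ==>
  (ALL i<m. (LINT x|GG I. \<bar>T (%y. f' i y - f i y) x\<bar>) <= 2 * s) ==>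
  (ALL i<m. (LINT x|GG I. \<bar>T (%y. g' i y - g i y) x\<bar>) <= 2 * s) ==>
  L f g - ep * s\<^sup>2 <= L f' g'" by blast
 obtain s1 where s1: "0 < s1" and c1: "!!s. 0 < s ==> s < s1 ==> L (mv ?\<tau> a s) g <= L f g + ep * s\<^sup>2"
  using mv_cost[OF kl(1,2) i(1) e(1), of al be] a sa by blast
 obtain s2 where s2: "0 < s2" and c2: "!!s. 0 < s ==> s < s2 ==> S.L (S.mv ?\<tau>' b s) f <= S.L g f + ep * s\<^sup>2"
  using S.mv_cost[OF kl(3,4) i(2) e(1), of al' be'] b sb by blast
 have w: "al + \<iota> < ?\<tau> q & ?\<tau> q < be - \<iota>" if "q : space (GG J)" "a q ~= 0" for q using sa[OF that] unfolding cross_def by blast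
 have w': "al' + \<iota>' < ?\<tau>' q & ?\<tau>' q < be' - \<iota>'" if "q : space (GG J)" "b q ~= 0" for q using sb[OF that] unfolding S.cross_def by blast
 obtain s3 where s3: "0 < s3" and c3: "!!s. 0 < s ==> s < s3 ==> \<bar>pr (lay ?\<tau> a s) (lay ?\<tau>' b s) - s\<^sup>2 * K\<bar> <= ep / (\<bar>\<sigma>\<bar> + 1) * s\<^sup>2"
  using pr_lay[OF tm a(1) b(1) a(2) b(2) w w' i de] unfolding K_def by blast
 define s where "s = Min {s0, s1, s2, s3, \<iota>, \<iota>'} / 2"
 have mp: "0 < Min {s0, s1, s2, s3, \<iota>, \<iota>'}" using s0 s1 s2 s3 i by simp
 have ml: "Min {s0, s1, s2, s3, \<iota>, \<iota>'} <= u" if "u : {s0, s1, s2, s3, \<iota>, \<iota>'}" for u using that by (intro Min_le) auto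
 have sl: "s < u" if "u : {s0, s1, s2, s3, \<iota>, \<iota>'}" for u using ml[OF that] mp unfolding s_def by linarith
 have p0: "0 < s" unfolding s_def using mp by (rule half_gt_zero)
 have s: "0 < s" "s < s0" "s < s1" "s < s2" "s < s3" "s < \<iota>" "s < \<iota>'"
  by (rule p0, (rule sl, simp)+)
 define f' where "f' = mv ?\<tau> a s"
 define g' where "g' = S.mv ?\<tau>' b s"
 have rf: "relaxed (GG I) m f'" "relaxed (GG I) m g'" unfolding f'_def g'_def
  by (rule mv_relaxed[OF tm(1) a], simp, rule S.mv_relaxed[OF tm(2) b], simp)
 have low: "L f g - ep * s\<^sup>2 <= L f' g'"
 proof (rule ms[OF s(1,2) rf]; intro allI impI)
  fix i assume im: "i < m"
  show "\<bar>(LINT x|GG I. f' i x) - (LINT x|GG I. f i x)\<bar> <= 2 * s\<^sup>2" "(LINT x|GG I. \<bar>T (%y. f' i y - f i y) x\<bar>) <= 2 * s"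
   unfolding f'_def by (rule mv_est[OF kl(1,2) im a sa s(1,6) za]; assumption)+
  show "\<bar>(LINT x|GG I. g' i x) - (LINT x|GG I. g i x)\<bar> <= 2 * s\<^sup>2" "(LINT x|GG I. \<bar>T (%y. g' i y - g i y) x\<bar>) <= 2 * s"
   unfolding g'_def by (rule S.mv_est[OF kl(3,4) im b sb s(1,7) zb]; assumption)+
 qed
 have up1: "L f' g <= L f g + ep * s\<^sup>2" unfolding f'_def by (rule c1[OF s(1,3)])
 have up2: "L f g' <= L f g + ep * s\<^sup>2"
  using c2[OF s(1,4)] L_swap[OF f_rel rf(2)] L_swap[OF f_rel g_rel] unfolding g'_def by simp
 have prs: "(\<Sum>i<m. pr (%x. f' i x - f i x) (%x. g' i x - g i x)) = \<sigma> * pr (lay ?\<tau> a s) (lay ?\<tau>' b s)"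
 proof -
  have lb: "bdd (GG I) (lay ?\<tau> a s)" "bdd (GG I) (lay ?\<tau>' b s)" by (rule lay_bdd[OF tm(1) a], simp, rule lay_bdd[OF tm(2) b], simp)
  have "pr (%x. f' i x - f i x) (%x. g' i x - g i x) = (dk k l i * dk k' l' i) * pr (lay ?\<tau> a s) (lay ?\<tau>' b s)" if im: "i < m" for i
  proof -
   have "pr (%x. f' i x - f i x) (%x. g' i x - g i x) = pr (%x. dk k l i * lay ?\<tau> a s x) (%x. dk k' l' i * lay ?\<tau>' b s x)"
   proof (rule pr_cong_AE)
    show "AE x in GG I. f' i x - f i x = dk k l i * lay ?\<tau> a s x" unfolding f'_def by (rule mv_eq[OF kl(1,2) im a sa s(1,6)])
    show "AE x in GG I. g' i x - g i x = dk k' l' i * lay ?\<tau>' b s x" unfolding g'_def by (rule S.mv_eq[OF kl(3,4) im b sb s(1,7)])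
   qed (intro bdd_diff bdd_cmult lb relaxed_bdd[OF rf(1) im] relaxed_bdd[OF rf(2) im] fb gb im)+
   also have "... = dk k l i * (dk k' l' i * pr (lay ?\<tau> a s) (lay ?\<tau>' b s))"
    using pr_cmult_left pr_cmult_right[OF lb] by simp
   finally show ?thesis by simp
  qed
  then have "(\<Sum>i<m. pr (%x. f' i x - f i x) (%x. g' i x - g i x)) = (\<Sum>i<m. dk k l i * dk k' l' i) * pr (lay ?\<tau> a s) (lay ?\<tau>' b s)"
   by (simp add: sum_distrib_right)
  also have "(\<Sum>i<m. dk k l i * dk k' l' i) = (\<Sum>i<m. (if i = k' then dk k l i else 0) - (if i = l' then dk k l i else 0))"
   unfolding dk_def[of k' l'] by (intro sum.cong) auto
  also have "... = \<sigma>" unfolding \<sigma>_def using kl by (simp add: sum_subtractf)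
  finally show ?thesis .
 qed
 define X where "X = pr (lay ?\<tau> a s) (lay ?\<tau>' b s)"
 have "\<bar>\<sigma> * (X - s\<^sup>2 * K)\<bar> <= \<bar>\<sigma>\<bar> * (ep / (\<bar>\<sigma>\<bar> + 1) * s\<^sup>2)"
  unfolding abs_mult X_def by (intro mult_left_mono c3[OF s(1,5)]) simp
 also have "... = (\<bar>\<sigma>\<bar> / (\<bar>\<sigma>\<bar> + 1)) * (ep * s\<^sup>2)" by simp
 also have "... <= 1 * (ep * s\<^sup>2)" using e by (intro mult_right_mono) auto
 finally have "\<sigma> * (X - s\<^sup>2 * K) <= ep * s\<^sup>2" by linarith
 then have "\<sigma> * X <= ep * s\<^sup>2 + s\<^sup>2 * (\<sigma> * K)" by (simp add: algebra_simps)
 also have "... = - 9 * (ep * s\<^sup>2)" unfolding e(2) by (simp add: algebra_simps)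
 finally have X: "\<sigma> * X <= - 9 * (ep * s\<^sup>2)" .
 have "L f' g' = L f' g + L f g' - L f g + \<sigma> * X" using L_bilin[OF rf] unfolding prs X_def .
 moreover have "0 < ep * s\<^sup>2" using e s by simp
 ultimately show False using low up1 up2 X by linarith
qed

text \<open>Replacing \<open>b\<close> by \<open>- b\<close> reverses the sign of \<open>KB\<close>
  and respects all constraints on \<open>b\<close>.\<close>

lemma bilin_zero:
 assumes kl: "k < m" "l < m" "k' < m" "l' < m" and i: "0 < \<iota>" "0 < \<iota>'" and sg: "dk k l k' ~= dk k l l'"
  and a: "a : bm (GG J)" "!!q. q : space (GG J) ==> \<bar>a q\<bar> <= 1" and sa: "!!q. q : space (GG J) ==> a q ~= 0 ==> q : cross k l al be \<iota>"
  and b: "b : bm (GG J)" "!!q. q : space (GG J) ==> \<bar>b q\<bar> <= 1" and sb: "!!q. q : space (GG J) ==> b q ~= 0 ==> q : gminj.cross I g j k' l' al' be' \<iota>'"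
  and za: "(LINT q|GG J. a q * nd (tau k al be q)) = 0" and zb: "(LINT q|GG J. b q * nd (gminj.tau g j k' al' be' q)) = 0"
 shows "KB (tau k al be) (gminj.tau g j k' al' be') a b = 0"
proof -
 have "0 <= (dk k l k' - dk k l l') * KB (tau k al be) (gminj.tau g j k' al' be') a b"
  by (rule bilin_nonneg[OF kl i a sa b sb za zb])
 moreover have "0 <= (dk k l k' - dk k l l') * KB (tau k al be) (gminj.tau g j k' al' be') a (%q. - b q)"
  by (rule bilin_nonneg[OF kl i a sa _ _ _ za]) (use b sb zb in auto)
 moreover have "KB (tau k al be) (gminj.tau g j k' al' be') a (%q. - b q) = - KB (tau k al be) (gminj.tau g j k' al' be') a b"
  unfolding KB_def by simp
 ultimately have "(dk k l k' - dk k l l') * KB (tau k al be) (gminj.tau g j k' al' be') a b = 0" by simp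
 then show ?thesis using sg by simp
qed

end

section \<open>Kernels that vanish on constrained products\<close>

lemma AE_zero_rect:
 fixes h :: "'a \<times> 'a => real"
 assumes M: "prob_space M" and h: "integrable (M \<Otimes>\<^sub>M M) h"
  and z: "!!A B. A : sets M ==> B : sets M ==> (LINT z|(M \<Otimes>\<^sub>M M). indicator (A \<times> B) z * h z) = 0"
 shows "AE z in M \<Otimes>\<^sub>M M. h z = 0"
proof (rule density_unique_real[OF h])
 show "integrable (M \<Otimes>\<^sub>M M) (%_. 0 :: real)" by simp
 define G where "G = {a \<times> b | a b. a : sets M & b : sets M}"
 have sG: "sets (M \<Otimes>\<^sub>M M) = sigma_sets (space M \<times> space M) G" unfolding G_def sets_pair_measure ..
 fix E assume "E : sets (M \<Otimes>\<^sub>M M)"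
 then have E: "E : sigma_sets (space M \<times> space M) G" unfolding sG .
 have "(\<integral>z\<in>E. h z \<partial>(M \<Otimes>\<^sub>M M)) = 0"
  using Int_stable_pair_measure_generator[of M M, folded G_def] pair_measure_closed[of M M, folded G_def] E
 proof (induction rule: sigma_sets_induct_disjoint)
  case (basic A)
  then obtain a b where "A = a \<times> b" "a : sets M" "b : sets M" unfolding G_def by blast
  then show ?case using z[of a b] by (simp add: set_lebesgue_integral_def)
 next
  case empty
  show ?case by (simp add: set_lebesgue_integral_def)
 next
  case (compl A)
  have A: "A : sets (M \<Otimes>\<^sub>M M)" using compl sG by simp
  have i: "integrable (M \<Otimes>\<^sub>M M) (%z. indicator A z * h z)" using integrable_mult_indicator[OF A h] by simp
  have "(\<integral>z\<in>(space M \<times> space M - A). h z \<partial>(M \<Otimes>\<^sub>M M)) = (LINT z|(M \<Otimes>\<^sub>M M). indicator (space M \<times> space M) z * h z - indicator A z * h z)"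
   unfolding set_lebesgue_integral_def
   using sets.sets_into_space[OF A] by (intro BI_integral_cong refl) (auto simp: space_pair_measure split: split_indicator)
  also have "... = (LINT z|(M \<Otimes>\<^sub>M M). indicator (space M \<times> space M) z * h z) - (LINT z|(M \<Otimes>\<^sub>M M). indicator A z * h z)"
  proof (rule BI_integral_diff[OF _ i])
   have "space M \<times> space M : sets (M \<Otimes>\<^sub>M M)" by auto
   from integrable_mult_indicator[OF this h] show "integrable (M \<Otimes>\<^sub>M M) (%z. indicator (space M \<times> space M) z * h z)" by simp
  qed
  also have "... = 0" using z[OF sets.top sets.top] compl(2) by (simp add: set_lebesgue_integral_def)
  finally show ?case .
 next
  case (union A)
  have A: "A i : sets (M \<Otimes>\<^sub>M M)" for i using union(2) sG by auto
  have "(\<integral>z\<in>(\<Union>i. A i). h z \<partial>(M \<Otimes>\<^sub>M M)) = (\<Sum>i. (\<integral>z\<in>A i. h z \<partial>(M \<Otimes>\<^sub>M M)))"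
  proof (rule lebesgue_integral_countable_add[OF A])
   show "!!i j. i ~= j ==> A i \<inter> A j = {}" using union(1) unfolding disjoint_family_on_def by blast
   show "set_integrable (M \<Otimes>\<^sub>M M) (\<Union> (range A)) h" unfolding set_integrable_def
    by (rule integrable_mult_indicator[OF _ h]) (use A in auto)
  qed
  then show ?case using union(3) by simp
 qed
 then show "(\<integral>z\<in>E. h z \<partial>(M \<Otimes>\<^sub>M M)) = (\<integral>z\<in>E. 0 \<partial>(M \<Otimes>\<^sub>M M))" by (simp add: set_lebesgue_integral_def)
qed

text \<open>Test with indicators of sets, corrected by constants so that they meet the linear
  constraints. The resulting identity says that over every rectangle \<open>F\<close> has the same
  integral as \<open>p\<close> times a function of the second variable plus \<open>p'\<close> times
  a function of the first, both read off the marginals \<open>f1\<close> and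
  \<open>f2\<close>.\<close>

lemma additive_kernel:
 fixes F :: "'a => 'a => real"
 assumes M: "prob_space M" and F: "integrable (M \<Otimes>\<^sub>M M) (%z. F (fst z) (snd z))"
  and p: "integrable M p" "!!x. 0 <= p x" "(LINT x|M. p x) ~= 0" and p': "integrable M p'" "!!x. 0 <= p' x" "(LINT x|M. p' x) ~= 0"
  and z: "!!a b. a : bm M ==> b : bm M ==> (!!x. x : space M ==> \<bar>a x\<bar> <= 1) ==> (!!x. x : space M ==> \<bar>b x\<bar> <= 1) ==>
   (LINT x|M. a x * p x) = 0 ==> (LINT x|M. b x * p' x) = 0 ==> (LINT x|M. a x * (LINT y|M. b y * F x y)) = 0"
 shows "EX A B. AE z in M \<Otimes>\<^sub>M M. F (fst z) (snd z) = p (fst z) * A (snd z) + B (fst z) * p' (snd z)"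
proof -
 interpret M: prob_space M by (rule M)
 interpret PP: pair_sigma_finite M M by unfold_locales
 define W where "W = (LINT x|M. p x)"
 define W' where "W' = (LINT x|M. p' x)"
 have W: "0 < W" "0 < W'" unfolding W_def W'_def
  using p(3) p'(3) BI_integral_nonneg[of M p] BI_integral_nonneg[of M p'] p(2) p'(2) by (auto simp: less_le)
 define f1 where "f1 y = (LINT x|M. F x y)" for y
 define f2 where "f2 x = (LINT y|M. F x y)" for x
 define u where "u B x = (LINT y|M. indicator B y * F x y)" for B x
 have Fs: "integrable (M \<Otimes>\<^sub>M M) (%(x, y). F x y)" using F by (simp add: split_beta')
 have f2i: "integrable M f2" unfolding f2_def[abs_def] using PP.integrable_fst[OF Fs] by simp
 have f1i: "integrable M f1" unfolding f1_def[abs_def] using PP.integrable_snd[OF Fs] .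
 have FB: "integrable (M \<Otimes>\<^sub>M M) (%(x, y). indicator B y * F x y)" if B: "B : sets M" for B
 proof -
  have "space M \<times> B : sets (M \<Otimes>\<^sub>M M)" using B by auto
  from integrable_mult_indicator[OF this F] have "integrable (M \<Otimes>\<^sub>M M) (%z. indicator (space M \<times> B) z * F (fst z) (snd z))" by simp
  then show ?thesis
   by (rule BI_integrable_cong[THEN iffD1, rotated 2]) (auto simp: space_pair_measure indicator_times)
 qed
 have ui: "integrable M (u B)" if "B : sets M" for B unfolding u_def[abs_def] using PP.integrable_fst[OF FB[OF that]] by simp
 have u1: "(LINT x|M. u B x) = (LINT y|M. indicator B y * f1 y)" if "B : sets M" for B
  using PP.Fubini_integral[OF FB[OF that]] unfolding u_def f1_def by simp
 have AEF: "AE x in M. integrable M (F x)" using PP.AE_integrable_fst[OF Fs] by simp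
 have mi: "integrable M (%x. indicator A x * v x)" if "A : sets M" "integrable M v" for A and v :: "'a => real"
  using integrable_mult_indicator[OF that] by simp
 \<comment> \<open>Both marginal terms contain the total integral of \<open>F\<close>; it is
   subtracted once.\<close>
 define R where "R z = F (fst z) (snd z) - p (fst z) * (f1 (snd z) / W) - (f2 (fst z) / W' - (LINT x|M. f2 x) * p (fst z) / (W * W')) * p' (snd z)" for z
 have prodi: "integrable (M \<Otimes>\<^sub>M M) (%z. v (fst z) * w (snd z))" if v: "integrable M v" and w: "integrable M w" for v w :: "'a => real"
 proof -
  have [measurable]: "v : bm M" "w : bm M" using v w by auto
  show ?thesis
  proof (rule PP.Fubini_integrable)
   show "integrable M (%x. (LINT y|M. norm (v (fst (x, y)) * w (snd (x, y)))))" using integrable_abs[OF v] by (simp add: abs_mult)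
   show "AE x in M. integrable M (%y. v (fst (x, y)) * w (snd (x, y)))" using w by simp
  qed measurable
 qed
 have prodI: "(LINT z|(M \<Otimes>\<^sub>M M). v (fst z) * w (snd z)) = (LINT x|M. v x) * (LINT x|M. w x)" if v: "integrable M v" and w: "integrable M w" for v w :: "'a => real"
  using PP.integral_fst'[OF prodi[OF v w]] by simp
 define f0 where "f0 = (LINT x|M. f2 x)"
 define g2 where "g2 x = f2 x / W' - f0 * p x / (W * W')" for x
 have g2i: "integrable M g2" unfolding g2_def[abs_def] using f2i p(1) by simp
 have f1W: "integrable M (%y. f1 y / W)" using f1i by simp
 have Re: "R z = F (fst z) (snd z) - p (fst z) * (f1 (snd z) / W) - g2 (fst z) * p' (snd z)" for z
  unfolding R_def g2_def f0_def ..
 have Ri: "integrable (M \<Otimes>\<^sub>M M) R"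
  unfolding Re[abs_def] by (intro BI_integrable_diff F prodi p(1) p'(1) f1W g2i)
 have "AE z in M \<Otimes>\<^sub>M M. R z = 0"
 proof (rule AE_zero_rect[OF M Ri])
  fix A B assume A: "A : sets M" and B: "B : sets M"
  \<comment> \<open>The constants that make \<open>indicator A - c\<close> orthogonal to
    \<open>p\<close> and \<open>indicator B - c'\<close> orthogonal to \<open>p'\<close>.\<close>
  define c where "c = (LINT x|M. indicator A x * p x) / W"
  define c' where "c' = (LINT x|M. indicator B x * p' x) / W'"
  have bnd: "0 <= (LINT x|M. indicator A x * v x)" "(LINT x|M. indicator A x * v x) <= (LINT x|M. v x)"
   if "A : sets M" "integrable M v" "!!x. 0 <= v x" for A and v :: "'a => real"
  proof -
   show "0 <= (LINT x|M. indicator A x * v x)" using that(3) by (intro BI_integral_nonneg) simp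
   show "(LINT x|M. indicator A x * v x) <= (LINT x|M. v x)"
    using that mi[OF that(1,2)] by (intro integral_mono) (auto split: split_indicator)
  qed
  have c01: "0 <= c" "c <= 1" "0 <= c'" "c' <= 1"
   using bnd[OF A p(1,2)] bnd[OF B p'(1,2)] W unfolding c_def c'_def W_def[symmetric] W'_def[symmetric] by (auto simp: divide_le_eq)
  have "(LINT x|M. (indicator A x - c) * (LINT y|M. (indicator B y - c') * F x y)) = 0"
  proof (rule z)
   show "(%x. indicator A x - c) : bm M" "(%x. indicator B x - c') : bm M" using A B by measurable
   show "\<bar>indicator A x - c\<bar> <= 1" "\<bar>indicator B x - c'\<bar> <= 1" for x using c01 by (auto split: split_indicator)
   have "(LINT x|M. (indicator A x - c) * p x) = (LINT x|M. indicator A x * p x - c * p x)" by (simp add: left_diff_distrib)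
   also have "... = c * W - c * W" using mi[OF A p(1)] p(1) W unfolding c_def W_def by simp
   finally show "(LINT x|M. (indicator A x - c) * p x) = 0" by simp
   have "(LINT x|M. (indicator B x - c') * p' x) = (LINT x|M. indicator B x * p' x - c' * p' x)" by (simp add: left_diff_distrib)
   also have "... = c' * W' - c' * W'" using mi[OF B p'(1)] p'(1) W unfolding c'_def W'_def by simp
   finally show "(LINT x|M. (indicator B x - c') * p' x) = 0" by simp
  qed
  moreover have "(LINT x|M. (indicator A x - c) * (LINT y|M. (indicator B y - c') * F x y)) =
   (LINT x|M. indicator A x * u B x - c * u B x - c' * (indicator A x * f2 x) + c * c' * f2 x)"
  proof (rule integral_cong_AE)
   have "(%x. (LINT y|M. (indicator B y - c') * F x y)) : bm M"
   proof -
    have "(%z. (indicator B (snd z) - c') * F (fst z) (snd z)) : bm (M \<Otimes>\<^sub>M M)"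
     using B borel_measurable_integrable[OF F] by (intro borel_measurable_times borel_measurable_diff) auto
    then show ?thesis by (intro M.borel_measurable_lebesgue_integral) (simp add: split_beta')
   qed
   then show "(%x. (indicator A x - c) * (LINT y|M. (indicator B y - c') * F x y)) : bm M"
    using A by (intro borel_measurable_times borel_measurable_diff) auto
   show "(%x. indicator A x * u B x - c * u B x - c' * (indicator A x * f2 x) + c * c' * f2 x) : bm M"
    using ui[OF B] f2i A by (intro borel_measurable_add borel_measurable_diff borel_measurable_times) auto
   show "AE x in M. (indicator A x - c) * (LINT y|M. (indicator B y - c') * F x y) =
    indicator A x * u B x - c * u B x - c' * (indicator A x * f2 x) + c * c' * f2 x"
    using AEF
   proof eventually_elim
    case (elim x)
    have "(LINT y|M. (indicator B y - c') * F x y) = (LINT y|M. indicator B y * F x y - c' * F x y)" by (simp add: left_diff_distrib)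
    also have "... = u B x - c' * f2 x" unfolding u_def f2_def using mi[OF B elim] elim by simp
    finally have e: "(LINT y|M. (indicator B y - c') * F x y) = u B x - c' * f2 x" .
    show ?case unfolding e by (simp add: algebra_simps)
   qed
  qed
  moreover have "... = (LINT x|M. indicator A x * u B x) - c * (LINT x|M. u B x) - c' * (LINT x|M. indicator A x * f2 x) + c * c' * f0"
   unfolding f0_def using ui[OF B] f2i mi[OF A ui[OF B]] mi[OF A f2i] by simp
  ultimately have key: "(LINT x|M. indicator A x * u B x) - c * (LINT x|M. u B x) - c' * (LINT x|M. indicator A x * f2 x) + c * c' * f0 = 0" by simp
  have i1: "(LINT z|(M \<Otimes>\<^sub>M M). indicator (A \<times> B) z * F (fst z) (snd z)) = (LINT x|M. indicator A x * u B x)"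
   and i1': "integrable (M \<Otimes>\<^sub>M M) (%z. indicator (A \<times> B) z * F (fst z) (snd z))"
  proof -
   have "A \<times> B : sets (M \<Otimes>\<^sub>M M)" using A B by auto
   from integrable_mult_indicator[OF this F] show i: "integrable (M \<Otimes>\<^sub>M M) (%z. indicator (A \<times> B) z * F (fst z) (snd z))" by simp
   have "(LINT z|(M \<Otimes>\<^sub>M M). indicator (A \<times> B) z * F (fst z) (snd z)) = (LINT x|M. (LINT y|M. indicator (A \<times> B) (x, y) * F x y))"
    using PP.integral_fst'[OF i] by simp
   also have "... = (LINT x|M. indicator A x * u B x)"
    unfolding u_def by (intro BI_integral_cong refl) (auto simp: indicator_times mult.assoc)
   finally show "(LINT z|(M \<Otimes>\<^sub>M M). indicator (A \<times> B) z * F (fst z) (snd z)) = (LINT x|M. indicator A x * u B x)" .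
  qed
  let ?v1 = "%x. indicator A x * p x" and ?w1 = "%y. indicator B y * (f1 y / W)" and ?v2 = "%x. indicator A x * g2 x" and ?w2 = "%y. indicator B y * p' y"
  have vi: "integrable M ?v1" "integrable M ?w1" "integrable M ?v2" "integrable M ?w2" by (intro mi A B p(1) p'(1) f1W g2i)+
  have "(LINT z|(M \<Otimes>\<^sub>M M). indicator (A \<times> B) z * R z) = (LINT z|(M \<Otimes>\<^sub>M M). indicator (A \<times> B) z * F (fst z) (snd z) - ?v1 (fst z) * ?w1 (snd z) - ?v2 (fst z) * ?w2 (snd z))"
   unfolding Re by (intro BI_integral_cong refl) (auto split: split_indicator)
  also have "... = (LINT z|(M \<Otimes>\<^sub>M M). indicator (A \<times> B) z * F (fst z) (snd z)) - (LINT z|(M \<Otimes>\<^sub>M M). ?v1 (fst z) * ?w1 (snd z)) - (LINT z|(M \<Otimes>\<^sub>M M). ?v2 (fst z) * ?w2 (snd z))"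
   by (subst BI_integral_diff[OF BI_integrable_diff[OF i1' prodi[OF vi(1,2)]] prodi[OF vi(3,4)]],
     subst BI_integral_diff[OF i1' prodi[OF vi(1,2)]]) (rule refl)
  also have "... = (LINT x|M. indicator A x * u B x) - (c * W) * ((LINT x|M. u B x) / W) - ((LINT x|M. indicator A x * f2 x) / W' - f0 * (c * W) / (W * W')) * (c' * W')"
  proof -
   have e1: "(LINT x|M. ?v1 x) = c * W" "(LINT x|M. ?w2 x) = c' * W'" unfolding c_def c'_def using W by auto
   have e2: "(LINT x|M. ?w1 x) = (LINT x|M. u B x) / W" unfolding u1[OF B] by simp
   have "(LINT x|M. ?v2 x) = (LINT x|M. (indicator A x * f2 x) / W' - f0 / (W * W') * ?v1 x)"
    unfolding g2_def by (intro BI_integral_cong refl) (simp add: algebra_simps)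
   also have "... = (LINT x|M. indicator A x * f2 x) / W' - f0 / (W * W') * (c * W)"
    using mi[OF A f2i] vi(1) unfolding e1(1)[symmetric] by simp
   finally have e3: "(LINT x|M. ?v2 x) = (LINT x|M. indicator A x * f2 x) / W' - f0 * (c * W) / (W * W')" by simp
   show ?thesis unfolding i1 prodI[OF vi(1,2)] prodI[OF vi(3,4)] e1 e2 e3 ..
  qed
  also have "... = (LINT x|M. indicator A x * u B x) - c * (LINT x|M. u B x) - c' * (LINT x|M. indicator A x * f2 x) + c * c' * f0"
   using W by (simp add: field_simps)
  also have "... = 0" by (rule key)
  finally show "(LINT z|(M \<Otimes>\<^sub>M M). indicator (A \<times> B) z * R z) = 0" .
 qed
 then have "AE z in M \<Otimes>\<^sub>M M. F (fst z) (snd z) = p (fst z) * (f1 (snd z) / W) + g2 (fst z) * p' (snd z)"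
 proof eventually_elim
  case (elim z)
  then show ?case using Re[of z] by linarith
 qed
 then show ?thesis by (intro exI[of _ "%y. f1 y / W"] exI[of _ g2])
qed

section \<open>Countably many solutions of the kernel equations\<close>

text \<open>With complex logarithms the difference of the two sides is holomorphic on a convex
  domain, so its zeros are countable unless it is constant. As \<open>w\<close> tends to 0 from the
  right, \<open>ln w\<close> diverges while the other logarithms tend to 0, so it is not
  constant.\<close>

lemma ln_quad_countable:
 fixes C1 C2 al0 al1 al2 be0 be1 be2 e0 a u v :: real
 defines "P \<equiv> %w. al0 + al1 * ln (1 + C1 * w) + al2 * ln (1 + C2 * w)"
  and "Q \<equiv> %w. be0 + be1 * ln (1 + C1 * w) + be2 * ln (1 + C2 * w)"
 shows "countable {w. 0 < w & 0 < 1 + C1 * w & 0 < 1 + C2 * w & ln w = e0 + a * ((P w)\<^sup>2 + (Q w)\<^sup>2) - u * P w - v * Q w}"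
proof -
 define D where "D = {z. 0 < Re z} \<inter> {z. 0 < Re (1 + of_real C1 * z)} \<inter> {z. 0 < Re (1 + of_real C2 * z)}"
 define L1 where "L1 z = Ln (1 + of_real C1 * z)" for z
 define L2 where "L2 z = Ln (1 + of_real C2 * z)" for z
 define Pc where "Pc z = of_real al0 + of_real al1 * L1 z + of_real al2 * L2 z" for z
 define Qc where "Qc z = of_real be0 + of_real be1 * L1 z + of_real be2 * L2 z" for z
 define F where "F z = Ln z - (of_real e0 + of_real a * ((Pc z)\<^sup>2 + (Qc z)\<^sup>2) - of_real u * Pc z - of_real v * Qc z)" for z
 define H where "H w = e0 + a * ((P w)\<^sup>2 + (Q w)\<^sup>2) - u * P w - v * Q w" for w
 have nz: "0 < Re z ==> z ~: \<real>\<^sub>\<le>\<^sub>0" for z :: complex by (auto simp: complex_nonpos_Reals_iff)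
 have h1: "Ln holomorphic_on D" by (rule holomorphic_on_Ln) (use nz in \<open>auto simp: D_def\<close>)
 have h2: "L1 holomorphic_on D" "L2 holomorphic_on D"
  unfolding L1_def[abs_def] L2_def[abs_def] by (intro holomorphic_intros; use nz in \<open>auto simp: D_def\<close>)+
 have h3: "F holomorphic_on D" unfolding F_def[abs_def] Pc_def[abs_def] Qc_def[abs_def]
  by (intro holomorphic_intros h1 h2)
 have o: "open D" unfolding D_def by (intro open_Int open_Collect_less continuous_intros)
 have cv: "convex D"
 proof -
  have "convex {z. 0 < Re (1 + of_real c * z)}" for c
  proof -
   have "{z. 0 < Re (1 + of_real c * z)} = {z. inner (complex_of_real c) z > -1}" by (auto simp: inner_complex_def)
   then show ?thesis using convex_halfspace_gt by metis
  qed
  moreover have "convex {z. 0 < Re z}" by (rule convex_halfspace_Re_gt)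
  ultimately show ?thesis unfolding D_def by (intro convex_Int)
 qed
 have real: "F (of_real w) = of_real (ln w - H w)" "of_real w : D" if "0 < w" "0 < 1 + C1 * w" "0 < 1 + C2 * w" for w
 proof -
  have l1: "L1 (of_real w) = of_real (ln (1 + C1 * w))"
   using Ln_of_real[OF that(2)] unfolding L1_def by simp
  have l2: "L2 (of_real w) = of_real (ln (1 + C2 * w))"
   using Ln_of_real[OF that(3)] unfolding L2_def by simp
  show "F (of_real w) = of_real (ln w - H w)"
   unfolding F_def H_def Pc_def Qc_def l1 l2 P_def Q_def Ln_of_real[OF that(1)] by simp
  show "of_real w : D" unfolding D_def using that by simp
 qed
 have nc: "\<not> F constant_on D"
 proof
  assume "F constant_on D"
  then obtain k where k: "!!z. z : D ==> F z = k" unfolding constant_on_def by blast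
  have t1: "((%w. 1 + c * w) \<longlongrightarrow> 1 + c * 0) (at_right 0)" for c :: real by (intro tendsto_intros)
  have ev: "eventually (%w. 0 < 1 + c * w) (at_right 0)" for c :: real
   by (rule order_tendstoD(1)[OF t1]) simp
  have tl: "((%w. ln (1 + c * w)) \<longlongrightarrow> ln (1 + c * 0)) (at_right 0)" for c :: real
   by (rule tendsto_ln[OF t1]) simp
  obtain l0 where tH: "(H \<longlongrightarrow> l0) (at_right 0)"
  proof
   show "(H \<longlongrightarrow> e0 + a * ((al0 + al1 * ln (1 + C1 * 0) + al2 * ln (1 + C2 * 0))\<^sup>2 + (be0 + be1 * ln (1 + C1 * 0) + be2 * ln (1 + C2 * 0))\<^sup>2) -
    u * (al0 + al1 * ln (1 + C1 * 0) + al2 * ln (1 + C2 * 0)) - v * (be0 + be1 * ln (1 + C1 * 0) + be2 * ln (1 + C2 * 0))) (at_right 0)"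
    unfolding H_def[abs_def] P_def Q_def by (intro tendsto_intros tl)
  qed
  have X: "((%w. Re k + H w) \<longlongrightarrow> Re k + l0) (at_right 0)" by (intro tendsto_intros tH)
  have Y: "eventually (%w. ln w = Re k + H w) (at_right 0)"
   using ev[of C1] ev[of C2] eventually_at_right_less[of 0]
  proof eventually_elim
   case (elim w)
   have "of_real (ln w - H w) = k" using real[OF elim(3,1,2)] k by metis
   then have "ln w - H w = Re k" by (metis Re_complex_of_real)
   then show ?case by simp
  qed
  have "(ln \<longlongrightarrow> Re k + l0) (at_right (0::real))" using X tendsto_cong[OF Y] by blast
  moreover have "filterlim ln at_infinity (at_right (0::real))" using ln_at_0 filterlim_at_bot_imp_at_infinity by blast
  ultimately show False using not_tendsto_and_filterlim_at_infinity[of "at_right (0::real)"] trivial_limit_at_right_real by blast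
 qed
 have fs: "fsigma D"
 proof -
  obtain C :: "nat => complex set" where C: "!!n. compact (C n)" "\<Union> (range C) = D"
   using open_Union_compact_subsets[OF o] by metis
  show ?thesis unfolding fsigma_Union_compact by (rule exI[of _ C]) (use C in auto)
 qed
 have "countable {z\<in>D. F z = 0}"
  by (rule holomorphic_countable_zeros[OF h3 o convex_connected[OF cv] fs nc])
 moreover have "complex_of_real ` {w. 0 < w & 0 < 1 + C1 * w & 0 < 1 + C2 * w & ln w = H w} <= {z\<in>D. F z = 0}"
  using real by auto
 ultimately have "countable (complex_of_real ` {w. 0 < w & 0 < 1 + C1 * w & 0 < 1 + C2 * w & ln w = H w})"
  by (rule countable_subset[rotated])
 then have "countable {w. 0 < w & 0 < 1 + C1 * w & 0 < 1 + C2 * w & ln w = H w}"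
  by (rule countable_image_inj_on) (simp add: inj_on_def)
 then show ?thesis unfolding H_def .
qed

text \<open>Resample coordinate c: on each line the set is empty or countable.\<close>

lemma slice_null:
 assumes I: "finite I" "c : I" and S: "S : sets (GG I)" and sl: "!!x. x : S ==> countable {t. x(c := t) : S}"
 shows "AE x in GG I. x ~: S"
proof -
 have m: "{x\<in>space (GG I). x ~: S} : sets (GG I)" using S by simp
 have "AE t in N01. x(c := t) ~: S" for x
 proof (cases "EX t0. x(c := t0) : S")
  case True
  then obtain t0 where "x(c := t0) : S" by blast
  from sl[OF this] have "countable {t. x(c := t) : S}" by simp
  then have "{t. x(c := t) : S} : null_sets lborel" by (rule countable_imp_null_set_lborel)
  then have "AE t in lborel. t ~: {t. x(c := t) : S}" by (rule AE_not_in)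
  then show ?thesis unfolding AE_N01 by simp
 qed simp
 then show ?thesis using AE_resample[OF I m] by simp
qed

lemma hyper_null:
 assumes I: "finite I" "c1 : I" "c2 : I" "c1 ~= c2" and b: "b1 ~= 0 \<or> b2 ~= (0::real)"
 shows "AE x in GG I. b1 * x c1 + b2 * x c2 ~= d"
proof -
 define S where "S = {x\<in>space (GG I). b1 * x c1 + b2 * x c2 = d}"
 have S: "S : sets (GG I)" unfolding S_def using meas_comp[OF I(2)] meas_comp[OF I(3)] by measurable
 have "AE x in GG I. x ~: S"
 proof (cases "b1 = 0")
  case False
  show ?thesis
  proof (rule slice_null[OF I(1,2) S])
   fix x
   have "{t. x(c1 := t) : S} <= {(d - b2 * x c2) / b1}" unfolding S_def using I(4) False by (auto simp: field_simps)
   then show "countable {t. x(c1 := t) : S}" by (rule countable_subset) simp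
  qed
 next
  case True
  show ?thesis
  proof (rule slice_null[OF I(1,3) S])
   fix x
   have "{t. x(c2 := t) : S} <= {(d - b1 * x c1) / b2}" unfolding S_def using I(4) True b by (auto simp: field_simps)
   then show "countable {t. x(c2 := t) : S}" by (rule countable_subset) simp
  qed
 qed
 then show ?thesis using AE_space by eventually_elim (simp add: S_def)
qed

lemma k1_exp:
 assumes rho: "0 < rh" "rh < 1"
 shows "k1 rh t r = exp (- (rh\<^sup>2 / (2 * (1 - rh\<^sup>2))) * (t\<^sup>2 + r\<^sup>2) + kap rh * t * r) / sqrt (1 - rh\<^sup>2)"
proof -
 define A where "A = rh\<^sup>2 / (2 * (1 - rh\<^sup>2))"
 have e: "- rh\<^sup>2 * x / (2 * (1 - rh\<^sup>2)) = - A * x" for x unfolding A_def by simp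
 have "exp (- A * t\<^sup>2) * (exp (- A * r\<^sup>2) * exp (kap rh * t * r)) = exp (- A * (t\<^sup>2 + r\<^sup>2) + kap rh * t * r)"
  unfolding exp_add[symmetric] by (simp add: algebra_simps)
 then show ?thesis unfolding k1_factor[OF rho] e A_def[symmetric] by simp
qed

text \<open>The three exponents share their quadratic part in (s, t), so their differences are
  affine. With \<open>w = exp (- x)\<close>, where \<open>x\<close> is the exponent of index 0, the
  two equations say that these differences are \<open>ln (1 + C1 * w)\<close> and
  \<open>ln (1 + C2 * w)\<close>. By \<open>det\<close> this determines s and t as functions of
  \<open>w\<close>, and \<open>ln w = - x\<close> becomes one equation in \<open>w\<close> of the
  type of \<open>ln_quad_countable\<close>.\<close>

lemma core_countable:
 fixes u0 u1 u2 v0 v1 v2 D0 D1 D2 C1 C2 :: real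
 assumes rho: "0 < rh" "rh < 1" and D: "0 < D0" "0 < D1" "0 < D2"
  and det: "(u1 - u0) * (v2 - v0) - (u2 - u0) * (v1 - v0) ~= 0"
 shows "countable {(s, t). D1 * k1 rh u1 s * k1 rh v1 t - D0 * k1 rh u0 s * k1 rh v0 t = C1 & D2 * k1 rh u2 s * k1 rh v2 t - D0 * k1 rh u0 s * k1 rh v0 t = C2}"
proof -
 define A where "A = rh\<^sup>2 / (2 * (1 - rh\<^sup>2))"
 define \<kappa> where "\<kappa> = kap rh"
 have r2: "0 < 1 - rh\<^sup>2" using rho by (simp add: power_less_one_iff)
 have \<kappa>: "\<kappa> ~= 0" unfolding \<kappa>_def kap_def using rho r2 by simp
 define G where "G D u v = ln (D / (1 - rh\<^sup>2)) - A * (u\<^sup>2 + v\<^sup>2)" for D u v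
 define X where "X D u v s t = G D u v - A * (s\<^sup>2 + t\<^sup>2) + \<kappa> * (u * s + v * t)" for D u v s t
 have e: "D * k1 rh u s * k1 rh v t = exp (X D u v s t)" if "0 < D" for D u v s t
 proof -
  have "D * k1 rh u s * k1 rh v t = (D / (1 - rh\<^sup>2)) * (exp (- A * (u\<^sup>2 + s\<^sup>2) + \<kappa> * u * s) * exp (- A * (v\<^sup>2 + t\<^sup>2) + \<kappa> * v * t))"
   unfolding k1_exp[OF rho] A_def[symmetric] \<kappa>_def[symmetric] using r2 by (simp add: real_sqrt_mult_self)
  also have "D / (1 - rh\<^sup>2) = exp (ln (D / (1 - rh\<^sup>2)))" using that r2 by simp
  finally show ?thesis unfolding exp_add[symmetric] X_def G_def by (simp add: algebra_simps)
 qed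
 define d where "d = \<kappa> * ((u1 - u0) * (v2 - v0) - (u2 - u0) * (v1 - v0))"
 have d: "d ~= 0" unfolding d_def using det \<kappa> by simp
 define h1 where "h1 = G D1 u1 v1 - G D0 u0 v0"
 define h2 where "h2 = G D2 u2 v2 - G D0 u0 v0"
 \<comment> \<open>Cramer's rule: \<open>P\<close> and \<open>Q\<close> recover s and t from the two
   logarithms.\<close>
 define P where "P w = (- h1 * (v2 - v0) + h2 * (v1 - v0)) / d + (v2 - v0) / d * ln (1 + C1 * w) + (- (v1 - v0)) / d * ln (1 + C2 * w)" for w
 define Q where "Q w = (- (u1 - u0) * h2 + (u2 - u0) * h1) / d + (- (u2 - u0)) / d * ln (1 + C1 * w) + (u1 - u0) / d * ln (1 + C2 * w)" for w
 define Z where "Z = {w. 0 < w & 0 < 1 + C1 * w & 0 < 1 + C2 * w & ln w = - G D0 u0 v0 + A * ((P w)\<^sup>2 + (Q w)\<^sup>2) - (\<kappa> * u0) * P w - (\<kappa> * v0) * Q w}"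
 have Z: "countable Z" unfolding Z_def P_def Q_def by (rule ln_quad_countable)
 have "(s, t) : (%w. (P w, Q w)) ` Z" if c: "exp (X D1 u1 v1 s t) - exp (X D0 u0 v0 s t) = C1" "exp (X D2 u2 v2 s t) - exp (X D0 u0 v0 s t) = C2" for s t
 proof -
  define x where "x = X D0 u0 v0 s t"
  define w where "w = exp (- x)"
  have w: "0 < w" "ln w = - x" unfolding w_def by auto
  have q: "1 + C1 * w = exp (X D1 u1 v1 s t - x)" "1 + C2 * w = exp (X D2 u2 v2 s t - x)"
   unfolding c[symmetric] w_def x_def[symmetric] by (simp_all add: left_diff_distrib exp_diff exp_minus field_simps)
  have l1: "ln (1 + C1 * w) = h1 + \<kappa> * ((u1 - u0) * s + (v1 - v0) * t)" unfolding q(1) h1_def x_def X_def by (simp add: algebra_simps)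
  have l2: "ln (1 + C2 * w) = h2 + \<kappa> * ((u2 - u0) * s + (v2 - v0) * t)" unfolding q(2) h2_def x_def X_def by (simp add: algebra_simps)
  have "P w = (- h1 * (v2 - v0) + h2 * (v1 - v0) + (v2 - v0) * ln (1 + C1 * w) + (- (v1 - v0)) * ln (1 + C2 * w)) / d"
   unfolding P_def by (simp add: add_divide_distrib)
  also have "- h1 * (v2 - v0) + h2 * (v1 - v0) + (v2 - v0) * ln (1 + C1 * w) + (- (v1 - v0)) * ln (1 + C2 * w) = s * d"
   unfolding l1 l2 d_def by (simp add: algebra_simps)
  finally have Pw: "P w = s" using d by simp
  have "Q w = (- (u1 - u0) * h2 + (u2 - u0) * h1 + (- (u2 - u0)) * ln (1 + C1 * w) + (u1 - u0) * ln (1 + C2 * w)) / d"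
   unfolding Q_def by (simp add: add_divide_distrib)
  also have "- (u1 - u0) * h2 + (u2 - u0) * h1 + (- (u2 - u0)) * ln (1 + C1 * w) + (u1 - u0) * ln (1 + C2 * w) = t * d"
   unfolding l1 l2 d_def by (simp add: algebra_simps)
  finally have Qw: "Q w = t" using d by simp
  have "w : Z" unfolding Z_def mem_Collect_eq Pw Qw using w q by (simp add: x_def X_def algebra_simps)
  then show ?thesis using Pw Qw by (intro image_eqI[of _ _ w]) auto
 qed
 then have "{(s, t). D1 * k1 rh u1 s * k1 rh v1 t - D0 * k1 rh u0 s * k1 rh v0 t = C1 & D2 * k1 rh u2 s * k1 rh v2 t - D0 * k1 rh u0 s * k1 rh v0 t = C2} <= (%w. (P w, Q w)) ` Z"
  unfolding e[OF D(1)] e[OF D(2)] e[OF D(3)] by auto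
 then show ?thesis by (rule countable_subset) (rule countable_image[OF Z])
qed

section \<open>No additive kernel on a product of two graphs\<close>

context gminj
begin

lemma kk_two:
 assumes c: "c : I" "c' : I" "c ~= c'"
 shows "kk rh I p (q(c := s, c' := t)) = kk rh (I - {c} - {c'}) p q * k1 rh (p c) s * k1 rh (p c') t"
proof -
 let ?q = "q(c := s, c' := t)"
 have "kk rh I p ?q = k1 rh (p c) (?q c) * (k1 rh (p c') (?q c') * (\<Prod>i\<in>I - {c} - {c'}. k1 rh (p i) (?q i)))"
  unfolding kk_def using fin c by (subst prod.remove[of I c], simp, simp, subst prod.remove[of "I - {c}" c']) auto
 also have "(\<Prod>i\<in>I - {c} - {c'}. k1 rh (p i) (?q i)) = kk rh (I - {c} - {c'}) p q"
  unfolding kk_def by (intro prod.cong) auto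
 finally have e: "kk rh I p ?q = k1 rh (p c) (?q c) * (k1 rh (p c') (?q c') * kk rh (I - {c} - {c'}) p q)" .
 have "?q c = s" "?q c' = t" using c(3) by auto
 then show ?thesis unfolding e by (simp only: mult.assoc mult.left_commute mult.commute)
qed

lemma two_countable:
 assumes c: "c : I" "c' : I" "c ~= c'" and det: "(p1 c - p0 c) * (p2 c' - p0 c') - (p2 c - p0 c) * (p1 c' - p0 c') ~= (0::real)"
 shows "countable {(s, t). kk rh I p1 (q(c := s, c' := t)) - kk rh I p0 (q(c := s, c' := t)) = C1 & kk rh I p2 (q(c := s, c' := t)) - kk rh I p0 (q(c := s, c' := t)) = C2}"
 unfolding kk_two[OF c] by (rule core_countable[OF rho kk_pos kk_pos kk_pos det])

lemma kk_graph_meas: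
 assumes "p : space (GG I)" "r : bm (GG J)"
 shows "(%y. kk rh I p (y(j := r y))) : bm (GG J)"
 using measurable_compose[OF measJ[OF measurable_ident_sets[OF refl] assms(2)] k_section[OF assms(1)]] by simp

text \<open>Vary only coordinate c of \<open>y\<close>. The height \<open>r\<close> follows in an
  unknown way, but the pair of \<open>y c\<close> and the height stays in the countable set of
  \<open>two_countable\<close>, so only countably many values of \<open>y c\<close> occur.\<close>

lemma triple_null:
 assumes p: "p0 : space (GG I)" "p1 : space (GG I)" "p2 : space (GG I)" and r: "r : bm (GG J)" and c: "c : J"
  and det: "(p1 c - p0 c) * (p2 j - p0 j) - (p2 c - p0 c) * (p1 j - p0 j) ~= 0"
 shows "AE y in GG J. \<not> (kk rh I p1 (y(j := r y)) - kk rh I p0 (y(j := r y)) = C1 & kk rh I p2 (y(j := r y)) - kk rh I p0 (y(j := r y)) = C2)"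
proof -
 define S where "S = {y\<in>space (GG J). kk rh I p1 (y(j := r y)) - kk rh I p0 (y(j := r y)) = C1 & kk rh I p2 (y(j := r y)) - kk rh I p0 (y(j := r y)) = C2}"
 note [measurable] = kk_graph_meas[OF p(1) r] kk_graph_meas[OF p(2) r] kk_graph_meas[OF p(3) r]
 have S: "S : sets (GG J)" unfolding S_def by measurable
 have "AE y in GG J. y ~: S"
 proof (rule slice_null[OF insJ(2) c S])
  fix y
  have "countable {(s, t). kk rh I p1 (y(c := s, j := t)) - kk rh I p0 (y(c := s, j := t)) = C1 & kk rh I p2 (y(c := s, j := t)) - kk rh I p0 (y(c := s, j := t)) = C2}" (is "countable ?A")
   by (rule two_countable) (use c jI det in auto)
  moreover have "{t. y(c := t) : S} <= fst ` ?A"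
  proof
   fix t assume "t : {t. y(c := t) : S}"
   then have "(t, r (y(c := t))) : ?A" unfolding S_def by simp
   then show "t : fst ` ?A" by (rule image_eqI[rotated]) simp
  qed
  ultimately show "countable {t. y(c := t) : S}" by (meson countable_image countable_subset)
 qed
 then show ?thesis using AE_space by eventually_elim (simp add: S_def)
qed

text \<open>When the three points have equal heights, the determinant with j vanishes. If the second
  graph is flat too, its height is just a constant, and a second base coordinate \<open>c'\<close>
  takes the place of j.\<close>

lemma triple_null_const:
 assumes p: "p0 : space (GG I)" "p1 : space (GG I)" "p2 : space (GG I)" and c: "c : J" "c' : J" "c ~= c'"
  and det: "(p1 c - p0 c) * (p2 c' - p0 c') - (p2 c - p0 c) * (p1 c' - p0 c') ~= 0"
 shows "AE y in GG J. \<not> (kk rh I p1 (y(j := r0)) - kk rh I p0 (y(j := r0)) = C1 & kk rh I p2 (y(j := r0)) - kk rh I p0 (y(j := r0)) = C2)"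
proof -
 define S where "S = {y\<in>space (GG J). kk rh I p1 (y(j := r0)) - kk rh I p0 (y(j := r0)) = C1 & kk rh I p2 (y(j := r0)) - kk rh I p0 (y(j := r0)) = C2}"
 note [measurable] = kk_graph_meas[OF p(1) borel_measurable_const] kk_graph_meas[OF p(2) borel_measurable_const] kk_graph_meas[OF p(3) borel_measurable_const]
 have S: "S : sets (GG J)" unfolding S_def by measurable
 have "AE y in GG J. y ~: S"
 proof (rule slice_null[OF insJ(2) c(1) S])
  fix y
  have "countable {(s, t). kk rh I p1 ((y(j := r0))(c := s, c' := t)) - kk rh I p0 ((y(j := r0))(c := s, c' := t)) = C1 & kk rh I p2 ((y(j := r0))(c := s, c' := t)) - kk rh I p0 ((y(j := r0))(c := s, c' := t)) = C2}" (is "countable ?A")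
   by (rule two_countable) (use c det in auto)
  moreover have "{t. y(c := t) : S} <= fst ` ?A"
  proof
   fix t assume t: "t : {t. y(c := t) : S}"
   have "(y(c := t))(j := r0) = (y(j := r0))(c := t, c' := y c')" using c by (auto simp: fun_eq_iff)
   then have "(t, y c') : ?A" using t unfolding S_def by simp
   then show "t : fst ` ?A" by (rule image_eqI[rotated]) simp
  qed
  ultimately show "countable {t. y(c := t) : S}" by (meson countable_image countable_subset)
 qed
 then show ?thesis using AE_space by eventually_elim (simp add: S_def)
qed

text \<open>What remains of an additive relation once the function of \<open>y\<close> has
  cancelled: the kernel difference of two points of the first graph is constant over the
  second.\<close>

definition addrel :: "((nat => real) => real) => ((nat => real) => real) => (nat => real) set => (nat => real) set => bool" where
 "addrel \<tau> r P0 Q \<longleftrightarrow> P0 <= space (GG J) & \<not> (AE x in GG J. x ~: P0) & \<not> (AE y in GG J. y ~: Q) \<and>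
  (ALL x:P0. ALL x':P0. EX C. AE y in GG J. y : Q --> kk rh I (x'(j := \<tau> x')) (y(j := r y)) - kk rh I (x(j := \<tau> x)) (y(j := r y)) = C)"

lemma flat_null:
 assumes c: "c1 : J" "c2 : J" "c1 ~= c2" and P: "\<not> (AE x in GG J. x ~: P0)" and h: "!!x. x : P0 ==> b1 * x c1 + b2 * x c2 = d" and b: "b1 ~= 0 \<or> b2 ~= (0::real)"
 shows False
proof -
 have "AE x in GG J. b1 * x c1 + b2 * x c2 ~= d" by (rule hyper_null[OF insJ(2) c b])
 then have "AE x in GG J. x ~: P0" by eventually_elim (use h in blast)
 then show False using P by blast
qed

text \<open>If two heights differed, \<open>triple_null\<close> would force every third point of the
  graph to be collinear with these two in each plane (c, j). Eliminating the height leaves a linear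
  relation between two base coordinates on \<open>P0\<close>, which would make \<open>P0\<close>
  null.\<close>

lemma addrel_const:
 assumes c: "c1 : J" "c2 : J" "c1 ~= c2" and r: "r : bm (GG J)" and ar: "addrel \<tau> r P0 Q"
 shows "EX t0. ALL x:P0. \<tau> x = t0"
proof (rule ccontr)
 assume n: "\<not> ?thesis"
 have P0: "P0 <= space (GG J)" "\<not> (AE x in GG J. x ~: P0)" "\<not> (AE y in GG J. y ~: Q)" using ar unfolding addrel_def by auto
 obtain x0 where x0: "x0 : P0" using P0(2) by (metis AE_I2)
 obtain x1 where x1: "x1 : P0" "\<tau> x1 ~= \<tau> x0" using n x0 by blast
 have col: "(x1 c - x0 c) * (\<tau> x - \<tau> x0) - (x c - x0 c) * (\<tau> x1 - \<tau> x0) = 0" if x: "x : P0" and cJ: "c : J" for x c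
 proof (rule ccontr)
  assume d: "\<not> ?thesis"
  have cj: "c ~= j" using cJ by simp
  obtain C1 where C1: "AE y in GG J. y : Q --> kk rh I (x1(j := \<tau> x1)) (y(j := r y)) - kk rh I (x0(j := \<tau> x0)) (y(j := r y)) = C1"
   using ar x0 x1 unfolding addrel_def by blast
  obtain C2 where C2: "AE y in GG J. y : Q --> kk rh I (x(j := \<tau> x)) (y(j := r y)) - kk rh I (x0(j := \<tau> x0)) (y(j := r y)) = C2"
   using ar x0 x unfolding addrel_def by blast
  have "AE y in GG J. \<not> (kk rh I (x1(j := \<tau> x1)) (y(j := r y)) - kk rh I (x0(j := \<tau> x0)) (y(j := r y)) = C1 \<and>
    kk rh I (x(j := \<tau> x)) (y(j := r y)) - kk rh I (x0(j := \<tau> x0)) (y(j := r y)) = C2)"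
   by (rule triple_null[OF _ _ _ r cJ]) (use spJ P0(1) x0 x1 x d cj in auto)
  with C1 C2 have "AE y in GG J. y ~: Q" by eventually_elim blast
  then show False using P0(3) by blast
 qed
 define b where "b = \<tau> x1 - \<tau> x0"
 have b: "b ~= 0" using x1 unfolding b_def by simp
 show False
 proof (cases "x1 c1 = x0 c1")
  case True
  have "1 * x c1 + 0 * x c2 = x0 c1" if "x : P0" for x using col[OF that c(1)] True b unfolding b_def[symmetric] by simp
  then show False using flat_null[OF c P0(2), of 1 0 "x0 c1"] by simp
 next
  case False
  have "(x1 c2 - x0 c2) * x c1 + (- (x1 c1 - x0 c1)) * x c2 = (x1 c2 - x0 c2) * x0 c1 - (x1 c1 - x0 c1) * x0 c2" if x: "x : P0" for x
  proof -
   have e1: "(x c1 - x0 c1) * b = (x1 c1 - x0 c1) * (\<tau> x - \<tau> x0)" and e2: "(x c2 - x0 c2) * b = (x1 c2 - x0 c2) * (\<tau> x - \<tau> x0)"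
    using col[OF x c(1)] col[OF x c(2)] unfolding b_def by auto
   have "((x1 c2 - x0 c2) * (x c1 - x0 c1)) * b = ((x1 c1 - x0 c1) * (x c2 - x0 c2)) * b"
    unfolding mult.assoc e1 e2 by simp
   then have "(x1 c2 - x0 c2) * (x c1 - x0 c1) = (x1 c1 - x0 c1) * (x c2 - x0 c2)" using b by simp
   then show ?thesis by (simp add: algebra_simps)
  qed
  then show False using flat_null[OF c P0(2), of "x1 c2 - x0 c2" "- (x1 c1 - x0 c1)"] False by auto
 qed
qed

text \<open>The relation is symmetric in the two graphs, so \<open>addrel_const\<close> makes both
  flat. The nonnull \<open>P0\<close> contains three points not collinear in the plane (c1, c2), and
  for them \<open>triple_null_const\<close> contradicts the relation.\<close>

lemma no_additive:
 assumes c: "c1 : J" "c2 : J" "c1 ~= c2" and t: "\<tau> : bm (GG J)" and r: "r : bm (GG J)"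
  and P: "P <= space (GG J)" "\<not> (AE x in GG J. x ~: P)" and Q: "Q <= space (GG J)" "\<not> (AE y in GG J. y ~: Q)"
  and ad: "AE z in GG J \<Otimes>\<^sub>M GG J. fst z : P --> snd z : Q --> kk rh I ((fst z)(j := \<tau> (fst z))) ((snd z)(j := r (snd z))) = A (snd z) + B' (fst z)"
 shows False
proof -
 interpret GJ: gauss J rh by (intro gauss.intro insJ(2) J_ne rho)
 have a1: "AE x in GG J. AE y in GG J. x : P --> y : Q --> kk rh I (x(j := \<tau> x)) (y(j := r y)) = A y + B' x"
  using GJ.PP.AE_pair[OF ad] by simp
 have "AE z in distr (GG J \<Otimes>\<^sub>M GG J) (GG J \<Otimes>\<^sub>M GG J) (%(x, y). (y, x)). fst z : P --> snd z : Q --> kk rh I ((fst z)(j := \<tau> (fst z))) ((snd z)(j := r (snd z))) = A (snd z) + B' (fst z)"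
  unfolding GJ.PP.distr_pair_swap[symmetric] by (rule ad)
 from AE_distrD[OF measurable_pair_swap' this] have "AE z in GG J \<Otimes>\<^sub>M GG J. snd z : P --> fst z : Q --> kk rh I ((snd z)(j := \<tau> (snd z))) ((fst z)(j := r (fst z))) = A (fst z) + B' (snd z)"
  by (rule eventually_mono) (auto simp: split_beta')
 from GJ.PP.AE_pair[OF this] have a2: "AE y in GG J. AE x in GG J. x : P --> y : Q --> kk rh I (x(j := \<tau> x)) (y(j := r y)) = A y + B' x"
  by simp
 \<comment> \<open>Points for which the relation holds with almost every partner. Afterwards single
   points may be chosen, rather than almost all pairs.\<close>
 define P0 where "P0 = {x\<in>P. AE y in GG J. y : Q --> kk rh I (x(j := \<tau> x)) (y(j := r y)) = A y + B' x}"
 define Q0 where "Q0 = {y\<in>Q. AE x in GG J. x : P --> kk rh I (x(j := \<tau> x)) (y(j := r y)) = A y + B' x}"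
 have PP0: "AE x in GG J. x : P --> x : P0" using a1 unfolding P0_def by eventually_elim auto
 have QQ0: "AE y in GG J. y : Q --> y : Q0" using a2 unfolding Q0_def by eventually_elim auto
 have nP0: "\<not> (AE x in GG J. x ~: P0)"
 proof
  assume "AE x in GG J. x ~: P0"
  with PP0 have "AE x in GG J. x ~: P" by eventually_elim blast
  then show False using P(2) by blast
 qed
 have nQ0: "\<not> (AE x in GG J. x ~: Q0)"
 proof
  assume "AE x in GG J. x ~: Q0"
  with QQ0 have "AE x in GG J. x ~: Q" by eventually_elim blast
  then show False using Q(2) by blast
 qed
 have rel: "AE y in GG J. y : Q --> kk rh I (x'(j := \<tau> x')) (y(j := r y)) - kk rh I (x(j := \<tau> x)) (y(j := r y)) = B' x' - B' x" if "x : P0" "x' : P0" for x x'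
 proof -
  have "AE y in GG J. y : Q --> kk rh I (x(j := \<tau> x)) (y(j := r y)) = A y + B' x"
   "AE y in GG J. y : Q --> kk rh I (x'(j := \<tau> x')) (y(j := r y)) = A y + B' x'" using that unfolding P0_def by auto
  then show ?thesis by eventually_elim auto
 qed
 have ar1: "addrel \<tau> r P0 Q" unfolding addrel_def using P(1) nP0 Q(2) rel by (auto simp: P0_def)
 have rel2: "AE x in GG J. x : P --> kk rh I (y'(j := r y')) (x(j := \<tau> x)) - kk rh I (y(j := r y)) (x(j := \<tau> x)) = A y' - A y" if "y : Q0" "y' : Q0" for y y'
 proof -
  have "AE x in GG J. x : P --> kk rh I (x(j := \<tau> x)) (y(j := r y)) = A y + B' x"
   "AE x in GG J. x : P --> kk rh I (x(j := \<tau> x)) (y'(j := r y')) = A y' + B' x" using that unfolding Q0_def by auto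
  then show ?thesis
  proof eventually_elim
   case (elim x)
   show ?case using elim kk_sym[of I "x(j := \<tau> x)" "y(j := r y)"] kk_sym[of I "x(j := \<tau> x)" "y'(j := r y')"] by auto
  qed
 qed
 have ar2: "addrel r \<tau> Q0 P" unfolding addrel_def using Q(1) nQ0 P(2) rel2 by (auto simp: Q0_def)
 obtain t0 where t0: "!!x. x : P0 ==> \<tau> x = t0" using addrel_const[OF c r ar1] by blast
 obtain r0 where r0: "!!y. y : Q0 ==> r y = r0" using addrel_const[OF c t ar2] by blast
 have P0s: "P0 <= space (GG J)" using P(1) unfolding P0_def by auto
 obtain x0 where x0: "x0 : P0" using nP0 by (metis AE_I2)
 have "EX x1:P0. x1 c1 ~= x0 c1"
 proof (rule ccontr)
  assume "\<not> ?thesis"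
  then show False using flat_null[OF c nP0, of 1 0 "x0 c1"] by auto
 qed
 then obtain x1 where x1: "x1 : P0" "x1 c1 ~= x0 c1" by blast
 have "EX x2:P0. (x1 c1 - x0 c1) * (x2 c2 - x0 c2) - (x2 c1 - x0 c1) * (x1 c2 - x0 c2) ~= 0"
 proof (rule ccontr)
  assume "\<not> ?thesis"
  then have "(x1 c2 - x0 c2) * x c1 + (- (x1 c1 - x0 c1)) * x c2 = (x1 c2 - x0 c2) * x0 c1 - (x1 c1 - x0 c1) * x0 c2" if "x : P0" for x
   using that by (auto simp: algebra_simps)
  then show False using flat_null[OF c nP0, of "x1 c2 - x0 c2" "- (x1 c1 - x0 c1)"] x1(2) by auto
 qed
 then obtain x2 where x2: "x2 : P0" and det: "(x1 c1 - x0 c1) * (x2 c2 - x0 c2) - (x2 c1 - x0 c1) * (x1 c2 - x0 c2) ~= 0" by blast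
 have "AE y in GG J. \<not> (kk rh I (x1(j := \<tau> x1)) (y(j := r0)) - kk rh I (x0(j := \<tau> x0)) (y(j := r0)) = B' x1 - B' x0 \<and>
  kk rh I (x2(j := \<tau> x2)) (y(j := r0)) - kk rh I (x0(j := \<tau> x0)) (y(j := r0)) = B' x2 - B' x0)"
  by (rule triple_null_const[OF _ _ _ c]) (use spJ P0s x0 x1 x2 det c in auto)
 with rel[OF x0 x1(1)] rel[OF x0 x2] QQ0 have "AE y in GG J. y ~: Q"
 proof eventually_elim
  case (elim y)
  show ?case
  proof
   assume y: "y : Q"
   have "r y = r0" using elim y r0 by blast
   then show False using elim y by simp
  qed
 qed
 then show False using Q(2) by blast
qed

text \<open>Two crossings provide two graphs. \<open>bilin_zero\<close>, for all layers supported on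
  their bases, is the vanishing condition of \<open>additive_kernel\<close>, with the volume
  densities of the layers as \<open>p\<close> and \<open>p'\<close>. Dividing by these weights
  leaves the noise kernel itself in additive form.\<close>

theorem f_jinv:
 assumes c: "c1 : J" "c2 : J" "c1 ~= c2" and i: "i < m"
 shows "jinv (f i)"
proof (rule ccontr)
 assume nj: "\<not> jinv (f i)"
 interpret S: gminj I rh m g f mu lam j by (rule jswap)
 interpret GJ: gauss J rh by (intro gauss.intro insJ(2) J_ne rho)
 obtain k l al be \<iota> k' l' al' be' \<iota>' where kl: "k < m" "l < m" "k' < m" "l' < m" and io: "0 < \<iota>" "0 < \<iota>'"
  and nP: "\<not> (AE q in GG J. q ~: cross k l al be \<iota>)" and nQ: "\<not> (AE q in GG J. q ~: S.cross k' l' al' be' \<iota>')" and sg: "dk k l k' ~= dk k l l'"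
  using two_crossings[OF i nj] by blast
 define \<tau> where "\<tau> = tau k al be"
 define r where "r = S.tau k' al' be'"
 define P where "P = cross k l al be \<iota>"
 define Q where "Q = S.cross k' l' al' be' \<iota>'"
 have tm[measurable]: "\<tau> : bm (GG J)" and rm[measurable]: "r : bm (GG J)"
  unfolding \<tau>_def r_def by (rule tau_meas[OF kl(1)], rule S.tau_meas[OF kl(3)])
 have Pm[measurable]: "P : sets (GG J)" and Qm[measurable]: "Q : sets (GG J)"
  unfolding P_def Q_def by (rule cross_sets[OF kl(1,2)], rule S.cross_sets[OF kl(3,4)])
 have Pw: "\<tau> x : {al..be}" if "x : P" for x using that io unfolding P_def cross_def \<tau>_def by auto
 have Qw: "r x : {al'..be'}" if "x : Q" for x using that io unfolding Q_def S.cross_def r_def by auto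
 define p where "p x = indicator P x * nd (\<tau> x)" for x
 define p' where "p' y = indicator Q y * nd (r y)" for y
 have pm[measurable]: "p : bm (GG J)" "p' : bm (GG J)" unfolding p_def[abs_def] p'_def[abs_def] by measurable
 have nd01: "0 < nd u" "nd u <= 1" for u using std_le1[of u] normal_density_pos[of 1 0 u] by auto
 have p0: "0 <= p x" "0 <= p' x" for x unfolding p_def p'_def using nd01 by (auto intro!: mult_nonneg_nonneg less_imp_le)
 have pb: "bdd (GG J) p" "bdd (GG J) p'"
  by (rule bddI[where C=1], measurable, simp add: p_def p'_def nd01 less_imp_le split: split_indicator)+
 have pnz: "(LINT x|GG J. p x) ~= 0"
 proof
  assume "(LINT x|GG J. p x) = 0"
  then have "AE x in GG J. p x = 0" using integral_nonneg_eq_0_iff_AE[OF GJ.bdd_integrable[OF pb(1)]] p0 by simp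
  then have "AE x in GG J. x ~: P" by eventually_elim (use nd01 in \<open>auto simp: p_def less_le split: split_indicator_asm\<close>)
  then show False using nP unfolding P_def by blast
 qed
 have pnz': "(LINT x|GG J. p' x) ~= 0"
 proof
  assume "(LINT x|GG J. p' x) = 0"
  then have "AE x in GG J. p' x = 0" using integral_nonneg_eq_0_iff_AE[OF GJ.bdd_integrable[OF pb(2)]] p0 by simp
  then have "AE x in GG J. x ~: Q" by eventually_elim (use nd01 in \<open>auto simp: p'_def less_le split: split_indicator_asm\<close>)
  then show False using nQ unfolding Q_def by blast
 qed
 \<comment> \<open>With both weights included \<open>F\<close> is integrable, and \<open>KB\<close>
   is a double integral against it.\<close>
 define F where "F x y = p x * (p' y * (k1 rh (\<tau> x) (r y) * kk rh J x y))" for x y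
 obtain C where C: "!!t u. t : {al..be} ==> u : {al'..be'} ==> \<bar>Ph t u\<bar> <= C"
  using unif2(2)[OF Ph_cont(1) zero_less_one_real, of al be al' be'] by blast
 have Fb: "\<bar>F x y\<bar> <= \<bar>C\<bar> * kk rh J x y" for x y
 proof (cases "x : P & y : Q")
  case True
  then have e: "F x y = nd (\<tau> x) * (Ph (\<tau> x) (r y) * kk rh J x y)" unfolding F_def p_def p'_def Ph_def by simp
  have "\<bar>Ph (\<tau> x) (r y)\<bar> <= \<bar>C\<bar>" using C[OF Pw Qw, of x y] True by simp
  then have "\<bar>nd (\<tau> x)\<bar> * (\<bar>Ph (\<tau> x) (r y)\<bar> * \<bar>kk rh J x y\<bar>) <= 1 * (\<bar>C\<bar> * \<bar>kk rh J x y\<bar>)"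
   using nd01[of "\<tau> x"] by (intro mult_mono mult_nonneg_nonneg) auto
  then show ?thesis unfolding e using kk_pos[of J x y] by (simp add: abs_mult)
 next
  case False
  then have "F x y = 0" unfolding F_def p_def p'_def by auto
  then show ?thesis using kk_pos[of J x y] by (simp add: less_imp_le)
 qed
 have Fi: "integrable (GG J \<Otimes>\<^sub>M GG J) (%z. F (fst z) (snd z))"
 proof (rule BI_integrable_bound)
  show "integrable (GG J \<Otimes>\<^sub>M GG J) (%z. \<bar>C\<bar> * case_prod (kk rh J) z)" using GJ.kk_int by simp
  have km: "(%z. kk rh J (fst z) (snd z)) : bm (GG J \<Otimes>\<^sub>M GG J)" using GJ.kk_meas by (simp add: split_beta')
  show "(%z. F (fst z) (snd z)) : bm (GG J \<Otimes>\<^sub>M GG J)"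
   unfolding F_def by (intro borel_measurable_times km k1_meas measurable_compose[OF measurable_fst] measurable_compose[OF measurable_snd] pm tm rm)
  show "AE z in GG J \<Otimes>\<^sub>M GG J. norm (F (fst z) (snd z)) <= norm (\<bar>C\<bar> * case_prod (kk rh J) z)"
  proof (rule AE_I2)
   fix z show "norm (F (fst z) (snd z)) <= norm (\<bar>C\<bar> * case_prod (kk rh J) z)"
    using Fb[of "fst z" "snd z"] kk_pos[of J "fst z" "snd z"] by (simp add: split_beta' abs_mult)
  qed
 qed
 have "EX A B. AE z in GG J \<Otimes>\<^sub>M GG J. F (fst z) (snd z) = p (fst z) * A (snd z) + B (fst z) * p' (snd z)"
 proof (rule additive_kernel[OF prob_space_GG Fi GJ.bdd_integrable[OF pb(1)] p0(1) pnz GJ.bdd_integrable[OF pb(2)] p0(2) pnz'])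
  fix a b assume a: "a : bm (GG J)" "!!x. x : space (GG J) ==> \<bar>a x\<bar> <= 1" "(LINT x|GG J. a x * p x) = 0"
   and b: "b : bm (GG J)" "!!x. x : space (GG J) ==> \<bar>b x\<bar> <= 1" "(LINT x|GG J. b x * p' x) = 0"
  have "KB \<tau> r (%x. a x * indicator P x) (%y. b y * indicator Q y) = 0"
   unfolding \<tau>_def r_def
  proof (rule bilin_zero[OF kl io sg])
   show "(%x. a x * indicator P x) : bm (GG J)" "(%x. b x * indicator Q x) : bm (GG J)" using a(1) b(1) by measurable
   show "\<bar>a q * indicator P q\<bar> <= 1" "\<bar>b q * indicator Q q\<bar> <= 1" if "q : space (GG J)" for q using a(2)[OF that] b(2)[OF that] by (auto split: split_indicator)
   show "q : cross k l al be \<iota>" if "a q * indicator P q ~= 0" for q using that unfolding P_def by (auto split: split_indicator_asm)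
   show "q : S.cross k' l' al' be' \<iota>'" if "b q * indicator Q q ~= 0" for q using that unfolding Q_def by (auto split: split_indicator_asm)
   show "(LINT q|GG J. a q * indicator P q * nd (tau k al be q)) = 0" using a(3) unfolding p_def \<tau>_def by (simp add: mult.assoc)
   show "(LINT q|GG J. b q * indicator Q q * nd (S.tau k' al' be' q)) = 0" using b(3) unfolding p'_def r_def by (simp add: mult.assoc)
  qed
  moreover have "KB \<tau> r (%x. a x * indicator P x) (%y. b y * indicator Q y) = (LINT x|GG J. a x * (LINT y|GG J. b y * F x y))"
   unfolding KB_def
  proof (rule BI_integral_cong[OF refl])
   fix x
   have "(LINT y|GG J. b y * F x y) = (LINT y|GG J. p x * (kk rh J x y * (b y * indicator Q y * Ph (\<tau> x) (r y))))"
    unfolding F_def p'_def Ph_def by (intro BI_integral_cong refl) (simp only: mult.assoc mult.left_commute mult.commute)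
   also have "... = p x * (LINT y|GG J. kk rh J x y * (b y * indicator Q y * Ph (\<tau> x) (r y)))" by simp
   finally show "a x * indicator P x * nd (\<tau> x) * (LINT y|GG J. kk rh J x y * (b y * indicator Q y * Ph (\<tau> x) (r y))) = a x * (LINT y|GG J. b y * F x y)"
    unfolding p_def by (simp only: mult.assoc)
  qed
  ultimately show "(LINT x|GG J. a x * (LINT y|GG J. b y * F x y)) = 0" by simp
 qed
 then obtain A B' where AB: "AE z in GG J \<Otimes>\<^sub>M GG J. F (fst z) (snd z) = p (fst z) * A (snd z) + B' (fst z) * p' (snd z)" by blast
 show False
 proof (rule no_additive[OF c tm rm])
  show "P <= space (GG J)" "Q <= space (GG J)" using sets.sets_into_space[OF Pm] sets.sets_into_space[OF Qm] by auto
  show "\<not> (AE x in GG J. x ~: P)" "\<not> (AE x in GG J. x ~: Q)" using nP nQ unfolding P_def Q_def by auto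
  show "AE z in GG J \<Otimes>\<^sub>M GG J. fst z : P --> snd z : Q --> kk rh I ((fst z)(j := \<tau> (fst z))) ((snd z)(j := r (snd z))) =
    A (snd z) / p' (snd z) + B' (fst z) / p (fst z)"
   using AB
  proof eventually_elim
   case (elim z)
   show ?case
   proof (intro impI)
    assume z: "fst z : P" "snd z : Q"
    have pp: "0 < p (fst z)" "0 < p' (snd z)" unfolding p_def p'_def using z nd01 by auto
    define K where "K = k1 rh (\<tau> (fst z)) (r (snd z)) * kk rh J (fst z) (snd z)"
    have "p (fst z) * (p' (snd z) * K) = p (fst z) * A (snd z) + B' (fst z) * p' (snd z)" using elim unfolding F_def K_def .
    then have "K = A (snd z) / p' (snd z) + B' (fst z) / p (fst z)" using pp by (simp add: field_simps)
    then show "kk rh I ((fst z)(j := \<tau> (fst z))) ((snd z)(j := r (snd z))) = A (snd z) / p' (snd z) + B' (fst z) / p (fst z)"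
     unfolding kk_J K_def .
   qed
  qed
 qed
qed

end

section \<open>Rotations with prescribed zeros\<close>

definition orth :: "nat => (nat => nat => real) => bool" where
 "orth N A \<longleftrightarrow> (ALL i<N. ALL j<N. (\<Sum>k<N. A k i * A k j) = (if i = j then 1 else 0)) \<and>
  (ALL i<N. ALL j<N. (\<Sum>k<N. A i k * A j k) = (if i = j then 1 else 0))"

lemma gram:
 fixes A :: "nat => nat => real"
 assumes "!!a b. a < N ==> b < N ==> (\<Sum>k<N. A k a * A k b) = (if a = b then 1 else 0)"
 shows "(\<Sum>k<N. (\<Sum>a<N. A k a * x a) * (\<Sum>b<N. A k b * y b)) = (\<Sum>a<N. x a * y a)"
proof -
 have "(\<Sum>k<N. (\<Sum>a<N. A k a * x a) * (\<Sum>b<N. A k b * y b)) = (\<Sum>k<N. \<Sum>a<N. \<Sum>b<N. x a * y b * (A k a * A k b))"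
  unfolding sum_product by (intro sum.cong refl) (simp only: mult.assoc mult.left_commute mult.commute)
 also have "... = (\<Sum>a<N. \<Sum>k<N. \<Sum>b<N. x a * y b * (A k a * A k b))" by (rule sum.swap)
 also have "... = (\<Sum>a<N. \<Sum>b<N. \<Sum>k<N. x a * y b * (A k a * A k b))" by (intro sum.cong refl sum.swap)
 also have "... = (\<Sum>a<N. \<Sum>b<N. if b = a then x a * y a else 0)"
  unfolding sum_distrib_left[symmetric] using assms by (intro sum.cong refl) auto
 also have "... = (\<Sum>a<N. x a * y a)" by simp
 finally show ?thesis .
qed

definition mm :: "nat => (nat => nat => real) => (nat => nat => real) => nat => nat => real" where
 "mm N A B i j = (\<Sum>k<N. A i k * B k j)"

lemma orth_mm: "orth N A ==> orth N B ==> orth N (mm N A B)"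
proof -
 assume A: "orth N A" and B: "orth N B"
 have a: "(\<Sum>k<N. mm N A B k i * mm N A B k j) = (\<Sum>a<N. B a i * B a j)" for i j
  unfolding mm_def by (rule gram) (use A in \<open>auto simp: orth_def\<close>)
 have b: "(\<Sum>k<N. mm N A B i k * mm N A B j k) = (\<Sum>a<N. A i a * A j a)" for i j
 proof -
  have "(\<Sum>k<N. (\<Sum>a<N. B a k * A i a) * (\<Sum>b<N. B b k * A j b)) = (\<Sum>a<N. A i a * A j a)"
   by (rule gram[of N "%k a. B a k"]) (use B in \<open>auto simp: orth_def\<close>)
  then show ?thesis unfolding mm_def by (simp only: mult.commute)
 qed
 show ?thesis unfolding orth_def a b using A B unfolding orth_def by blast
qed

lemma orth_id: "orth N (%i j. if i = j then 1 else 0)"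
proof -
 have "(\<Sum>k<N. (if k = i then 1 else 0) * (if k = j then 1 else (0::real))) = (\<Sum>k<N. if k = i then (if i = j then 1 else 0) else 0)" for i j
  by (intro sum.cong) auto
 moreover have "(\<Sum>k<N. (if i = k then 1 else 0) * (if j = k then 1 else (0::real))) = (\<Sum>k<N. if k = i then (if i = j then 1 else 0) else 0)" for i j
  by (intro sum.cong) auto
 ultimately show ?thesis unfolding orth_def by simp
qed

text \<open>Reflect in \<open>u\<close>, the tail of \<open>v\<close> from K on minus
  \<open>al\<close> times the K-th unit vector, where \<open>al\<close> is the norm of the tail.
  This sends the tail onto axis K, and it fixes vectors supported below K because \<open>u\<close>
  vanishes there. If \<open>u\<close> is 0, the identity serves.\<close>

lemma householder:
 fixes v :: "nat => real"
 assumes K: "K < N"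
 shows "EX H. orth N H & (ALL x. (ALL i. K <= i --> i < N --> x i = 0) --> (ALL i<N. (\<Sum>j<N. H i j * x j) = x i)) \<and>
  (ALL i. K < i --> i < N --> (\<Sum>j<N. H i j * v j) = 0)"
proof -
 define t where "t i = (if K <= i then v i else 0)" for i
 define al where "al = sqrt (\<Sum>i<N. (t i)\<^sup>2)"
 have al: "al\<^sup>2 = (\<Sum>i<N. (t i)\<^sup>2)" unfolding al_def by (simp add: sum_nonneg)
 define u where "u i = t i - (if i = K then al else 0)" for i
 define S where "S = (\<Sum>i<N. (u i)\<^sup>2)"
 have u0: "u i = 0" if "i < K" for i using that unfolding u_def t_def by auto
 have u1: "u i = v i" if "K < i" for i using that unfolding u_def t_def by auto
 show ?thesis
 proof (cases "S = 0")
  case True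
  then have "u i = 0" if "i < N" for i using that unfolding S_def by (simp add: sum_nonneg_eq_0_iff)
  then have v: "v i = 0" if "K < i" "i < N" for i using u1 that by metis
  have e: "(\<Sum>j<N. (if i = j then 1 else 0) * x j) = x i" if "i < N" for i and x :: "nat => real"
  proof -
   have "(\<Sum>j<N. (if i = j then 1 else 0) * x j) = (\<Sum>j<N. if j = i then x i else 0)" by (intro sum.cong) auto
   then show ?thesis using that by simp
  qed
  show ?thesis by (intro exI[of _ "%i j. if i = j then 1 else 0"]) (use orth_id e v in auto)
 next
  case False
  define c where "c = 2 / S"
  define H where "H i j = (if i = j then 1 else 0) - c * u i * u j" for i j
  have Hx: "(\<Sum>j<N. H i j * x j) = x i - c * u i * (\<Sum>j<N. u j * x j)" if "i < N" for i x
  proof -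
   have "(\<Sum>j<N. H i j * x j) = (\<Sum>j<N. (if j = i then x i else 0) - c * u i * (u j * x j))"
    unfolding H_def by (intro sum.cong) (auto simp: algebra_simps)
   then show ?thesis using that by (simp add: sum_subtractf sum_distrib_left)
  qed
  have sym: "H i j = H j i" for i j unfolding H_def by (simp add: mult_ac)
  have o: "(\<Sum>k<N. H i k * H k j) = (if i = j then 1 else 0)" if "i < N" "j < N" for i j
  proof -
   have "(\<Sum>k<N. u k * H k j) = (\<Sum>k<N. H j k * u k)" using sym by (simp add: mult.commute)
   also have "... = u j - c * u j * S" unfolding Hx[OF that(2)] S_def by (simp add: power2_eq_square)
   finally have uH: "(\<Sum>k<N. u k * H k j) = u j - c * u j * S" .
   have cS: "c * S = 2" unfolding c_def using False by simp
   have "(\<Sum>k<N. H i k * H k j) = H i j - c * u i * (u j - c * u j * S)" unfolding Hx[OF that(1)] uH ..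
   also have "... = (if i = j then 1 else 0) + c * u i * u j * (c * S - 2)" unfolding H_def by (simp add: algebra_simps)
   finally show ?thesis unfolding cS by simp
  qed
  have oH: "orth N H" unfolding orth_def
   using o sym by (metis (no_types, lifting) sum.cong)
  have fx: "(\<Sum>j<N. H i j * x j) = x i" if x: "!!i. K <= i ==> i < N ==> x i = 0" and i: "i < N" for x i
  proof -
   have "(\<Sum>j<N. u j * x j) = 0" by (rule sum.neutral) (use u0 x in \<open>auto simp: not_le\<close>, metis not_le)
   then show ?thesis unfolding Hx[OF i] by simp
  qed
  \<comment> \<open>The squared norm of \<open>u\<close> is twice its inner product with
    \<open>v\<close>, so the reflection subtracts exactly \<open>u\<close> from
    \<open>v\<close>.\<close>
  have uv: "c * (\<Sum>j<N. u j * v j) = 1"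
  proof -
   have 1: "(\<Sum>j<N. (if j = K then al else 0) * w j) = al * w K" for w :: "nat => real"
   proof -
    have "(\<Sum>j<N. (if j = K then al else 0) * w j) = (\<Sum>j<N. if j = K then al * w K else 0)" by (intro sum.cong) auto
    then show ?thesis using K by simp
   qed
   have "(\<Sum>j<N. u j * v j) = (\<Sum>j<N. (t j)\<^sup>2 - (if j = K then al else 0) * v j)"
    unfolding u_def t_def by (intro sum.cong refl) (auto simp: algebra_simps power2_eq_square)
   also have "... = al\<^sup>2 - al * v K" unfolding sum_subtractf 1 al ..
   finally have a: "(\<Sum>j<N. u j * v j) = al\<^sup>2 - al * v K" .
   have "S = (\<Sum>j<N. (t j)\<^sup>2 - 2 * ((if j = K then al else 0) * t j) + (if j = K then al else 0) * (if j = K then al else 0))"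
    unfolding S_def u_def by (intro sum.cong refl) (auto simp: algebra_simps power2_eq_square)
   also have "... = al\<^sup>2 - 2 * (al * t K) + al * al"
    unfolding sum_subtractf sum.distrib sum_distrib_left[symmetric] 1 al by simp
   finally have "S = 2 * (al\<^sup>2 - al * v K)" unfolding t_def by (simp add: power2_eq_square)
   then show ?thesis unfolding a c_def using False by (simp add: field_simps)
  qed
  have "(\<Sum>j<N. H i j * v j) = 0" if "K < i" "i < N" for i
  proof -
   have "(\<Sum>j<N. H i j * v j) = v i - u i * (c * (\<Sum>j<N. u j * v j))" unfolding Hx[OF that(2)] by simp
   then show ?thesis unfolding uv using u1[OF that(1)] by simp
  qed
  then show ?thesis using oH fx by blast
 qed
qed

text \<open>One reflection per vector: the next one does not disturb the earlier vectors, which are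
  already confined to the first K coordinates.\<close>

lemma exists_orth:
 fixes w :: "nat => nat => real"
 assumes "K <= N"
 shows "EX A. orth N A & (ALL l<K. ALL i. K <= i --> i < N --> (\<Sum>j<N. A i j * w l j) = 0)"
 using assms
proof (induction K)
 case 0
 show ?case using orth_id by blast
next
 case (Suc K)
 then obtain A where A: "orth N A" "!!l i. l < K ==> K <= i ==> i < N ==> (\<Sum>j<N. A i j * w l j) = 0" by auto
 define W where "W l i = (\<Sum>j<N. A i j * w l j)" for l i
 have "K < N" using Suc by simp
 from householder[OF this, of "W K"] obtain H where H: "orth N H" "!!x i. (!!i. K <= i ==> i < N ==> x i = 0) ==> i < N ==> (\<Sum>j<N. H i j * x j) = x i"
  "!!i. K < i ==> i < N ==> (\<Sum>j<N. H i j * W K j) = 0" by blast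
 have e: "(\<Sum>j<N. mm N H A i j * w l j) = (\<Sum>k<N. H i k * W l k)" for i l
 proof -
  have "(\<Sum>j<N. mm N H A i j * w l j) = (\<Sum>j<N. \<Sum>k<N. H i k * (A k j * w l j))"
   unfolding mm_def sum_distrib_right by (simp only: mult.assoc)
  also have "... = (\<Sum>k<N. \<Sum>j<N. H i k * (A k j * w l j))" by (rule sum.swap)
  finally show ?thesis unfolding W_def sum_distrib_left .
 qed
 show ?case
 proof (intro exI[of _ "mm N H A"] conjI allI impI orth_mm H(1) A(1))
  fix l i assume l: "l < Suc K" and i: "Suc K <= i" "i < N"
  show "(\<Sum>j<N. mm N H A i j * w l j) = 0"
  proof (cases "l = K")
   case True
   then show ?thesis unfolding e using H(3) i by simp
  next
   case False
   then have "l < K" using l by simp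
   then have "W l i' = 0" if "K <= i'" "i' < N" for i' using A(2)[OF _ that] unfolding W_def by simp
   then show ?thesis unfolding e using H(2)[of "W l" i] i by simp
  qed
 qed
qed

lemma detN_det: "detN N A = det (mat N N (%(i, j). A i j))"
proof -
 have "detN N A = (\<Sum>p | p permutes {0..<N}. signof p * (\<Prod>i = 0..<N. A i (p i)))"
  unfolding detN_def lessThan_atLeast0 ..
 also have "... = (\<Sum>p | p permutes {0..<N}. signof p * (\<Prod>i = 0..<N. mat N N (%(i, j). A i j) $$ (i, p i)))"
 proof (intro sum.cong refl arg_cong2[where f="(*)"] prod.cong)
  fix p i assume "p : {p. p permutes {0..<N}}" "i : {0..<N}"
  then have "p i < N" "i < N" using permutes_in_image[of p "{0..<N}" i] by auto
  then show "A i (p i) = mat N N (%(i, j). A i j) $$ (i, p i)" by simp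
 qed
 finally show ?thesis using det_def'[of "mat N N (%(i, j). A i j)" N] by simp
qed

lemma detN_orth:
 assumes "orth N A"
 shows "detN N A = 1 \<or> detN N A = -1"
proof -
 define M where "M = mat N N (%(i, j). A i j)"
 have M: "M : carrier_mat N N" unfolding M_def by simp
 have "M * transpose_mat M = 1\<^sub>m N"
 proof (rule eq_matI)
  fix i j assume ij: "i < dim_row (1\<^sub>m N)" "j < dim_col (1\<^sub>m N)"
  have "(M * transpose_mat M) $$ (i, j) = (\<Sum>k<N. A i k * A j k)"
   using ij unfolding M_def by (simp add: scalar_prod_def lessThan_atLeast0)
  then show "(M * transpose_mat M) $$ (i, j) = 1\<^sub>m N $$ (i, j)" using assms ij unfolding orth_def by simp
 qed (use M in auto)
 then have "det M * det (transpose_mat M) = 1" using det_mult[OF M, of "transpose_mat M"] M by simp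
 then have "det M * det M = 1" using det_transpose[OF M] by simp
 then show ?thesis unfolding detN_det M_def[symmetric] by (simp add: square_eq_1_iff)
qed

lemma detN_id: "detN N (%i j. if i = j then 1 else 0) = 1"
proof -
 have "mat N N (%(i, j). if i = j then 1 else (0::real)) = 1\<^sub>m N" by (rule eq_matI) auto
 then show ?thesis unfolding detN_det by simp
qed

text \<open>Negating the last row corrects the sign of the determinant and keeps the zeros. For
  \<open>K = N\<close> no zeros are required and the identity serves.\<close>

lemma exists_rotation:
 fixes w :: "nat => nat => real"
 assumes K: "K <= N"
 shows "EX A. is_rotation N A & orth N A & (ALL l<K. ALL i. K <= i --> i < N --> (\<Sum>j<N. A i j * w l j) = 0)"
proof (cases "K = N")
 case True
 then show ?thesis using orth_id[of N] detN_id[of N] unfolding is_rotation_def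
  by (intro exI[of _ "%i j. if i = j then 1 else 0"]) (auto simp: orth_def)
next
 case False
 then have KN: "K < N" using K by simp
 obtain A where A: "orth N A" "!!l i. l < K ==> K <= i ==> i < N ==> (\<Sum>j<N. A i j * w l j) = 0"
  using exists_orth[OF K, of w] by blast
 show ?thesis
 proof (cases "detN N A = 1")
  case True
  then show ?thesis using A unfolding is_rotation_def by (intro exI[of _ A]) (auto simp: orth_def)
 next
  case False
  then have dA: "detN N A = -1" using detN_orth[OF A(1)] by simp
  define s :: "nat => real" where "s i = (if i = N - 1 then -1 else 1)" for i
  have s2: "s i * s i = 1" for i unfolding s_def by simp
  define A' where "A' i j = s i * A i j" for i j
  have "detN N A' = (\<Prod>i<N. s i) * detN N A"
   unfolding detN_def A'_def prod.distrib sum_distrib_left by (intro sum.cong refl) (simp only: mult.assoc mult.left_commute)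
  also have "(\<Prod>i<N. s i) = s (N - 1) * (\<Prod>i\<in>{..<N} - {N - 1}. s i)" using KN by (intro prod.remove) auto
  also have "(\<Prod>i\<in>{..<N} - {N - 1}. s i) = 1" by (rule prod.neutral) (simp add: s_def)
  finally have d: "detN N A' = 1" using dA unfolding s_def by simp
  have 1: "(\<Sum>k<N. A' k i * A' k j) = (\<Sum>k<N. A k i * A k j)" for i j
  proof (rule sum.cong[OF refl])
   fix k
   have "A' k i * A' k j = (s k * s k) * (A k i * A k j)"
    unfolding A'_def by (simp only: mult.assoc mult.left_commute mult.commute)
   then show "A' k i * A' k j = A k i * A k j" unfolding s2 by simp
  qed
  have 2: "(\<Sum>k<N. A' i k * A' j k) = s i * s j * (\<Sum>k<N. A i k * A j k)" for i j
   unfolding A'_def sum_distrib_left by (intro sum.cong refl) (simp only: mult.assoc mult.left_commute)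
  have o: "orth N A'" unfolding orth_def 1 2 using A(1) s2 unfolding orth_def by auto
  have 3: "(\<Sum>j<N. A' i j * w l j) = s i * (\<Sum>j<N. A i j * w l j)" for i l
   unfolding A'_def sum_distrib_left by (simp only: mult.assoc)
  show ?thesis by (intro exI[of _ A'] conjI) (use o d A(2) 3 in \<open>auto simp: is_rotation_def orth_def\<close>)
 qed
qed

section \<open>Lebesgue and Gaussian measure under orthogonal maps\<close>

interpretation LP: product_sigma_finite "%_::nat. lborel :: real measure"
 by unfold_locales

lemma space_lebN: "space (lebN N) = RN N" "space (GG {..<N}) = RN N"
 unfolding lebN_def RN_def by (auto simp: space_PiM)

lemma sets_lebN: "sets (lebN N) = sets (GG {..<N})"
 unfolding lebN_def by (intro sets_PiM_cong) auto

lemma lebN_comp: "i < N ==> (%x. x i) : bm (lebN N)"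
 unfolding lebN_def using measurable_component_singleton[of i "{..<N}" "%_. lborel :: real measure"] by simp

lemma gauss_density_prod: "gauss_density N x = (\<Prod>i<N. nd (x i))"
proof -
 have "(\<Prod>i<N. nd (x i)) = (1 / sqrt (2 * pi)) ^ N * exp (\<Sum>i<N. - (x i)\<^sup>2 / 2)"
  unfolding std_normal_density_def prod.distrib by (simp add: exp_sum)
 also have "(\<Sum>i<N. - (x i)\<^sup>2 / 2) = - (\<Sum>i<N. (x i)\<^sup>2) / 2" by (simp add: sum_negf sum_divide_distrib)
 also have "1 / sqrt (2 * pi) = (2 * pi) powr (- 1 / 2)" using pi_gt_zero by (simp add: powr_minus_divide powr_half_sqrt)
 also have "((2 * pi) powr (- 1 / 2)) ^ N = (2 * pi) powr (- real N / 2)" using pi_gt_zero by (simp add: powr_power)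
 finally show ?thesis unfolding gauss_density_def by simp
qed

lemma gauss_density_meas: "gauss_density N : bm (lebN N)"
proof -
 have "(%x. \<Prod>i<N. nd (x i)) : bm (lebN N)"
  by (intro borel_measurable_prod measurable_compose[OF lebN_comp]) auto
 then show ?thesis by (simp add: gauss_density_prod[abs_def])
qed

lemma gauss_density_pos: "0 < gauss_density N x"
 unfolding gauss_density_prod by (intro prod_pos) (auto simp: normal_density_pos)

lemma gaussN_GG: "gaussN N = GG {..<N}"
proof (rule NP.PiM_eqI)
 show "sets (gaussN N) = sets (GG {..<N})" unfolding gaussN_def using sets_lebN by simp
 fix A assume A: "!!i. i : {..<N} ==> A i : sets N01"
 have P: "PiE {..<N} A : sets (lebN N)" unfolding lebN_def by (rule sets_PiM_I_finite) (use A in auto)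
 have "emeasure (gaussN N) (PiE {..<N} A) = (\<integral>\<^sup>+x. ennreal (gauss_density N x) * indicator (PiE {..<N} A) x \<partial>lebN N)"
  unfolding gaussN_def using P gauss_density_meas by (subst emeasure_density) auto
 also have "... = (\<integral>\<^sup>+x. (\<Prod>i<N. ennreal (nd (x i)) * indicator (A i) (x i)) \<partial>lebN N)"
 proof (rule nn_integral_cong)
  fix x assume x: "x : space (lebN N)"
  have "indicator (PiE {..<N} A) x = (\<Prod>i<N. indicator (A i) (x i) :: ennreal)"
   using x unfolding space_lebN RN_def by (auto simp: indicator_def PiE_iff prod_zero_iff)
  moreover have "ennreal (gauss_density N x) = (\<Prod>i<N. ennreal (nd (x i)))"
   unfolding gauss_density_prod by (subst prod_ennreal) (auto intro: less_imp_le normal_density_pos)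
  ultimately show "ennreal (gauss_density N x) * indicator (PiE {..<N} A) x = (\<Prod>i<N. ennreal (nd (x i)) * indicator (A i) (x i))"
   by (simp only: prod.distrib)
 qed
 also have "... = (\<Prod>i<N. \<integral>\<^sup>+t. ennreal (nd t) * indicator (A i) t \<partial>lborel)"
  unfolding lebN_def by (rule LP.product_nn_integral_prod) (use A in auto)
 also have "... = (\<Prod>i<N. emeasure N01 (A i))"
  unfolding N01_def using A by (intro prod.cong refl) (subst emeasure_density, auto)
 finally show "emeasure (gaussN N) (PiE {..<N} A) = (\<Prod>i<N. emeasure N01 (A i))" .
qed simp

lemma AE_lebN: "(AE x in lebN N. P x) \<longleftrightarrow> (AE x in GG {..<N}. P x)"
 unfolding gaussN_GG[symmetric] gaussN_def using gauss_density_meas gauss_density_pos by (subst AE_density) auto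

definition tr :: "nat => (nat => real) => (nat => real) => nat => real" where
 "tr N a x = (\<lambda>i\<in>{..<N}. x i + a i)"

lemma tr_meas2: "(%p. tr N (h p) (k p)) : M \<rightarrow>\<^sub>M lebN N"
 if "h : M \<rightarrow>\<^sub>M lebN N" "k : M \<rightarrow>\<^sub>M lebN N"
 unfolding tr_def lebN_def
proof (rule measurable_restrict)
 fix i assume i: "i : {..<N}"
 have "(%p. k p i + h p i) : bm M"
  using measurable_compose[OF that(1) lebN_comp] measurable_compose[OF that(2) lebN_comp] i by auto
 then show "(%p. k p i + h p i) : M \<rightarrow>\<^sub>M lborel" by simp
qed

lemma tr_meas: "tr N a : lebN N \<rightarrow>\<^sub>M lebN N"
 unfolding tr_def lebN_def
proof (rule measurable_restrict)
 fix i assume i: "i : {..<N}"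
 have "(%x. x i + a i) : bm (lebN N)" using lebN_comp i by auto
 then show "(%x. x i + a i) : PiM {..<N} (%_. lborel) \<rightarrow>\<^sub>M lborel" unfolding lebN_def by simp
qed

lemma lebN_tr: "distr (lebN N) (lebN N) (tr N a) = lebN N"
 unfolding lebN_def
proof (rule LP.PiM_eqI)
 let ?L = "PiM {..<N} (%_. lborel :: real measure)"
 show "sets (distr ?L ?L (tr N a)) = sets ?L" by simp
 fix A :: "nat => real set" assume A: "!!i. i : {..<N} ==> A i : sets lborel"
 have P: "PiE {..<N} A : sets ?L" by (rule sets_PiM_I_finite) (use A in auto)
 have "emeasure (distr ?L ?L (tr N a)) (PiE {..<N} A) = emeasure ?L (tr N a -` PiE {..<N} A \<inter> space ?L)"
  using tr_meas P unfolding lebN_def by (rule emeasure_distr)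
 also have "tr N a -` PiE {..<N} A \<inter> space ?L = PiE {..<N} (%i. {t. t + a i : A i})"
  by (intro Set.set_eqI) (simp add: tr_def space_PiM PiE_iff conj_commute)
 also have "emeasure ?L ... = (\<Prod>i<N. emeasure lborel {t. t + a i : A i})"
 proof (rule LP.emeasure_PiM)
  fix i assume "i : {..<N}"
  then have "(+) (a i) -` A i \<inter> space borel : sets borel" by (intro measurable_sets[of _ borel borel]) (use A in auto)
  then show "{t. t + a i : A i} : sets lborel" by (simp add: vimage_def add.commute)
 qed simp
 also have "... = (\<Prod>i<N. emeasure lborel (A i))"
 proof (rule prod.cong[OF refl])
  fix i assume i: "i : {..<N}"
  have "emeasure lborel (A i) = emeasure (distr lborel borel ((+) (a i))) (A i)" unfolding lborel_distr_plus ..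
  also have "... = emeasure lborel ((+) (a i) -` A i \<inter> space lborel)" by (rule emeasure_distr) (use A i in auto)
  also have "(+) (a i) -` A i \<inter> space lborel = {t. t + a i : A i}" by (auto simp: add.commute)
  finally show "emeasure lborel {t. t + a i : A i} = emeasure lborel (A i)" ..
 qed
 finally show "emeasure (distr ?L ?L (tr N a)) (PiE {..<N} A) = (\<Prod>i\<in>{..<N}. emeasure lborel (A i))" .
qed simp

lemma nn_tr: "F : bm (lebN N) ==> (\<integral>\<^sup>+x. F (tr N a x) \<partial>lebN N) = (\<integral>\<^sup>+x. F x \<partial>lebN N)"
 using nn_integral_distr[OF tr_meas[of N a], of F] unfolding lebN_tr by simp

lemma mat_meas: "mat_apply N A : lebN N \<rightarrow>\<^sub>M lebN N"
 unfolding mat_apply_def lebN_def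
proof (rule measurable_restrict)
 fix i assume i: "i : {..<N}"
 have "(%x. \<Sum>j<N. A i j * x j) : bm (lebN N)"
  by (intro borel_measurable_sum borel_measurable_times borel_measurable_const lebN_comp) auto
 then show "(%x. \<Sum>j<N. A i j * x j) : PiM {..<N} (%_. lborel) \<rightarrow>\<^sub>M lborel" unfolding lebN_def by simp
qed

lemma mat_space: "mat_apply N A x : RN N"
 unfolding mat_apply_def RN_def by auto

definition tp :: "(nat => nat => real) => nat => nat => real" where "tp A i j = A j i"

lemma orth_tp: "orth N A ==> orth N (tp A)"
 unfolding orth_def tp_def by blast

lemma mat_tp:
 assumes A: "orth N A" and x: "x : RN N"
 shows "mat_apply N A (mat_apply N (tp A) x) = x"
proof
 fix i
 show "mat_apply N A (mat_apply N (tp A) x) i = x i"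
 proof (cases "i < N")
  case True
  have "mat_apply N A (mat_apply N (tp A) x) i = (\<Sum>j<N. \<Sum>k<N. A i j * (A k j * x k))"
   using True unfolding mat_apply_def tp_def by (simp add: sum_distrib_left)
  also have "... = (\<Sum>k<N. \<Sum>j<N. A i j * (A k j * x k))" by (rule sum.swap)
  also have "... = (\<Sum>k<N. (\<Sum>j<N. A i j * A k j) * x k)" unfolding sum_distrib_right by (simp only: mult.assoc)
  also have "... = (\<Sum>k<N. if k = i then x i else 0)" using A True unfolding orth_def by (intro sum.cong refl) auto
  finally show ?thesis using True by simp
 next
  case False
  then show ?thesis using x unfolding mat_apply_def RN_def by (auto simp: PiE_iff extensional_def)
 qed
qed

lemma mat_tp': "orth N A ==> x : RN N ==> mat_apply N (tp A) (mat_apply N A x) = x"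
 using mat_tp[OF orth_tp, of N A x] by (simp add: tp_def[abs_def])

lemma mat_inner:
 assumes A: "orth N A"
 shows "(\<Sum>i<N. mat_apply N A x i * mat_apply N A y i) = (\<Sum>i<N. x i * y i)"
proof -
 have "(\<Sum>i<N. mat_apply N A x i * mat_apply N A y i) = (\<Sum>k<N. (\<Sum>a<N. A k a * x a) * (\<Sum>b<N. A k b * y b))"
  unfolding mat_apply_def by (intro sum.cong) auto
 also have "... = (\<Sum>a<N. x a * y a)" by (rule gram) (use A in \<open>auto simp: orth_def\<close>)
 finally show ?thesis .
qed

lemma mat_norm: "orth N A ==> (\<Sum>i<N. (mat_apply N A x i)\<^sup>2) = (\<Sum>i<N. (x i)\<^sup>2)"
 using mat_inner[of N A x x] by (simp add: power2_eq_square)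

lemma gd_mat: "orth N A ==> gauss_density N (mat_apply N A x) = gauss_density N x"
 unfolding gauss_density_def by (simp add: mat_norm)

lemma mat_add:
 shows "mat_apply N A (tr N b x) = tr N (mat_apply N A b) (mat_apply N A x)"
 unfolding mat_apply_def tr_def by (auto simp: fun_eq_iff sum.distrib distrib_left)

lemma gauss_prob: "(\<integral>\<^sup>+x. ennreal (gauss_density N x) \<partial>lebN N) = 1"
proof -
 interpret prob_space "GG {..<N}" by (rule prob_space_PiM) (rule prob_space_N01)
 have "(\<integral>\<^sup>+x. ennreal (gauss_density N x) \<partial>lebN N) = emeasure (gaussN N) (space (lebN N))"
  unfolding gaussN_def using gauss_density_meas by (subst emeasure_density) (auto cong: nn_integral_cong)
 also have "... = 1" unfolding gaussN_GG space_lebN(1) space_lebN(2)[symmetric] by (rule emeasure_space_1)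
 finally show ?thesis .
qed

text \<open>Translation invariance and the Gaussian density \<open>h\<close> suffice. Insert the
  integral 1 of \<open>h\<close>, translate so that \<open>F\<close> is evaluated at x + A y,
  exchange the integrals and translate again: \<open>h\<close> is then evaluated at x - A y. As A
  preserves norms, this is its value at y minus the transpose of A applied to x, and the integral
  over y is 1 again.\<close>

lemma lebN_mat:
 assumes A: "orth N A" and F: "F : bm (lebN N)"
 shows "(\<integral>\<^sup>+y. F (mat_apply N A y) \<partial>lebN N) = (\<integral>\<^sup>+x. F x \<partial>lebN N)"
proof -
 interpret finite_product_sigma_finite "%_::nat. lborel :: real measure" "{..<N}" by standard simp
 interpret L: sigma_finite_measure "lebN N" unfolding lebN_def by unfold_locales
 interpret LL: pair_sigma_finite "lebN N" "lebN N" by unfold_locales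
 define h where "h x = ennreal (gauss_density N x)" for x
 have hm: "h : bm (lebN N)" unfolding h_def[abs_def] using gauss_density_meas by simp
 have h1: "(\<integral>\<^sup>+x. h x \<partial>lebN N) = 1" unfolding h_def by (rule gauss_prob)
 let ?M = "mat_apply N A"
 have FM: "(%y. F (?M y)) : bm (lebN N)" by (rule measurable_compose[OF mat_meas F])
 have neg: "tr N (mat_apply N A y) (\<lambda>i\<in>{..<N}. - mat_apply N A y i) = (\<lambda>i\<in>{..<N}. 0)" for y unfolding tr_def by auto
 have m1: "(%p. tr N (fst p) (?M (snd p))) : lebN N \<Otimes>\<^sub>M lebN N \<rightarrow>\<^sub>M lebN N"
  by (rule tr_meas2) (auto intro: measurable_compose[OF measurable_snd mat_meas])
 have "(\<integral>\<^sup>+y. F (?M y) \<partial>lebN N) = (\<integral>\<^sup>+x. h x * (\<integral>\<^sup>+y. F (?M y) \<partial>lebN N) \<partial>lebN N)"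
  using hm h1 by (simp add: nn_integral_multc)
 also have "... = (\<integral>\<^sup>+x. (\<integral>\<^sup>+y. h x * F (tr N x (?M y)) \<partial>lebN N) \<partial>lebN N)"
 proof (rule nn_integral_cong)
  fix x assume x: "x : space (lebN N)"
  have "(\<integral>\<^sup>+y. F (?M y) \<partial>lebN N) = (\<integral>\<^sup>+y. F (?M (tr N (mat_apply N (tp A) x) y)) \<partial>lebN N)"
   by (rule nn_tr[OF FM, symmetric])
  also have "... = (\<integral>\<^sup>+y. F (tr N x (?M y)) \<partial>lebN N)" unfolding mat_add using mat_tp[OF A] x by (simp add: space_lebN)
  finally have e: "(\<integral>\<^sup>+y. F (?M y) \<partial>lebN N) = (\<integral>\<^sup>+y. F (tr N x (?M y)) \<partial>lebN N)" .
  have "(%y. F (tr N x (?M y))) : bm (lebN N)"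
   by (rule measurable_compose[OF mat_meas measurable_compose[OF tr_meas F]])
  then show "h x * (\<integral>\<^sup>+y. F (?M y) \<partial>lebN N) = (\<integral>\<^sup>+y. h x * F (tr N x (?M y)) \<partial>lebN N)" unfolding e by (simp add: nn_integral_cmult)
 qed
 also have "... = (\<integral>\<^sup>+y. (\<integral>\<^sup>+x. h x * F (tr N x (?M y)) \<partial>lebN N) \<partial>lebN N)"
  by (rule LL.Fubini'[symmetric])
   (simp add: split_beta' measurable_compose[OF m1 F] measurable_compose[OF measurable_fst hm] borel_measurable_times_ennreal)
 also have "... = (\<integral>\<^sup>+y. (\<integral>\<^sup>+x. h (tr N (%i. - ?M y i) x) * F x \<partial>lebN N) \<partial>lebN N)"
 proof (rule nn_integral_cong)
  fix y
  define G where "G x = h (tr N (%i. - ?M y i) x) * F x" for x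
  have G: "G : bm (lebN N)" unfolding G_def[abs_def]
   by (intro borel_measurable_times_ennreal F measurable_compose[OF tr_meas hm])
  have "h x * F (tr N x (?M y)) = G (tr N (?M y) x)" if "x : space (lebN N)" for x
  proof -
   have "tr N (%i. - ?M y i) (tr N (?M y) x) = x" using that unfolding tr_def space_lebN RN_def by (auto simp: PiE_iff extensional_def fun_eq_iff)
   moreover have "tr N x (?M y) = tr N (?M y) x" unfolding tr_def by (auto simp: add.commute)
   ultimately show ?thesis unfolding G_def by simp
  qed
  then have "(\<integral>\<^sup>+x. h x * F (tr N x (?M y)) \<partial>lebN N) = (\<integral>\<^sup>+x. G (tr N (?M y) x) \<partial>lebN N)" by (intro nn_integral_cong) auto
  also have "... = (\<integral>\<^sup>+x. G x \<partial>lebN N)" by (rule nn_tr[OF G])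
  finally show "(\<integral>\<^sup>+x. h x * F (tr N x (?M y)) \<partial>lebN N) = (\<integral>\<^sup>+x. h (tr N (%i. - ?M y i) x) * F x \<partial>lebN N)" unfolding G_def .
 qed
 also have "... = (\<integral>\<^sup>+y. (\<integral>\<^sup>+x. h (tr N (%i. - mat_apply N (tp A) x i) y) * F x \<partial>lebN N) \<partial>lebN N)"
 proof (intro nn_integral_cong arg_cong2[where f="(*)"] refl)
  fix x y assume x: "x : space (lebN N)"
  let ?z = "tr N (%i. - mat_apply N (tp A) x i) y"
  have "(\<Sum>i<N. (mat_apply N A ?z i)\<^sup>2) = (\<Sum>i<N. (tr N (%i. - ?M y i) x i)\<^sup>2)"
  proof (rule sum.cong[OF refl])
   fix i assume i: "i : {..<N}"
   have "mat_apply N A (%i. - mat_apply N (tp A) x i) i = - mat_apply N A (mat_apply N (tp A) x) i"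
    using i unfolding mat_apply_def by (simp add: sum_negf)
   also have "... = - x i" using mat_tp[OF A] x by (simp add: space_lebN)
   finally have "mat_apply N A ?z i = ?M y i - x i" using i unfolding mat_add by (simp add: tr_def)
   moreover have "tr N (%i. - ?M y i) x i = - (?M y i - x i)" using i unfolding tr_def by simp
   ultimately show "(mat_apply N A ?z i)\<^sup>2 = (tr N (%i. - ?M y i) x i)\<^sup>2" by (simp only: power2_minus)
  qed
  then show "h (tr N (%i. - ?M y i) x) = h ?z" unfolding h_def gauss_density_def mat_norm[OF A] by simp
 qed
 also have "... = (\<integral>\<^sup>+x. (\<integral>\<^sup>+y. h (tr N (%i. - mat_apply N (tp A) x i) y) * F x \<partial>lebN N) \<partial>lebN N)"
 proof -
  have nm: "(%z. \<lambda>i\<in>{..<N}. - mat_apply N (tp A) z i) : lebN N \<rightarrow>\<^sub>M lebN N"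
   unfolding lebN_def
  proof (rule measurable_restrict)
   fix i assume "i : {..<N}"
   then have "(%z. - mat_apply N (tp A) z i) : bm (lebN N)"
    using measurable_compose[OF mat_meas lebN_comp, of i N "tp A"] by simp
   then show "(%z. - mat_apply N (tp A) z i) : PiM {..<N} (%_. lborel) \<rightarrow>\<^sub>M lborel" unfolding lebN_def by simp
  qed
  have e: "tr N (\<lambda>i\<in>{..<N}. - mat_apply N (tp A) z i) y = tr N (%i. - mat_apply N (tp A) z i) y" for z y unfolding tr_def by auto
  have "(%p. tr N (\<lambda>i\<in>{..<N}. - mat_apply N (tp A) (snd p) i) (fst p)) : lebN N \<Otimes>\<^sub>M lebN N \<rightarrow>\<^sub>M lebN N"
   by (rule tr_meas2[OF measurable_compose[OF measurable_snd nm] measurable_fst])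
  from measurable_compose[OF this hm] have "(%p. h (tr N (%i. - mat_apply N (tp A) (snd p) i) (fst p)) * F (snd p)) : bm (lebN N \<Otimes>\<^sub>M lebN N)"
   unfolding e by (intro borel_measurable_times_ennreal measurable_compose[OF measurable_snd F])
  then show ?thesis by (intro LL.Fubini'[symmetric]) (simp add: split_beta')
 qed
 also have "... = (\<integral>\<^sup>+x. F x \<partial>lebN N)"
 proof (rule nn_integral_cong)
  fix x
  have "(\<integral>\<^sup>+y. h (tr N (%i. - mat_apply N (tp A) x i) y) * F x \<partial>lebN N) = (\<integral>\<^sup>+y. h (tr N (%i. - mat_apply N (tp A) x i) y) \<partial>lebN N) * F x"
   by (rule nn_integral_multc) (rule measurable_compose[OF tr_meas hm])
  then show "(\<integral>\<^sup>+y. h (tr N (%i. - mat_apply N (tp A) x i) y) * F x \<partial>lebN N) = F x" unfolding nn_tr[OF hm] h1 by simp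
 qed
 finally show ?thesis .
qed

lemma mat_measG: "mat_apply N A : GG {..<N} \<rightarrow>\<^sub>M GG {..<N}"
 using mat_meas[of N A] unfolding measurable_cong_sets[OF sets_lebN sets_lebN] .

lemma distr_mat:
 assumes A: "orth N A"
 shows "distr (GG {..<N}) (GG {..<N}) (mat_apply N A) = GG {..<N}"
proof (rule measure_eqI)
 fix S assume "S : sets (distr (GG {..<N}) (GG {..<N}) (mat_apply N A))"
 then have S: "S : sets (GG {..<N})" "S : sets (lebN N)" by (simp_all add: sets_lebN)
 define F where "F x = ennreal (gauss_density N x) * indicator S x" for x
 have F: "F : bm (lebN N)" unfolding F_def[abs_def] using gauss_density_meas S by simp
 have pre: "mat_apply N A -` S \<inter> space (lebN N) : sets (lebN N)" by (rule measurable_sets[OF mat_meas S(2)])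
 have "emeasure (distr (GG {..<N}) (GG {..<N}) (mat_apply N A)) S = emeasure (gaussN N) (mat_apply N A -` S \<inter> space (lebN N))"
  unfolding gaussN_GG space_lebN(1) space_lebN(2)[symmetric] by (rule emeasure_distr[OF mat_measG S(1)])
 also have "... = (\<integral>\<^sup>+x. ennreal (gauss_density N x) * indicator (mat_apply N A -` S \<inter> space (lebN N)) x \<partial>lebN N)"
  unfolding gaussN_def using gauss_density_meas pre by (subst emeasure_density) auto
 also have "... = (\<integral>\<^sup>+x. F (mat_apply N A x) \<partial>lebN N)"
  unfolding F_def gd_mat[OF A] by (intro nn_integral_cong) (auto split: split_indicator)
 also have "... = (\<integral>\<^sup>+x. F x \<partial>lebN N)" by (rule lebN_mat[OF A F])
 also have "... = emeasure (gaussN N) S" unfolding F_def gaussN_def using gauss_density_meas S by (subst emeasure_density) auto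
 finally show "emeasure (distr (GG {..<N}) (GG {..<N}) (mat_apply N A)) S = emeasure (GG {..<N}) S" unfolding gaussN_GG .
qed simp

lemma integral_mat:
 fixes F :: "(nat => real) => real"
 assumes A: "orth N A" and F: "F : bm (GG {..<N})"
 shows "(LINT x|GG {..<N}. F (mat_apply N A x)) = (LINT x|GG {..<N}. F x)"
 using integral_distr[OF mat_measG[of N A] F] unfolding distr_mat[OF A] by simp

text \<open>The exponent involves only the two norms and the inner product.\<close>

lemma kk_mat:
 assumes rho: "0 < rh" "rh < 1" and A: "orth N A"
 shows "kk rh {..<N} (mat_apply N A x) (mat_apply N A y) = kk rh {..<N} x y"
proof -
 define a where "a = - (rh\<^sup>2 / (2 * (1 - rh\<^sup>2)))"
 have e: "kk rh {..<N} x y = exp (a * ((\<Sum>i<N. (x i)\<^sup>2) + (\<Sum>i<N. (y i)\<^sup>2)) + kap rh * (\<Sum>i<N. x i * y i)) / sqrt (1 - rh\<^sup>2) ^ N" for x y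
 proof -
  have "kk rh {..<N} x y = (\<Prod>i<N. exp (a * ((x i)\<^sup>2 + (y i)\<^sup>2) + kap rh * x i * y i)) / (\<Prod>i<N. sqrt (1 - rh\<^sup>2))"
   unfolding kk_def k1_exp[OF rho] a_def by (rule prod_dividef)
  also have "(\<Prod>i<N. exp (a * ((x i)\<^sup>2 + (y i)\<^sup>2) + kap rh * x i * y i)) = exp (\<Sum>i<N. a * ((x i)\<^sup>2 + (y i)\<^sup>2) + kap rh * x i * y i)"
   by (simp add: exp_sum)
  also have "(\<Sum>i<N. a * ((x i)\<^sup>2 + (y i)\<^sup>2) + kap rh * x i * y i) = a * ((\<Sum>i<N. (x i)\<^sup>2) + (\<Sum>i<N. (y i)\<^sup>2)) + kap rh * (\<Sum>i<N. x i * y i)"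
   by (simp add: sum.distrib sum_distrib_left distrib_left mult.assoc)
  finally show ?thesis by simp
 qed
 show ?thesis unfolding e mat_norm[OF A] mat_inner[OF A] ..
qed

section \<open>The noise operator in kernel form, and cylinders\<close>

text \<open>Both measures are the product of the one-dimensional noise laws \<open>K i\<close>; in
  each coordinate this is \<open>nn_k1\<close>.\<close>

lemma noise_distr:
 assumes rho: "0 < rh" "rh < 1"
 shows "distr (GG {..<N}) (GG {..<N}) (%y. \<lambda>i\<in>{..<N}. x i * rh + y i * sqrt (1 - rh\<^sup>2)) = density (GG {..<N}) (%y. ennreal (kk rh {..<N} x y))"
  and "(%y. \<lambda>i\<in>{..<N}. x i * rh + y i * sqrt (1 - rh\<^sup>2)) : GG {..<N} \<rightarrow>\<^sub>M GG {..<N}"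
  and "kk rh {..<N} x : bm (GG {..<N})"
proof -
 define K where "K i = density N01 (%r. ennreal (k1 rh (x i) r))" for i
 have km: "(%r. ennreal (k1 rh t r)) : bm N01" for t
  by (rule measurable_compose[OF k1_meas measurable_ennreal]) (auto intro: measurable_ident_sets)
 have Kp: "prob_space (K i)" for i
 proof
  show "emeasure (K i) (space (K i)) = 1" unfolding K_def using nn_k1_1[OF rho, of "x i"] km by (subst emeasure_density) auto
 qed
 interpret KP: product_sigma_finite K using Kp by (intro product_sigma_finite.intro) (rule prob_space_imp_sigma_finite)
 have sK: "sets (PiM {..<N} K) = sets (GG {..<N})" by (rule sets_PiM_cong) (auto simp: K_def)
 let ?S = "%y. \<lambda>i\<in>{..<N}. x i * rh + y i * sqrt (1 - rh\<^sup>2)"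
 show Sm: "?S : GG {..<N} \<rightarrow>\<^sub>M GG {..<N}"
 proof (rule measurable_restrict)
  fix i assume i: "i : {..<N}"
  have "(%y. x i * rh + y i * sqrt (1 - rh\<^sup>2)) : bm (GG {..<N})" using meas_comp[OF i] by simp
  then show "(%y. x i * rh + y i * sqrt (1 - rh\<^sup>2)) : GG {..<N} \<rightarrow>\<^sub>M N01" by (simp cong: measurable_cong_sets)
 qed
 show kkm: "kk rh {..<N} x : bm (GG {..<N})"
  unfolding kk_def[abs_def] by (intro borel_measurable_prod k1_meas borel_measurable_const meas_comp)
 have Kv: "emeasure (K i) A = (\<integral>\<^sup>+r. ennreal (k1 rh (x i) r) * indicator A r \<partial>N01)" if "A : sets borel" for A i
  unfolding K_def using km that by (subst emeasure_density) auto
 have 1: "distr (GG {..<N}) (GG {..<N}) ?S = PiM {..<N} K"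
 proof (rule KP.PiM_eqI)
  show "sets (distr (GG {..<N}) (GG {..<N}) ?S) = sets (PiM {..<N} K)" using sK by simp
  fix A assume "!!i. i : {..<N} ==> A i : sets (K i)"
  then have A: "A i : sets borel" if "i : {..<N}" for i using that by (simp add: K_def)
  have P: "PiE {..<N} A : sets (GG {..<N})" by (rule sets_PiM_I_finite) (use A in auto)
  have Am: "{z. x i * rh + z * sqrt (1 - rh\<^sup>2) : A i} : sets borel" if "i : {..<N}" for i
  proof -
   have "(%z. x i * rh + z * sqrt (1 - rh\<^sup>2)) -` A i \<inter> space borel : sets borel"
    by (rule measurable_sets[of _ borel borel]) (use A that in auto)
   then show ?thesis by (simp add: vimage_def)
  qed
  have "emeasure (distr (GG {..<N}) (GG {..<N}) ?S) (PiE {..<N} A) = emeasure (GG {..<N}) (?S -` PiE {..<N} A \<inter> space (GG {..<N}))"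
   by (rule emeasure_distr[OF Sm P])
  also have "?S -` PiE {..<N} A \<inter> space (GG {..<N}) = PiE {..<N} (%i. {z. x i * rh + z * sqrt (1 - rh\<^sup>2) : A i})"
   by (intro Set.set_eqI) (simp add: space_PiM PiE_iff conj_commute)
  also have "emeasure (GG {..<N}) ... = (\<Prod>i<N. emeasure N01 {z. x i * rh + z * sqrt (1 - rh\<^sup>2) : A i})"
   by (rule NP.emeasure_PiM) (use Am in auto)
  also have "... = (\<Prod>i<N. emeasure (K i) (A i))"
  proof (rule prod.cong[OF refl])
   fix i assume i: "i : {..<N}"
   have "emeasure N01 {z. x i * rh + z * sqrt (1 - rh\<^sup>2) : A i} = (\<integral>\<^sup>+z. indicator {z. x i * rh + z * sqrt (1 - rh\<^sup>2) : A i} z \<partial>N01)"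
    using Am[OF i] by simp
   also have "... = (\<integral>\<^sup>+z. indicator (A i) (x i * rh + z * sqrt (1 - rh\<^sup>2)) \<partial>N01)"
    by (intro nn_integral_cong) (auto split: split_indicator)
   also have "... = emeasure (K i) (A i)" unfolding Kv[OF A[OF i]] by (rule nn_k1[OF rho]) (use A[OF i] in simp)
   finally show "emeasure N01 {z. x i * rh + z * sqrt (1 - rh\<^sup>2) : A i} = emeasure (K i) (A i)" .
  qed
  finally show "emeasure (distr (GG {..<N}) (GG {..<N}) ?S) (PiE {..<N} A) = (\<Prod>i\<in>{..<N}. emeasure (K i) (A i))" .
 qed simp
 have 2: "density (GG {..<N}) (%y. ennreal (kk rh {..<N} x y)) = PiM {..<N} K"
 proof (rule KP.PiM_eqI)
  show "sets (density (GG {..<N}) (%y. ennreal (kk rh {..<N} x y))) = sets (PiM {..<N} K)" using sK by simp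
  fix A assume "!!i. i : {..<N} ==> A i : sets (K i)"
  then have A: "A i : sets borel" if "i : {..<N}" for i using that by (simp add: K_def)
  have P: "PiE {..<N} A : sets (GG {..<N})" by (rule sets_PiM_I_finite) (use A in auto)
  have "emeasure (density (GG {..<N}) (%y. ennreal (kk rh {..<N} x y))) (PiE {..<N} A) = (\<integral>\<^sup>+y. ennreal (kk rh {..<N} x y) * indicator (PiE {..<N} A) y \<partial>GG {..<N})"
   using kkm P by (subst emeasure_density) auto
  also have "... = (\<integral>\<^sup>+y. (\<Prod>i<N. ennreal (k1 rh (x i) (y i)) * indicator (A i) (y i)) \<partial>GG {..<N})"
  proof (rule nn_integral_cong)
   fix y assume y: "y : space (GG {..<N})"
   have "indicator (PiE {..<N} A) y = (\<Prod>i<N. indicator (A i) (y i) :: ennreal)"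
    using y by (auto simp: indicator_def PiE_iff prod_zero_iff space_PiM)
   moreover have "ennreal (kk rh {..<N} x y) = (\<Prod>i<N. ennreal (k1 rh (x i) (y i)))"
    unfolding kk_def using k1_pos[OF rho] by (subst prod_ennreal) (auto intro: less_imp_le)
   ultimately show "ennreal (kk rh {..<N} x y) * indicator (PiE {..<N} A) y = (\<Prod>i<N. ennreal (k1 rh (x i) (y i)) * indicator (A i) (y i))"
    by (simp only: prod.distrib)
  qed
  also have "... = (\<Prod>i<N. \<integral>\<^sup>+r. ennreal (k1 rh (x i) r) * indicator (A i) r \<partial>N01)"
   by (rule NP.product_nn_integral_prod[OF finite_lessThan])
    (intro borel_measurable_times_ennreal km borel_measurable_indicator, use A in simp)
  also have "... = (\<Prod>i<N. emeasure (K i) (A i))" using Kv A by (intro prod.cong) auto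
  finally show "emeasure (density (GG {..<N}) (%y. ennreal (kk rh {..<N} x y))) (PiE {..<N} A) = (\<Prod>i\<in>{..<N}. emeasure (K i) (A i))" .
 qed simp
 show "distr (GG {..<N}) (GG {..<N}) ?S = density (GG {..<N}) (%y. ennreal (kk rh {..<N} x y))" unfolding 1 2 ..
qed

lemma T_op_eq:
 assumes rho: "0 < rh" "rh < 1" and f: "f : bm (GG {..<N})"
 shows "T_op N rh f x = (LINT y|GG {..<N}. kk rh {..<N} x y * f y)"
proof -
 have "T_op N rh f x = (\<integral>y. f y \<partial>distr (GG {..<N}) (GG {..<N}) (%y. \<lambda>i\<in>{..<N}. x i * rh + y i * sqrt (1 - rh\<^sup>2)))"
  unfolding T_op_def gaussN_GG by (rule integral_distr[OF noise_distr(2)[OF rho] f, symmetric])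
 also have "... = (LINT y|GG {..<N}. kk rh {..<N} x y * f y)"
  unfolding noise_distr(1)[OF rho] using noise_distr(3)[OF rho] f k1_pos[OF rho]
  by (subst integral_density) (simp_all add: kk_def prod_nonneg less_imp_le)
 finally show ?thesis .
qed

text \<open>Two independent heights on the same line see the same value, so resampling the height
  preserves membership.\<close>

lemma (in gminj) inv_of_jinv:
 assumes V: "V : sets (GG I)" and i: "jinv (indicator V)"
 shows "inv_in V j"
proof -
 note [measurable] = V
 have h[measurable]: "(%p. (fst p)(j := snd p)) : GG I \<Otimes>\<^sub>M N01 \<rightarrow>\<^sub>M GG I" by (rule meas_upd) (use jI in auto)
 have m: "{x\<in>space (GG I). AE t in N01. x(j := t) : V \<longleftrightarrow> x : V} : sets (GG I)"
  by (rule sets_AE_N01) measurable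
 have "AE q in GG J. AE s in N01. AE t in N01. (q(j := s))(j := t) : V \<longleftrightarrow> q(j := s) : V"
  using i[unfolded jinv_def]
 proof eventually_elim
  case (elim q)
  then obtain v where v: "AE t in N01. indicator V (q(j := t)) = (v::real)" by blast
  show ?case using v
  proof eventually_elim
   case (elim s)
   note vs = elim
   show ?case using v
   proof eventually_elim
    case (elim t)
    then show ?case using vs by (auto simp: indicator_def split: if_splits)
   qed
  qed
 qed
 then show ?thesis unfolding inv_in_def AE_J[OF m] .
qed

text \<open>The base consists of those p that lie in \<open>V\<close> for almost every choice of the
  coordinates from d on. As \<open>V\<close> is jointly independent of these, membership of x is
  decided by its first d coordinates. The zeros with which \<open>ext\<close> pads p are overwritten
  by \<open>mg\<close>.\<close>

lemma cylinder_of_inv: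
 assumes g: "gauss {..<N} rh" and d: "d <= N" and V: "V : sets (GG {..<N})" and inv: "!!j. d <= j ==> j < N ==> gauss.inv_in {..<N} V j"
 shows "EX \<Theta>. \<Theta> <= RN d & \<Theta> : sets (lebN d) & (EX Z:null_sets (lebN N). symdiff V (cylinder N d \<Theta>) <= Z)"
proof -
 interpret gauss "{..<N}" rh by (rule g)
 define ext where "ext p = (\<lambda>i\<in>{..<N}. if i < d then p i else (0::real))" for p :: "nat => real"
 have em: "ext : lebN d \<rightarrow>\<^sub>M GG {..<N}"
  unfolding ext_def[abs_def]
 proof (rule measurable_restrict)
  fix i
  have "(%p. if i < d then p i else 0) : bm (lebN d)" by (cases "i < d") (auto intro: lebN_comp)
  then show "(%p. if i < d then p i else 0) : lebN d \<rightarrow>\<^sub>M N01" by (simp cong: measurable_cong_sets)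
 qed
 have "(%p. (ext (fst p), snd p)) : lebN d \<Otimes>\<^sub>M GG {..<N} \<rightarrow>\<^sub>M GG {..<N} \<Otimes>\<^sub>M GG {..<N}"
  by (intro measurable_Pair measurable_compose[OF measurable_fst em] measurable_snd)
 from measurable_compose[OF this mg_meas[of "{d..<N}"]]
 have hm: "(%p. mg {d..<N} (ext (fst p)) (snd p)) : lebN d \<Otimes>\<^sub>M GG {..<N} \<rightarrow>\<^sub>M GG {..<N}" by simp
 define \<Theta> where "\<Theta> = {p\<in>space (lebN d). AE z in GG {..<N}. mg {d..<N} (ext p) z : V}"
 have T: "\<Theta> : sets (lebN d)" unfolding \<Theta>_def
 proof (rule sets_AE)
  have "(%p. mg {d..<N} (ext (fst p)) (snd p)) -` V \<inter> space (lebN d \<Otimes>\<^sub>M GG {..<N}) : sets (lebN d \<Otimes>\<^sub>M GG {..<N})"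
   by (rule measurable_sets[OF hm V])
  then show "{p : space (lebN d \<Otimes>\<^sub>M GG {..<N}). mg {d..<N} (ext (fst p)) (snd p) : V} : sets (lebN d \<Otimes>\<^sub>M GG {..<N})"
   by (simp add: vimage_def Int_def conj_commute)
 qed
 have ext: "mg {d..<N} (ext (restrict x {..<d})) z = mg {d..<N} x z" for x z
  unfolding mg_def ext_def by (auto simp: fun_eq_iff)
 have "AE x in GG {..<N}. AE z in GG {..<N}. mg {d..<N} x z : V \<longleftrightarrow> x : V"
  by (rule inv_in_mg[OF V]) (use inv in auto)
 then have "AE x in GG {..<N}. x : V \<longleftrightarrow> restrict x {..<d} : \<Theta>" using AE_space
 proof eventually_elim
  case (elim x)
  have r: "restrict x {..<d} : space (lebN d)" unfolding space_lebN RN_def by auto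
  show ?case
  proof
   assume "x : V"
   then have "AE z in GG {..<N}. mg {d..<N} x z : V" using elim(1) by (auto elim: eventually_mono)
   then show "restrict x {..<d} : \<Theta>" unfolding \<Theta>_def using r ext by simp
  next
   assume "restrict x {..<d} : \<Theta>"
   then have "AE z in GG {..<N}. mg {d..<N} x z : V" unfolding \<Theta>_def using ext by simp
   with elim(1) have "AE z in GG {..<N}. x : V" by eventually_elim blast
   then show "x : V" by simp
  qed
 qed
 then have "AE x in lebN N. x : V \<longleftrightarrow> restrict x {..<d} : \<Theta>" unfolding AE_lebN .
 then obtain Z where Z: "{x\<in>space (lebN N). \<not> (x : V \<longleftrightarrow> restrict x {..<d} : \<Theta>)} <= Z" "emeasure (lebN N) Z = 0" "Z : sets (lebN N)"
  by (rule AE_E)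
 have "V <= RN N" using sets.sets_into_space[OF V] by (simp add: space_lebN)
 then have "symdiff V (cylinder N d \<Theta>) <= Z" using Z(1) unfolding symdiff_def cylinder_def space_lebN by auto
 moreover have "Z : null_sets (lebN N)" using Z by auto
 moreover have "\<Theta> <= RN d" unfolding \<Theta>_def space_lebN by auto
 ultimately show ?thesis using T by blast
qed

section \<open>Transporting partitions and their moments by a rotation\<close>

lemma partition_part: "is_partition N m Gm \<longleftrightarrow> part (GG {..<N}) m Gm"
 unfolding is_partition_def part_def sets_lebN space_lebN disjoint_family_on_def by auto

text \<open>Preimages keep measurability and the partition property immediate; the image under A is
  the preimage under its transpose, see \<open>pull_tp\<close>.\<close>

definition pull :: "nat => (nat => nat => real) => (nat => (nat => real) set) => nat => (nat => real) set" where
 "pull N A Gm i = {x : RN N. mat_apply N A x : Gm i}"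

lemma pull_vimage: "pull N A Gm i = mat_apply N A -` Gm i \<inter> space (GG {..<N})"
 unfolding pull_def space_lebN by auto

lemma pull_partition: "is_partition N m Gm ==> is_partition N m (pull N A Gm)"
 unfolding is_partition_def
proof (intro conjI allI impI)
 assume p: "(ALL i<m. Gm i : sets (lebN N)) & (ALL i<m. ALL j<m. i ~= j --> Gm i \<inter> Gm j = {}) & (\<Union>i<m. Gm i) = RN N"
 show "pull N A Gm i : sets (lebN N)" if "i < m" for i
  unfolding pull_vimage sets_lebN by (rule measurable_sets[OF mat_measG]) (use p that sets_lebN in blast)
 show "pull N A Gm i \<inter> pull N A Gm j = {}" if "i < m" "j < m" "i ~= j" for i j
  using p that unfolding pull_def by blast
 show "(\<Union>i<m. pull N A Gm i) = RN N"
 proof (intro subset_antisym subsetI)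
  fix x assume x: "x : RN N"
  have "mat_apply N A x : (\<Union>i<m. Gm i)" using p mat_space by simp
  then show "x : (\<Union>i<m. pull N A Gm i)" using x unfolding pull_def by blast
 qed (auto simp: pull_def)
qed

lemma pull_measure:
 assumes A: "orth N A" and G: "Gm i : sets (GG {..<N})"
 shows "measure (GG {..<N}) (pull N A Gm i) = measure (GG {..<N}) (Gm i)"
 using measure_distr[OF mat_measG[of N A] G] unfolding distr_mat[OF A] pull_vimage by simp

lemma pull_tp:
 assumes A: "orth N A" and G: "Gm i <= RN N"
 shows "pull N A (pull N (tp A) Gm) i = Gm i" "pull N (tp A) Gm i = mat_apply N A ` Gm i"
proof -
 show "pull N A (pull N (tp A) Gm) i = Gm i"
  unfolding pull_def using mat_tp'[OF A] G mat_space by auto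
 show "pull N (tp A) Gm i = mat_apply N A ` Gm i"
 proof (intro subset_antisym subsetI)
  fix x assume "x : pull N (tp A) Gm i"
  then have "x : RN N" "mat_apply N (tp A) x : Gm i" unfolding pull_def by auto
  then show "x : mat_apply N A ` Gm i" using mat_tp[OF A, of x] by (metis image_eqI)
 next
  fix x assume "x : mat_apply N A ` Gm i"
  then obtain y where "y : Gm i" "x = mat_apply N A y" by blast
  then show "x : pull N (tp A) Gm i" unfolding pull_def using mat_tp'[OF A, of y] G mat_space by auto
 qed
qed

lemma noise_obj_B:
 assumes g: "gauss {..<N} rh" and G: "!!i. i < m ==> Gm' i : sets (GG {..<N})"
 shows "noise_obj N rh m Gm Gm' = noise.B (GG {..<N}) (kk rh {..<N}) m (%i. indicator (Gm i)) (%i. indicator (Gm' i))"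
proof -
 interpret gauss "{..<N}" rh by (rule g)
 show ?thesis unfolding noise_obj_def B_def pr_def T_def gaussN_GG
  by (intro sum.cong refl BI_integral_cong arg_cong2[where f="(*)"] T_op_eq[OF rho]) (use G in simp)
qed

lemma B_pull:
 assumes g: "gauss {..<N} rh" and A: "orth N A" and G: "!!i. i < m ==> Gm i : sets (GG {..<N})" "!!i. i < m ==> Gm' i : sets (GG {..<N})"
 shows "noise.B (GG {..<N}) (kk rh {..<N}) m (%i. indicator (pull N A Gm i)) (%i. indicator (pull N A Gm' i)) =
  noise.B (GG {..<N}) (kk rh {..<N}) m (%i. indicator (Gm i)) (%i. indicator (Gm' i))"
proof -
 interpret gauss "{..<N}" rh by (rule g)
 have ind: "indicator (pull N A Gm i) x = (indicator (Gm i) (mat_apply N A x) :: real)" if "x : space (GG {..<N})" for Gm i x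
  using that unfolding pull_def space_lebN by (auto split: split_indicator)
 show ?thesis unfolding B_def
 proof (rule sum.cong[OF refl])
  fix i assume "i : {..<m}"
  then have i: "i < m" by simp
  have b: "bdd (GG {..<N}) (indicator (Gm i))" "bdd (GG {..<N}) (indicator (Gm' i))" by (intro bdd_indicator G i)+
  have T: "T (indicator (pull N A Gm' i)) x = T (indicator (Gm' i)) (mat_apply N A x)" if x: "x : space (GG {..<N})" for x
  proof -
   have Ax: "mat_apply N A x : space (GG {..<N})" using mat_space by (simp add: space_lebN)
   have "T (indicator (pull N A Gm' i)) x = (LINT y|GG {..<N}. kk rh {..<N} (mat_apply N A x) (mat_apply N A y) * indicator (Gm' i) (mat_apply N A y))"
    unfolding T_def kk_mat[OF rho A] by (intro BI_integral_cong refl) (simp add: ind)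
   also have "... = T (indicator (Gm' i)) (mat_apply N A x)" unfolding T_def
    by (rule integral_mat[OF A, where F="%y. kk rh {..<N} (mat_apply N A x) y * indicator (Gm' i) y"])
     (rule borel_measurable_integrable[OF kf_int[OF b(2) Ax]])
   finally show ?thesis .
  qed
  have "pr (indicator (pull N A Gm i)) (indicator (pull N A Gm' i)) = (LINT x|GG {..<N}. indicator (Gm i) (mat_apply N A x) * T (indicator (Gm' i)) (mat_apply N A x))"
   unfolding pr_def by (intro BI_integral_cong refl) (simp add: ind T)
  also have "... = pr (indicator (Gm i)) (indicator (Gm' i))" unfolding pr_def
   by (rule integral_mat[OF A, where F="%x. indicator (Gm i) x * T (indicator (Gm' i)) x"])
    (rule borel_measurable_integrable[OF pr_int[OF b]])
  finally show "pr (indicator (pull N A Gm i)) (indicator (pull N A Gm' i)) = pr (indicator (Gm i)) (indicator (Gm' i))" .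
 qed
qed

lemma comp_int:
 assumes "finite I" "k : I"
 shows "integrable (GG I) (%x. x k)" "(LINT x|GG I. x k) = 0"
proof -
 have d: "distr (GG I) N01 (%x. x k) = N01"
  using distr_PiM_component[of I "%_. N01" k] assms prob_space_N01 by simp
 have mj: "(%x. x k) : GG I \<rightarrow>\<^sub>M N01" using measurable_component_singleton[OF assms(2), of "%_. N01"] .
 have mt: "(%t::real. t) : bm N01" by (simp add: N01_meas)
 have i: "integrable N01 (%t. t)" "(LINT t|N01. t) = 0"
  using integrable_std_normal_moment[of 1] integral_std_normal_moment_odd[of 0] unfolding N01_def
  by (simp_all add: integrable_density integral_density)
 show "integrable (GG I) (%x. x k)" using integrable_distr_eq[OF mj mt] d i by simp
 show "(LINT x|GG I. x k) = 0" using integral_distr[OF mj mt] d i by simp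
qed

text \<open>Moment vectors rotate along with the sets, by invariance of the Gaussian
  measure.\<close>

lemma pull_moment:
 assumes A: "orth N A" and G: "Gm i : sets (GG {..<N})" and j: "j < N"
 shows "(LINT x|GG {..<N}. indicator (pull N (tp A) Gm i) x * x j) = (\<Sum>k<N. A j k * (LINT x|GG {..<N}. indicator (Gm i) x * x k))"
proof -
 have Gs: "Gm i <= RN N" using sets.sets_into_space[OF G] by (simp add: space_lebN)
 have Ps: "pull N (tp A) Gm i : sets (GG {..<N})" unfolding pull_vimage by (rule measurable_sets[OF mat_measG G])
 have ind: "indicator (pull N (tp A) Gm i) (mat_apply N A x) = (indicator (Gm i) x :: real)" if "x : space (GG {..<N})" for x
  using that mat_tp'[OF A, of x] mat_space unfolding pull_def space_lebN by (auto split: split_indicator)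
 have ii: "integrable (GG {..<N}) (%x. indicator (Gm i) x * x k)" if "k < N" for k
  using integrable_mult_indicator[OF G comp_int(1)[of "{..<N}" k]] that by simp
 have "(LINT x|GG {..<N}. indicator (pull N (tp A) Gm i) x * x j) = (LINT x|GG {..<N}. indicator (pull N (tp A) Gm i) (mat_apply N A x) * (mat_apply N A x) j)"
  by (rule integral_mat[OF A, symmetric]) (use Ps meas_comp[of j "{..<N}"] j in \<open>auto intro!: borel_measurable_times\<close>)
 also have "... = (LINT x|GG {..<N}. (\<Sum>k<N. A j k * (indicator (Gm i) x * x k)))"
 proof (rule BI_integral_cong[OF refl])
  fix x assume x: "x : space (GG {..<N})"
  have "mat_apply N A x j = (\<Sum>k<N. A j k * x k)" using j by (simp add: mat_apply_def)
  then show "indicator (pull N (tp A) Gm i) (mat_apply N A x) * mat_apply N A x j = (\<Sum>k<N. A j k * (indicator (Gm i) x * x k))"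
   unfolding ind[OF x] by (simp add: sum_distrib_left mult.left_commute)
 qed
 also have "... = (\<Sum>k<N. (LINT x|GG {..<N}. A j k * (indicator (Gm i) x * x k)))"
  by (rule BI_integral_sum) (use ii in auto)
 finally show ?thesis by simp
qed

text \<open>The moments of all cells add up to that of the whole space, which is 0, so m - 1
  vanishing ones force the last.\<close>

lemma last_moment:
 assumes p: "part (GG {..<N}) m V" and m: "0 < m" and j: "j < N" and z: "!!i. i < m - 1 ==> (LINT x|GG {..<N}. indicator (V i) x * x j) = 0" and i: "i < m"
 shows "(LINT x|GG {..<N}. indicator (V i) x * x j) = 0"
proof (cases "i < m - 1")
 case False
 then have im: "i = m - 1" using i by simp
 have V: "V k : sets (GG {..<N})" if "k < m" for k using p that unfolding part_def by blast
 have ii: "integrable (GG {..<N}) (%x. indicator (V k) x * x j)" if "k < m" for k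
  using integrable_mult_indicator[OF V[OF that] comp_int(1)[of "{..<N}" j]] j by simp
 have one: "(\<Sum>k<m. indicator (V k) x * x j) = x j" if "x : space (GG {..<N})" for x
 proof -
  have "(\<Sum>k<m. indicator (V k) x) = (1::real)" using part_relaxed[OF p] that unfolding relaxed_def by blast
  then show ?thesis by (simp flip: sum_distrib_right)
 qed
 have "(\<Sum>k<m. (LINT x|GG {..<N}. indicator (V k) x * x j)) = (LINT x|GG {..<N}. (\<Sum>k<m. indicator (V k) x * x j))"
  by (rule BI_integral_sum[symmetric]) (use ii in auto)
 also have "... = (LINT x|GG {..<N}. x j)" by (intro BI_integral_cong refl one)
 also have "... = 0" using comp_int(2)[of "{..<N}" j] j by simp
 finally have "(\<Sum>k<m. (LINT x|GG {..<N}. indicator (V k) x * x j)) = 0" .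
 moreover have "(\<Sum>k<m. (LINT x|GG {..<N}. indicator (V k) x * x j)) = (LINT x|GG {..<N}. indicator (V i) x * x j)"
 proof -
  have "(\<Sum>k<m. (LINT x|GG {..<N}. indicator (V k) x * x j)) = (\<Sum>k\<in>{i}. (LINT x|GG {..<N}. indicator (V k) x * x j))"
  proof (rule sum.mono_neutral_right)
   show "ALL k:{..<m} - {i}. (LINT x|GG {..<N}. indicator (V k) x * x j) = 0"
   proof
    fix k assume "k : {..<m} - {i}"
    then have "k < m - 1" using im by auto
    then show "(LINT x|GG {..<N}. indicator (V k) x * x j) = 0" by (rule z)
   qed
  qed (use i in auto)
  then show ?thesis by simp
 qed
 ultimately show ?thesis by simp
qed (use z in simp)

theorem theorem7p9:
  fixes \<rho> :: real and n m :: nat and a :: "nat \<Rightarrow> real"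
    and \<Omega> \<Omega>' :: "nat \<Rightarrow> (nat \<Rightarrow> real) set"
  assumes "0 < \<rho>" "\<rho> < 1" "n \<ge> 1" "m \<ge> 2" "2 * m \<le> n + 3"
    and "\<forall>i<m. a i > 0" "(\<Sum>i<m. a i) = 1"
    and "admissible (n + 1) m a \<Omega> \<Omega>'"
    and "\<forall>\<Gamma> \<Gamma>'. admissible (n + 1) m a \<Gamma> \<Gamma>' \<longrightarrow>
           noise_obj (n + 1) \<rho> m \<Omega> \<Omega>' \<le> noise_obj (n + 1) \<rho> m \<Gamma> \<Gamma>'"
  shows "\<exists>A. is_rotation (n + 1) A \<and>
    (\<exists>\<Theta> \<Theta>'. \<forall>i<m.
        \<Theta> i \<subseteq> RN (2 * m - 2) \<and> \<Theta> i \<in> sets (lebN (2 * m - 2)) \<and>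
        \<Theta>' i \<subseteq> RN (2 * m - 2) \<and> \<Theta>' i \<in> sets (lebN (2 * m - 2)) \<and>
        (\<exists>Z\<in>null_sets (lebN (n + 1)).
           symdiff (mat_apply (n + 1) A ` \<Omega> i) (cylinder (n + 1) (2 * m - 2) (\<Theta> i)) \<subseteq> Z) \<and>
        (\<exists>Z\<in>null_sets (lebN (n + 1)).
           symdiff (mat_apply (n + 1) A ` \<Omega>' i) (cylinder (n + 1) (2 * m - 2) (\<Theta>' i)) \<subseteq> Z))"
proof -
 define N where "N = n + 1"
 define d where "d = 2 * m - 2"
 \<comment> \<open>\<open>2 * m <= n + 3\<close> amounts to \<open>d <= N\<close>, and
   \<open>m >= 2\<close> gives \<open>d >= 2\<close>, so that 0 and 1 can serve as the two base
   coordinates for every j from d on.\<close>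
 have dN: "d <= N" "2 <= d" unfolding d_def N_def using assms(4,5) by auto
 have g: "gauss {..<N} \<rho>" by unfold_locales (use assms(1,2) in \<open>auto simp: N_def\<close>)
 interpret G: gauss "{..<N}" \<rho> by (rule g)
 have ad: "is_partition N m \<Omega>" "is_partition N m \<Omega>'" "!!i. i < m ==> measure (GG {..<N}) (\<Omega> i) = a i" "!!i. i < m ==> measure (GG {..<N}) (\<Omega>' i) = a i"
  using assms(8) unfolding admissible_def N_def[symmetric] gaussN_GG by auto
 have Os: "\<Omega> i : sets (GG {..<N})" "\<Omega>' i : sets (GG {..<N})" "\<Omega> i <= RN N" "\<Omega>' i <= RN N" if "i < m" for i
  using ad(1,2) that unfolding is_partition_def sets_lebN by auto
 \<comment> \<open>The moment vectors of the first m - 1 cells of each partition, d in all, which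
   the rotation is to confine to the first d coordinates.\<close>
 define w where "w l k = (if l < m - 1 then (LINT x|GG {..<N}. indicator (\<Omega> l) x * x k) else (LINT x|GG {..<N}. indicator (\<Omega>' (l - (m - 1))) x * x k))" for l k
 obtain A where A: "is_rotation N A" "orth N A" and Aw: "!!l i. l < d ==> d <= i ==> i < N ==> (\<Sum>k<N. A i k * w l k) = 0"
  using exists_rotation[OF dN(1), of w] by blast
 define V where "V = pull N (tp A) \<Omega>"
 define V' where "V' = pull N (tp A) \<Omega>'"
 have pV: "part (GG {..<N}) m V" "part (GG {..<N}) m V'"
  using pull_partition[OF ad(1)] pull_partition[OF ad(2)] unfolding V_def V'_def partition_part by auto
 have Vs: "V i : sets (GG {..<N})" "V' i : sets (GG {..<N})" if "i < m" for i using pV that unfolding part_def by auto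
 have mV: "measure (GG {..<N}) (V i) = a i" "measure (GG {..<N}) (V' i) = a i" if "i < m" for i
  unfolding V_def V'_def using pull_measure[OF orth_tp[OF A(2)]] Os[OF that] ad(3,4)[OF that] by auto
 have obj: "noise_obj N \<rho> m \<Omega> \<Omega>' = G.B m (%i. indicator (V i)) (%i. indicator (V' i))"
 proof -
  have "G.B m (%i. indicator (V i)) (%i. indicator (V' i)) = G.B m (%i. indicator (\<Omega> i)) (%i. indicator (\<Omega>' i))"
   unfolding V_def V'_def by (rule B_pull[OF g orth_tp[OF A(2)] Os(1,2)])
  then show ?thesis using noise_obj_B[OF g Os(2)] by simp
 qed
 \<comment> \<open>A competitor of the rotated pair, pulled back by \<open>A\<close>, is a
   competitor of the original pair with the same volumes and objective.\<close>
 have "EX lam mu. rmin (GG {..<N}) (kk \<rho> {..<N}) m (%i. indicator (V i)) (%i. indicator (V' i)) lam mu"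
 proof (rule G.rmin_exists[OF _ pV])
  show "0 < m" using assms(4) by simp
  show "0 < measure (GG {..<N}) (V i)" "0 < measure (GG {..<N}) (V' i)" if "i < m" for i using mV[OF that] assms(6) that by auto
  fix \<Gamma> \<Gamma>' assume p: "part (GG {..<N}) m \<Gamma>" "part (GG {..<N}) m \<Gamma>'"
   and v: "!!i. i < m ==> measure (GG {..<N}) (\<Gamma> i) = measure (GG {..<N}) (V i)" "!!i. i < m ==> measure (GG {..<N}) (\<Gamma>' i) = measure (GG {..<N}) (V' i)"
  have Gs: "\<Gamma> i : sets (GG {..<N})" "\<Gamma>' i : sets (GG {..<N})" if "i < m" for i using p that unfolding part_def by auto
  have pp: "is_partition N m (pull N A \<Gamma>)" "is_partition N m (pull N A \<Gamma>')" using pull_partition p unfolding partition_part by auto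
  have ps: "pull N A \<Gamma>' i : sets (GG {..<N})" if "i < m" for i using pp(2) that unfolding is_partition_def sets_lebN by auto
  have "admissible N m a (pull N A \<Gamma>) (pull N A \<Gamma>')"
   unfolding admissible_def gaussN_GG using pp pull_measure[OF A(2)] Gs v mV by auto
  then have "noise_obj N \<rho> m \<Omega> \<Omega>' <= noise_obj N \<rho> m (pull N A \<Gamma>) (pull N A \<Gamma>')"
   using assms(9) unfolding N_def by blast
  also have "... = G.B m (%i. indicator (pull N A \<Gamma> i)) (%i. indicator (pull N A \<Gamma>' i))" by (rule noise_obj_B[OF g ps])
  also have "... = G.B m (%i. indicator (\<Gamma> i)) (%i. indicator (\<Gamma>' i))" by (rule B_pull[OF g A(2) Gs])
  finally show "G.B m (%i. indicator (V i)) (%i. indicator (V' i)) <= G.B m (%i. indicator (\<Gamma> i)) (%i. indicator (\<Gamma>' i))" unfolding obj .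
 qed
 then obtain lam mu where rm: "rmin (GG {..<N}) (kk \<rho> {..<N}) m (%i. indicator (V i)) (%i. indicator (V' i)) lam mu" by blast
 have gm: "gmin {..<N} \<rho> m (%i. indicator (V i)) (%i. indicator (V' i)) lam mu" by (intro gmin.intro g rm)
 have m0: "0 < m" using assms(4) by simp
 have mom: "(LINT x|GG {..<N}. indicator (V i) x * x j) = 0" "(LINT x|GG {..<N}. indicator (V' i) x * x j) = 0"
  if j: "d <= j" "j < N" and i: "i < m" for i j
 proof -
  have "(LINT x|GG {..<N}. indicator (V i) x * x j) = 0" if "i < m - 1" for i
  proof -
   have im: "i < m" "i < d" using that dN unfolding d_def by auto
   have "(LINT x|GG {..<N}. indicator (V i) x * x j) = (\<Sum>k<N. A j k * w i k)"
    unfolding V_def pull_moment[where Gm=\<Omega> and i=i, OF A(2) Os(1)[OF im(1)] j(2)] w_def using that by simp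
   then show ?thesis using Aw[OF im(2) j] by simp
  qed
  then show "(LINT x|GG {..<N}. indicator (V i) x * x j) = 0" by (rule last_moment[OF pV(1) m0 j(2) _ i])
  have "(LINT x|GG {..<N}. indicator (V' i) x * x j) = 0" if "i < m - 1" for i
  proof -
   have im: "i < m" "i + (m - 1) < d" using that unfolding d_def by auto
   have "(LINT x|GG {..<N}. indicator (V' i) x * x j) = (\<Sum>k<N. A j k * w (i + (m - 1)) k)"
    unfolding V'_def pull_moment[where Gm=\<Omega>' and i=i, OF A(2) Os(2)[OF im(1)] j(2)] w_def by simp
   then show ?thesis using Aw[OF im(2) j] by simp
  qed
  then show "(LINT x|GG {..<N}. indicator (V' i) x * x j) = 0" by (rule last_moment[OF pV(2) m0 j(2) _ i])
 qed
 \<comment> \<open>Each coordinate from d on has vanishing moments for all cells of both partitions,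
   so \<open>f_jinv\<close> applies; the roles are swapped for the second partition.\<close>
 have inv: "G.inv_in (V i) j & G.inv_in (V' i) j" if i: "i < m" and j: "d <= j" "j < N" for i j
 proof -
  have c: "0 : {..<N} - {j}" "1 : {..<N} - {j}" "(0::nat) ~= 1" using j dN by auto
  interpret J: gminj "{..<N}" \<rho> m "%i. indicator (V i)" "%i. indicator (V' i)" lam mu j
  proof (intro gminj.intro gm gminj_axioms.intro)
   show "j : {..<N}" using j by simp
   show "{..<N} - {j} ~= {}" using c(1) by blast
  qed (rule mom[OF j]; assumption)+
  interpret J': gminj "{..<N}" \<rho> m "%i. indicator (V' i)" "%i. indicator (V i)" mu lam j
   by (rule J.jswap)
  show ?thesis using J.inv_of_jinv[OF Vs(1)[OF i] J.f_jinv[OF c i]] J'.inv_of_jinv[OF Vs(2)[OF i] J'.f_jinv[OF c i]] by simp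
 qed
 define cy where "cy W \<Theta> \<longleftrightarrow> \<Theta> <= RN d & \<Theta> : sets (lebN d) & (EX Z:null_sets (lebN N). symdiff W (cylinder N d \<Theta>) <= Z)" for W \<Theta>
 have cyl1: "EX \<Theta>. cy (V i) \<Theta>" if i: "i < m" for i
  unfolding cy_def by (rule cylinder_of_inv[OF g dN(1) Vs(1)[OF i]]) (use inv[OF i] in blast)
 have cyl2: "EX \<Theta>. cy (V' i) \<Theta>" if i: "i < m" for i
  unfolding cy_def by (rule cylinder_of_inv[OF g dN(1) Vs(2)[OF i]]) (use inv[OF i] in blast)
 define \<Theta> where "\<Theta> i = (SOME \<Theta>. cy (V i) \<Theta>)" for i
 define \<Theta>' where "\<Theta>' i = (SOME \<Theta>. cy (V' i) \<Theta>)" for i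
 have T: "cy (mat_apply N A ` \<Omega> i) (\<Theta> i)" if i: "i < m" for i
  using someI_ex[OF cyl1[OF i]] unfolding \<Theta>_def V_def pull_tp(2)[where Gm=\<Omega>, OF A(2) Os(3)[OF i]] .
 have T': "cy (mat_apply N A ` \<Omega>' i) (\<Theta>' i)" if i: "i < m" for i
  using someI_ex[OF cyl2[OF i]] unfolding \<Theta>'_def V'_def pull_tp(2)[where Gm=\<Omega>', OF A(2) Os(4)[OF i]] .
 have fin: "\<Theta> i <= RN d & \<Theta> i : sets (lebN d) & \<Theta>' i <= RN d & \<Theta>' i : sets (lebN d) \<and>
   (EX Z:null_sets (lebN N). symdiff (mat_apply N A ` \<Omega> i) (cylinder N d (\<Theta> i)) <= Z) \<and>
   (EX Z:null_sets (lebN N). symdiff (mat_apply N A ` \<Omega>' i) (cylinder N d (\<Theta>' i)) <= Z)" if i: "i < m" for i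
  using T[OF i, unfolded cy_def] T'[OF i, unfolded cy_def] by (elim conjE, intro conjI)
 show ?thesis unfolding N_def[symmetric] d_def[symmetric]
  by (rule exI[of _ A], rule conjI, rule A(1), rule exI[of _ \<Theta>], rule exI[of _ \<Theta>'], intro allI impI, rule fin)
qed

end
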